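(* Let $q,p\in(1,\infty]$ be such that $\frac1p+\frac1q<1$, and let $b\in L^1(0,T;W^{1,q}(\mathbb{R}^d;\mathbb{R}^d))$ with $\operatorname{div}b\in L^1(0,T;L^\infty(\mathbb{R}^d))$. Then for any probability density $\rho\in L^p(\mathbb{R}^d)$ and any independent input data $(\xi,W)$ with values in $\mathbb{R}^d$ and $C_T$, with $\mathcal{L}(\xi)(dx)=\rho(x)\,dx$, there exists a strong solution $X$ to $$X_t=\xi+\int_0^t (b_s*\mathcal{L}(X_s))(X_s)\,ds+W_t,\qquad t\in[0,T],$$ satisfying $\sup_{t\in[0,T]}\|\mathcal{L}(X_t)\|_{L^p(\mathbb{R}^d)}<\infty$, and it is unique in the class of solutions satisfying this bound: any two solutions satisfying it have the same law on $C_T$, and if in addition they are defined on the same probability space with the same input data $(\xi,W)$, they coincide $\mathbb{P}$-a.s.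
   Context: $T>0$ is fixed, $C_T:=C([0,T];\mathbb{R}^d)$ with supremum norm; $\mathcal{L}(Z)$ is the law of $Z$. $(b_s*\mu)(x)=\int_{\mathbb{R}^d}b_s(x-y)\,\mu(dy)$. For a probability measure $\mu$ on $\mathbb{R}^d$, $\|\mu\|_{L^p}$ denotes the $L^p$ norm of its Lebesgue density. No assumption is made on the law of $W$ on $C_T$. (Weak) solution: a tuple $(\Omega,\mathcal{F},\mathbb{P};X,W,\xi)$, consisting of a probability space and a measurable map $(X,W,\xi):\Omega\to C_T\times C_T\times\mathbb{R}^d$ with $(\xi,W)$ independent and having the prescribed laws, such that: (1) for all $t>0$, $\mathcal{L}(X_t)$ is absolutely continuous with respect to Lebesgue measure; (2) there exists a measurable representative of $(t,x)\mapsto(|b_t|*\mathcal{L}(X_t))(x)$ such that $\int_0^T(|b_s|*\mathcal{L}(X_s))(X_s)\,ds<\infty$ $\mathbb{P}$-a.s.; (3) the equation holds $\mathbb{P}$-a.s., the integral being a Lebesgue integral. A strong solution is one for which $X$ is adapted to the filtration generated by the input process $Y_t=\xi+W_t$, i.e. to $\sigma\{Y_s:s\in[0,t]\}$. *)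

theory Defs
  imports "HOL-Probability.Probability"
begin

section \<open>Lebesgue norms\<close>

text \<open>The exponent is an extended nonnegative real, so that \<open>1 / \<infinity> = 0\<close>. The value is \<open>\<infinity>\<close> if \<open>f\<close> is
  Borel measurable but not in \<open>L\<^sup>p\<close>. Membership in \<open>L\<^sup>p\<close> is a finite norm together with
  measurability, which is always stated separately.\<close>

definition Lp_norm :: "'a measure \<Rightarrow> ennreal \<Rightarrow> ('a \<Rightarrow> 'b::real_normed_vector) \<Rightarrow> ennreal" where
  "Lp_norm M p f =
    (if p = \<infinity> then esssup M (\<lambda>x. ennreal (norm (f x)))
     else let I = (\<integral>\<^sup>+ x. ennreal (norm (f x) powr enn2real p) \<partial>M)
          in if I = \<infinity> then \<infinity> else ennreal (enn2real I powr (1 / enn2real p)))"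

text \<open>The \<open>L\<^sup>p\<close> norm of the Lebesgue density of a measure on \<open>\<real>\<^sup>d\<close>; a measure without a density
  gets norm \<open>\<infinity>\<close>.\<close>

definition density_Lp_norm :: "ennreal \<Rightarrow> 'a::euclidean_space measure \<Rightarrow> ennreal" where
  "density_Lp_norm p \<mu> =
    (if absolutely_continuous lborel \<mu>
     then Lp_norm lborel p (\<lambda>x. enn2real (RN_deriv lborel \<mu> x)) else \<infinity>)"


section \<open>Weak derivatives\<close>

fun iterated_partial :: "'a list \<Rightarrow> ('a::euclidean_space \<Rightarrow> real) \<Rightarrow> 'a \<Rightarrow> real" where
  "iterated_partial [] \<phi> = \<phi>"
| "iterated_partial (i # is) \<phi> = (\<lambda>x. frechet_derivative (iterated_partial is \<phi>) (at x) i)"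

text \<open>\<open>C\<^sub>c\<^sup>\<infinity>\<close>: all iterated partial derivatives exist and are again (Frechet) differentiable, and the
  support is compact.\<close>

definition test_function :: "('a::euclidean_space \<Rightarrow> real) \<Rightarrow> bool" where
  "test_function \<phi> \<longleftrightarrow>
    (\<forall>is x. set is \<subseteq> Basis \<longrightarrow> iterated_partial is \<phi> differentiable (at x)) \<and>
    compact (closure {x. \<phi> x \<noteq> 0})"

definition locally_integrable :: "('a::euclidean_space \<Rightarrow> 'b::euclidean_space) \<Rightarrow> bool" where
  "locally_integrable u \<longleftrightarrow> (\<forall>K. compact K \<longrightarrow> set_integrable lborel K u)"

definition has_weak_partial ::
    "('a::euclidean_space \<Rightarrow> 'b::euclidean_space) \<Rightarrow> 'a \<Rightarrow> ('a \<Rightarrow> 'b) \<Rightarrow> bool" where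
  "has_weak_partial u i v \<longleftrightarrow> locally_integrable u \<and> locally_integrable v \<and>
    (\<forall>\<phi>. test_function \<phi> \<longrightarrow>
      (\<integral>x. frechet_derivative \<phi> (at x) i *\<^sub>R u x \<partial>lborel) = - (\<integral>x. \<phi> x *\<^sub>R v x \<partial>lborel))"

text \<open>The integrand on the left is \<open>\<nabla>\<phi> \<cdot> u\<close>.\<close>

definition has_weak_divergence ::
    "('a::euclidean_space \<Rightarrow> 'a) \<Rightarrow> ('a \<Rightarrow> real) \<Rightarrow> bool" where
  "has_weak_divergence u g \<longleftrightarrow> locally_integrable u \<and> locally_integrable g \<and>
    (\<forall>\<phi>. test_function \<phi> \<longrightarrow>
      (\<integral>x. frechet_derivative \<phi> (at x) (u x) \<partial>lborel) = - (\<integral>x. \<phi> x * g x \<partial>lborel))"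


section \<open>Time-dependent function spaces\<close>

abbreviation time_measure :: "real \<Rightarrow> real measure" where
  "time_measure T \<equiv> restrict_space lborel {0..T}"

text \<open>\<open>L\<^sup>1(0,T;L\<^sup>q)\<close>, \<open>L\<^sup>1(0,T;W\<^sup>1\<^sup>,\<^sup>q)\<close> and the condition \<open>div b \<in> L\<^sup>1(0,T;L\<^sup>q)\<close>, for jointly Borel
  measurable representatives. For \<open>q = \<infinity>\<close>, where the spaces are not separable, joint
  measurability is more general than Bochner measurability in time.\<close>

definition L1_Lq ::
    "real \<Rightarrow> ennreal \<Rightarrow> (real \<Rightarrow> 'a::euclidean_space \<Rightarrow> 'b::euclidean_space) \<Rightarrow> bool" where
  "L1_Lq T q f \<longleftrightarrow>
    (\<lambda>(t, x). f t x) \<in> borel_measurable (time_measure T \<Otimes>\<^sub>M lborel) \<and>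
    (\<integral>\<^sup>+ t. Lp_norm lborel q (f t) \<partial>time_measure T) < \<infinity>"

definition L1_W1q ::
    "real \<Rightarrow> ennreal \<Rightarrow> (real \<Rightarrow> 'a::euclidean_space \<Rightarrow> 'b::euclidean_space) \<Rightarrow> bool" where
  "L1_W1q T q f \<longleftrightarrow> L1_Lq T q f \<and>
    (\<forall>i\<in>Basis. \<exists>v. L1_Lq T q v \<and> (AE t in time_measure T. has_weak_partial (f t) i (v t)))"

definition divergence_L1_Lq ::
    "real \<Rightarrow> ennreal \<Rightarrow> (real \<Rightarrow> 'a::euclidean_space \<Rightarrow> 'a) \<Rightarrow> bool" where
  "divergence_L1_Lq T q f \<longleftrightarrow>
    (\<exists>g. L1_Lq T q g \<and> (AE t in time_measure T. has_weak_divergence (f t) (g t)))"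


section \<open>Path space\<close>

text \<open>\<open>C([0,T];\<real>\<^sup>d)\<close> with the supremum metric; its elements are total functions that are
  \<^term>\<open>undefined\<close> outside \<open>[0,T]\<close>, so that equality of paths is equality on \<open>[0,T]\<close>.\<close>

definition path_space :: "real \<Rightarrow> (real \<Rightarrow> 'a::euclidean_space) metric" where
  "path_space T = cfunspace (top_of_set {0..T}) euclidean_metric"

definition path_borel :: "real \<Rightarrow> (real \<Rightarrow> 'a::euclidean_space) measure" where
  "path_borel T = sigma (mspace (path_space T)) {U. openin (mtopology_of (path_space T)) U}"

lemma mspace_path_space:
  "mspace (path_space T :: (real \<Rightarrow> 'a::euclidean_space) metric) =
    {f \<in> extensional {0..T}. continuous_on {0..T} f}"
proof -
  have "bounded (f ` {0..T})" if "continuous_on {0..T} f" for f :: "real \<Rightarrow> 'a"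
    using that by (intro compact_imp_bounded compact_continuous_image) auto
  then show ?thesis
    by (auto simp: path_space_def)
qed

lemma space_path_borel:
  "space (path_borel T :: (real \<Rightarrow> 'a::euclidean_space) measure) =
    {f \<in> extensional {0..T}. continuous_on {0..T} f}"
proof -
  have "{U. openin (mtopology_of (path_space T)) U} \<subseteq>
      Pow (mspace (path_space T :: (real \<Rightarrow> 'a) metric))"
    using openin_subset by fastforce
  then show ?thesis
    unfolding path_borel_def by (simp add: space_measure_of mspace_path_space)
qed


section \<open>The McKean--Vlasov equation\<close>

definition measure_convolution ::
    "('a::euclidean_space \<Rightarrow> 'a) \<Rightarrow> 'a measure \<Rightarrow> 'a \<Rightarrow> 'a" where
  "measure_convolution f \<mu> x = (\<integral>y. f (x - y) \<partial>\<mu>)"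

definition abs_measure_convolution ::
    "('a::euclidean_space \<Rightarrow> 'a) \<Rightarrow> 'a measure \<Rightarrow> 'a \<Rightarrow> ennreal" where
  "abs_measure_convolution f \<mu> x = (\<integral>\<^sup>+ y. ennreal (norm (f (x - y))) \<partial>\<mu>)"

definition time_law ::
    "'w measure \<Rightarrow> ('w \<Rightarrow> real \<Rightarrow> 'a::euclidean_space) \<Rightarrow> real \<Rightarrow> 'a measure" where
  "time_law M X t = distr M borel (\<lambda>\<omega>. X \<omega> t)"

text \<open>Independence is stated through the generated \<open>\<sigma>\<close>-algebras because the two variables take
  values in different types.\<close>

definition input_data ::
    "real \<Rightarrow> 'a::euclidean_space measure \<Rightarrow> (real \<Rightarrow> 'a) measure \<Rightarrow>
     'w measure \<Rightarrow> ('w \<Rightarrow> real \<Rightarrow> 'a) \<Rightarrow> ('w \<Rightarrow> 'a) \<Rightarrow> bool" where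
  "input_data T \<mu>0 \<nu> M W \<xi> \<longleftrightarrow>
    prob_space M \<and> W \<in> M \<rightarrow>\<^sub>M path_borel T \<and> \<xi> \<in> M \<rightarrow>\<^sub>M borel \<and>
    prob_space.indep_set M
      (sets (vimage_algebra (space M) \<xi> borel)) (sets (vimage_algebra (space M) W (path_borel T))) \<and>
    distr M borel \<xi> = \<mu>0 \<and> distr M (path_borel T) W = \<nu>"

text \<open>Clause (2) uses the extended-valued convolution of \<open>|b\<^sub>t|\<close>, and by absolute continuity of the
  time marginals it does not depend on the representative \<open>h\<close>. It also guarantees that, almost
  surely, the Bochner integrals in (3) exist (for almost every \<open>s\<close> in the case of the convolution),
  so that their default value 0 plays no role.\<close>

definition weak_solution ::
    "real \<Rightarrow> (real \<Rightarrow> 'a::euclidean_space \<Rightarrow> 'a) \<Rightarrow> 'a measure \<Rightarrow> (real \<Rightarrow> 'a) measure \<Rightarrow>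
     'w measure \<Rightarrow> ('w \<Rightarrow> real \<Rightarrow> 'a) \<Rightarrow> ('w \<Rightarrow> real \<Rightarrow> 'a) \<Rightarrow> ('w \<Rightarrow> 'a) \<Rightarrow> bool" where
  "weak_solution T b \<mu>0 \<nu> M X W \<xi> \<longleftrightarrow>
    input_data T \<mu>0 \<nu> M W \<xi> \<and> X \<in> M \<rightarrow>\<^sub>M path_borel T \<and>
    \<comment> \<open>(1)\<close>
    (\<forall>t\<in>{0<..T}. absolutely_continuous lborel (time_law M X t)) \<and>
    \<comment> \<open>(2)\<close>
    (\<exists>h :: real \<times> 'a \<Rightarrow> ennreal. h \<in> borel_measurable (time_measure T \<Otimes>\<^sub>M lborel) \<and>
      (AE (t, x) in time_measure T \<Otimes>\<^sub>M lborel.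
        h (t, x) = abs_measure_convolution (b t) (time_law M X t) x) \<and>
      (AE \<omega> in M. (\<integral>\<^sup>+ s. h (s, X \<omega> s) \<partial>time_measure T) < \<infinity>)) \<and>
    \<comment> \<open>(3)\<close>
    (AE \<omega> in M. \<forall>t\<in>{0..T}.
      X \<omega> t = \<xi> \<omega>
        + (LINT s:{0..t}|lborel. measure_convolution (b s) (time_law M X s) (X \<omega> s)) + W \<omega> t)"

text \<open>The raw filtration \<open>\<sigma>{Y\<^sub>s : s \<in> [0,t]}\<close>, not completed by null sets.\<close>

definition generated_filtration ::
    "'w measure \<Rightarrow> ('w \<Rightarrow> real \<Rightarrow> 'a::topological_space) \<Rightarrow> real \<Rightarrow> 'w measure" where
  "generated_filtration M Y t =
    sigma (space M) {(\<lambda>\<omega>. Y \<omega> s) -` A \<inter> space M | s A. s \<in> {0..t} \<and> A \<in> sets borel}"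

definition strong_solution ::
    "real \<Rightarrow> (real \<Rightarrow> 'a::euclidean_space \<Rightarrow> 'a) \<Rightarrow> 'a measure \<Rightarrow> (real \<Rightarrow> 'a) measure \<Rightarrow>
     'w measure \<Rightarrow> ('w \<Rightarrow> real \<Rightarrow> 'a) \<Rightarrow> ('w \<Rightarrow> real \<Rightarrow> 'a) \<Rightarrow> ('w \<Rightarrow> 'a) \<Rightarrow> bool" where
  "strong_solution T b \<mu>0 \<nu> M X W \<xi> \<longleftrightarrow>
    weak_solution T b \<mu>0 \<nu> M X W \<xi> \<and>
    (\<forall>t\<in>{0..T}. (\<lambda>\<omega>. X \<omega> t) \<in>
      borel_measurable (generated_filtration M (\<lambda>\<omega> s. \<xi> \<omega> + W \<omega> s) t))"

definition bounded_marginals ::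
    "real \<Rightarrow> ennreal \<Rightarrow> 'w measure \<Rightarrow> ('w \<Rightarrow> real \<Rightarrow> 'a::euclidean_space) \<Rightarrow> bool" where
  "bounded_marginals T p M X \<longleftrightarrow> (SUP t\<in>{0..T}. density_Lp_norm p (time_law M X t)) < \<infinity>"

end

theory Submission
  imports Defs
begin

text \<open>If \<open>\<mu>\<^sub>s\<close> acts boundedly on \<open>L\<^sup>q\<close>, then \<open>b\<^sub>s * \<mu>\<^sub>s\<close> is Lipschitz with a constant \<open>C \<parallel>D b\<^sub>s\<parallel>\<^sub>q\<close>, and its
  Jacobian matrix inherits the lower bound of \<open>div b\<^sub>s\<close> on the trace. Moreover, two processes on the same probability space
  that stay within distance \<open>\<delta>\<close> of each other produce drifts that differ by at most \<open>C \<delta> \<parallel>D b\<^sub>s\<parallel>\<^sub>q\<close>: both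
  values of \<open>b\<^sub>s\<close> are compared with the values on a ball of radius \<open>\<delta>\<close>, and after averaging over the ball only
  increments of \<open>b\<^sub>s\<close> by deterministic vectors remain, tested against one law at a time. So Gronwall's inequality in the supremum norm over all paths gives uniqueness and the
  convergence of the Euler scheme.

  The \<open>L\<^sup>p\<close> bound comes from freezing \<open>W\<close>. An Euler step is then a map \<open>x \<mapsto> x + A x\<close>, where \<open>A\<close> has a small Lipschitz
  constant \<open>\<epsilon>\<close>; its Jacobian determinant is at least \<open>1 - \<integral> (div b\<^sub>s)\<^sup>- ds - O(\<epsilon>\<^sup>2)\<close>, and the quadratic errors sum up to at
  most one on a fine grid. The initial point is therefore moved by a map that compresses volumes by at most a constant
  factor, and \<open>\<L>(X\<^sub>t)\<close> is a mixture over \<open>W\<close> of images of \<open>\<rho>\<close> under such maps. As \<open>1/p + 1/q < 1\<close>, these laws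
  act boundedly on \<open>L\<^sup>q\<close>, uniformly in the grid.\<close>

section \<open>Path space and the generated filtration\<close>

text \<open>The solution is built as a functional of the path of \<xi> + W, on path space with the
  law of this path and for every path, not just almost every one. This gives a solution on any
  probability space carrying the input, adapted to the raw filtration; and since pathwise uniqueness
  identifies every solution with the same functional of its input, it also gives equality of laws
  across different spaces.

  The obstacle is a loop of constants. The gradient of the drift is bounded by \<open>K\<close>
  times the integral of \<beta>; \<open>K\<close> comes from the compression factor of the Euler
  maps; and these maps move points by that drift. The loop is cut because the determinant of one
  step depends to first order on the trace alone. So \<gamma> fixes the compression factor
  \<open>\<Lambda>\<close>, then \<open>\<Lambda>\<close> fixes \<open>K\<close>, and only then is
  the mesh chosen, so fine that all errors depending on \<open>K\<close> together cost at most a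
  factor e, which is already part of \<open>\<Lambda>\<close>.\<close>

lemma mdist_path_space_le_iff:
  assumes "f \<in> space (path_borel T :: (real \<Rightarrow> 'a::euclidean_space) measure)" "g \<in> space (path_borel T)" "0 \<le> T"
  shows "mdist (path_space T) f g \<le> r \<longleftrightarrow> (\<forall>t\<in>{0..T}. dist (f t) (g t) \<le> r)"
  using assms cfunspace_mdist_le[of f "top_of_set {0..T}" euclidean_metric g r]
  unfolding space_path_borel mspace_path_space[symmetric] path_space_def by auto

lemma sets_path_borel:
  "sets (path_borel T :: (real \<Rightarrow> 'a::euclidean_space) measure) =
     sigma_sets (mspace (path_space T)) {U. openin (mtopology_of (path_space T)) U}"
proof -
  have "{U. openin (mtopology_of (path_space T)) U} \<subseteq>
      Pow (mspace (path_space T :: (real \<Rightarrow> 'a) metric))"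
    using openin_subset by fastforce
  then show ?thesis
    unfolding path_borel_def by simp
qed

lemma openin_path_space_iff:
  "openin (mtopology_of (path_space T)) U \<longleftrightarrow> U \<subseteq> mspace (path_space T) \<and>
     (\<forall>f\<in>U. \<exists>r>0. {g \<in> mspace (path_space T). mdist (path_space T) f g < r} \<subseteq> U)"
proof -
  interpret Metric_space "mspace (path_space T)" "mdist (path_space T)" by simp
  show ?thesis
    unfolding mtopology_of_def openin_mtopology by (auto simp: mball_def subset_eq)
qed

lemma measurable_eval_path:
  assumes "0 \<le> T"
  shows "(\<lambda>f. f t) \<in> borel_measurable (path_borel T :: (real \<Rightarrow> 'a::euclidean_space) measure)"
proof (cases "t \<in> {0..T}")
  case False
  then show ?thesis
    by (subst measurable_cong[where g="\<lambda>_. undefined"]) (auto simp: space_path_borel extensional_def)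
next
  case True
  show ?thesis
  proof (rule borel_measurableI)
    fix S :: "'a set" assume S: "open S"
    let ?U = "(\<lambda>f. f t) -` S \<inter> mspace (path_space T)"
    have "openin (mtopology_of (path_space T)) ?U"
      unfolding openin_path_space_iff
    proof (intro conjI ballI)
      show "?U \<subseteq> mspace (path_space T)" by auto
      fix f :: "real \<Rightarrow> 'a" assume "f \<in> ?U"
      then have f: "f \<in> mspace (path_space T)" "f t \<in> S" by auto
      obtain e where e: "e > 0" "ball (f t) e \<subseteq> S" using S f open_contains_ball by blast
      have "{g \<in> mspace (path_space T). mdist (path_space T) f g < e} \<subseteq> ?U"
      proof safe
        fix g assume g: "g \<in> mspace (path_space T)" "mdist (path_space T) f g < e"
        have "dist (f t) (g t) \<le> mdist (path_space T) f g"
          using mdist_path_space_le_iff[of f T g "mdist (path_space T) f g"] f g True assms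
          by (simp add: space_path_borel mspace_path_space)
        then show "g \<in> (\<lambda>f. f t) -` S" using e g by auto
      qed
      then show "\<exists>r>0. {g \<in> mspace (path_space T). mdist (path_space T) f g < r} \<subseteq> ?U" using e by blast
    qed
    then show "(\<lambda>f. f t) -` S \<inter> space (path_borel T) \<in> sets (path_borel T)"
      unfolding sets_path_borel by (auto simp: space_path_borel mspace_path_space)
  qed
qed

text \<open>Every open set is a countable union of tubes \<open>{f. \<forall>k. \<forall>s \<in> [kT/N,(k+1)T/N]. dist (f s) c\<^sub>k \<le> 1/m}\<close>,
  which replaces separability of the path space.\<close>

lemma measurable_path_borelI:
  fixes X :: "'w \<Rightarrow> real \<Rightarrow> 'a::euclidean_space"
  assumes T: "0 \<le> T"
    and sp: "\<And>\<omega>. \<omega> \<in> space M \<Longrightarrow> X \<omega> \<in> space (path_borel T)"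
    and ev: "\<And>t. t \<in> {0..T} \<Longrightarrow> (\<lambda>\<omega>. X \<omega> t) \<in> borel_measurable M"
  shows "X \<in> M \<rightarrow>\<^sub>M path_borel T"
  unfolding path_borel_def
proof (rule measurable_measure_of)
  show "{U. openin (mtopology_of (path_space T)) U} \<subseteq> Pow (mspace (path_space T :: (real \<Rightarrow> 'a) metric))"
    using openin_subset by fastforce
  show "X \<in> space M \<rightarrow> mspace (path_space T)" using sp by (auto simp: space_path_borel mspace_path_space)
  fix U :: "(real \<Rightarrow> 'a) set" assume "U \<in> {U. openin (mtopology_of (path_space T)) U}"
  then have U: "U \<subseteq> mspace (path_space T)"
     "\<And>f. f \<in> U \<Longrightarrow> \<exists>r>0. {g \<in> mspace (path_space T). mdist (path_space T) f g < r} \<subseteq> U"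
    unfolding mem_Collect_eq openin_path_space_iff by auto
  obtain D :: "'a set" where D: "countable D" "\<And>V. open V \<Longrightarrow> V \<noteq> {} \<Longrightarrow> \<exists>d\<in>D. d \<in> V"
    using countable_dense_setE by blast
  \<comment> \<open>The length of the list is the number of cells, its entries are the centres and
    \<open>m\<close> sets the tolerance. With centres from the countable dense set \<open>D\<close>
    only countably many tubes occur.\<close>
  define tube where "tube = (\<lambda>(m::nat, cs :: 'a list). {f :: real \<Rightarrow> 'a. f \<in> mspace (path_space T) \<and> (\<forall>k<length cs.
     \<forall>s\<in>{0..T}. s \<in> {real k * T / length cs .. (real k + 1) * T / length cs} \<longrightarrow> dist (f s) (cs ! k) \<le> 1 / Suc m)})"
  define I where "I = {p \<in> UNIV \<times> (lists D - {[]}). tube p \<subseteq> U}"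
  have cI: "countable I" unfolding I_def using D(1)
    by (intro countable_subset[OF _ countable_SIGMA[of UNIV "\<lambda>_. lists D"]]) auto
  have "f \<in> (\<Union>p\<in>I. tube p)" if f: "f \<in> U" for f
  proof -
    obtain r where r: "r > 0" "{g \<in> mspace (path_space T). mdist (path_space T) f g < r} \<subseteq> U"
      using U(2)[OF f] by blast
    have f': "f \<in> mspace (path_space T)" using U f by auto
    then have cf: "continuous_on {0..T} f" by (simp add: mspace_path_space)
    obtain m where m: "inverse (real (Suc m)) < r / 3" using reals_Archimedean[of "r/3"] r(1) by auto
    define e where "e = 1 / real (Suc m)"
    \<comment> \<open>Two paths in one tube differ by at most \<open>2 * e\<close>, which
      \<open>3 * e < r\<close> keeps inside the ball around \<open>f\<close>.\<close>
    have e: "e > 0" "3 * e < r" using m unfolding e_def inverse_eq_divide by auto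
    have "uniformly_continuous_on {0..T} f" using cf compact_uniformly_continuous by blast
    then obtain d where d: "d > 0" "\<And>s t. s \<in> {0..T} \<Longrightarrow> t \<in> {0..T} \<Longrightarrow> dist s t < d \<Longrightarrow> dist (f s) (f t) < e/2"
      unfolding uniformly_continuous_on_def using e(1) by (metis half_gt_zero)
    obtain N :: nat where N: "T / d < real N" using reals_Archimedean2 by blast
    then have N: "T / real (Suc N) < d" using d(1) by (simp add: divide_simps) (simp add: algebra_simps)
    define n where "n = Suc N"
    have n: "n > 0" "T / real n < d" using N by (auto simp: n_def)
    have "\<exists>c\<in>D. dist (f (real k * T / n)) c < e/2" for k
      using D(2)[of "ball (f (real k * T / n)) (e/2)"] e by auto
    then obtain c where c: "\<And>k. c k \<in> D" "\<And>k. dist (f (real k * T / n)) (c k) < e/2" by metis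
    define cs where "cs = map c [0..<n]"
    have len: "length cs = n" by (simp add: cs_def)
    have "dist (f s) (cs ! k) \<le> e" if "k < n" "s \<in> {0..T}" "s \<in> {real k * T / n .. (real k + 1) * T / n}" for k s
    proof -
      have "real k * T / n \<in> {0..T}" using that n T by (auto simp: field_simps mult_left_mono)
      moreover have "dist s (real k * T / n) < d" using that n by (auto simp: dist_real_def field_simps)
      ultimately have "dist (f s) (f (real k * T / n)) < e/2" using d(2) that by auto
      then show ?thesis using c(2)[of k] dist_triangle[of "f s" "c k" "f (real k * T / n)"] that by (auto simp: cs_def)
    qed
    then have ft: "f \<in> tube (m, cs)" using f' by (auto simp: tube_def len e_def)
    have "tube (m, cs) \<subseteq> U"
    proof
      fix g assume g: "g \<in> tube (m, cs)"
      have "dist (f s) (g s) \<le> 2 * e" if s: "s \<in> {0..T}" for s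
      proof -
        obtain k where k: "k < n" "s \<in> {real k * T / n .. (real k + 1) * T / n}"
        \<comment> \<open>The end point belongs to the last cell, whereas the floor formula would
          return the index \<open>n\<close>.\<close>
        proof (cases "s = T")
          case True
          have "s \<in> {real (n-1) * T / n .. (real (n-1) + 1) * T / n}"
            using True n T by (auto simp: field_simps of_nat_diff)
          then show ?thesis using n that[of "n-1"] by auto
        next
          case False
          then have T0: "T > 0" "s < T" "s \<ge> 0" using s by auto
          define k where "k = nat \<lfloor>s * n / T\<rfloor>"
          have k1: "real k = of_int \<lfloor>s * n / T\<rfloor>" unfolding k_def using T0 n by simp
          have "real k \<le> s * n / T" "s * n / T < real k + 1" unfolding k1 by linarith+
          moreover have "s * n / T < n" using T0 n by (auto simp: field_simps)
          moreover from calculation have "real k < real n" by linarith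
          ultimately have "real k < real n" "s \<in> {real k * T / n .. (real k + 1) * T / n}"
            using T0 n by (auto simp: field_simps)
          then show ?thesis using that[of k] by simp
        qed
        have "dist (g s) (cs ! k) \<le> e" using g k s by (auto simp: tube_def len e_def)
        moreover have "dist (f s) (cs ! k) \<le> e" using ft k s by (auto simp: tube_def len e_def)
        ultimately show ?thesis using dist_triangle2[of "f s" "g s" "cs ! k"] by linarith
      qed
      then have "mdist (path_space T) f g \<le> 2 * e"
        using mdist_path_space_le_iff[of f T g "2*e"] f' g T by (auto simp: space_path_borel mspace_path_space tube_def)
      then show "g \<in> U" using r(2) e g by (auto simp: tube_def)
    qed
    moreover have "cs \<in> lists D - {[]}" using c n by (auto simp: cs_def)
    ultimately show ?thesis using ft unfolding I_def by blast
  qed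
  then have Ueq: "U = (\<Union>p\<in>I. tube p)" unfolding I_def by blast
  have tm: "X -` tube p \<inter> space M \<in> sets M" for p
  proof -
    obtain m cs where p: "p = (m, cs)" by force
    let ?J = "\<lambda>k. {0..T} \<inter> {real k * T / length cs .. (real k + 1) * T / length cs}"
    \<comment> \<open>Continuity reduces the condition on a cell to a dense countable subset. The
      end points are adjoined because a cell can degenerate to a single, possibly irrational
      point.\<close>
    define Q where "Q k = (if ?J k = {} then {} else {s. s \<in> ?J k \<and> (s \<in> \<rat> \<or> s = max 0 (real k * T / length cs) \<or> s = min T ((real k + 1) * T / length cs))})" for k
    have cQ: "countable (Q k)" for k
    proof -
      have "Q k \<subseteq> \<rat> \<union> {max 0 (real k * T / length cs), min T ((real k + 1) * T / length cs)}" unfolding Q_def by auto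
      then show ?thesis using countable_subset countable_rat by (metis countable_Un countable_finite finite.emptyI finite_insert)
    qed
    have QJ: "?J k \<subseteq> closure (Q k)" "Q k \<subseteq> ?J k" for k
    proof -
      show "Q k \<subseteq> ?J k" unfolding Q_def by auto
      define l where "l = max 0 (real k * T / length cs)"
      define u where "u = min T ((real k + 1) * T / length cs)"
      have J: "?J k = {l..u}" by (auto simp: l_def u_def)
      show "?J k \<subseteq> closure (Q k)"
      proof
        fix s assume s: "s \<in> ?J k"
        then have Q: "Q k = {s\<in>{l..u}. s \<in> \<rat> \<or> s = l \<or> s = u}" unfolding Q_def J l_def[symmetric] u_def[symmetric] by auto
        have lus: "l \<le> s" "s \<le> u" using s J by auto
        show "s \<in> closure (Q k)"
        proof (cases "l = s")
          case True then show ?thesis using lus by (intro subsetD[OF closure_subset]) (auto simp: Q)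
        next
          case False
          show ?thesis unfolding closure_approachable
          proof safe
            fix e :: real assume "e > 0"
            then obtain x where "x \<in> \<rat>" "max l (s - e) < x" "x < s"
              using Rats_dense_in_real[of "max l (s - e)" s] False lus by auto
            then show "\<exists>y\<in>Q k. dist y s < e" using lus by (intro bexI[of _ x]) (auto simp: Q dist_real_def)
          qed
        qed
      qed
    qed
    have "X -` tube p \<inter> space M = {\<omega>\<in>space M. \<forall>k<length cs. \<forall>s\<in>Q k. dist (X \<omega> s) (cs ! k) \<le> 1 / Suc m}" (is "?L = ?R")
    proof
      show "?L \<subseteq> ?R" using QJ(2) unfolding p tube_def by fastforce
      show "?R \<subseteq> ?L"
      proof safe
        fix \<omega> assume w: "\<omega> \<in> space M" "\<forall>k<length cs. \<forall>s\<in>Q k. dist (X \<omega> s) (cs ! k) \<le> 1 / Suc m"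
        have X: "X \<omega> \<in> mspace (path_space T)" "continuous_on {0..T} (X \<omega>)"
          using sp[OF w(1)] by (auto simp: space_path_borel mspace_path_space)
        have "dist (X \<omega> s) (cs ! k) \<le> 1 / Suc m" if k: "k < length cs" "s \<in> ?J k" for k s
        proof -
          have "closed (?J k)" by (intro closed_Int) auto
          then have cl: "closure (Q k) \<subseteq> ?J k" using QJ(2) by (simp add: closure_minimal)
          have "continuous_on (closure (Q k)) (\<lambda>s. dist (X \<omega> s) (cs ! k))"
            by (intro continuous_intros continuous_on_subset[OF X(2)]) (use cl in auto)
          then show ?thesis
            by (rule continuous_le_on_closure[OF _ subsetD[OF QJ(1) k(2)]]) (use w(2) k(1) in blast)
        qed
        then show "\<omega> \<in> X -` tube p" using X unfolding p tube_def by auto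
      qed
    qed
    also have "\<dots> \<in> sets M"
    proof -
      have "(\<lambda>\<omega>. dist (X \<omega> s) (cs ! k)) \<in> borel_measurable M" if "s \<in> Q k" for k s
        using ev[of s] QJ(2)[of k] that by (intro borel_measurable_dist) auto
      then have "{\<omega>\<in>space M. 1 / Suc m < dist (X \<omega> s) (cs ! k)} \<in> sets M" if "s \<in> Q k" for k s
        using that by (intro borel_measurable_less) auto
      then have "space M - (\<Union>k<length cs. \<Union>s\<in>Q k. {\<omega>\<in>space M. 1 / Suc m < dist (X \<omega> s) (cs ! k)}) \<in> sets M"
        using cQ by (intro sets.Diff sets.top sets.finite_UN sets.countable_UN'') auto
      also have "space M - (\<Union>k<length cs. \<Union>s\<in>Q k. {\<omega>\<in>space M. 1 / Suc m < dist (X \<omega> s) (cs ! k)})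
         = {\<omega>\<in>space M. \<forall>k<length cs. \<forall>s\<in>Q k. dist (X \<omega> s) (cs ! k) \<le> 1 / Suc m}"
        using not_le by blast
      finally show ?thesis .
    qed
    finally show ?thesis .
  qed
  have "X -` U \<inter> space M = (\<Union>p\<in>I. X -` tube p \<inter> space M)" unfolding Ueq by auto
  also have "\<dots> \<in> sets M" using cI tm by (intro sets.countable_UN'')
  finally show "X -` U \<inter> space M \<in> sets M" .
qed

text \<open>Rounding time down to a grid leaves countably many fixed-time evaluations, and
  continuity of the paths gives convergence as the grid is refined. The clamp lets time run over the
  whole line while looking at the path up to \<open>t\<close> only, so with a filtration at time
  \<open>t\<close> in place of \<open>M\<close> this is progressive measurability.\<close>

lemma measurable_continuous_process:
  fixes X :: "'w \<Rightarrow> real \<Rightarrow> 'a::euclidean_space"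
  assumes t: "0 \<le> t" and cont: "\<And>\<omega>. \<omega> \<in> space M \<Longrightarrow> continuous_on {0..t} (X \<omega>)"
    and meas: "\<And>s. s \<in> {0..t} \<Longrightarrow> (\<lambda>\<omega>. X \<omega> s) \<in> borel_measurable M"
  shows "(\<lambda>(s, \<omega>). X \<omega> (max 0 (min t s))) \<in> borel_measurable (borel \<Otimes>\<^sub>M M)"
proof -
  define r where "r n (k::int) = max 0 (min t (real_of_int k / real (Suc n)))" for n k
  have r01: "r n k \<in> {0..t}" for n k using t by (auto simp: r_def)
  show ?thesis
  proof (rule borel_measurable_LIMSEQ_metric)
    show "(\<lambda>(s, \<omega>). X \<omega> (r n \<lfloor>s * real (Suc n)\<rfloor>)) \<in> borel_measurable (borel \<Otimes>\<^sub>M M)" for n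
      unfolding case_prod_beta
    proof (rule measurable_compose_countable[where g="\<lambda>x. \<lfloor>fst x * real (Suc n)\<rfloor>"])
      show "(\<lambda>x. X (snd x) (r n k)) \<in> borel_measurable (borel \<Otimes>\<^sub>M M)" for k
        by (rule measurable_compose[OF measurable_snd meas[OF r01]])
      have "(\<lambda>x. fst x * real (Suc n)) \<in> borel_measurable (borel \<Otimes>\<^sub>M M)"
        by (intro borel_measurable_times measurable_fst borel_measurable_const)
      from measurable_compose[OF this measurable_real_floor]
      show "(\<lambda>x. \<lfloor>fst x * real (Suc n)\<rfloor>) \<in> borel \<Otimes>\<^sub>M M \<rightarrow>\<^sub>M count_space UNIV" .
    qed
    fix x assume "x \<in> space (borel \<Otimes>\<^sub>M M :: (real \<times> 'w) measure)"
    then obtain s \<omega> where x: "x = (s, \<omega>)" "\<omega> \<in> space M" by (auto simp: space_pair_measure)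
    have "(\<lambda>n. of_int \<lfloor>s * Suc n\<rfloor> / real (Suc n)) \<longlonglongrightarrow> s"
    proof (rule Lim_null[THEN iffD2], rule Lim_null_comparison[OF _ LIMSEQ_inverse_real_of_nat], intro always_eventually allI)
      fix n
      have "real_of_int \<lfloor>s * Suc n\<rfloor> \<le> s * Suc n" "s * Suc n < real_of_int \<lfloor>s * Suc n\<rfloor> + 1" by linarith+
      then have "\<bar>real_of_int \<lfloor>s * Suc n\<rfloor> - s * Suc n\<bar> / real (Suc n) \<le> 1 / real (Suc n)"
        by (intro divide_right_mono) linarith+
      moreover have "of_int \<lfloor>s * Suc n\<rfloor> / real (Suc n) - s = (of_int \<lfloor>s * Suc n\<rfloor> - s * Suc n) / real (Suc n)"
        by (simp add: diff_divide_distrib del: of_nat_Suc)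
      ultimately show "norm (of_int \<lfloor>s * Suc n\<rfloor> / real (Suc n) - s) \<le> inverse (real (Suc n))"
        by (simp add: inverse_eq_divide)
    qed
    then have "(\<lambda>n. r n \<lfloor>s * Suc n\<rfloor>) \<longlonglongrightarrow> max 0 (min t s)"
      unfolding r_def by (intro tendsto_intros)
    then show "(\<lambda>n. case x of (s, \<omega>) \<Rightarrow> X \<omega> (r n \<lfloor>s * Suc n\<rfloor>)) \<longlonglongrightarrow> (case x of (s, \<omega>) \<Rightarrow> X \<omega> (max 0 (min t s)))"
      unfolding x case_prod_conv
      by (intro continuous_on_tendsto_compose[OF cont[OF x(2)]]) (use r01 t in auto)
  qed
qed

section \<open>The raw generated filtration\<close>

lemma space_generated_filtration [simp]: "space (generated_filtration M Y t) = space M"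
  unfolding generated_filtration_def by (rule space_measure_of) auto

lemma sets_generated_filtration:
  "sets (generated_filtration M Y t) =
     sigma_sets (space M) {(\<lambda>\<omega>. Y \<omega> s) -` A \<inter> space M | s A. s \<in> {0..t} \<and> A \<in> sets borel}"
  unfolding generated_filtration_def by (rule sets_measure_of) auto

lemma measurable_generated_filtration_eval:
  "s \<in> {0..t} \<Longrightarrow> (\<lambda>\<omega>. Y \<omega> s) \<in> borel_measurable (generated_filtration M Y t)"
  by (rule measurableI) (auto simp: sets_generated_filtration intro!: sigma_sets.Basic)

lemma measurable_generated_filtrationI:
  assumes "f \<in> space N \<rightarrow> space M" "\<And>s. s \<in> {0..t} \<Longrightarrow> (\<lambda>\<omega>. Y (f \<omega>) s) \<in> borel_measurable N"
  shows "f \<in> N \<rightarrow>\<^sub>M generated_filtration M Y t"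
  unfolding generated_filtration_def
proof (rule measurable_measure_of)
  fix U assume "U \<in> {(\<lambda>\<omega>. Y \<omega> s) -` A \<inter> space M | s A. s \<in> {0..t} \<and> A \<in> sets borel}"
  then obtain s A where U: "U = (\<lambda>\<omega>. Y \<omega> s) -` A \<inter> space M" "s \<in> {0..t}" "A \<in> sets borel" by auto
  have "f -` U \<inter> space N = (\<lambda>\<omega>. Y (f \<omega>) s) -` A \<inter> space N" using assms(1) by (auto simp: U)
  then show "f -` U \<inter> space N \<in> sets N" using measurable_sets[OF assms(2)] U by auto
qed (use assms in auto)

lemma measurable_generated_filtration_mono:
  assumes "f \<in> generated_filtration M Y s \<rightarrow>\<^sub>M N" "s \<le> t"
  shows "f \<in> generated_filtration M Y t \<rightarrow>\<^sub>M N"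
proof -
  have "(\<lambda>x. x) \<in> generated_filtration M Y t \<rightarrow>\<^sub>M generated_filtration M Y s"
    using assms(2) by (intro measurable_generated_filtrationI measurable_generated_filtration_eval) auto
  from measurable_compose[OF this assms(1)] show ?thesis by simp
qed

lemma measurable_generated_filtration_sub:
  assumes "f \<in> generated_filtration M Y t \<rightarrow>\<^sub>M N" "\<And>s. s \<in> {0..t} \<Longrightarrow> (\<lambda>\<omega>. Y \<omega> s) \<in> borel_measurable M"
  shows "f \<in> M \<rightarrow>\<^sub>M N"
proof -
  have "(\<lambda>x. x) \<in> M \<rightarrow>\<^sub>M generated_filtration M Y t"
    using assms(2) by (intro measurable_generated_filtrationI) auto
  from measurable_compose[OF this assms(1)] show ?thesis by simp
qed

section \<open>Increments of weakly differentiable functions\<close>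

lemma iterated_partial_prod:
  fixes G :: "'a::euclidean_space \<Rightarrow> nat \<Rightarrow> real \<Rightarrow> real"
  assumes G: "\<And>i k t. i \<in> Basis \<Longrightarrow> (G i k has_real_derivative G i (Suc k) t) (at t)"
    and "set is \<subseteq> Basis"
  shows "iterated_partial is (\<lambda>x. \<Prod>i\<in>Basis. G i 0 (x \<bullet> i)) = (\<lambda>x. \<Prod>i\<in>Basis. G i (count_list is i) (x \<bullet> i))"
    and "((\<lambda>x. \<Prod>i\<in>Basis. G i (c i) (x \<bullet> i)) has_derivative
       (\<lambda>h. \<Sum>i\<in>Basis. (h \<bullet> i) * (G i (Suc (c i)) (x \<bullet> i) * (\<Prod>j\<in>Basis - {i}. G j (c j) (x \<bullet> j))))) (at x)"
proof -
  have D: "((\<lambda>x. \<Prod>i\<in>Basis. G i (c i) (x \<bullet> i)) has_derivative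
       (\<lambda>h. \<Sum>i\<in>Basis. (h \<bullet> i) * (G i (Suc (c i)) (x \<bullet> i) * (\<Prod>j\<in>Basis - {i}. G j (c j) (x \<bullet> j))))) (at x)" for c x
  proof (rule has_derivative_eq_rhs[OF has_derivative_prod])
    fix i :: 'a assume i: "i \<in> Basis"
    have "((\<lambda>x. x \<bullet> i) has_derivative (\<lambda>h. h \<bullet> i)) (at x)" by (intro derivative_eq_intros) auto
    from has_derivative_compose[OF this G[OF i, unfolded has_field_derivative_def]]
    show "((\<lambda>x. G i (c i) (x \<bullet> i)) has_derivative (\<lambda>h. G i (Suc (c i)) (x \<bullet> i) * (h \<bullet> i))) (at x)" .
  qed (auto simp: ac_simps)
  show "((\<lambda>x. \<Prod>i\<in>Basis. G i (c i) (x \<bullet> i)) has_derivative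
       (\<lambda>h. \<Sum>i\<in>Basis. (h \<bullet> i) * (G i (Suc (c i)) (x \<bullet> i) * (\<Prod>j\<in>Basis - {i}. G j (c j) (x \<bullet> j))))) (at x)"
    by (rule D)
  show "iterated_partial is (\<lambda>x. \<Prod>i\<in>Basis. G i 0 (x \<bullet> i)) = (\<lambda>x. \<Prod>i\<in>Basis. G i (count_list is i) (x \<bullet> i))"
    using assms(2)
  proof (induction "is")
    case Nil then show ?case by simp
  next
    case (Cons i "is")
    then have i: "i \<in> Basis" by auto
    show ?case
    proof
      fix x
      have "iterated_partial (i # is) (\<lambda>x. \<Prod>i\<in>Basis. G i 0 (x \<bullet> i)) x
        = frechet_derivative (\<lambda>x. \<Prod>i\<in>Basis. G i (count_list is i) (x \<bullet> i)) (at x) i"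
        using Cons by simp
      also have "\<dots> = (\<Sum>j\<in>Basis. (i \<bullet> j) * (G j (Suc (count_list is j)) (x \<bullet> j) * (\<Prod>k\<in>Basis - {j}. G k (count_list is k) (x \<bullet> k))))"
        unfolding frechet_derivative_at[OF D, symmetric] ..
      also have "\<dots> = (\<Sum>j\<in>Basis. if j = i then G j (Suc (count_list is j)) (x \<bullet> j) * (\<Prod>k\<in>Basis - {j}. G k (count_list is k) (x \<bullet> k)) else 0)"
        using i by (intro sum.cong) (auto simp: inner_Basis)
      also have "\<dots> = G i (Suc (count_list is i)) (x \<bullet> i) * (\<Prod>k\<in>Basis - {i}. G k (count_list is k) (x \<bullet> k))"
        using i by simp
      also have "(\<Prod>k\<in>Basis - {i}. G k (count_list is k) (x \<bullet> k)) = (\<Prod>k\<in>Basis - {i}. G k (count_list (i # is) k) (x \<bullet> k))"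
        by (intro prod.cong) auto
      also have "G i (Suc (count_list is i)) (x \<bullet> i) * \<dots> = (\<Prod>k\<in>Basis. G k (count_list (i # is) k) (x \<bullet> k))"
        using i by (simp add: prod.remove[of Basis i])
      finally show "iterated_partial (i # is) (\<lambda>x. \<Prod>i\<in>Basis. G i 0 (x \<bullet> i)) x = (\<Prod>k\<in>Basis. G k (count_list (i # is) k) (x \<bullet> k))" .
    qed
  qed
qed

text \<open>The flat function exp(-1/t) with a polynomial factor in 1/t. The factor makes the family
  closed under differentiation, so that a single derivative formula yields smoothness of all
  orders.\<close>

definition exp_flat :: "real poly \<Rightarrow> real \<Rightarrow> real" where
  "exp_flat P t = (if t \<le> 0 then 0 else poly P (inverse t) * exp (- inverse t))"

lemma tendsto_poly_exp_minus: "((\<lambda>x. poly P x * exp (- x)) \<longlongrightarrow> 0) (at_top :: real filter)"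
proof -
  have "((\<lambda>x. \<Sum>i\<le>degree P. coeff P i * (x ^ i / exp x)) \<longlongrightarrow> (\<Sum>i\<le>degree P. coeff P i * 0)) (at_top :: real filter)"
    by (intro tendsto_intros tendsto_power_div_exp_0)
  then show ?thesis by (simp add: poly_altdef sum_distrib_right exp_minus divide_inverse mult.assoc)
qed

text \<open>With s = 1/t, the derivative of P(s) exp(-s) in t is s^2 (P(s) - P'(s)) exp(-s). At 0
  the difference quotient from the right equals s P(s) exp(-s) with s tending to infinity, hence
  vanishes in the limit.\<close>

lemma exp_flat_deriv:
  "(exp_flat P has_real_derivative exp_flat ([:0,0,1:] * (P - pderiv P)) t) (at t)"
proof -
  consider "t < 0" | "t > 0" | "t = 0" by linarith
  then show ?thesis
  proof cases
    case 1
    have "((\<lambda>_. 0) has_real_derivative 0) (at t)" by simp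
    then show ?thesis
    proof (rule has_field_derivative_transform_within_open[where S="{..<0}", THEN DERIV_cong])
    qed (use 1 in \<open>auto simp: exp_flat_def\<close>)
  next
    case 2
    have "((\<lambda>t. poly P (inverse t) * exp (- inverse t)) has_real_derivative
        poly ([:0,0,1:] * (P - pderiv P)) (inverse t) * exp (- inverse t)) (at t)"
    proof (rule DERIV_cong)
      have inv: "(inverse has_real_derivative - (inverse t * inverse t)) (at t)"
        using DERIV_inverse[of t UNIV] 2 by (simp add: power2_eq_square)
      have 1: "((\<lambda>t. poly P (inverse t)) has_real_derivative poly (pderiv P) (inverse t) * - (inverse t * inverse t)) (at t)"
        by (rule DERIV_chain2[OF poly_DERIV inv])
      have 2: "((\<lambda>t. exp (- inverse t)) has_real_derivative exp (- inverse t) * - (- (inverse t * inverse t))) (at t)"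
        by (rule DERIV_chain2[OF DERIV_exp DERIV_minus[OF inv]])
      show "((\<lambda>t. poly P (inverse t) * exp (- inverse t)) has_real_derivative
         poly (pderiv P) (inverse t) * - (inverse t * inverse t) * exp (- inverse t)
          + exp (- inverse t) * - (- (inverse t * inverse t)) * poly P (inverse t)) (at t)"
        by (rule DERIV_mult[OF 1 2])
    qed (simp add: algebra_simps)
    then show ?thesis
    proof (rule has_field_derivative_transform_within_open[where S="{0<..}", THEN DERIV_cong])
    qed (use 2 in \<open>auto simp: exp_flat_def\<close>)
  next
    case 3
    have "((\<lambda>h. exp_flat P h / h) \<longlongrightarrow> 0) (at 0)"
    proof (rule filterlim_split_at)
      show "((\<lambda>h. exp_flat P h / h) \<longlongrightarrow> 0) (at_left 0)"
        by (rule tendsto_eventually) (auto simp: eventually_at_filter exp_flat_def)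
      have "((\<lambda>x. poly ([:0,1:] * P) x * exp (- x)) \<longlongrightarrow> 0) (at_top :: real filter)"
        by (rule tendsto_poly_exp_minus)
      then have "((\<lambda>h. poly ([:0,1:] * P) (inverse h) * exp (- inverse h)) \<longlongrightarrow> 0) (at_right 0)"
        using filterlim_compose filterlim_inverse_at_top_right by blast
      then show "((\<lambda>h. exp_flat P h / h) \<longlongrightarrow> 0) (at_right 0)"
        by (rule Lim_transform_eventually)
           (auto simp: eventually_at_filter exp_flat_def field_simps)
    qed
    then show ?thesis unfolding 3 DERIV_def by (simp add: exp_flat_def)
  qed
qed

text \<open>Finite sums of products of a factor flat at \<open>a\<close> and a factor flat at
  \<open>b\<close>. A list encodes the sum because the product rule produces two terms out of
  each.\<close>

definition exp_bumps :: "real \<Rightarrow> real \<Rightarrow> real \<Rightarrow> (real poly \<times> real poly) list \<Rightarrow> real \<Rightarrow> real" where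
  "exp_bumps n a b l t = (\<Sum>(P, Q)\<leftarrow>l. exp_flat P (n * (t - a)) * exp_flat Q (n * (b - t)))"

lemma exp_bumps_deriv: "\<exists>l'. \<forall>t. (exp_bumps n a b l has_real_derivative exp_bumps n a b l' t) (at t)"
proof (induction l)
  case Nil
  show ?case by (intro exI[of _ "[]"]) (simp add: exp_bumps_def)
next
  case (Cons p l)
  obtain P Q where p: "p = (P, Q)" by force
  obtain l' where l': "\<And>t. (exp_bumps n a b l has_real_derivative exp_bumps n a b l' t) (at t)" using Cons by auto
  let ?D = "\<lambda>P. [:0,0,1:] * (P - pderiv P) :: real poly"
  have 1: "((\<lambda>t. exp_flat P (n * (t - a))) has_real_derivative exp_flat (?D P) (n * (t - a)) * n) (at t)" for P t
    by (rule DERIV_chain2[OF exp_flat_deriv]) (auto intro!: derivative_eq_intros)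
  have 2: "((\<lambda>t. exp_flat P (n * (b - t))) has_real_derivative exp_flat (?D P) (n * (b - t)) * (- n)) (at t)" for P t
    by (rule DERIV_chain2[OF exp_flat_deriv]) (auto intro!: derivative_eq_intros)
  have sm: "exp_flat (smult c P) t = c * exp_flat P t" for c P t by (simp add: exp_flat_def)
  define DP where "DP = ?D P"
  \<comment> \<open>The factor \<open>- n\<close> is the inner derivative of
    \<open>n * (b - t)\<close>.\<close>
  define DQ where "DQ = smult (- n) (?D Q)"
  have DQ: "exp_flat DQ t = - n * exp_flat (?D Q) t" for t unfolding DQ_def by (rule sm)
  show ?case
  proof (intro exI[of _ "(smult n DP, Q) # (P, DQ) # l'"] allI)
    fix t
    have "exp_bumps n a b (p # l) = (\<lambda>t. exp_flat P (n * (t - a)) * exp_flat Q (n * (b - t)) + exp_bumps n a b l t)"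
      by (auto simp: exp_bumps_def p)
    moreover have "((\<lambda>t. exp_flat P (n * (t - a)) * exp_flat Q (n * (b - t)) + exp_bumps n a b l t) has_real_derivative
        exp_flat DP (n * (t - a)) * n * exp_flat Q (n * (b - t)) + exp_flat (?D Q) (n * (b - t)) * (- n) * exp_flat P (n * (t - a))
        + exp_bumps n a b l' t) (at t)"
      unfolding DP_def by (intro DERIV_add DERIV_mult 1 2 l')
    moreover have "exp_bumps n a b ((smult n DP, Q) # (P, DQ) # l') t =
        exp_flat DP (n * (t - a)) * n * exp_flat Q (n * (b - t)) + exp_flat (?D Q) (n * (b - t)) * (- n) * exp_flat P (n * (t - a))
        + exp_bumps n a b l' t"
      by (simp add: exp_bumps_def sm DQ)
    ultimately show "(exp_bumps n a b (p # l) has_real_derivative exp_bumps n a b ((smult n DP, Q) # (P, DQ) # l') t) (at t)"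
      by simp
  qed
qed

definition exp_bump :: "real \<Rightarrow> real \<Rightarrow> real \<Rightarrow> real \<Rightarrow> real" where
  "exp_bump n a b t = exp_flat 1 (n * (t - a)) * exp_flat 1 (n * (b - t))"

lemma exp_bump_smooth:
  "\<exists>G. G 0 = exp_bump n a b \<and> (\<forall>k t. (G k has_real_derivative G (Suc k) t) (at t))"
proof -
  obtain d where d: "\<And>l t. (exp_bumps n a b l has_real_derivative exp_bumps n a b (d l) t) (at t)"
    using exp_bumps_deriv[of n a b] by metis
  have "exp_bumps n a b [(1,1)] = exp_bump n a b" by (auto simp: exp_bumps_def exp_bump_def)
  then show ?thesis
    by (intro exI[of _ "\<lambda>k. exp_bumps n a b ((d ^^ k) [(1,1)])"]) (auto intro: d)
qed

lemma exp_flat_1: "exp_flat 1 t = (if t \<le> 0 then 0 else exp (- inverse t))" by (simp add: exp_flat_def)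

lemma exp_flat_1_bounds: "0 \<le> exp_flat 1 t" "exp_flat 1 t \<le> 1"
  by (auto simp: exp_flat_1)

text \<open>As \<open>n\<close> grows, factors exp(-1/(n c)) tend to 1; so these test functions,
  bounded by 1 and zero outside the box, converge pointwise to its indicator. Translates are again
  of this form, so that a weak identity known for them is known for all their translates.\<close>

definition box_bump :: "real \<Rightarrow> 'a::euclidean_space \<Rightarrow> 'a \<Rightarrow> 'a \<Rightarrow> real" where
  "box_bump n a b x = (\<Prod>i\<in>Basis. exp_bump n (a \<bullet> i) (b \<bullet> i) (x \<bullet> i))"

lemma box_bump_le1: "0 \<le> box_bump n a b x" "box_bump n a b x \<le> 1"
  unfolding box_bump_def by (intro prod_nonneg prod_le_1 ballI conjI; simp add: exp_bump_def exp_flat_1_bounds mult_le_one)+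

lemma box_bump_outside: "0 < n \<Longrightarrow> x \<notin> box a b \<Longrightarrow> box_bump n a b x = 0"
proof -
  assume "0 < n" "x \<notin> box a b"
  then obtain i where i: "i \<in> Basis" "\<not> (a \<bullet> i < x \<bullet> i \<and> x \<bullet> i < b \<bullet> i)" unfolding mem_box by blast
  then have "n * (x \<bullet> i - a \<bullet> i) \<le> 0 \<or> n * (b \<bullet> i - x \<bullet> i) \<le> 0" using \<open>0 < n\<close> by (auto simp: mult_le_0_iff)
  then have "exp_bump n (a \<bullet> i) (b \<bullet> i) (x \<bullet> i) = 0" by (auto simp: exp_bump_def exp_flat_1)
  then show ?thesis unfolding box_bump_def using i(1) by (intro prod_zero) auto
qed

lemma box_bump_tendsto: "(\<lambda>n. box_bump (real (Suc n)) a b x) \<longlonglongrightarrow> indicator (box a b) x"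
proof (cases "x \<in> box a b")
  case False
  then show ?thesis using box_bump_outside[of "real (Suc _)" x a b] by simp
next
  case True
  have ef: "(\<lambda>n. exp_flat 1 (real (Suc n) * c)) \<longlonglongrightarrow> 1" if "c > 0" for c
  proof -
    have "(\<lambda>n. exp (- (inverse (real (Suc n)) * inverse c))) \<longlonglongrightarrow> exp (- (0 * inverse c))"
      by (intro tendsto_intros LIMSEQ_inverse_real_of_nat)
    moreover have "exp_flat 1 (real (Suc n) * c) = exp (- (inverse (real (Suc n)) * inverse c))" for n
      using that by (simp add: exp_flat_1 mult_le_0_iff del: of_nat_Suc)
    ultimately show ?thesis by simp
  qed
  have "(\<lambda>n. box_bump (real (Suc n)) a b x) \<longlonglongrightarrow> (\<Prod>i\<in>(Basis::'a set). 1 * 1)"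
    unfolding box_bump_def exp_bump_def using True by (intro tendsto_intros ef) (auto simp: mem_box)
  then show ?thesis using True by simp
qed

lemma box_bump_translate: "box_bump n a b (x - c) = box_bump n (a + c) (b + c) x"
  by (simp add: box_bump_def exp_bump_def inner_diff_left inner_add_left algebra_simps)

lemma box_bump_test:
  fixes a b :: "'a::euclidean_space"
  assumes "0 < n"
  shows "test_function (box_bump n a b)"
    and "\<exists>D. (\<forall>i\<in>Basis. continuous_on UNIV (D i)) \<and> (\<forall>i\<in>Basis. \<forall>x. x \<notin> cbox a b \<longrightarrow> D i x = 0) \<and>
       (\<forall>x. (box_bump n a b has_derivative (\<lambda>h. \<Sum>i\<in>Basis. (h \<bullet> i) * D i x)) (at x))"
proof -
  \<comment> \<open>One sequence of derivatives is fixed for each pair of end points, so that the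
    factors of all coordinates come from a single family \<open>G\<close>.\<close>
  define H where "H c d = (SOME G. G 0 = exp_bump n c d \<and> (\<forall>k t. (G k has_real_derivative G (Suc k) t) (at t)))" for c d
  have H': "H c d 0 = exp_bump n c d \<and> (\<forall>k t. (H c d k has_real_derivative H c d (Suc k) t) (at t))" for c d
    unfolding H_def by (rule someI_ex[OF exp_bump_smooth])
  then have H: "H c d 0 = exp_bump n c d" "(H c d k has_real_derivative H c d (Suc k) t) (at t)" for c d k t
    by blast+
  define G where "G i = H (a \<bullet> i) (b \<bullet> i)" for i
  have G: "(G i k has_real_derivative G i (Suc k) t) (at t)" for i k t unfolding G_def by (rule H)
  have bb: "box_bump n a b = (\<lambda>x. \<Prod>i\<in>Basis. G i 0 (x \<bullet> i))"
    by (auto simp: box_bump_def G_def H fun_eq_iff)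
  show "test_function (box_bump n a b)"
    unfolding test_function_def
  proof (intro conjI allI impI)
    fix "is" x assume "set is \<subseteq> (Basis::'a set)"
    then have "iterated_partial is (box_bump n a b) = (\<lambda>x. \<Prod>i\<in>Basis. G i (count_list is i) (x \<bullet> i))"
      unfolding bb by (rule iterated_partial_prod(1)[where G=G, OF G])
    then show "iterated_partial is (box_bump n a b) differentiable at x"
      using iterated_partial_prod(2)[where G=G and c="\<lambda>i. count_list is i", OF G, of "[]" x]
      by (auto simp: differentiable_def)
  next
    have "{x. box_bump n a b x \<noteq> 0} \<subseteq> cbox a b" using box_bump_outside[OF assms] box_subset_cbox by blast
    then have "bounded {x. box_bump n a b x \<noteq> 0}" using bounded_cbox bounded_subset by blast
    then show "compact (closure {x. box_bump n a b x \<noteq> 0})" by (simp add: compact_closure)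
  qed
  have cG: "continuous_on UNIV (\<lambda>x. G i k (x \<bullet> j))" for i j k
  proof (rule continuous_on_compose2[of UNIV "G i k"])
    show "continuous_on UNIV (G i k)" using G DERIV_isCont continuous_at_imp_continuous_on by blast
  qed (auto intro!: continuous_intros)
  define D where "D i x = G i (Suc 0) (x \<bullet> i) * (\<Prod>j\<in>Basis - {i}. G j 0 (x \<bullet> j))" for i x
  have der: "(box_bump n a b has_derivative (\<lambda>h. \<Sum>i\<in>Basis. (h \<bullet> i) * D i x)) (at x)" for x
    unfolding bb D_def by (rule iterated_partial_prod(2)[where G=G and c="\<lambda>_. 0", OF G, of "[]"]) auto
  show "\<exists>D. (\<forall>i\<in>Basis. continuous_on UNIV (D i)) \<and> (\<forall>i\<in>Basis. \<forall>x. x \<notin> cbox a b \<longrightarrow> D i x = 0) \<and>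
       (\<forall>x. (box_bump n a b has_derivative (\<lambda>h. \<Sum>i\<in>Basis. (h \<bullet> i) * D i x)) (at x))"
  proof (intro exI[of _ D] conjI ballI allI impI der)
    fix i :: 'a assume i: "i \<in> Basis"
    show "continuous_on UNIV (D i)" unfolding D_def by (intro continuous_intros cG)
    fix x assume x: "x \<notin> cbox a b"
    \<comment> \<open>Outside the closed box the bump vanishes on a neighbourhood, and uniqueness of
      the derivative then makes all its partial derivatives zero.\<close>
    have "((\<lambda>_. 0) has_derivative (\<lambda>_. 0)) (at x)" by simp
    then have "(box_bump n a b has_derivative (\<lambda>_. 0)) (at x)"
    proof (rule has_derivative_transform_within_open)
      show "open (- cbox a b)" by (simp add: closed_cbox open_Compl)
      show "x \<in> - cbox a b" using x by simp
      fix y assume "y \<in> - cbox a b"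
      then have "y \<notin> box a b" using box_subset_cbox by blast
      then show "0 = box_bump n a b y" using box_bump_outside[OF assms] by simp
    qed
    then have "(\<lambda>h. \<Sum>i\<in>Basis. (h \<bullet> i) * D i x) = (\<lambda>_. 0)" using der[of x] has_derivative_unique by blast
    from fun_cong[OF this, of i] have "(\<Sum>j\<in>Basis. (i \<bullet> j) * D j x) = 0" .
    also have "(\<Sum>j\<in>Basis. (i \<bullet> j) * D j x) = (\<Sum>j\<in>Basis. if j = i then D j x else 0)"
      using i by (intro sum.cong) (auto simp: inner_Basis)
    finally show "D i x = 0" using i by simp
  qed
qed

lemma
  fixes c :: "'a::euclidean_space" and f :: "'a \<Rightarrow> ennreal" and g :: "'a \<Rightarrow> 'b::{banach, second_countable_topology}"
  shows lborel_distr_add: "distr lborel borel (\<lambda>x. x + c) = lborel"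
    and nn_integral_lborel_add: "f \<in> borel_measurable borel \<Longrightarrow> (\<integral>\<^sup>+x. f (x + c) \<partial>lborel) = (\<integral>\<^sup>+x. f x \<partial>lborel)"
    and integral_lborel_add: "g \<in> borel_measurable borel \<Longrightarrow> (\<integral>x. g (x + c) \<partial>lborel) = (\<integral>x. g x \<partial>lborel)"
    and integrable_lborel_add: "g \<in> borel_measurable borel \<Longrightarrow> integrable lborel (\<lambda>x. g (x + c)) \<longleftrightarrow> integrable lborel g"
proof -
  have "(\<lambda>x. x + c) = (+) c" by (rule ext) (rule add.commute)
  then show *: "distr lborel borel (\<lambda>x. x + c) = lborel" by (simp only: lborel_distr_plus)
  have m: "(\<lambda>x. x + c) \<in> lborel \<rightarrow>\<^sub>M borel" by simp
  show "f \<in> borel_measurable borel \<Longrightarrow> (\<integral>\<^sup>+x. f (x + c) \<partial>lborel) = (\<integral>\<^sup>+x. f x \<partial>lborel)"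
    using nn_integral_distr[OF m, of f] unfolding * by simp
  show "g \<in> borel_measurable borel \<Longrightarrow> (\<integral>x. g (x + c) \<partial>lborel) = (\<integral>x. g x \<partial>lborel)"
    using integral_distr[OF m, of g] unfolding * by simp
  show "g \<in> borel_measurable borel \<Longrightarrow> integrable lborel (\<lambda>x. g (x + c)) \<longleftrightarrow> integrable lborel g"
    using integrable_distr_eq[OF m, of g] unfolding * by simp
qed

lemma integrable_bounded_support:
  fixes u :: "'a::euclidean_space \<Rightarrow> 'b::euclidean_space" and f :: "'a \<Rightarrow> real"
  assumes u: "locally_integrable u" and [measurable]: "u \<in> borel_measurable borel" "f \<in> borel_measurable borel"
    and f: "\<And>x. \<bar>f x\<bar> \<le> C" "\<And>x. x \<notin> K \<Longrightarrow> f x = 0" and K: "bounded K"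
  shows "integrable lborel (\<lambda>x. f x *\<^sub>R u x)"
proof -
  have c: "compact (closure K)" using K by (simp add: compact_closure)
  have "integrable lborel (\<lambda>x. indicator (closure K) x *\<^sub>R u x)"
    by (rule u[unfolded locally_integrable_def set_integrable_def, rule_format, OF c])
  then have i: "integrable lborel (\<lambda>x. C *\<^sub>R (indicator (closure K) x *\<^sub>R u x))"
    by (rule integrable_scaleR_right)
  show ?thesis
  proof (rule Bochner_Integration.integrable_bound[OF i])
    have "norm (f x *\<^sub>R u x) \<le> norm (C *\<^sub>R (indicator (closure K) x *\<^sub>R u x))" for x
    proof (cases "x \<in> closure K")
      case True
      have "\<bar>f x\<bar> * norm (u x) \<le> \<bar>C\<bar> * norm (u x)" using f(1)[of x] by (intro mult_right_mono) auto
      then show ?thesis using True by simp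
    next
      case False
      then have "x \<notin> K" using closure_subset[of K] by auto
      then show ?thesis using f(2)[of x] by simp
    qed
    then show "AE x in lborel. norm (f x *\<^sub>R u x) \<le> norm (C *\<^sub>R (indicator (closure K) x *\<^sub>R u x))" by simp
  qed simp
qed

lemma box_bump_measurable: "0 < n \<Longrightarrow> box_bump n a b \<in> borel_measurable borel"
proof (rule borel_measurable_continuous_onI)
  assume "0 < n"
  then obtain D where "\<And>x. (box_bump n a b has_derivative (\<lambda>h. \<Sum>i\<in>Basis. (h \<bullet> i) * D i x)) (at x)"
    using box_bump_test(2)[of n a b] by blast
  then show "continuous_on UNIV (box_bump n a b)"
    by (intro continuous_at_imp_continuous_on ballI has_derivative_continuous)
qed

text \<open>The du Bois-Reymond lemma for one explicit family of test functions. Dominated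
  convergence passes from bumps to indicators of boxes; boxes form an intersection-stable generator,
  so the integrals over all Borel subsets of a bounded box vanish.\<close>

lemma AE_zero_box_bump:
  fixes F :: "'a::euclidean_space \<Rightarrow> 'b::euclidean_space"
  assumes F: "locally_integrable F" and [measurable]: "F \<in> borel_measurable borel"
    and z: "\<And>n a b. 0 < n \<Longrightarrow> (\<integral>x. box_bump n a b x *\<^sub>R F x \<partial>lborel) = 0"
  shows "AE x in lborel. F x = 0"
proof -
  have box0: "(\<integral>x. indicator (box a b) x *\<^sub>R F x \<partial>lborel) = 0" for a b :: 'a
  proof -
    have "(\<lambda>n. \<integral>x. box_bump (real (Suc n)) a b x *\<^sub>R F x \<partial>lborel) \<longlonglongrightarrow> (\<integral>x. indicator (box a b) x *\<^sub>R F x \<partial>lborel)"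
    proof (rule integral_dominated_convergence[where w="\<lambda>x. norm (indicator (cbox a b) x *\<^sub>R F x)"])
      show "integrable lborel (\<lambda>x. norm (indicator (cbox a b) x *\<^sub>R F x))"
        by (intro integrable_norm F[unfolded locally_integrable_def set_integrable_def, rule_format] compact_cbox)
      show "AE x in lborel. (\<lambda>n. box_bump (real (Suc n)) a b x *\<^sub>R F x) \<longlonglongrightarrow> indicator (box a b) x *\<^sub>R F x"
        by (intro AE_I2 tendsto_intros box_bump_tendsto)
      fix n
      show "(\<lambda>x. box_bump (real (Suc n)) a b x *\<^sub>R F x) \<in> borel_measurable lborel"
        using box_bump_measurable[of "real (Suc n)" a b] by simp
      have "norm (box_bump (real (Suc n)) a b x *\<^sub>R F x) \<le> norm (indicator (cbox a b) x *\<^sub>R F x)" for x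
      proof (cases "x \<in> cbox a b")
        case True
        have "\<bar>box_bump (real (Suc n)) a b x\<bar> * norm (F x) \<le> 1 * norm (F x)"
          using box_bump_le1[of "real (Suc n)" a b x] by (intro mult_right_mono) auto
        then show ?thesis using True by simp
      next
        case False
        then have "x \<notin> box a b" using box_subset_cbox by blast
        then show ?thesis using box_bump_outside[of "real (Suc n)" x a b] by simp
      qed
      then show "AE x in lborel. norm (box_bump (real (Suc n)) a b x *\<^sub>R F x) \<le> norm (indicator (cbox a b) x *\<^sub>R F x)" by simp
    qed simp
    moreover have "(\<lambda>n. \<integral>x. box_bump (real (Suc n)) a b x *\<^sub>R F x \<partial>lborel) \<longlonglongrightarrow> 0" using z by simp
    ultimately show ?thesis by (rule LIMSEQ_unique)
  qed
  \<comment> \<open>Cutting off to a bounded box makes \<open>F\<close> integrable, which the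
    complement and union steps of the Dynkin induction rely on.\<close>
  have "AE x in lborel. indicat_real (box (- (real R *\<^sub>R One)) (real R *\<^sub>R One)) x *\<^sub>R F x = 0" for R
  proof -
    let ?B = "box (- (real R *\<^sub>R One)) (real R *\<^sub>R One) :: 'a set"
    let ?f = "\<lambda>x. indicator ?B x *\<^sub>R F x"
    have int: "integrable lborel ?f"
      by (rule integrable_bounded_support[OF F, where C=1 and K="?B"]) (auto simp: indicator_def bounded_box)
    have "set_lebesgue_integral lborel A ?f = 0" if "A \<in> sets lborel" for A
    proof -
      have "Int_stable (range (\<lambda>(a, b). box a b :: 'a set))" by (auto simp: Int_stable_def box_Int_box)
      moreover have "range (\<lambda>(a, b). box a b :: 'a set) \<subseteq> Pow UNIV" by auto
      moreover have "A \<in> sigma_sets UNIV (range (\<lambda>(a, b). box a b))" using that by (simp add: borel_eq_box)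
      ultimately show ?thesis
      proof (induction rule: sigma_sets_induct_disjoint)
        case (basic A)
        then obtain a b where "A = box a b" by auto
        moreover obtain c d where "box a b \<inter> ?B = box c d" unfolding box_Int_box by blast
        then have "indicator (box a b) x *\<^sub>R ?f x = indicator (box c d) x *\<^sub>R F x" for x
          by (auto simp: indicator_def)
        ultimately show ?case using box0[of c d]
          by (simp only: set_lebesgue_integral_def)
      next
        case empty then show ?case by (simp add: set_lebesgue_integral_def)
      next
        case (compl A)
        then have A: "A \<in> sets lborel" by (simp add: borel_eq_box)
        have "set_lebesgue_integral lborel (UNIV - A) ?f = (\<integral>x. ?f x - indicator A x *\<^sub>R ?f x \<partial>lborel)"
          unfolding set_lebesgue_integral_def by (intro Bochner_Integration.integral_cong) (auto simp: indicator_def)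
        also have "\<dots> = (\<integral>x. ?f x \<partial>lborel) - (\<integral>x. indicator A x *\<^sub>R ?f x \<partial>lborel)"
          using A by (intro Bochner_Integration.integral_diff int integrable_mult_indicator)
        finally show ?case using compl box0 by (simp add: set_lebesgue_integral_def)
      next
        case (union A)
        have A: "A i \<in> sets lborel" for i
        proof -
          have "A i \<in> sigma_sets UNIV (range (\<lambda>(a, b). box a b))" using union(2) by blast
          then show ?thesis by (simp add: borel_eq_box)
        qed
        have "set_integrable lborel (\<Union>i. A i) ?f"
          unfolding set_integrable_def using A by (intro integrable_mult_indicator int sets.countable_UN) auto
        then have "set_lebesgue_integral lborel (\<Union>i. A i) ?f = (\<Sum>i. set_lebesgue_integral lborel (A i) ?f)"
          using A union(1) by (intro lebesgue_integral_countable_add) (auto simp: disjoint_family_on_def)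
        then show ?case using union(3) by (simp only: suminf_zero)
      qed
    qed
    then show ?thesis by (rule sigma_finite_measure.density_zero[OF sigma_finite_lborel int])
  qed
  then have "AE x in lborel. \<forall>R. indicat_real (box (- (real R *\<^sub>R One)) (real R *\<^sub>R One)) x *\<^sub>R F x = 0"
    unfolding AE_all_countable by (rule allI)
  then show ?thesis
  proof eventually_elim
    case (elim x)
    have "x \<in> (\<Union>i::nat. box (- (real i *\<^sub>R One)) (real i *\<^sub>R One))" unfolding UN_box_eq_UNIV by simp
    then obtain R :: nat where "x \<in> box (- (real R *\<^sub>R One)) (real R *\<^sub>R One)" by (rule UN_E)
    then show ?case using elim[rule_format, of R] by simp
  qed
qed

text \<open>Justifies exchanging the average over the segment from x to x + h with the integral over
  x. For \<theta> in [0,1] the translates of the support stay in one ball, on which \<open>w\<close>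
  is integrable.\<close>

lemma integrable_shear:
  fixes w :: "'a::euclidean_space \<Rightarrow> 'b::euclidean_space" and f :: "'a \<Rightarrow> real"
  assumes w: "locally_integrable w" and [measurable]: "w \<in> borel_measurable borel" "f \<in> borel_measurable borel"
    and f: "\<And>x. \<bar>f x\<bar> \<le> C" "\<And>x. x \<notin> K \<Longrightarrow> f x = 0" and K: "bounded K"
  shows "integrable (lborel \<Otimes>\<^sub>M lborel) (\<lambda>(\<theta>, x). (indicator {0..1::real} \<theta> * f x) *\<^sub>R w (x + \<theta> *\<^sub>R h))" (is ?trans)
    and "integrable (lborel \<Otimes>\<^sub>M lborel) (\<lambda>(\<theta>, x). (indicator {0..1::real} \<theta> * f (x - \<theta> *\<^sub>R h)) *\<^sub>R w x)" (is ?shear)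
proof -
  obtain R where R: "\<And>x. x \<in> K \<Longrightarrow> norm x \<le> R" using K by (auto simp: bounded_iff)
  let ?K = "cball 0 (R + norm h) :: 'a set"
  have [measurable]: "?K \<in> sets borel" by simp
  define W where "W = (\<integral>x. C * norm (indicator ?K x *\<^sub>R w x) \<partial>lborel)"
  have iW: "integrable lborel (\<lambda>x. C * norm (indicator ?K x *\<^sub>R w x))"
    by (intro integrable_mult_right integrable_norm w[unfolded locally_integrable_def set_integrable_def, rule_format] compact_cball)
  have C: "C \<ge> 0" using f(1)[of undefined] by linarith
  have bd: "norm (f (x - \<theta> *\<^sub>R h) *\<^sub>R w x) \<le> C * norm (indicator ?K x *\<^sub>R w x)" if "\<theta> \<in> {0..1}" for x \<theta>
  proof (cases "x - \<theta> *\<^sub>R h \<in> K")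
    case True
    have "norm x \<le> norm (x - \<theta> *\<^sub>R h) + norm (\<theta> *\<^sub>R h)" using norm_triangle_ineq[of "x - \<theta> *\<^sub>R h" "\<theta> *\<^sub>R h"] by simp
    also have "\<dots> \<le> R + norm h" using R[OF True] that by (intro add_mono) (auto intro: mult_left_le_one_le)
    finally show ?thesis using f(1) by (auto intro!: mult_right_mono)
  next
    case False then show ?thesis using f(2) C by simp
  qed
  have int: "integrable lborel (\<lambda>x. f x *\<^sub>R w (x + \<theta> *\<^sub>R h))"
    and int': "integrable lborel (\<lambda>x. f (x - \<theta> *\<^sub>R h) *\<^sub>R w x)"
    and le': "(\<integral>x. norm (f (x - \<theta> *\<^sub>R h) *\<^sub>R w x) \<partial>lborel) \<le> W"
    and le: "(\<integral>x. norm (f x *\<^sub>R w (x + \<theta> *\<^sub>R h)) \<partial>lborel) \<le> W" if "\<theta> \<in> {0..1}" for \<theta>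
  proof -
    show 1: "integrable lborel (\<lambda>x. f (x - \<theta> *\<^sub>R h) *\<^sub>R w x)"
      by (rule Bochner_Integration.integrable_bound[OF iW]) (use bd[OF that] C in auto)
    then have "integrable lborel (\<lambda>x. (\<lambda>x. f (x - \<theta> *\<^sub>R h) *\<^sub>R w x) (x + \<theta> *\<^sub>R h))"
      by (subst integrable_lborel_add) auto
    then show "integrable lborel (\<lambda>x. f x *\<^sub>R w (x + \<theta> *\<^sub>R h))" by simp
    have "(\<integral>x. norm (f x *\<^sub>R w (x + \<theta> *\<^sub>R h)) \<partial>lborel) = (\<integral>x. (\<lambda>x. norm (f (x - \<theta> *\<^sub>R h) *\<^sub>R w x)) (x + \<theta> *\<^sub>R h) \<partial>lborel)" by simp
    also have "\<dots> = (\<integral>x. norm (f (x - \<theta> *\<^sub>R h) *\<^sub>R w x) \<partial>lborel)" by (subst integral_lborel_add) auto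
    also show 2: "\<dots> \<le> W" unfolding W_def by (intro integral_mono integrable_norm 1 iW bd that)
    finally show "(\<integral>x. norm (f x *\<^sub>R w (x + \<theta> *\<^sub>R h)) \<partial>lborel) \<le> W" .
  qed
  show ?trans
  proof (rule lborel_pair.Fubini_integrable)
    show "AE \<theta> in lborel. integrable lborel (\<lambda>x. case (\<theta>, x) of (\<theta>, x) \<Rightarrow> (indicator {0..1} \<theta> * f x) *\<^sub>R w (x + \<theta> *\<^sub>R h))"
    proof (rule AE_I2)
      fix \<theta> :: real
      show "integrable lborel (\<lambda>x. case (\<theta>, x) of (\<theta>, x) \<Rightarrow> (indicator {0..1} \<theta> * f x) *\<^sub>R w (x + \<theta> *\<^sub>R h))"
        using int[of \<theta>] by (cases "\<theta> \<in> {0..1}") auto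
    qed
    have "integrable lborel (\<lambda>\<theta>. W * indicator {0..1::real} \<theta>)" by (intro integrable_mult_right) (auto simp: integrable_indicator_iff)
    then show "integrable lborel (\<lambda>\<theta>. \<integral>x. norm (case (\<theta>, x) of (\<theta>, x) \<Rightarrow> (indicator {0..1} \<theta> * f x) *\<^sub>R w (x + \<theta> *\<^sub>R h)) \<partial>lborel)"
    proof (rule Bochner_Integration.integrable_bound)
      have "norm (\<integral>x. norm ((indicator {0..1} \<theta> * f x) *\<^sub>R w (x + \<theta> *\<^sub>R h)) \<partial>lborel) \<le> norm (W * indicator {0..1::real} \<theta>)" for \<theta> :: real
        using le[of \<theta>] by (cases "\<theta> \<in> {0..1}") auto
      then show "AE \<theta> in lborel. norm (\<integral>x. norm (case (\<theta>, x) of (\<theta>, x) \<Rightarrow> (indicator {0..1} \<theta> * f x) *\<^sub>R w (x + \<theta> *\<^sub>R h)) \<partial>lborel) \<le> norm (W * indicator {0..1::real} \<theta>)"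
        by simp
    qed measurable
  qed measurable
  show ?shear
  proof (rule lborel_pair.Fubini_integrable)
    show "AE \<theta> in lborel. integrable lborel (\<lambda>x. case (\<theta>, x) of (\<theta>, x) \<Rightarrow> (indicator {0..1} \<theta> * f (x - \<theta> *\<^sub>R h)) *\<^sub>R w x)"
    proof (rule AE_I2)
      fix \<theta> :: real
      show "integrable lborel (\<lambda>x. case (\<theta>, x) of (\<theta>, x) \<Rightarrow> (indicator {0..1} \<theta> * f (x - \<theta> *\<^sub>R h)) *\<^sub>R w x)"
        using int'[of \<theta>] by (cases "\<theta> \<in> {0..1}") auto
    qed
    have "integrable lborel (\<lambda>\<theta>. W * indicator {0..1::real} \<theta>)" by (intro integrable_mult_right) (auto simp: integrable_indicator_iff)
    then show "integrable lborel (\<lambda>\<theta>. \<integral>x. norm (case (\<theta>, x) of (\<theta>, x) \<Rightarrow> (indicator {0..1} \<theta> * f (x - \<theta> *\<^sub>R h)) *\<^sub>R w x) \<partial>lborel)"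
    proof (rule Bochner_Integration.integrable_bound)
      have "norm (\<integral>x. norm ((indicator {0..1} \<theta> * f (x - \<theta> *\<^sub>R h)) *\<^sub>R w x) \<partial>lborel) \<le> norm (W * indicator {0..1::real} \<theta>)" for \<theta> :: real
        using le'[of \<theta>] by (cases "\<theta> \<in> {0..1}") auto
      then show "AE \<theta> in lborel. norm (\<integral>x. norm (case (\<theta>, x) of (\<theta>, x) \<Rightarrow> (indicator {0..1} \<theta> * f (x - \<theta> *\<^sub>R h)) *\<^sub>R w x) \<partial>lborel) \<le> norm (W * indicator {0..1::real} \<theta>)"
        by simp
    qed measurable
  qed measurable
qed

text \<open>The increment is moved onto the test function: testing u(x + h) - u(x) with \<phi>
  amounts to testing u with \<phi>(x - h) - \<phi>(x), which is minus an integral over \<theta> of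
  directional derivatives of translated bumps. Each of these falls under \<open>weak\<close>,
  because a translated bump is a bump.\<close>

lemma weak_derivative_increment:
  fixes u w :: "'a::euclidean_space \<Rightarrow> 'b::euclidean_space"
  assumes u: "locally_integrable u" and w: "locally_integrable w"
    and [measurable]: "u \<in> borel_measurable borel" "w \<in> borel_measurable borel"
    and weak: "\<And>n a b. 0 < n \<Longrightarrow>
       (\<integral>x. frechet_derivative (box_bump n a b) (at x) h *\<^sub>R u x \<partial>lborel) = - (\<integral>x. box_bump n a b x *\<^sub>R w x \<partial>lborel)"
  shows "AE x in lborel. u (x + h) - u x = (LINT \<theta>:{0..1}|lborel. w (x + \<theta> *\<^sub>R h))"
proof -
  define v where "v x = (LINT \<theta>:{0..1}|lborel. w (x + \<theta> *\<^sub>R h))" for x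
  have [measurable]: "v \<in> borel_measurable borel"
    unfolding v_def set_lebesgue_integral_def by measurable
  define F where "F x = u (x + h) - u x - v x" for x
  have vint: "integrable lborel (\<lambda>x. f x *\<^sub>R v x)"
    and vswap: "(\<integral>x. f x *\<^sub>R v x \<partial>lborel) = (\<integral>\<theta>. \<integral>x. (indicator {0..1} \<theta> * f x) *\<^sub>R w (x + \<theta> *\<^sub>R h) \<partial>lborel \<partial>lborel)"
    if [measurable]: "f \<in> borel_measurable borel" and f: "\<And>x. \<bar>f x\<bar> \<le> C" "\<And>x. x \<notin> K \<Longrightarrow> f x = 0" "bounded K" for f C K
  proof -
    have i: "integrable (lborel \<Otimes>\<^sub>M lborel) (\<lambda>(\<theta>, x). (indicator {0..1::real} \<theta> * f x) *\<^sub>R w (x + \<theta> *\<^sub>R h))"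
      by (rule integrable_shear(1)[OF w _ _ f]) measurable
    have eq: "f x *\<^sub>R v x = (\<integral>\<theta>. (indicator {0..1} \<theta> * f x) *\<^sub>R w (x + \<theta> *\<^sub>R h) \<partial>lborel)" for x
      unfolding v_def set_lebesgue_integral_def
      by (subst integral_scaleR_right[symmetric]) (simp add: mult.commute)
    show "integrable lborel (\<lambda>x. f x *\<^sub>R v x)" unfolding eq using lborel_pair.integrable_snd[OF i] .
    show "(\<integral>x. f x *\<^sub>R v x \<partial>lborel) = (\<integral>\<theta>. \<integral>x. (indicator {0..1} \<theta> * f x) *\<^sub>R w (x + \<theta> *\<^sub>R h) \<partial>lborel \<partial>lborel)"
      unfolding eq by (rule lborel_pair.Fubini_integral[OF i])
  qed
  have ush: "locally_integrable (\<lambda>x. u (x + h))"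
    unfolding locally_integrable_def set_integrable_def
  proof safe
    fix K :: "'a set" assume K: "compact K"
    then have [measurable]: "K \<in> sets borel" by (simp add: borel_compact)
    have "integrable lborel (\<lambda>x. indicator K (x - h) *\<^sub>R u x)"
    proof (rule integrable_bounded_support[OF u, where C=1 and K="(\<lambda>x. h + x) ` K"])
      show "bounded ((\<lambda>x. h + x) ` K)" using K by (simp add: bounded_translation compact_imp_bounded)
      show "x \<notin> (\<lambda>x. h + x) ` K \<Longrightarrow> indicator K (x - h) = (0::real)" for x
        by (auto simp: indicator_def image_iff dest!: bspec[of _ _ "x - h"])
    qed (auto simp: indicator_def)
    then have "integrable lborel (\<lambda>x. (\<lambda>x. indicator K (x - h) *\<^sub>R u x) (x + h))"
      by (subst integrable_lborel_add) auto
    then show "integrable lborel (\<lambda>x. indicator K x *\<^sub>R u (x + h))" by simp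
  qed
  have "AE x in lborel. F x = 0"
  proof (rule AE_zero_box_bump)
    show "locally_integrable F"
      unfolding locally_integrable_def set_integrable_def
    proof safe
      fix K :: "'a set" assume K: "compact K"
      then have [measurable]: "K \<in> sets borel" by (simp add: borel_compact)
      have "integrable lborel (\<lambda>x. indicator K x *\<^sub>R v x)"
        by (rule vint[where C=1 and K=K]) (use K in \<open>auto simp: compact_imp_bounded indicator_def\<close>)
      then show "integrable lborel (\<lambda>x. indicator K x *\<^sub>R F x)"
        unfolding F_def scaleR_diff_right
        using u ush K unfolding locally_integrable_def set_integrable_def by (intro Bochner_Integration.integrable_diff) auto
    qed
    show "F \<in> borel_measurable borel" unfolding F_def by measurable
    fix n :: real and a b :: 'a assume n: "0 < n"
    let ?\<phi> = "box_bump n a b"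
    have [measurable]: "?\<phi> \<in> borel_measurable borel" by (rule box_bump_measurable[OF n])
    obtain D where D: "\<And>i. i \<in> Basis \<Longrightarrow> continuous_on UNIV (D i)" "\<And>i x. i \<in> Basis \<Longrightarrow> x \<notin> cbox a b \<Longrightarrow> D i x = 0"
      "\<And>x. (?\<phi> has_derivative (\<lambda>h. \<Sum>i\<in>Basis. (h \<bullet> i) * D i x)) (at x)"
      using box_bump_test(2)[OF n, of a b] by blast
    define g where "g x = (\<Sum>i\<in>Basis. (h \<bullet> i) * D i x)" for x
    have cg: "continuous_on UNIV g" unfolding g_def by (intro continuous_intros D) auto
    then have [measurable]: "g \<in> borel_measurable borel" by (rule borel_measurable_continuous_onI)
    have g0: "x \<notin> cbox a b \<Longrightarrow> g x = 0" for x unfolding g_def using D(2) by simp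
    have "bounded (g ` cbox a b)"
      by (intro compact_imp_bounded compact_continuous_image continuous_on_subset[OF cg]) auto
    then obtain C where C: "\<And>x. x \<in> cbox a b \<Longrightarrow> \<bar>g x\<bar> \<le> C" by (auto simp: bounded_iff)
    have gC: "\<bar>g x\<bar> \<le> \<bar>C\<bar>" for x using C[of x] g0[of x] by (cases "x \<in> cbox a b") auto
    have \<phi>1: "\<bar>?\<phi> x\<bar> \<le> 1" for x using box_bump_le1[of n a b x] by auto
    have \<phi>0: "x \<notin> cbox a b \<Longrightarrow> ?\<phi> x = 0" for x using box_bump_outside[OF n, of x a b] box_subset_cbox[of a b] by blast
    have weak_shift: "(\<integral>x. g (x - \<theta> *\<^sub>R h) *\<^sub>R u x \<partial>lborel) = - (\<integral>x. ?\<phi> (x - \<theta> *\<^sub>R h) *\<^sub>R w x \<partial>lborel)" for \<theta>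
    proof -
      have "((\<lambda>x. x - \<theta> *\<^sub>R h) has_derivative (\<lambda>k. k)) (at x)" for x by (auto intro!: derivative_eq_intros)
      from has_derivative_compose[OF this D(3)]
      have der: "((\<lambda>x. ?\<phi> (x - \<theta> *\<^sub>R h)) has_derivative (\<lambda>k. \<Sum>i\<in>Basis. (k \<bullet> i) * D i (x - \<theta> *\<^sub>R h))) (at x)" for x .
      have "frechet_derivative (\<lambda>x. ?\<phi> (x - \<theta> *\<^sub>R h)) (at x) h = g (x - \<theta> *\<^sub>R h)" for x
        using fun_cong[OF frechet_derivative_at[OF der[of x]], of h] by (simp only: g_def)
      note fd = this
      have eq: "(\<lambda>x. ?\<phi> (x - \<theta> *\<^sub>R h)) = box_bump n (a + \<theta> *\<^sub>R h) (b + \<theta> *\<^sub>R h)"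
        by (rule ext) (rule box_bump_translate)
      show ?thesis
        using weak[OF n, of "a + \<theta> *\<^sub>R h" "b + \<theta> *\<^sub>R h"]
        unfolding eq[symmetric] fd box_bump_translate[symmetric] .
    qed
    have ftc: "?\<phi> (x - h) - ?\<phi> x = (\<integral>\<theta>. indicator {0..1} \<theta> *\<^sub>R (- g (x - \<theta> *\<^sub>R h)) \<partial>lborel)" for x
    proof -
      have "(\<integral>\<theta>. indicator {0..1} \<theta> *\<^sub>R (- g (x - \<theta> *\<^sub>R h)) \<partial>lborel) = ?\<phi> (x - 1 *\<^sub>R h) - ?\<phi> (x - 0 *\<^sub>R h)"
      proof (rule integral_FTC_Icc)
        fix \<theta> :: real
        have "((\<lambda>\<theta>. x - \<theta> *\<^sub>R h) has_derivative (\<lambda>t. - (t *\<^sub>R h))) (at \<theta> within {0..1})" by (auto intro!: derivative_eq_intros)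
        from has_derivative_compose[OF this D(3)]
        have "((\<lambda>\<theta>. ?\<phi> (x - \<theta> *\<^sub>R h)) has_derivative (\<lambda>t. \<Sum>i\<in>Basis. (- (t *\<^sub>R h) \<bullet> i) * D i (x - \<theta> *\<^sub>R h))) (at \<theta> within {0..1})" .
        moreover have "(\<lambda>t. \<Sum>i\<in>Basis. (- (t *\<^sub>R h) \<bullet> i) * D i (x - \<theta> *\<^sub>R h)) = (\<lambda>t. t *\<^sub>R (- g (x - \<theta> *\<^sub>R h)))"
          by (rule ext) (simp add: g_def sum_distrib_left sum_negf mult.assoc)
        ultimately show "((\<lambda>\<theta>. ?\<phi> (x - \<theta> *\<^sub>R h)) has_vector_derivative - g (x - \<theta> *\<^sub>R h)) (at \<theta> within {0..1})"
          by (simp add: has_vector_derivative_def)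
        show "continuous_on {0..1} (\<lambda>\<theta>. - g (x - \<theta> *\<^sub>R h))"
          by (rule continuous_on_minus[OF continuous_on_compose2[OF cg]]) (auto intro!: continuous_intros)
      qed simp
      then show ?thesis by simp
    qed
    have "integrable (lborel \<Otimes>\<^sub>M lborel) (\<lambda>(\<theta>, x). (indicator {0..1::real} \<theta> * - g (x - \<theta> *\<^sub>R h)) *\<^sub>R u x)"
      by (rule integrable_shear(2)[OF u, where f="\<lambda>x. - g x" and C="\<bar>C\<bar>" and K="cbox a b"]) (use gC g0 in auto)
    then have i1: "integrable (lborel \<Otimes>\<^sub>M lborel) (\<lambda>(\<theta>, x). indicator {0..1::real} \<theta> *\<^sub>R (- g (x - \<theta> *\<^sub>R h) *\<^sub>R u x))"
      by (simp add: mult.commute)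
    have "(\<integral>x. (?\<phi> (x - h) - ?\<phi> x) *\<^sub>R u x \<partial>lborel)
       = (\<integral>x. (\<integral>\<theta>. indicator {0..1} \<theta> *\<^sub>R (- g (x - \<theta> *\<^sub>R h) *\<^sub>R u x) \<partial>lborel) \<partial>lborel)"
    proof (rule Bochner_Integration.integral_cong[OF refl])
      fix x
      have "integrable lborel (\<lambda>\<theta>. indicator {0..1} \<theta> *\<^sub>R (- g (x - \<theta> *\<^sub>R h)))"
        by (rule borel_integrable_compact[OF compact_Icc continuous_on_minus[OF continuous_on_compose2[OF cg]]]) (auto intro!: continuous_intros)
      then show "(?\<phi> (x - h) - ?\<phi> x) *\<^sub>R u x = (\<integral>\<theta>. indicator {0..1} \<theta> *\<^sub>R (- g (x - \<theta> *\<^sub>R h) *\<^sub>R u x) \<partial>lborel)"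
        unfolding ftc by (subst integral_scaleR_left[symmetric]) auto
    qed
    also have "\<dots> = (\<integral>\<theta>. (\<integral>x. indicator {0..1} \<theta> *\<^sub>R (- g (x - \<theta> *\<^sub>R h) *\<^sub>R u x) \<partial>lborel) \<partial>lborel)"
      by (rule lborel_pair.Fubini_integral[OF i1])
    \<comment> \<open>For fixed \<theta> the weak identity replaces the derivative of the translated
      bump by \<open>w\<close>; translating the variable by \<theta> h then moves the shift from the
      bump to \<open>w\<close>.\<close>
    also have "\<dots> = (\<integral>\<theta>. (\<integral>x. (indicator {0..1} \<theta> * ?\<phi> x) *\<^sub>R w (x + \<theta> *\<^sub>R h) \<partial>lborel) \<partial>lborel)"
    proof (rule Bochner_Integration.integral_cong[OF refl])
      fix \<theta> :: real
      have "(\<integral>x. indicator {0..1} \<theta> *\<^sub>R (- g (x - \<theta> *\<^sub>R h) *\<^sub>R u x) \<partial>lborel) = indicator {0..1} \<theta> *\<^sub>R (\<integral>x. ?\<phi> (x - \<theta> *\<^sub>R h) *\<^sub>R w x \<partial>lborel)"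
        by (simp only: integral_scaleR_right scaleR_minus_left integral_minus weak_shift minus_minus)
      also have "(\<integral>x. ?\<phi> (x - \<theta> *\<^sub>R h) *\<^sub>R w x \<partial>lborel) = (\<integral>x. ?\<phi> (x + \<theta> *\<^sub>R h - \<theta> *\<^sub>R h) *\<^sub>R w (x + \<theta> *\<^sub>R h) \<partial>lborel)"
        by (rule integral_lborel_add[symmetric]) measurable
      finally show "(\<integral>x. indicator {0..1} \<theta> *\<^sub>R (- g (x - \<theta> *\<^sub>R h) *\<^sub>R u x) \<partial>lborel) = (\<integral>x. (indicator {0..1} \<theta> * ?\<phi> x) *\<^sub>R w (x + \<theta> *\<^sub>R h) \<partial>lborel)"
        by (simp only: scaleR_scaleR[symmetric] integral_scaleR_right add_diff_cancel_right')
    qed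
    also have "\<dots> = (\<integral>x. ?\<phi> x *\<^sub>R v x \<partial>lborel)" by (rule vswap[OF _ \<phi>1 \<phi>0, symmetric]) auto
    finally have main: "(\<integral>x. (?\<phi> (x - h) - ?\<phi> x) *\<^sub>R u x \<partial>lborel) = (\<integral>x. ?\<phi> x *\<^sub>R v x \<partial>lborel)" .
    have iu: "integrable lborel (\<lambda>x. ?\<phi> x *\<^sub>R u x)" by (rule integrable_bounded_support[OF u _ _ \<phi>1 \<phi>0]) auto
    have ih: "integrable lborel (\<lambda>x. ?\<phi> x *\<^sub>R u (x + h))" by (rule integrable_bounded_support[OF ush _ _ \<phi>1 \<phi>0]) auto
    have iv: "integrable lborel (\<lambda>x. ?\<phi> x *\<^sub>R v x)" by (rule vint[OF _ \<phi>1 \<phi>0]) auto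
    have ih': "integrable lborel (\<lambda>x. ?\<phi> (x - h) *\<^sub>R u x)"
      using ih integrable_lborel_add[of "\<lambda>x. ?\<phi> (x - h) *\<^sub>R u x" h] by simp
    have sh: "(\<integral>x. ?\<phi> x *\<^sub>R u (x + h) \<partial>lborel) = (\<integral>x. ?\<phi> (x - h) *\<^sub>R u x \<partial>lborel)"
      using integral_lborel_add[of "\<lambda>x. ?\<phi> (x - h) *\<^sub>R u x" h] by simp
    have "(\<integral>x. ?\<phi> x *\<^sub>R F x \<partial>lborel) = (\<integral>x. ?\<phi> x *\<^sub>R u (x + h) \<partial>lborel) - (\<integral>x. ?\<phi> x *\<^sub>R u x \<partial>lborel) - (\<integral>x. ?\<phi> x *\<^sub>R v x \<partial>lborel)"
      unfolding F_def scaleR_diff_right using iu ih iv by simp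
    also have "\<dots> = 0" unfolding sh main[symmetric] scaleR_diff_left using ih' iu by simp
    finally show "(\<integral>x. ?\<phi> x *\<^sub>R F x \<partial>lborel) = 0" .
  qed
  then show ?thesis by eventually_elim (simp add: F_def v_def)
qed

lemma box_bump_deriv_basis:
  fixes a b :: "'a::euclidean_space"
  assumes "0 < n"
  shows "frechet_derivative (box_bump n a b) (at x) h = (\<Sum>i\<in>Basis. (h \<bullet> i) * frechet_derivative (box_bump n a b) (at x) i)"
    and "\<exists>C. \<forall>x. \<bar>frechet_derivative (box_bump n a b) (at x) h\<bar> \<le> C"
    and "x \<notin> cbox a b \<Longrightarrow> frechet_derivative (box_bump n a b) (at x) h = 0"
    and "(\<lambda>x. frechet_derivative (box_bump n a b) (at x) h) \<in> borel_measurable borel"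
proof -
  obtain D where D: "\<And>i. i \<in> Basis \<Longrightarrow> continuous_on UNIV (D i)" "\<And>i x. i \<in> Basis \<Longrightarrow> x \<notin> cbox a b \<Longrightarrow> D i x = 0"
    "\<And>x. (box_bump n a b has_derivative (\<lambda>h. \<Sum>i\<in>Basis. (h \<bullet> i) * D i x)) (at x)"
    using box_bump_test(2)[OF assms, of a b] by blast
  have fd: "frechet_derivative (box_bump n a b) (at x) h = (\<Sum>i\<in>Basis. (h \<bullet> i) * D i x)" for h x
    using fun_cong[OF frechet_derivative_at[OF D(3)[of x]], of h] by simp
  have fdi: "frechet_derivative (box_bump n a b) (at x) i = D i x" if i: "i \<in> Basis" for i x
  proof -
    have "(\<Sum>j\<in>Basis. (i \<bullet> j) * D j x) = (\<Sum>j\<in>Basis. if j = i then D j x else 0)"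
      using i by (intro sum.cong) (auto simp: inner_Basis)
    then show ?thesis using i by (simp add: fd)
  qed
  show "frechet_derivative (box_bump n a b) (at x) h = (\<Sum>i\<in>Basis. (h \<bullet> i) * frechet_derivative (box_bump n a b) (at x) i)"
    unfolding fd[of x h] by (intro sum.cong refl) (simp add: fdi)
  have c: "continuous_on UNIV (\<lambda>x. \<Sum>i\<in>Basis. (h \<bullet> i) * D i x)" by (intro continuous_intros D)
  show "(\<lambda>x. frechet_derivative (box_bump n a b) (at x) h) \<in> borel_measurable borel"
    unfolding fd by (rule borel_measurable_continuous_onI[OF c])
  show z: "x \<notin> cbox a b \<Longrightarrow> frechet_derivative (box_bump n a b) (at x) h = 0" for x
    unfolding fd using D(2) by simp
  have "bounded ((\<lambda>x. \<Sum>i\<in>Basis. (h \<bullet> i) * D i x) ` cbox a b)"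
    by (intro compact_imp_bounded compact_continuous_image continuous_on_subset[OF c]) auto
  then obtain C where C: "\<And>x. x \<in> cbox a b \<Longrightarrow> \<bar>\<Sum>i\<in>Basis. (h \<bullet> i) * D i x\<bar> \<le> C" by (auto simp: bounded_iff)
  have "\<bar>frechet_derivative (box_bump n a b) (at x) h\<bar> \<le> \<bar>C\<bar>" for x
  proof (cases "x \<in> cbox a b")
    case True then show ?thesis using C[of x] unfolding fd by linarith
  next
    case False then show ?thesis using z[of x] by simp
  qed
  then show "\<exists>C. \<forall>x. \<bar>frechet_derivative (box_bump n a b) (at x) h\<bar> \<le> C" by blast
qed

lemma locally_integrable_scaleR: "locally_integrable u \<Longrightarrow> locally_integrable (\<lambda>x. c *\<^sub>R u x)"
  unfolding locally_integrable_def set_integrable_def scaleR_left_commute[of _ c] by (intro allI impI integrable_scaleR_right) blast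

lemma locally_integrable_sum:
  "(\<And>i. i \<in> I \<Longrightarrow> locally_integrable (u i)) \<Longrightarrow> locally_integrable (\<lambda>x. \<Sum>i\<in>I. u i x)"
  unfolding locally_integrable_def set_integrable_def scaleR_sum_right by (intro allI impI Bochner_Integration.integrable_sum) blast

lemma locally_integrable_add:
  "locally_integrable u \<Longrightarrow> locally_integrable v \<Longrightarrow> locally_integrable (\<lambda>x. u x + v x)"
  unfolding locally_integrable_def set_integrable_def scaleR_right_distrib by (intro allI impI Bochner_Integration.integrable_add) blast+

lemma locally_integrable_inner: "locally_integrable u \<Longrightarrow> locally_integrable (\<lambda>x. u x \<bullet> c)"
  unfolding locally_integrable_def set_integrable_def real_scaleR_def inner_scaleR_left[symmetric]
  by (intro allI impI integrable_inner_left) blast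

text \<open>Apart from the trace, weak derivatives enter the later estimates only through this
  identity. Its exceptional null set depends on \<open>h\<close>; it applies to deterministic shifts
  but not directly to random ones, which is what forces the averaging over balls later on.\<close>

lemma sobolev_increment:
  fixes u :: "'a::euclidean_space \<Rightarrow> 'b::euclidean_space" and v :: "'a \<Rightarrow> 'a \<Rightarrow> 'b"
  assumes wp: "\<And>i. i \<in> Basis \<Longrightarrow> has_weak_partial u i (v i)"
    and u[measurable]: "u \<in> borel_measurable borel" and v[measurable]: "\<And>i. i \<in> Basis \<Longrightarrow> v i \<in> borel_measurable borel"
  shows "AE x in lborel. u (x + h) - u x = (LINT \<theta>:{0..1}|lborel. (\<Sum>i\<in>Basis. (h \<bullet> i) *\<^sub>R v i (x + \<theta> *\<^sub>R h)))"
proof (rule weak_derivative_increment)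
  have lu: "locally_integrable u" and lv: "\<And>i. i \<in> Basis \<Longrightarrow> locally_integrable (v i)"
    using wp nonempty_Basis unfolding has_weak_partial_def by blast+
  show "locally_integrable u" by (rule lu)
  show "locally_integrable (\<lambda>x. \<Sum>i\<in>Basis. (h \<bullet> i) *\<^sub>R v i x)"
    by (intro locally_integrable_sum locally_integrable_scaleR lv)
  show "(\<lambda>x. \<Sum>i\<in>Basis. (h \<bullet> i) *\<^sub>R v i x) \<in> borel_measurable borel"
    by (intro borel_measurable_sum borel_measurable_scaleR borel_measurable_const v)
  fix n :: real and a b :: 'a assume n: "0 < n"
  let ?\<phi> = "box_bump n a b" let ?D = "\<lambda>i x. frechet_derivative ?\<phi> (at x) i"
  note D = box_bump_deriv_basis[OF n, where a=a and b=b]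
  have iD: "integrable lborel (\<lambda>x. ?D i x *\<^sub>R u x)" for i
  proof -
    obtain C where "\<And>x. \<bar>?D i x\<bar> \<le> C" using D(2)[of i] by blast
    then show ?thesis by (rule integrable_bounded_support[OF lu u D(4) _ D(3) bounded_cbox])
  qed
  have ip: "integrable lborel (\<lambda>x. ?\<phi> x *\<^sub>R v i x)" if i: "i \<in> Basis" for i
  proof (rule integrable_bounded_support[OF lv[OF i] v[OF i] box_bump_measurable[OF n]])
    show "\<bar>?\<phi> x\<bar> \<le> 1" for x using box_bump_le1[of n a b x] by auto
    show "x \<notin> cbox a b \<Longrightarrow> ?\<phi> x = 0" for x using box_bump_outside[OF n, of x a b] box_subset_cbox[of a b] by blast
  qed (rule bounded_cbox)
  have "(\<integral>x. ?D h x *\<^sub>R u x \<partial>lborel) = (\<integral>x. (\<Sum>i\<in>Basis. (h \<bullet> i) *\<^sub>R (?D i x *\<^sub>R u x)) \<partial>lborel)"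
    by (subst D(1)) (simp only: scaleR_sum_left scaleR_scaleR)
  also have "\<dots> = (\<Sum>i\<in>Basis. (h \<bullet> i) *\<^sub>R (\<integral>x. ?D i x *\<^sub>R u x \<partial>lborel))"
    by (subst Bochner_Integration.integral_sum) (intro integrable_scaleR_right iD, simp only: integral_scaleR_right)
  also have "\<dots> = (\<Sum>i\<in>Basis. (h \<bullet> i) *\<^sub>R - (\<integral>x. ?\<phi> x *\<^sub>R v i x \<partial>lborel))"
    using wp box_bump_test(1)[OF n, of a b] unfolding has_weak_partial_def by (intro sum.cong refl) metis
  also have "\<dots> = - (\<Sum>i\<in>Basis. (h \<bullet> i) *\<^sub>R (\<integral>x. ?\<phi> x *\<^sub>R v i x \<partial>lborel))"
    by (simp only: scaleR_minus_right sum_negf)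
  also have "(\<Sum>i\<in>Basis. (h \<bullet> i) *\<^sub>R (\<integral>x. ?\<phi> x *\<^sub>R v i x \<partial>lborel)) = (\<integral>x. (\<Sum>i\<in>Basis. (h \<bullet> i) *\<^sub>R (?\<phi> x *\<^sub>R v i x)) \<partial>lborel)"
    by (subst Bochner_Integration.integral_sum) (intro integrable_scaleR_right ip, assumption, simp only: integral_scaleR_right)
  also have "\<dots> = (\<integral>x. ?\<phi> x *\<^sub>R (\<Sum>i\<in>Basis. (h \<bullet> i) *\<^sub>R v i x) \<partial>lborel)"
    by (simp only: scaleR_sum_right scaleR_left_commute)
  finally show "(\<integral>x. ?D h x *\<^sub>R u x \<partial>lborel) = - (\<integral>x. ?\<phi> x *\<^sub>R (\<Sum>i\<in>Basis. (h \<bullet> i) *\<^sub>R v i x) \<partial>lborel)" .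
qed (rule u)

text \<open>The derivative of \<phi> in the direction u(x) is the sum over \<open>i\<close> of its
  partial derivatives times the components of u(x). Tested with the same bump, the divergence
  identity and the sum of the identities for the components therefore have equal left-hand
  sides.\<close>

lemma weak_divergence_trace:
  fixes u :: "'a::euclidean_space \<Rightarrow> 'a" and v :: "'a \<Rightarrow> 'a \<Rightarrow> 'a"
  assumes wp: "\<And>i. i \<in> Basis \<Longrightarrow> has_weak_partial u i (v i)" and wd: "has_weak_divergence u g"
    and u[measurable]: "u \<in> borel_measurable borel" and v[measurable]: "\<And>i. i \<in> Basis \<Longrightarrow> v i \<in> borel_measurable borel"
    and g[measurable]: "g \<in> borel_measurable borel"
  shows "AE x in lborel. (\<Sum>i\<in>Basis. v i x \<bullet> i) = g x"
proof -
  have lu: "locally_integrable u" and lv: "\<And>i. i \<in> Basis \<Longrightarrow> locally_integrable (v i)"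
    using wp nonempty_Basis unfolding has_weak_partial_def by blast+
  have lg: "locally_integrable g" using wd unfolding has_weak_divergence_def by blast
  define F where "F x = (\<Sum>i\<in>Basis. v i x \<bullet> i) + (- 1) *\<^sub>R g x" for x
  have lF: "locally_integrable F"
    unfolding F_def
    by (intro locally_integrable_add locally_integrable_sum locally_integrable_inner locally_integrable_scaleR lv lg)
  have mF: "F \<in> borel_measurable borel" unfolding F_def
    by (intro borel_measurable_add borel_measurable_sum borel_measurable_inner borel_measurable_scaleR borel_measurable_const v g)
  have "AE x in lborel. F x = 0"
  proof (rule AE_zero_box_bump[OF lF mF])
    fix n :: real and a b :: 'a assume n: "0 < n"
    let ?\<phi> = "box_bump n a b" let ?D = "\<lambda>i x. frechet_derivative ?\<phi> (at x) i"
    note D = box_bump_deriv_basis[OF n, where a=a and b=b]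
    have t: "test_function ?\<phi>" by (rule box_bump_test(1)[OF n])
    have b1: "\<bar>?\<phi> x\<bar> \<le> 1" for x using box_bump_le1[of n a b x] by auto
    have b0: "x \<notin> cbox a b \<Longrightarrow> ?\<phi> x = 0" for x using box_bump_outside[OF n, of x a b] box_subset_cbox[of a b] by blast
    have iD: "integrable lborel (\<lambda>x. ?D i x *\<^sub>R u x)" for i
    proof -
      obtain C where "\<And>x. \<bar>?D i x\<bar> \<le> C" using D(2)[of i] by blast
      then show ?thesis by (rule integrable_bounded_support[OF lu u D(4) _ D(3) bounded_cbox])
    qed
    have ip: "integrable lborel (\<lambda>x. ?\<phi> x *\<^sub>R v i x)" if i: "i \<in> Basis" for i
      by (rule integrable_bounded_support[OF lv[OF i] v[OF i] box_bump_measurable[OF n] b1 b0 bounded_cbox])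
    have ig: "integrable lborel (\<lambda>x. ?\<phi> x *\<^sub>R g x)"
      by (rule integrable_bounded_support[OF lg g box_bump_measurable[OF n] b1 b0 bounded_cbox])
    have "- (\<integral>x. ?\<phi> x * g x \<partial>lborel) = (\<integral>x. ?D (u x) x \<partial>lborel)"
      using wd t unfolding has_weak_divergence_def by simp
    also have "\<dots> = (\<integral>x. (\<Sum>i\<in>Basis. (?D i x *\<^sub>R u x) \<bullet> i) \<partial>lborel)"
      by (subst D(1)) (simp only: inner_scaleR_left mult.commute)
    also have "\<dots> = (\<Sum>i\<in>Basis. (\<integral>x. ?D i x *\<^sub>R u x \<partial>lborel) \<bullet> i)"
      by (subst Bochner_Integration.integral_sum) (intro integrable_inner_left iD, intro sum.cong refl integral_inner_left iD)
    also have "\<dots> = (\<Sum>i\<in>Basis. - (\<integral>x. ?\<phi> x *\<^sub>R v i x \<partial>lborel) \<bullet> i)"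
    proof (intro sum.cong refl)
      fix i :: 'a assume "i \<in> Basis"
      then have "(\<integral>x. ?D i x *\<^sub>R u x \<partial>lborel) = - (\<integral>x. ?\<phi> x *\<^sub>R v i x \<partial>lborel)"
        using wp t unfolding has_weak_partial_def by blast
      then show "(\<integral>x. ?D i x *\<^sub>R u x \<partial>lborel) \<bullet> i = - (\<integral>x. ?\<phi> x *\<^sub>R v i x \<partial>lborel) \<bullet> i" by simp
    qed
    also have "\<dots> = - (\<Sum>i\<in>Basis. (\<integral>x. ?\<phi> x *\<^sub>R v i x \<partial>lborel) \<bullet> i)" by (simp only: inner_minus_left sum_negf)
    also have "(\<Sum>i\<in>Basis. (\<integral>x. ?\<phi> x *\<^sub>R v i x \<partial>lborel) \<bullet> i) = (\<Sum>i\<in>Basis. \<integral>x. (?\<phi> x *\<^sub>R v i x) \<bullet> i \<partial>lborel)"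
      by (intro sum.cong refl integral_inner_left[symmetric] ip)
    also have "\<dots> = (\<integral>x. (\<Sum>i\<in>Basis. (?\<phi> x *\<^sub>R v i x) \<bullet> i) \<partial>lborel)"
      by (rule Bochner_Integration.integral_sum[symmetric]) (intro integrable_inner_left ip)
    finally have eq: "(\<integral>x. (\<Sum>i\<in>Basis. (?\<phi> x *\<^sub>R v i x) \<bullet> i) \<partial>lborel) = (\<integral>x. ?\<phi> x *\<^sub>R g x \<partial>lborel)" by simp
    have "(\<integral>x. ?\<phi> x *\<^sub>R F x \<partial>lborel) = (\<integral>x. (\<Sum>i\<in>Basis. (?\<phi> x *\<^sub>R v i x) \<bullet> i) - ?\<phi> x *\<^sub>R g x \<partial>lborel)"
      by (intro Bochner_Integration.integral_cong refl) (simp add: F_def algebra_simps sum_distrib_left)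
    also have "\<dots> = 0"
      using eq by (subst Bochner_Integration.integral_diff) (intro Bochner_Integration.integrable_sum integrable_inner_left ip, assumption, rule ig, simp)
    finally show "(\<integral>x. ?\<phi> x *\<^sub>R F x \<partial>lborel) = 0" .
  qed
  then show ?thesis by eventually_elim (simp add: F_def)
qed

section \<open>Maps of bounded compression\<close>

text \<open>The image of Lebesgue measure is at most \<open>\<Lambda>\<close> times Lebesgue
  measure. Neither injectivity nor differentiability is part of the notion, so it is stable under
  composition and under pointwise limits; mollified drifts and Euler schemes pass to their limits in
  this form.\<close>

definition compresses :: "real \<Rightarrow> ('a::euclidean_space \<Rightarrow> 'b::euclidean_space) \<Rightarrow> bool" where
  "compresses \<Lambda> \<Psi> \<longleftrightarrow> \<Psi> \<in> borel_measurable borel \<and>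
    (\<forall>B\<in>sets borel. emeasure lborel (\<Psi> -` B) \<le> ennreal \<Lambda> * emeasure lborel B)"

lemma compresses_measurable: "compresses \<Lambda> \<Psi> \<Longrightarrow> \<Psi> \<in> borel_measurable borel"
  by (simp add: compresses_def)

text \<open>Outer regularity of Lebesgue measure: a Borel set is enclosed in an open set of almost
  the same volume.\<close>

lemma compressesI_open:
  fixes \<Psi> :: "'a::euclidean_space \<Rightarrow> 'b::euclidean_space"
  assumes m[measurable]: "\<Psi> \<in> borel_measurable borel"
    and le: "\<And>U. open U \<Longrightarrow> emeasure lborel (\<Psi> -` U) \<le> ennreal \<Lambda> * emeasure lborel U"
  shows "compresses \<Lambda> \<Psi>"
  unfolding compresses_def
proof (intro conjI ballI m)
  fix B :: "'b set" assume B: "B \<in> sets borel"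
  show "emeasure lborel (\<Psi> -` B) \<le> ennreal \<Lambda> * emeasure lborel B"
  proof (rule ennreal_le_epsilon)
    fix e :: real assume e: "0 < e"
    \<comment> \<open>The absolute value covers a negative \<open>\<Lambda>\<close>, for which
      \<open>ennreal \<Lambda>\<close> is 0; the summand 1 keeps the denominator positive.\<close>
    define e' where "e' = e / (\<bar>\<Lambda>\<bar> + 1)"
    have e': "e' > 0" using e by (simp add: e'_def add_nonneg_pos)
    obtain U where U: "open U" "B \<subseteq> U" "emeasure lborel (U - B) < ennreal e'"
      using outer_regular_lborel[OF B e'] by auto
    have sU: "U \<in> sets borel" using U by simp
    have mB: "\<Psi> -` B \<in> sets lborel" "\<Psi> -` U \<in> sets lborel"
      using measurable_sets[OF m B] measurable_sets[OF m sU] by auto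
    have "emeasure lborel (\<Psi> -` B) \<le> emeasure lborel (\<Psi> -` U)"
      using U(2) mB by (intro emeasure_mono) auto
    also have "\<dots> \<le> ennreal \<Lambda> * emeasure lborel U" by (rule le[OF U(1)])
    also have "emeasure lborel U = emeasure lborel (B \<union> (U - B))" using U(2) by (simp add: Un_absorb1)
    also have "\<dots> \<le> emeasure lborel B + emeasure lborel (U - B)"
      using B sU by (intro emeasure_subadditive) auto
    also have "\<dots> \<le> emeasure lborel B + ennreal e'" using U(3) by (intro add_left_mono) auto
    also have "ennreal \<Lambda> * (emeasure lborel B + ennreal e') = ennreal \<Lambda> * emeasure lborel B + ennreal \<Lambda> * ennreal e'"
      by (simp add: distrib_left)
    also have "ennreal \<Lambda> * ennreal e' \<le> ennreal e"
    proof -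
      have "ennreal \<Lambda> * ennreal e' \<le> ennreal \<bar>\<Lambda>\<bar> * ennreal e'" by (intro mult_right_mono ennreal_leI) auto
      also have "\<dots> = ennreal (\<bar>\<Lambda>\<bar> * e')" using e' by (simp add: ennreal_mult)
      also have "\<bar>\<Lambda>\<bar> * e' \<le> e" unfolding e'_def using e by (simp add: field_simps)
      finally show ?thesis by (simp add: ennreal_leI)
    qed
    finally show "emeasure lborel (\<Psi> -` B) \<le> ennreal \<Lambda> * emeasure lborel B + ennreal e"
      by (simp add: mult_left_mono add_left_mono)
  qed
qed

lemma compresses_id: "compresses 1 (\<lambda>x. x)"
  by (simp add: compresses_def)

lemma compresses_compose:
  fixes f :: "'a::euclidean_space \<Rightarrow> 'b::euclidean_space" and g :: "'b \<Rightarrow> 'c::euclidean_space"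
  assumes "compresses a f" "compresses b g" "0 \<le> a" "0 \<le> b"
  shows "compresses (a * b) (\<lambda>x. g (f x))"
  unfolding compresses_def
proof (intro conjI ballI)
  have [measurable]: "f \<in> borel_measurable borel" "g \<in> borel_measurable borel" using assms by (auto simp: compresses_def)
  show "(\<lambda>x. g (f x)) \<in> borel_measurable borel" by measurable
  fix B :: "'c set" assume B: "B \<in> sets borel"
  have gB: "g -` B \<in> sets borel" using measurable_sets[of g borel borel B] B by simp
  have "(\<lambda>x. g (f x)) -` B = f -` (g -` B)" by auto
  then have "emeasure lborel ((\<lambda>x. g (f x)) -` B) \<le> ennreal a * emeasure lborel (g -` B)"
    using assms(1) gB by (simp add: compresses_def)
  also have "\<dots> \<le> ennreal a * (ennreal b * emeasure lborel B)"
    using assms(2) B by (intro mult_left_mono) (auto simp: compresses_def)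
  finally show "emeasure lborel ((\<lambda>x. g (f x)) -` B) \<le> ennreal (a * b) * emeasure lborel B"
    using assms(3,4) by (simp add: ennreal_mult mult.assoc)
qed

lemma compresses_mono: "compresses a f \<Longrightarrow> a \<le> b \<Longrightarrow> compresses b f"
  unfolding compresses_def by (meson ennreal_leI mult_right_mono order_trans zero_le)

lemma compresses_translate: "compresses 1 (\<lambda>x::'a::euclidean_space. x + c)"
  unfolding compresses_def
proof (intro conjI ballI)
  fix B :: "'a set" assume B: "B \<in> sets borel"
  have "(\<lambda>x. x + c) = (+) c" by (rule ext) (rule add.commute)
  then have "emeasure lborel ((\<lambda>x. x + c) -` B) = emeasure (distr lborel borel ((+) c)) B"
    using B by (subst emeasure_distr) auto
  then show "emeasure lborel ((\<lambda>x. x + c) -` B) \<le> ennreal 1 * emeasure lborel B"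
    by (simp add: lborel_distr_plus)
qed simp

lemma compresses_nn_integral:
  assumes "compresses \<Lambda> \<Psi>" "f \<in> borel_measurable borel"
  shows "(\<integral>\<^sup>+x. f (\<Psi> x) \<partial>lborel) \<le> ennreal \<Lambda> * (\<integral>\<^sup>+x. f x \<partial>lborel)"
proof -
  have m: "\<Psi> \<in> lborel \<rightarrow>\<^sub>M borel" using assms by (simp add: compresses_def)
  have "(\<integral>\<^sup>+x. f (\<Psi> x) \<partial>lborel) = (\<integral>\<^sup>+x. f x \<partial>distr lborel borel \<Psi>)"
    using assms by (subst nn_integral_distr[OF m]) auto
  also have "\<dots> \<le> (\<integral>\<^sup>+x. f x \<partial>scale_measure (ennreal \<Lambda>) lborel)"
  proof (rule nn_integral_mono_measure)
    show "distr lborel borel \<Psi> \<le> scale_measure (ennreal \<Lambda>) lborel"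
      using assms(1) by (subst le_measure) (auto simp: le_fun_def emeasure_distr[OF m] compresses_def)
  qed simp
  also have "\<dots> = ennreal \<Lambda> * (\<integral>\<^sup>+x. f x \<partial>lborel)"
    using assms(2) by (simp add: nn_integral_scale_measure)
  finally show ?thesis .
qed

text \<open>If the limit point lies in an open set, so do the approximating points from some index
  on. Hence the indicator of the limiting preimage is below the lower limit of the indicators, and
  Fatou's lemma gives the bound on open sets. Pointwise convergence without a rate is
  enough.\<close>

lemma compresses_limit:
  fixes \<Psi> :: "'a::euclidean_space \<Rightarrow> 'b::euclidean_space"
  assumes c: "\<And>n. compresses \<Lambda> (\<Psi>n n)" and lim: "\<And>x. (\<lambda>n. \<Psi>n n x) \<longlonglongrightarrow> \<Psi> x"
  shows "compresses \<Lambda> \<Psi>"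
proof (rule compressesI_open)
  have mn: "\<Psi>n n \<in> borel_measurable borel" for n using c by (simp add: compresses_def)
  show m: "\<Psi> \<in> borel_measurable borel"
    by (rule borel_measurable_LIMSEQ_metric[OF mn lim])
  fix U :: "'b set" assume U: "open U"
  have sn: "\<Psi>n n -` U \<in> sets borel" for n using measurable_sets[OF mn borel_open[OF U], of n] by simp
  have s: "\<Psi> -` U \<in> sets borel" using measurable_sets[OF m borel_open[OF U]] by simp
  have "emeasure lborel (\<Psi> -` U) = (\<integral>\<^sup>+x. indicator (\<Psi> -` U) x \<partial>lborel)" using s by simp
  also have "\<dots> \<le> (\<integral>\<^sup>+x. liminf (\<lambda>n. indicator (\<Psi>n n -` U) x) \<partial>lborel)"
  proof (intro nn_integral_mono)
    fix x
    show "indicator (\<Psi> -` U) x \<le> liminf (\<lambda>n. indicator (\<Psi>n n -` U) x :: ennreal)"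
    proof (cases "\<Psi> x \<in> U")
      case True
      have "\<forall>\<^sub>F n in sequentially. \<Psi>n n x \<in> U" by (rule topological_tendstoD[OF lim U True])
      then have "1 \<le> liminf (\<lambda>n. indicator (\<Psi>n n -` U) x :: ennreal)"
        by (intro Liminf_bounded) (auto elim!: eventually_mono)
      then show ?thesis using True by simp
    qed simp
  qed
  also have "\<dots> \<le> liminf (\<lambda>n. \<integral>\<^sup>+x. indicator (\<Psi>n n -` U) x \<partial>lborel)"
    using sn by (intro nn_integral_liminf) simp
  also have "(\<lambda>n. \<integral>\<^sup>+x. indicator (\<Psi>n n -` U) x \<partial>lborel) = (\<lambda>n. emeasure lborel (\<Psi>n n -` U))"
    using sn by simp
  also have "liminf (\<lambda>n. emeasure lborel (\<Psi>n n -` U)) \<le> ennreal \<Lambda> * emeasure lborel U"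
  proof -
    have "limsup (\<lambda>n. emeasure lborel (\<Psi>n n -` U)) \<le> ennreal \<Lambda> * emeasure lborel U"
      using c U by (intro Limsup_bounded always_eventually allI) (auto simp: compresses_def)
    then show ?thesis using Liminf_le_Limsup[OF sequentially_bot] order_trans by blast
  qed
  finally show "emeasure lborel (\<Psi> -` U) \<le> ennreal \<Lambda> * emeasure lborel U" .
qed

text \<open>Change of variables: the part of \<open>U\<close> hit by \<open>g\<close> has as volume
  the integral of the Jacobian over the preimage, hence at least \<open>c\<close> times the volume
  of the preimage. Cutting the preimage off at balls keeps all volumes finite.\<close>

lemma compresses_differentiable_wellorder:
  fixes g :: "real^'n::{finite,wellorder} \<Rightarrow> real^'n::_"
  assumes der: "\<And>x. (g has_derivative g' x) (at x)" and inj: "inj g"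
    and c: "0 < c" "\<And>x. c \<le> \<bar>det (matrix (g' x))\<bar>"
  shows "compresses (1 / c) g"
proof (rule compressesI_open)
  have cg: "continuous_on UNIV g" using der has_derivative_continuous continuous_at_imp_continuous_on by blast
  show "g \<in> borel_measurable borel" by (rule borel_measurable_continuous_onI[OF cg])
  fix U :: "(real^'n::_) set" assume U: "open U"
  show "emeasure lborel (g -` U) \<le> ennreal (1 / c) * emeasure lborel U"
  proof (cases "emeasure lborel U = \<infinity>")
    case True
    then show ?thesis using c by (simp add: ennreal_mult_top)
  next
    case False
    then have Uf: "U \<in> lmeasurable" using U by (intro fmeasurableI) (auto simp: less_top emeasure_completion)
    define S where "S k = g -` U \<inter> ball 0 (real k)" for k
    have oS: "open (S k)" for k unfolding S_def using open_vimage[OF U cg] by auto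
    have le: "emeasure lborel (S k) \<le> ennreal (1 / c) * emeasure lborel U" for k
    proof -
      have sS: "S k \<in> sets lebesgue" using oS by (simp add: borel_open)
      have bS: "S k \<in> lmeasurable" by (intro bounded_set_imp_lmeasurable sS) (auto simp: S_def)
      have d: "(g has_derivative g' x) (at x within S k)" for x using der has_derivative_at_withinI by blast
      have inj': "inj_on g (S k)" using inj inj_on_subset by blast
      have "g ` S k \<in> sets lebesgue"
        using d by (intro differentiable_image_in_sets_lebesgue sS) (auto simp: differentiable_on_def differentiable_def)
      then have gS: "g ` S k \<in> lmeasurable"
        using fmeasurableI2[OF Uf, of "g ` S k"] by (auto simp: S_def)
      have hi: "((\<lambda>x. \<bar>det (matrix (g' x))\<bar>) has_integral measure lebesgue (g ` S k)) (S k)"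
        using has_measure_differentiable_image[OF sS d inj', of "measure lebesgue (g ` S k)"] gS by simp
      have hc: "((\<lambda>x. c) has_integral c * measure lebesgue (S k)) (S k)"
      proof -
        have "((\<lambda>x. 1::real) has_integral measure lebesgue (S k)) (S k)"
          using bS by (simp add: lmeasurable_iff_integrable_on lmeasure_integral[OF bS] has_integral_integral[symmetric])
        from has_integral_mult_right[OF this, of c] show ?thesis by simp
      qed
      have "c * measure lebesgue (S k) \<le> measure lebesgue (g ` S k)"
        by (rule has_integral_le[OF hc hi]) (rule c(2))
      also have "\<dots> \<le> measure lebesgue U" by (rule measure_mono_fmeasurable[OF _ _ Uf]) (use gS in \<open>auto simp: S_def\<close>)
      finally have "measure lebesgue (S k) \<le> (1 / c) * measure lebesgue U" using c by (simp add: field_simps)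
      then have "ennreal (measure lebesgue (S k)) \<le> ennreal (1 / c) * ennreal (measure lebesgue U)"
        using c by (subst ennreal_mult[symmetric]) (auto intro: ennreal_leI)
      then show ?thesis
        using emeasure_eq_measure2[OF bS] emeasure_eq_measure2[OF Uf] oS U by (simp add: emeasure_completion)
    qed
    have "emeasure lborel (g -` U) = emeasure lborel (\<Union>k. S k)"
    proof -
      have "g -` U = (\<Union>k. S k)" unfolding S_def using reals_Archimedean2 by auto
      then show ?thesis by simp
    qed
    also have "\<dots> = (SUP k. emeasure lborel (S k))"
      using oS by (intro SUP_emeasure_incseq[symmetric]) (auto simp: S_def incseq_def)
    also have "\<dots> \<le> ennreal (1 / c) * emeasure lborel U" by (intro SUP_least le)
    finally show ?thesis .
  qed
qed

section \<open>Determinants near the identity\<close>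

lemma prod_one_plus_bounds:
  fixes e :: "'i \<Rightarrow> real"
  assumes "finite S" and e: "\<And>i. i \<in> S \<Longrightarrow> \<bar>e i\<bar> \<le> \<epsilon>" "\<epsilon> \<le> 1" "0 \<le> \<epsilon>"
  shows "\<bar>(\<Prod>i\<in>S. 1 + e i) - 1\<bar> \<le> (2 ^ card S - 1) * \<epsilon>"
    and "\<bar>(\<Prod>i\<in>S. 1 + e i) - 1 - (\<Sum>i\<in>S. e i)\<bar> \<le> 4 ^ card S * \<epsilon>\<^sup>2"
  using assms(1) e(1)
proof (induction S)
  case empty
  { case 1 then show ?case by simp }
  { case 2 then show ?case by simp }
next
  case (insert a S)
  let ?P = "\<Prod>i\<in>S. 1 + e i"
  have I1: "\<bar>?P - 1\<bar> \<le> (2 ^ card S - 1) * \<epsilon>" and I2: "\<bar>?P - 1 - (\<Sum>i\<in>S. e i)\<bar> \<le> 4 ^ card S * \<epsilon>\<^sup>2" if "\<And>i. i \<in> insert a S \<Longrightarrow> \<bar>e i\<bar> \<le> \<epsilon>"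
    using insert.IH that by auto
  { case 1
    have ea: "\<bar>e a\<bar> \<le> \<epsilon>" using 1 by simp
    have "(\<Prod>i\<in>insert a S. 1 + e i) - 1 = (?P - 1) * (1 + e a) + e a" using insert.hyps by (simp add: algebra_simps)
    also have "\<bar>\<dots>\<bar> \<le> \<bar>?P - 1\<bar> * \<bar>1 + e a\<bar> + \<bar>e a\<bar>" using abs_triangle_ineq[of "(?P - 1) * (1 + e a)" "e a"] by (simp add: abs_mult)
    also have "\<dots> \<le> ((2 ^ card S - 1) * \<epsilon>) * 2 + \<epsilon>"
      using ea assms(3,4) I1[OF 1] by (intro add_mono mult_mono) auto
    finally show ?case using insert.hyps by (simp add: algebra_simps) }
  { case 2
    have ea: "\<bar>e a\<bar> \<le> \<epsilon>" using 2 by simp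
    \<comment> \<open>The cross term \<open>e a * (?P - 1)\<close> is quadratic by the first bound;
      this is why both bounds are proved in one induction.\<close>
    have "(\<Prod>i\<in>insert a S. 1 + e i) - 1 - (\<Sum>i\<in>insert a S. e i) = (?P - 1 - (\<Sum>i\<in>S. e i)) + e a * (?P - 1)"
      using insert.hyps by (simp add: algebra_simps)
    also have "\<bar>\<dots>\<bar> \<le> \<bar>?P - 1 - (\<Sum>i\<in>S. e i)\<bar> + \<bar>e a\<bar> * \<bar>?P - 1\<bar>"
      using abs_triangle_ineq[of "?P - 1 - (\<Sum>i\<in>S. e i)" "e a * (?P - 1)"] by (simp add: abs_mult)
    also have "\<dots> \<le> 4 ^ card S * \<epsilon>\<^sup>2 + \<epsilon> * ((2 ^ card S - 1) * \<epsilon>)"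
      using ea assms(4) I1[OF 2] I2[OF 2] by (intro add_mono mult_mono) auto
    also have "\<dots> = (4 ^ card S + (2 ^ card S - 1)) * \<epsilon>\<^sup>2" by (simp add: power2_eq_square algebra_simps)
    also have "\<dots> \<le> (4 ^ card S + 4 ^ card S * 3) * \<epsilon>\<^sup>2"
    proof (intro mult_right_mono add_left_mono)
      have "(2::real) ^ card S \<le> 4 ^ card S" by (intro power_mono) auto
      moreover have "(0::real) \<le> 4 ^ card S" by simp
      ultimately show "(2::real) ^ card S - 1 \<le> 4 ^ card S * 3" by linarith
    qed simp
    finally show ?case using insert.hyps by (simp add: algebra_simps) }
qed

text \<open>In the Leibniz formula a permutation other than the identity moves at least two indices,
  say a and p a. Its term thus has two off-diagonal factors of size \<epsilon>, while the other
  factors are at most 2. The identity contributes 1 plus the trace up to order \<epsilon>^2. To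
  first order only the trace is visible.\<close>

lemma det_one_plus_lower_bound:
  fixes E :: "real^'n^'n"
  assumes e: "\<And>i j. \<bar>E $ i $ j\<bar> \<le> \<epsilon>" "\<epsilon> \<le> 1" "0 \<le> \<epsilon>"
  shows "1 + (\<Sum>i\<in>UNIV. E $ i $ i) - (4 ^ CARD('n) + fact (CARD('n)) * 2 ^ CARD('n)) * \<epsilon>\<^sup>2 \<le> det (mat 1 + E)"
proof -
  let ?M = "mat 1 + E" let ?P = "{p. p permutes (UNIV :: 'n set)}"
  let ?t = "\<lambda>p. of_int (sign p) * (\<Prod>i\<in>UNIV. ?M $ i $ p i)"
  have fin: "finite ?P" by (rule finite_permutations) simp
  have idP: "id \<in> ?P" by (simp add: permutes_id)
  have M: "?M $ i $ j = (if i = j then 1 else 0) + E $ i $ j" for i j by (simp add: mat_def)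
  have M2: "\<bar>?M $ i $ j\<bar> \<le> 2" for i j using e(1)[of i j] e(2) unfolding M by auto
  have "\<bar>?t p\<bar> \<le> 2 ^ CARD('n) * \<epsilon>\<^sup>2" if p: "p \<in> ?P - {id}" for p
  proof -
    have pp: "p permutes UNIV" "p \<noteq> id" using p by auto
    then obtain a where a: "p a \<noteq> a" by (auto simp: fun_eq_iff)
    have b: "p (p a) \<noteq> p a" using a permutes_inj[OF pp(1)] by (auto dest: injD)
    have sg: "\<bar>of_int (sign p) :: real\<bar> = 1" by (simp add: sign_def)
    have "\<bar>?t p\<bar> = (\<Prod>i\<in>UNIV. \<bar>?M $ i $ p i\<bar>)" using sg by (simp add: abs_mult abs_prod)
    also have "\<dots> = \<bar>?M $ a $ p a\<bar> * (\<bar>?M $ (p a) $ p (p a)\<bar> * (\<Prod>i\<in>UNIV - {a} - {p a}. \<bar>?M $ i $ p i\<bar>))"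
      using a by (subst prod.remove[of UNIV a], simp, simp, subst prod.remove[of "UNIV - {a}" "p a"]) auto
    also have "\<dots> \<le> \<epsilon> * (\<epsilon> * (\<Prod>i\<in>UNIV - {a} - {p a}. 2))"
    proof (intro mult_mono prod_mono conjI)
      show "\<bar>?M $ a $ p a\<bar> \<le> \<epsilon>" using a e(1)[of a "p a"] unfolding M by auto
      show "\<bar>?M $ (p a) $ p (p a)\<bar> \<le> \<epsilon>" using b e(1)[of "p a" "p (p a)"] unfolding M by auto
    qed (use M2 e in \<open>auto intro!: mult_nonneg_nonneg prod_nonneg\<close>)
    also have "\<dots> \<le> \<epsilon> * (\<epsilon> * 2 ^ CARD('n))"
    proof (intro mult_left_mono e)
      have "(\<Prod>i\<in>UNIV - {a} - {p a}. 2::real) = 2 ^ card (UNIV - {a} - {p a})" by (rule prod_constant)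
      also have "\<dots> \<le> 2 ^ CARD('n)" by (intro power_increasing card_mono) auto
      finally show "(\<Prod>i\<in>UNIV - {a} - {p a}. 2::real) \<le> 2 ^ CARD('n)" .
    qed
    finally show ?thesis by (simp only: power2_eq_square ac_simps)
  qed
  then have s: "\<bar>\<Sum>p\<in>?P - {id}. ?t p\<bar> \<le> fact CARD('n) * (2 ^ CARD('n) * \<epsilon>\<^sup>2)"
  proof -
    assume h: "\<And>p. p \<in> ?P - {id} \<Longrightarrow> \<bar>?t p\<bar> \<le> 2 ^ CARD('n) * \<epsilon>\<^sup>2"
    have "\<bar>\<Sum>p\<in>?P - {id}. ?t p\<bar> \<le> (\<Sum>p\<in>?P - {id}. \<bar>?t p\<bar>)" by (rule sum_abs)
    also have "\<dots> \<le> real (card (?P - {id})) * (2 ^ CARD('n) * \<epsilon>\<^sup>2)" by (rule sum_bounded_above[OF h])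
    also have "\<dots> \<le> real (card ?P) * (2 ^ CARD('n) * \<epsilon>\<^sup>2)"
      using fin by (intro mult_right_mono) (auto intro!: card_mono)
    also have "card ?P = fact CARD('n)" by (rule card_permutations) auto
    finally show ?thesis by (simp only: of_nat_fact)
  qed
  have "det ?M = ?t id + (\<Sum>p\<in>?P - {id}. ?t p)"
    unfolding det_def using fin idP by (rule sum.remove)
  moreover have "?t id = (\<Prod>i\<in>UNIV. 1 + E $ i $ i)"
    by (simp only: M id_apply sign_id of_int_1 mult_1 if_True simp_thms)
  moreover have "\<bar>(\<Prod>i\<in>UNIV. 1 + E $ i $ i) - 1 - (\<Sum>i\<in>UNIV. E $ i $ i)\<bar> \<le> 4 ^ CARD('n) * \<epsilon>\<^sup>2"
    by (rule prod_one_plus_bounds(2)) (use e in auto)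
  ultimately show ?thesis using s by (simp add: algebra_simps)
qed

section \<open>Functions with an integral gradient\<close>

lemma norm_set_integral_unit_le:
  fixes f :: "real \<Rightarrow> 'b::euclidean_space"
  assumes "\<And>\<theta>. \<theta> \<in> {0..1} \<Longrightarrow> norm (f \<theta>) \<le> C" "0 \<le> C"
  shows "norm (LINT \<theta>:{0..1}|lborel. f \<theta>) \<le> C"
proof (cases "set_integrable lborel {0..1} f")
  case True
  have "norm (LINT \<theta>:{0..1}|lborel. f \<theta>) \<le> (\<integral>\<theta>. norm (indicator {0..1} \<theta> *\<^sub>R f \<theta>) \<partial>lborel)"
    unfolding set_lebesgue_integral_def by (rule integral_norm_bound)
  also have "\<dots> \<le> (\<integral>\<theta>. C * indicator {0..1::real} \<theta> \<partial>lborel)"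
  proof (rule Bochner_Integration.integral_mono)
    show "integrable lborel (\<lambda>\<theta>. norm (indicator {0..1} \<theta> *\<^sub>R f \<theta>))"
      using True unfolding set_integrable_def by (rule integrable_norm)
    show "integrable lborel (\<lambda>\<theta>. C * indicator {0..1::real} \<theta>)"
      by (intro integrable_mult_right) (simp add: integrable_indicator_iff)
    show "norm (indicator {0..1} \<theta> *\<^sub>R f \<theta>) \<le> C * indicator {0..1} \<theta>" for \<theta> :: real
      using assms(1)[of \<theta>] by (cases "\<theta> \<in> {0..1}") auto
  qed
  also have "\<dots> = C" by simp
  finally show ?thesis .
next
  case False
  then have "(LINT \<theta>:{0..1}|lborel. f \<theta>) = 0"
    unfolding set_integrable_def set_lebesgue_integral_def by (rule not_integrable_integral_eq)
  then show ?thesis using assms(2) by simp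
qed

lemma integrable_pair_mult:
  fixes f :: "'a::euclidean_space \<Rightarrow> real" and g :: "'b::euclidean_space \<Rightarrow> real"
  assumes f: "integrable lborel f" and g: "integrable lborel g"
  shows "integrable (lborel \<Otimes>\<^sub>M lborel) (\<lambda>(x, y). f x * g y)"
proof (rule lborel_pair.Fubini_integrable)
  have [measurable]: "f \<in> borel_measurable borel" "g \<in> borel_measurable borel"
    using borel_measurable_integrable[OF f] borel_measurable_integrable[OF g] by auto
  show "(\<lambda>(x, y). f x * g y) \<in> borel_measurable (lborel \<Otimes>\<^sub>M lborel)" by measurable
  have "(\<lambda>x. \<integral>y. norm (case (x, y) of (x, y) \<Rightarrow> f x * g y) \<partial>lborel) = (\<lambda>x. norm (f x) * (\<integral>y. norm (g y) \<partial>lborel))"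
    by (simp add: abs_mult)
  then show "integrable lborel (\<lambda>x. \<integral>y. norm (case (x, y) of (x, y) \<Rightarrow> f x * g y) \<partial>lborel)"
    using f by simp
  show "AE x in lborel. integrable lborel (\<lambda>y. case (x, y) of (x, y) \<Rightarrow> f x * g y)"
    using g by simp
qed

text \<open>The fundamental theorem of calculus along every segment, with a gradient that is merely
  measurable. For the field \<open>b\<close> the identity holds only for almost every
  \<open>x\<close>; for its convolution with a law acting boundedly on L^q it holds for all
  \<open>x\<close> and \<open>h\<close>.\<close>

definition integral_gradient :: "('a::euclidean_space \<Rightarrow> 'b::euclidean_space) \<Rightarrow> ('a \<Rightarrow> 'a \<Rightarrow> 'b) \<Rightarrow> bool" where
  "integral_gradient A B \<longleftrightarrow> (\<forall>i\<in>Basis. B i \<in> borel_measurable borel) \<and>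
    (\<forall>x h. A (x + h) - A x = (LINT \<theta>:{0..1}|lborel. (\<Sum>i\<in>Basis. (h \<bullet> i) *\<^sub>R B i (x + \<theta> *\<^sub>R h))))"

lemma norm_sum_basis_le:
  fixes v :: "'a::euclidean_space \<Rightarrow> 'b::real_normed_vector"
  shows "norm (\<Sum>i\<in>Basis. (h \<bullet> i) *\<^sub>R v i) \<le> norm h * (\<Sum>i\<in>Basis. norm (v i))"
proof -
  have "norm (\<Sum>i\<in>Basis. (h \<bullet> i) *\<^sub>R v i) \<le> (\<Sum>i\<in>Basis. norm ((h \<bullet> i) *\<^sub>R v i))" by (rule norm_sum)
  also have "\<dots> \<le> (\<Sum>i\<in>Basis. norm h * norm (v i))"
    by (intro sum_mono) (auto intro!: mult_right_mono Basis_le_norm)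
  finally show ?thesis by (simp add: sum_distrib_left)
qed

lemma integral_gradient_lipschitz:
  fixes A :: "'a::euclidean_space \<Rightarrow> 'b::euclidean_space"
  assumes ig: "integral_gradient A B" and B: "\<And>i x. i \<in> Basis \<Longrightarrow> norm (B i x) \<le> \<epsilon>"
  shows "norm (A (x + h) - A x) \<le> real DIM('a) * \<epsilon> * norm h"
proof -
  obtain i :: 'a where "i \<in> Basis" using nonempty_Basis by blast
  then have e: "0 \<le> \<epsilon>" using B[of i undefined] norm_ge_zero order_trans by blast
  have "norm (A (x + h) - A x) = norm (LINT \<theta>:{0..1}|lborel. (\<Sum>i\<in>Basis. (h \<bullet> i) *\<^sub>R B i (x + \<theta> *\<^sub>R h)))"
    using ig unfolding integral_gradient_def by simp
  also have "\<dots> \<le> norm h * (real DIM('a) * \<epsilon>)"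
  proof (rule norm_set_integral_unit_le)
    fix \<theta> :: real
    have "norm (\<Sum>i\<in>Basis. (h \<bullet> i) *\<^sub>R B i (x + \<theta> *\<^sub>R h)) \<le> norm h * (\<Sum>i\<in>Basis. norm (B i (x + \<theta> *\<^sub>R h)))"
      by (rule norm_sum_basis_le)
    also have "\<dots> \<le> norm h * (\<Sum>i\<in>(Basis::'a set). \<epsilon>)" by (intro mult_left_mono sum_mono B) auto
    finally show "norm (\<Sum>i\<in>Basis. (h \<bullet> i) *\<^sub>R B i (x + \<theta> *\<^sub>R h)) \<le> norm h * (real DIM('a) * \<epsilon>)" by simp
  qed (use e in simp)
  finally show ?thesis by (simp only: ac_simps)
qed

lemma integral_gradient_has_derivative:
  fixes A :: "'a::euclidean_space \<Rightarrow> 'b::euclidean_space"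
  assumes ig: "integral_gradient A B" and c: "\<And>i. i \<in> Basis \<Longrightarrow> continuous_on UNIV (B i)"
  shows "(A has_derivative (\<lambda>h. \<Sum>i\<in>Basis. (h \<bullet> i) *\<^sub>R B i x)) (at x)"
  unfolding has_derivative_at_alt
proof (intro conjI allI impI)
  show "bounded_linear (\<lambda>h. \<Sum>i\<in>Basis. (h \<bullet> i) *\<^sub>R B i x)"
    by (intro bounded_linear_sum bounded_linear_scaleR_const bounded_linear_inner_left)
  fix e :: real assume e: "0 < e"
  have "continuous_on UNIV (\<lambda>z. \<Sum>i\<in>Basis. norm (B i z - B i x))" by (intro continuous_intros c)
  then have "isCont (\<lambda>z. \<Sum>i\<in>Basis. norm (B i z - B i x)) x" by (simp add: continuous_on_eq_continuous_at)
  then obtain d where d: "d > 0" "\<And>z. dist z x < d \<Longrightarrow> dist (\<Sum>i\<in>Basis. norm (B i z - B i x)) (\<Sum>i\<in>Basis. norm (B i x - B i x)) < e"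
    using e unfolding continuous_at_eps_delta by blast
  show "\<exists>d>0. \<forall>y. norm (y - x) < d \<longrightarrow> norm (A y - A x - (\<Sum>i\<in>Basis. ((y - x) \<bullet> i) *\<^sub>R B i x)) \<le> e * norm (y - x)"
  proof (intro exI[of _ d] conjI d(1) allI impI)
    fix y assume y: "norm (y - x) < d"
    define h where "h = y - x"
    let ?f = "\<lambda>\<theta>. \<Sum>i\<in>Basis. (h \<bullet> i) *\<^sub>R B i (x + \<theta> *\<^sub>R h)" let ?c = "\<Sum>i\<in>Basis. (h \<bullet> i) *\<^sub>R B i x"
    have "continuous_on {0..1} (\<lambda>\<theta>. B i (x + \<theta> *\<^sub>R h))" if "i \<in> Basis" for i
      by (rule continuous_on_compose2[OF c[OF that]]) (auto intro!: continuous_intros)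
    then have "continuous_on {0..1} ?f" by (intro continuous_intros)
    then have i: "set_integrable lborel {0..1} ?f" "set_integrable lborel {0..1} (\<lambda>\<theta>::real. ?c)"
      unfolding set_integrable_def by (auto intro!: borel_integrable_compact)
    have k: "(LINT \<theta>:{0..1::real}|lborel. ?c) = ?c" by (simp add: set_lebesgue_integral_def)
    have xh: "x + h = y" by (simp add: h_def)
    have "A y - A x = (LINT \<theta>:{0..1}|lborel. ?f \<theta>)"
      using ig[unfolded integral_gradient_def, THEN conjunct2, rule_format, of x h] unfolding xh .
    then have "A y - A x - ?c = (LINT \<theta>:{0..1}|lborel. ?f \<theta> - ?c)"
      by (subst set_integral_diff(2)[OF i]) (simp only: k)
    also have "norm \<dots> \<le> norm h * e"
    proof (rule norm_set_integral_unit_le)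
      fix \<theta> :: real assume t: "\<theta> \<in> {0..1}"
      have "norm (\<theta> *\<^sub>R h) \<le> norm h" using t by (auto intro: mult_left_le_one_le)
      then have "dist (x + \<theta> *\<^sub>R h) x < d" using y by (simp add: dist_norm h_def)
      from d(2)[OF this] have "(\<Sum>i\<in>Basis. norm (B i (x + \<theta> *\<^sub>R h) - B i x)) < e" by (simp add: dist_real_def)
      then have "norm h * (\<Sum>i\<in>Basis. norm (B i (x + \<theta> *\<^sub>R h) - B i x)) \<le> norm h * e" by (intro mult_left_mono) auto
      with norm_sum_basis_le[of h "\<lambda>i. B i (x + \<theta> *\<^sub>R h) - B i x"]
      have "norm (\<Sum>i\<in>Basis. (h \<bullet> i) *\<^sub>R (B i (x + \<theta> *\<^sub>R h) - B i x)) \<le> norm h * e" by (rule order_trans)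
      moreover have "?f \<theta> - ?c = (\<Sum>i\<in>Basis. (h \<bullet> i) *\<^sub>R (B i (x + \<theta> *\<^sub>R h) - B i x))"
        by (simp add: scaleR_diff_right sum_subtractf)
      ultimately show "norm (?f \<theta> - ?c) \<le> norm h * e" by simp
    qed (use e in simp)
    finally show "norm (A y - A x - (\<Sum>i\<in>Basis. ((y - x) \<bullet> i) *\<^sub>R B i x)) \<le> e * norm (y - x)"
      by (simp only: h_def mult.commute)
  qed
qed

text \<open>Averaging against the cone \<open>max 0 (1 - N |y|)\<close> turns a bounded gradient into a continuous one and
  preserves its bounds; no smoothness of the kernel is needed.\<close>

lemma integral_gradient_mollify:
  fixes A :: "'a::euclidean_space \<Rightarrow> 'a"
  assumes ig: "integral_gradient A B" and B: "\<And>i x. i \<in> Basis \<Longrightarrow> norm (B i x) \<le> \<epsilon>"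
    and tr: "\<And>x. - \<delta> \<le> (\<Sum>i\<in>Basis. B i x \<bullet> i)" and N: "1 \<le> N"
  shows "\<exists>A' B'. integral_gradient A' B' \<and> (\<forall>i\<in>Basis. continuous_on UNIV (B' i)) \<and>
    (\<forall>i\<in>Basis. \<forall>x. norm (B' i x) \<le> \<epsilon>) \<and> (\<forall>x. - \<delta> \<le> (\<Sum>i\<in>Basis. B' i x \<bullet> i)) \<and>
    (\<forall>x. norm (A' x - A x) \<le> real DIM('a) * \<epsilon> / N)"
proof -
  have mB[measurable]: "\<And>i. i \<in> Basis \<Longrightarrow> B i \<in> borel_measurable borel" using ig by (simp add: integral_gradient_def)
  obtain i0 :: 'a where i0: "i0 \<in> Basis" using nonempty_Basis by blast
  then have e: "0 \<le> \<epsilon>" using B[of i0 undefined] norm_ge_zero order_trans by blast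
  note lip = integral_gradient_lipschitz[OF ig B]
  define L where "L = real DIM('a) * \<epsilon>"
  have L: "0 \<le> L" using e by (simp add: L_def)
  have lipL: "norm (A y - A x) \<le> L * norm (y - x)" for x y using lip[of x "y - x"] by (simp add: L_def)
  then have "L-lipschitz_on UNIV A" using L by (intro lipschitz_onI) (auto simp: dist_norm)
  then have cA: "continuous_on UNIV A" by (rule lipschitz_on_continuous_on)
  define k :: "'a \<Rightarrow> real" where "k y = max 0 (1 - N * norm y)" for y
  have k0: "0 \<le> k y" and k1: "k y \<le> 1" for y using N by (auto simp: k_def)
  have ks: "k y = 0" if "1 / N < norm y" for y using that N by (auto simp: k_def field_simps)
  have ks1: "k y = 0" if "y \<notin> cball 0 1" for y
  proof (rule ks)
    have "1 / N \<le> 1" using N by simp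
    then show "1 / N < norm y" using that by simp
  qed
  have ck: "continuous_on UNIV k" unfolding k_def by (intro continuous_intros)
  then have mk[measurable]: "k \<in> borel_measurable borel" by (rule borel_measurable_continuous_onI)
  have int_c: "integrable lborel (\<lambda>y. k y *\<^sub>R f y)" if "continuous_on UNIV f" for f :: "'a \<Rightarrow> 'b::euclidean_space"
  proof -
    have "continuous_on (cball 0 1) (\<lambda>y. k y *\<^sub>R f y)"
      by (intro continuous_intros continuous_on_subset[OF ck] continuous_on_subset[OF that]) auto
    then have "integrable lborel (\<lambda>y. indicator (cball 0 1) y *\<^sub>R (k y *\<^sub>R f y))" by (intro borel_integrable_compact) auto
    also have "(\<lambda>y. indicator (cball 0 1) y *\<^sub>R (k y *\<^sub>R f y)) = (\<lambda>y. k y *\<^sub>R f y)"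
    proof
      fix y show "indicator (cball 0 1) y *\<^sub>R (k y *\<^sub>R f y) = k y *\<^sub>R f y" using ks1[of y] by (cases "y \<in> cball 0 1") auto
    qed
    finally show ?thesis .
  qed
  have ik: "integrable lborel k" using int_c[of "\<lambda>_. 1::real"] by simp
  define I where "I = (\<integral>y. k y \<partial>lborel)"
  have I: "0 < I"
  proof -
    \<comment> \<open>On the ball of radius 1/(2N) the kernel is at least 1/2.\<close>
    have "(\<integral>y. indicator (ball (0::'a) (1 / (2 * N))) y / 2 \<partial>lborel) \<le> I"
      unfolding I_def
    proof (rule Bochner_Integration.integral_mono[OF _ ik])
      show "integrable lborel (\<lambda>y::'a. indicator (ball 0 (1 / (2 * N))) y / 2 :: real)"
        by (intro integrable_divide integrable_real_indicator) (simp_all add: emeasure_bounded_finite[unfolded infinity_ennreal_def] bounded_ball)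
      show "indicator (ball 0 (1 / (2 * N))) y / 2 \<le> k y" for y :: 'a
        using N by (auto simp: k_def indicator_def field_simps)
    qed
    moreover have "(\<integral>y. indicator (ball (0::'a) (1 / (2 * N))) y / 2 \<partial>lborel) = measure lborel (ball (0::'a) (1 / (2 * N))) / 2"
      by simp
    moreover have "0 < measure lborel (ball (0::'a) (1 / (2 * N)))"
      using content_ball_pos[of "1 / (2 * N)" "0::'a"] N by (simp add: measure_completion)
    ultimately show ?thesis by linarith
  qed
  define A' where "A' x = (1 / I) *\<^sub>R (\<integral>y. k y *\<^sub>R A (x + y) \<partial>lborel)" for x
  define B' where "B' i x = (1 / I) *\<^sub>R (\<integral>y. k y *\<^sub>R B i (x + y) \<partial>lborel)" for i x
  have iA: "integrable lborel (\<lambda>y. k y *\<^sub>R A (x + y))" for x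
    by (rule int_c) (rule continuous_on_compose2[OF cA], auto intro!: continuous_intros)
  have iB: "integrable lborel (\<lambda>y. k y *\<^sub>R B i (x + y))" if i: "i \<in> Basis" for i x
  proof (rule Bochner_Integration.integrable_bound)
    show "integrable lborel (\<lambda>y. k y * \<epsilon>)" using ik by (rule integrable_mult_left)
    show "(\<lambda>y. k y *\<^sub>R B i (x + y)) \<in> borel_measurable lborel" using i by measurable
    have "norm (k y *\<^sub>R B i (x + y)) \<le> norm (k y * \<epsilon>)" for y
      using k0[of y] B[OF i, of "x + y"] e by (simp add: mult_left_mono)
    then show "AE y in lborel. norm (k y *\<^sub>R B i (x + y)) \<le> norm (k y * \<epsilon>)" by simp
  qed
  have kconst: "(\<integral>y. k y * c \<partial>lborel) = I * c" for c by (simp add: I_def)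
  have B'norm: "norm (B' i x) \<le> \<epsilon>" if i: "i \<in> Basis" for i x
  proof -
    have "norm (\<integral>y. k y *\<^sub>R B i (x + y) \<partial>lborel) \<le> (\<integral>y. norm (k y *\<^sub>R B i (x + y)) \<partial>lborel)" by (rule integral_norm_bound)
    also have "\<dots> \<le> (\<integral>y. k y * \<epsilon> \<partial>lborel)"
      using k0 B[OF i] by (intro Bochner_Integration.integral_mono integrable_norm iB[OF i] integrable_mult_left ik) (simp add: mult_left_mono)
    finally show ?thesis using I unfolding kconst B'_def by (simp add: field_simps)
  qed
  have B'tr: "- \<delta> \<le> (\<Sum>i\<in>Basis. B' i x \<bullet> i)" for x
  proof -
    have "I * (- \<delta>) = (\<integral>y. k y * (- \<delta>) \<partial>lborel)" by (rule kconst[symmetric])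
    also have "\<dots> \<le> (\<integral>y. (\<Sum>i\<in>Basis. (k y *\<^sub>R B i (x + y)) \<bullet> i) \<partial>lborel)"
    proof (intro Bochner_Integration.integral_mono integrable_mult_left ik Bochner_Integration.integrable_sum integrable_inner_left iB)
      fix y
      have "k y * (- \<delta>) \<le> k y * (\<Sum>i\<in>Basis. B i (x + y) \<bullet> i)" by (intro mult_left_mono tr k0)
      then show "k y * (- \<delta>) \<le> (\<Sum>i\<in>Basis. (k y *\<^sub>R B i (x + y)) \<bullet> i)" by (simp add: sum_distrib_left)
    qed
    also have "\<dots> = (\<Sum>i\<in>Basis. \<integral>y. (k y *\<^sub>R B i (x + y)) \<bullet> i \<partial>lborel)"
      by (rule Bochner_Integration.integral_sum) (intro integrable_inner_left iB)
    also have "\<dots> = (\<Sum>i\<in>Basis. (\<integral>y. k y *\<^sub>R B i (x + y) \<partial>lborel) \<bullet> i)"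
      by (intro sum.cong refl integral_inner_left iB)
    also have "\<dots> = I * (\<Sum>i\<in>Basis. B' i x \<bullet> i)" using I by (simp add: B'_def sum_distrib_left)
    finally show ?thesis using I by (simp only: mult_le_cancel_left_pos)
  qed
  have B'cont: "continuous_on UNIV (B' i)" if i: "i \<in> Basis" for i
  proof (intro continuous_at_imp_continuous_on ballI continuous_at_sequentiallyI)
    fix x and u :: "nat \<Rightarrow> 'a" assume u: "u \<longlonglongrightarrow> x"
    \<comment> \<open>The substitution moves the base point from the merely measurable
      \<open>B i\<close> into the continuous kernel.\<close>
    have eq: "(\<integral>y. k y *\<^sub>R B i (z + y) \<partial>lborel) = (\<integral>y. k (y - z) *\<^sub>R B i y \<partial>lborel)" for z
    proof -
      have m: "(\<lambda>y. k (y - z) *\<^sub>R B i y) \<in> borel_measurable borel" using mB[OF i] by measurable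
      show ?thesis using integral_lborel_add[OF m, of z] by (simp add: add.commute)
    qed
    obtain R where R: "\<And>n. norm (u n) \<le> R" using convergent_imp_Bseq[OF convergentI[OF u]] unfolding Bseq_def by blast
    have "(\<lambda>n. \<integral>y. k (y - u n) *\<^sub>R B i y \<partial>lborel) \<longlonglongrightarrow> (\<integral>y. k (y - x) *\<^sub>R B i y \<partial>lborel)"
    proof (rule integral_dominated_convergence[where w="\<lambda>y. \<epsilon> * indicator (cball 0 (R + 1)) y"])
      show "integrable lborel (\<lambda>y::'a. \<epsilon> * indicator (cball 0 (R + 1)) y)"
        by (intro integrable_mult_right integrable_real_indicator) (simp_all add: emeasure_bounded_finite[unfolded infinity_ennreal_def] bounded_cball)
      have kt: "(\<lambda>n. k (y - u n)) \<longlonglongrightarrow> k (y - x)" for y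
        by (rule continuous_on_tendsto_compose[OF ck]) (auto intro!: tendsto_intros u)
      show "AE y in lborel. (\<lambda>n. k (y - u n) *\<^sub>R B i y) \<longlonglongrightarrow> k (y - x) *\<^sub>R B i y"
        by (intro AE_I2 tendsto_intros kt)
      show "(\<lambda>y. k (y - x) *\<^sub>R B i y) \<in> borel_measurable lborel" using mB[OF i] by measurable
      fix n
      show "(\<lambda>y. k (y - u n) *\<^sub>R B i y) \<in> borel_measurable lborel" using mB[OF i] by measurable
      show "AE y in lborel. norm (k (y - u n) *\<^sub>R B i y) \<le> \<epsilon> * indicator (cball 0 (R + 1)) y"
      proof (rule AE_I2)
        fix y
        show "norm (k (y - u n) *\<^sub>R B i y) \<le> \<epsilon> * indicator (cball 0 (R + 1)) y"
        proof (cases "norm y \<le> R + 1")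
          case True
          have "k (y - u n) * norm (B i y) \<le> 1 * \<epsilon>" using k0 k1 B[OF i] by (intro mult_mono) auto
          then show ?thesis using True k0 by simp
        next
          case False
          have "norm y \<le> norm (y - u n) + norm (u n)" using norm_triangle_ineq[of "y - u n" "u n"] by simp
          then have "y - u n \<notin> cball 0 1" using False R[of n] by simp
          then show ?thesis using ks1 e by simp
        qed
      qed
    qed
    then show "(\<lambda>n. B' i (u n)) \<longlonglongrightarrow> B' i x" unfolding B'_def eq by (intro tendsto_intros)
  qed
  have close: "norm (A' x - A x) \<le> L / N" for x
  proof -
    have "(\<integral>y. k y *\<^sub>R A x \<partial>lborel) = I *\<^sub>R A x" unfolding I_def by (rule integral_scaleR_left) (rule ik)
    then have "A' x - A x = (1 / I) *\<^sub>R ((\<integral>y. k y *\<^sub>R A (x + y) \<partial>lborel) - (\<integral>y. k y *\<^sub>R A x \<partial>lborel))"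
      using I by (simp add: A'_def scaleR_diff_right)
    also have "\<dots> = (1 / I) *\<^sub>R (\<integral>y. k y *\<^sub>R A (x + y) - k y *\<^sub>R A x \<partial>lborel)"
      using iA ik by (subst Bochner_Integration.integral_diff) auto
    also have "norm \<dots> \<le> (1 / I) * (I * (L / N))"
    proof -
      have "norm (\<integral>y. k y *\<^sub>R A (x + y) - k y *\<^sub>R A x \<partial>lborel) \<le> (\<integral>y. norm (k y *\<^sub>R A (x + y) - k y *\<^sub>R A x) \<partial>lborel)"
        by (rule integral_norm_bound)
      also have "\<dots> \<le> (\<integral>y. k y * (L / N) \<partial>lborel)"
      proof (intro Bochner_Integration.integral_mono integrable_norm Bochner_Integration.integrable_diff iA integrable_mult_left ik)
        show "integrable lborel (\<lambda>y. k y *\<^sub>R A x)" using ik by simp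
        fix y
        show "norm (k y *\<^sub>R A (x + y) - k y *\<^sub>R A x) \<le> k y * (L / N)"
        proof (cases "1 / N < norm y")
          case True then show ?thesis using ks by simp
        next
          case False
          have "norm (A (x + y) - A x) \<le> L * norm y" using lipL[of "x + y" x] by simp
          also have "\<dots> \<le> L * (1 / N)" using False L by (intro mult_left_mono) auto
          finally have "k y * norm (A (x + y) - A x) \<le> k y * (L / N)" using k0 by (intro mult_left_mono) auto
          then show ?thesis using k0 by (simp add: scaleR_diff_right[symmetric])
        qed
      qed
      finally show ?thesis using I unfolding kconst by (simp add: field_simps)
    qed
    also have "\<dots> = L / N" using I by simp
    finally show ?thesis .
  qed
  have "integral_gradient A' B'"
    unfolding integral_gradient_def
  proof (intro conjI ballI allI)
    show "B' i \<in> borel_measurable borel" if "i \<in> Basis" for i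
      by (rule borel_measurable_continuous_onI[OF B'cont[OF that]])
    fix x h
    define G where "G z = (\<Sum>i\<in>Basis. (h \<bullet> i) *\<^sub>R B i z)" for z
    have mG[measurable]: "G \<in> borel_measurable borel" unfolding G_def by measurable
    have Gn: "norm (G z) \<le> norm h * L" for z
    proof -
      have "norm (G z) \<le> norm h * (\<Sum>i\<in>Basis. norm (B i z))" unfolding G_def by (rule norm_sum_basis_le)
      also have "\<dots> \<le> norm h * (\<Sum>i\<in>(Basis::'a set). \<epsilon>)" by (intro mult_left_mono sum_mono B) auto
      finally show ?thesis by (simp add: L_def)
    qed
    \<comment> \<open>The average along the segment and the average over the kernel are exchanged by
      Fubini, the bound on \<open>B\<close> and the integrable kernel providing the
      majorant.\<close>
    let ?F = "\<lambda>(\<theta>, y). indicator {0..1::real} \<theta> *\<^sub>R (k y *\<^sub>R G (x + y + \<theta> *\<^sub>R h))"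
    have iF: "integrable (lborel \<Otimes>\<^sub>M lborel) ?F"
    proof (rule Bochner_Integration.integrable_bound)
      show "integrable (lborel \<Otimes>\<^sub>M lborel) (\<lambda>(\<theta>, y). indicator {0..1::real} \<theta> * (k y * (norm h * L)))"
        by (rule integrable_pair_mult) (auto intro!: integrable_mult_left ik simp: integrable_indicator_iff)
      show "?F \<in> borel_measurable (lborel \<Otimes>\<^sub>M lborel)" by measurable
      have "norm (?F p) \<le> norm (case p of (\<theta>, y) \<Rightarrow> indicator {0..1::real} \<theta> * (k y * (norm h * L)))" for p
      proof -
        obtain \<theta> y where p: "p = (\<theta>, y)" by force
        have "k y * norm (G (x + y + \<theta> *\<^sub>R h)) \<le> k y * (norm h * L)" using k0 Gn by (intro mult_left_mono) auto
        then show ?thesis using k0[of y] L by (cases "\<theta> \<in> {0..1}") (auto simp: p abs_mult)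
      qed
      then show "AE p in lborel \<Otimes>\<^sub>M lborel. norm (?F p) \<le> norm (case p of (\<theta>, y) \<Rightarrow> indicator {0..1::real} \<theta> * (k y * (norm h * L)))"
        by simp
    qed
    have "A' (x + h) - A' x = (1 / I) *\<^sub>R ((\<integral>y. k y *\<^sub>R A (x + h + y) \<partial>lborel) - (\<integral>y. k y *\<^sub>R A (x + y) \<partial>lborel))"
      by (simp add: A'_def scaleR_diff_right)
    also have "(\<integral>y. k y *\<^sub>R A (x + h + y) \<partial>lborel) - (\<integral>y. k y *\<^sub>R A (x + y) \<partial>lborel)
       = (\<integral>y. k y *\<^sub>R A (x + h + y) - k y *\<^sub>R A (x + y) \<partial>lborel)"
      by (rule Bochner_Integration.integral_diff[symmetric]) (rule iA)+
    also have "\<dots> = (\<integral>y. (\<integral>\<theta>. ?F (\<theta>, y) \<partial>lborel) \<partial>lborel)"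
    proof (rule Bochner_Integration.integral_cong[OF refl])
      fix y
      have "A (x + y + h) - A (x + y) = (LINT \<theta>:{0..1}|lborel. G (x + y + \<theta> *\<^sub>R h))"
        using ig unfolding integral_gradient_def G_def by blast
      moreover have "x + y + h = x + h + y" by (simp only: ac_simps)
      ultimately have "A (x + h + y) - A (x + y) = (\<integral>\<theta>. indicator {0..1} \<theta> *\<^sub>R G (x + y + \<theta> *\<^sub>R h) \<partial>lborel)"
        unfolding set_lebesgue_integral_def by simp
      then have "k y *\<^sub>R A (x + h + y) - k y *\<^sub>R A (x + y) = k y *\<^sub>R (\<integral>\<theta>. indicator {0..1} \<theta> *\<^sub>R G (x + y + \<theta> *\<^sub>R h) \<partial>lborel)"
        by (simp only: scaleR_diff_right[symmetric])
      also have "\<dots> = (\<integral>\<theta>. k y *\<^sub>R (indicator {0..1} \<theta> *\<^sub>R G (x + y + \<theta> *\<^sub>R h)) \<partial>lborel)"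
        by (rule integral_scaleR_right[symmetric])
      finally show "k y *\<^sub>R A (x + h + y) - k y *\<^sub>R A (x + y) = (\<integral>\<theta>. ?F (\<theta>, y) \<partial>lborel)"
        by (simp only: prod.case scaleR_left_commute)
    qed
    also have "\<dots> = (\<integral>\<theta>. (\<integral>y. ?F (\<theta>, y) \<partial>lborel) \<partial>lborel)" using lborel_pair.Fubini_integral[OF iF] by (simp only: prod.case)
    also have "(1 / I) *\<^sub>R \<dots> = (\<integral>\<theta>. (1 / I) *\<^sub>R (\<integral>y. ?F (\<theta>, y) \<partial>lborel) \<partial>lborel)"
      by (rule integral_scaleR_right[symmetric])
    also have "\<dots> = (\<integral>\<theta>. indicator {0..1} \<theta> *\<^sub>R (\<Sum>i\<in>Basis. (h \<bullet> i) *\<^sub>R B' i (x + \<theta> *\<^sub>R h)) \<partial>lborel)"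
    proof (rule Bochner_Integration.integral_cong[OF refl])
      fix \<theta> :: real
      have pt: "k y *\<^sub>R G (x + y + \<theta> *\<^sub>R h) = (\<Sum>i\<in>Basis. (h \<bullet> i) *\<^sub>R (k y *\<^sub>R B i (x + \<theta> *\<^sub>R h + y)))" for y
      proof -
        have "x + y + \<theta> *\<^sub>R h = x + \<theta> *\<^sub>R h + y" by (simp only: ac_simps)
        then show ?thesis by (simp only: G_def scaleR_sum_right scaleR_left_commute)
      qed
      have "(\<integral>y. k y *\<^sub>R G (x + y + \<theta> *\<^sub>R h) \<partial>lborel) = (\<Sum>i\<in>Basis. \<integral>y. (h \<bullet> i) *\<^sub>R (k y *\<^sub>R B i (x + \<theta> *\<^sub>R h + y)) \<partial>lborel)"
        unfolding pt by (rule Bochner_Integration.integral_sum) (intro integrable_scaleR_right iB)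
      also have "\<dots> = (\<Sum>i\<in>Basis. (h \<bullet> i) *\<^sub>R (\<integral>y. k y *\<^sub>R B i (x + \<theta> *\<^sub>R h + y) \<partial>lborel))"
        by (simp only: integral_scaleR_right)
      finally have *: "(1 / I) *\<^sub>R (\<integral>y. k y *\<^sub>R G (x + y + \<theta> *\<^sub>R h) \<partial>lborel) = (\<Sum>i\<in>Basis. (h \<bullet> i) *\<^sub>R B' i (x + \<theta> *\<^sub>R h))"
        by (simp only: B'_def scaleR_sum_right scaleR_left_commute)
      have "(\<integral>y. ?F (\<theta>, y) \<partial>lborel) = indicator {0..1} \<theta> *\<^sub>R (\<integral>y. k y *\<^sub>R G (x + y + \<theta> *\<^sub>R h) \<partial>lborel)"
        by (simp only: prod.case integral_scaleR_right)
      then show "(1 / I) *\<^sub>R (\<integral>y. ?F (\<theta>, y) \<partial>lborel) = indicator {0..1} \<theta> *\<^sub>R (\<Sum>i\<in>Basis. (h \<bullet> i) *\<^sub>R B' i (x + \<theta> *\<^sub>R h))"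
        by (simp only: *[symmetric] scaleR_left_commute)
    qed
    finally show "A' (x + h) - A' x = (LINT \<theta>:{0..1}|lborel. (\<Sum>i\<in>Basis. (h \<bullet> i) *\<^sub>R B' i (x + \<theta> *\<^sub>R h)))"
      unfolding set_lebesgue_integral_def .
  qed
  with B'cont B'norm B'tr close show ?thesis unfolding L_def by blast
qed

section \<open>Change of variables over an arbitrary finite index type\<close>

typedef ('n::finite) wo = "UNIV :: 'n set" by simp

text \<open>The change of variables theorem of the library needs an index type of class \<open>wellorder\<close>; a finite
  index type is well-ordered by an arbitrary numbering.\<close>

instantiation wo :: (finite) wellorder
begin

definition wo_index :: "'a wo \<Rightarrow> nat" where
  "wo_index = (SOME f. inj f)"

definition less_eq_wo :: "'a wo \<Rightarrow> 'a wo \<Rightarrow> bool" where "x \<le> y \<longleftrightarrow> wo_index x \<le> wo_index y"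
definition less_wo :: "'a wo \<Rightarrow> 'a wo \<Rightarrow> bool" where "x < y \<longleftrightarrow> wo_index x < wo_index y"

instance
proof
  have "finite (UNIV :: 'a wo set)"
    using finite_imageI[of UNIV "Abs_wo :: 'a \<Rightarrow> 'a wo"] Abs_wo_cases by (metis UNIV_eq_I finite_class.finite_UNIV rangeI)
  then obtain f :: "'a wo \<Rightarrow> nat" where "inj f" using finite_imp_inj_to_nat_seg by blast
  then have inj: "inj (wo_index :: 'a wo \<Rightarrow> nat)" unfolding wo_index_def by (rule someI[of inj])
  fix x y z :: "'a wo"
  show "(x < y) = (x \<le> y \<and> \<not> y \<le> x)" by (auto simp: less_eq_wo_def less_wo_def)
  show "x \<le> x" by (simp add: less_eq_wo_def)
  show "x \<le> y \<Longrightarrow> y \<le> z \<Longrightarrow> x \<le> z" by (simp add: less_eq_wo_def)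
  show "x \<le> y \<Longrightarrow> y \<le> x \<Longrightarrow> x = y" using inj by (simp add: less_eq_wo_def inj_def)
  show "x \<le> y \<or> y \<le> x" by (auto simp: less_eq_wo_def)
next
  fix P :: "'a wo \<Rightarrow> bool" and a :: "'a wo" assume h: "\<And>x. (\<And>y. y < x \<Longrightarrow> P y) \<Longrightarrow> P x"
  show "P a"
  proof (induction a rule: measure_induct[where f=wo_index])
    case (1 x)
    show ?case by (rule h) (use 1 in \<open>simp add: less_wo_def\<close>)
  qed
qed

end

instance wo :: (finite) finite
proof
  show "finite (UNIV :: 'a wo set)"
    using finite_imageI[of UNIV "Abs_wo :: 'a \<Rightarrow> 'a wo"] Abs_wo_cases by (metis UNIV_eq_I finite_class.finite_UNIV rangeI)
qed

lemma Basis_vec_eq_range: "(Basis :: (real^'n) set) = range (\<lambda>k. axis k 1)"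
  by (auto simp: Basis_vec_def)

lemma inj_axis: "inj (\<lambda>k. axis k 1 :: real^'n)"
  by (auto simp: inj_def axis_eq_axis)

lemma prod_Basis_vec: "(\<Prod>b\<in>Basis. f b) = (\<Prod>k\<in>UNIV. f (axis k 1))" for f :: "real^'n \<Rightarrow> real"
  unfolding Basis_vec_eq_range by (subst prod.reindex[OF inj_axis]) simp

lemma sum_Basis_vec: "(\<Sum>b\<in>Basis. f b) = (\<Sum>k\<in>UNIV. f (axis k 1))" for f :: "real^'n \<Rightarrow> real"
  unfolding Basis_vec_eq_range by (subst sum.reindex[OF inj_axis]) simp

text \<open>A relabelling of coordinates maps boxes to boxes with the same side lengths. It carries
  the change of variables from the well-ordered copy of the index type back to the given
  one.\<close>

lemma compresses_reindex:
  fixes \<pi> :: "'m::finite \<Rightarrow> 'n::finite"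
  assumes "bij \<pi>"
  shows "compresses 1 (\<lambda>x::real^'n. (\<chi> i. x $ \<pi> i) :: real^'m)"
proof -
  let ?R = "\<lambda>x::real^'n. (\<chi> i. x $ \<pi> i) :: real^'m"
  have "linear ?R" by (intro linearI) (auto simp: vec_eq_iff)
  then have m: "?R \<in> borel_measurable borel"
    by (intro borel_measurable_continuous_onI linear_continuous_on) (simp add: linear_conv_bounded_linear)
  have "lborel = distr lborel borel ?R"
  proof (rule lborel_eqI)
    fix l u :: "real^'m" assume lu: "\<And>b. b \<in> Basis \<Longrightarrow> l \<bullet> b \<le> u \<bullet> b"
    let ?l = "(\<chi> k. l $ inv \<pi> k) :: real^'n" let ?u = "(\<chi> k. u $ inv \<pi> k) :: real^'n"
    have l1: "l $ i \<le> u $ i" for i using lu[of "axis i 1"] by (simp add: inner_axis)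
    have "?R -` box l u = box ?l ?u"
    proof -
      have "(\<forall>i. l $ i < x $ \<pi> i \<and> x $ \<pi> i < u $ i) \<longleftrightarrow> (\<forall>k. l $ inv \<pi> k < x $ k \<and> x $ k < u $ inv \<pi> k)" for x :: "real^'n"
      proof (intro iffI allI)
        fix k assume "\<forall>i. l $ i < x $ \<pi> i \<and> x $ \<pi> i < u $ i"
        then show "l $ inv \<pi> k < x $ k \<and> x $ k < u $ inv \<pi> k"
          using surj_f_inv_f[OF bij_is_surj[OF assms], of k] by metis
      next
        fix i assume "\<forall>k. l $ inv \<pi> k < x $ k \<and> x $ k < u $ inv \<pi> k"
        then show "l $ i < x $ \<pi> i \<and> x $ \<pi> i < u $ i"
          using inv_f_f[OF bij_is_inj[OF assms], of i] by metis
      qed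
      then show ?thesis by (auto simp: mem_box_cart)
    qed
    then have "emeasure (distr lborel borel ?R) (box l u) = emeasure lborel (box ?l ?u)"
      using m by (subst emeasure_distr) auto
    also have "\<dots> = (\<Prod>b\<in>Basis. (?u - ?l) \<bullet> b)"
      by (rule emeasure_lborel_box) (auto simp: Basis_vec_def inner_axis l1)
    also have "(\<Prod>b\<in>Basis. (?u - ?l) \<bullet> b) = (\<Prod>k\<in>UNIV. u $ inv \<pi> k - l $ inv \<pi> k)"
      by (subst prod_Basis_vec) (simp add: inner_axis)
    also have "\<dots> = (\<Prod>i\<in>UNIV. u $ i - l $ i)"
      using prod.reindex_bij_betw[of "inv \<pi>" UNIV UNIV "\<lambda>i. u $ i - l $ i"] bij_imp_bij_inv[OF assms] by simp
    also have "\<dots> = (\<Prod>b\<in>Basis. (u - l) \<bullet> b)" by (subst prod_Basis_vec) (simp add: inner_axis)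
    finally show "emeasure (distr lborel borel ?R) (box l u) = (\<Prod>b\<in>Basis. (u - l) \<bullet> b)" .
  qed simp
  then have "emeasure lborel B = emeasure lborel (?R -` B)" if "B \<in> sets borel" for B
    using emeasure_distr[of ?R lborel borel B] m that by simp
  then show ?thesis using m by (simp add: compresses_def)
qed

text \<open>Conjugation with the relabelling \<open>R\<close> gives the map \<open>g\<close>. It is
  injective because \<open>A\<close> is a strict contraction, by
  \<open>CARD('d) * \<epsilon> < 1\<close>, and its Jacobian matrix is the identity plus a matrix
  with entries of size at most \<epsilon> and trace at least -\<delta>.\<close>

lemma compresses_continuous_gradient:
  fixes A :: "real^'d \<Rightarrow> real^'d"
  assumes ig: "integral_gradient A B" and c: "\<And>i. i \<in> Basis \<Longrightarrow> continuous_on UNIV (B i)"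
    and B: "\<And>i x. i \<in> Basis \<Longrightarrow> norm (B i x) \<le> \<epsilon>" and tr: "\<And>x. - \<delta> \<le> (\<Sum>i\<in>Basis. B i x \<bullet> i)"
    and e: "0 \<le> \<epsilon>" "real CARD('d) * \<epsilon> < 1"
    and s: "\<delta> + (4 ^ CARD('d) + fact (CARD('d)) * 2 ^ CARD('d)) * \<epsilon>\<^sup>2 < 1"
  shows "compresses (1 / (1 - \<delta> - (4 ^ CARD('d) + fact (CARD('d)) * 2 ^ CARD('d)) * \<epsilon>\<^sup>2)) (\<lambda>x. x + A x)"
proof -
  let ?C = "(4 ^ CARD('d) + fact (CARD('d)) * 2 ^ CARD('d)) :: real"
  let ?c = "1 - \<delta> - ?C * \<epsilon>\<^sup>2"
  define R :: "real^'d \<Rightarrow> real^'d wo" where "R x = (\<chi> i. x $ Rep_wo i)" for x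
  define R' :: "real^'d wo \<Rightarrow> real^'d" where "R' x = (\<chi> i. x $ Abs_wo i)" for x
  have RR': "R (R' x) = x" "R' (R y) = y" for x y
    by (auto simp: R_def R'_def vec_eq_iff Rep_wo_inverse Abs_wo_inverse)
  have bR: "bij (Rep_wo :: 'd wo \<Rightarrow> 'd)" "bij (Abs_wo :: 'd \<Rightarrow> 'd wo)"
    by (auto intro!: bij_betw_byWitness[where f'=Abs_wo] bij_betw_byWitness[where f'=Rep_wo] simp: Rep_wo_inverse Abs_wo_inverse)
  have lR: "linear R" "linear R'" by (auto intro!: linearI simp: R_def R'_def vec_eq_iff)
  then have bl: "bounded_linear R" "bounded_linear R'" by (simp_all add: linear_conv_bounded_linear)
  have card: "CARD('d wo) = CARD('d)" using bij_betw_same_card[OF bR(1)] by simp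
  obtain i0 :: "real^'d" where "i0 \<in> Basis" using nonempty_Basis by blast
  have "real CARD('d) \<ge> 1" by (simp add: Suc_leI)
  then have "1 * \<epsilon> \<le> real CARD('d) * \<epsilon>" using e(1) by (rule mult_right_mono)
  then have e1: "\<epsilon> \<le> 1" using e(2) by simp
  have ax: "axis k 1 \<in> (Basis :: (real^'d) set)" for k by (simp add: axis_in_Basis_iff)
  define g where "g x = R (R' x + A (R' x))" for x
  define g' where "g' x h = R (R' h + (\<Sum>i\<in>Basis. (R' h \<bullet> i) *\<^sub>R B i (R' x)))" for x h
  have "compresses (1 / ?c) g"
  proof (rule compresses_differentiable_wellorder)
    fix x
    have dR': "(R' has_derivative R') (at x)" by (rule bounded_linear_imp_has_derivative[OF bl(2)])
    have dA: "((\<lambda>x. A (R' x)) has_derivative (\<lambda>h. \<Sum>i\<in>Basis. (R' h \<bullet> i) *\<^sub>R B i (R' x))) (at x)"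
      by (rule has_derivative_compose[OF dR' integral_gradient_has_derivative[OF ig c]])
    have "(g has_derivative (\<lambda>h. R (R' h + (\<Sum>i\<in>Basis. (R' h \<bullet> i) *\<^sub>R B i (R' x))))) (at x)"
      unfolding g_def by (rule bounded_linear.has_derivative[OF bl(1) has_derivative_add[OF dR' dA]])
    then show "(g has_derivative g' x) (at x)" unfolding g'_def .
    define E :: "real^'d wo^'d wo" where "E = (\<chi> i j. B (axis (Rep_wo j) 1) (R' x) $ Rep_wo i)"
    have "matrix (g' x) = mat 1 + E"
    proof (subst vec_eq_iff, intro allI, subst vec_eq_iff, intro allI)
      fix i j
      have R'a: "R' (axis j 1) = axis (Rep_wo j) 1"
        by (auto simp: R'_def vec_eq_iff axis_def Abs_wo_inverse Rep_wo_inverse)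
      have "(\<Sum>b\<in>Basis. (axis (Rep_wo j) 1 \<bullet> b) *\<^sub>R B b (R' x)) = (\<Sum>b\<in>Basis. if b = axis (Rep_wo j) 1 then B b (R' x) else 0)"
        using ax[of "Rep_wo j"] by (intro sum.cong) (auto simp: inner_Basis)
      also have "\<dots> = B (axis (Rep_wo j) 1) (R' x)" using ax by simp
      finally have "g' x (axis j 1) = R (axis (Rep_wo j) 1 + B (axis (Rep_wo j) 1) (R' x))" by (simp only: g'_def R'a)
      then show "matrix (g' x) $ i $ j = (mat 1 + E) $ i $ j"
        by (auto simp: matrix_def R_def E_def mat_def axis_def Rep_wo_inject)
    qed
    moreover have "1 + (\<Sum>i\<in>UNIV. E $ i $ i) - ?C * \<epsilon>\<^sup>2 \<le> det (mat 1 + E)"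
    proof -
      have "\<bar>E $ i $ j\<bar> \<le> \<epsilon>" for i j
        using order_trans[OF component_le_norm_cart B[OF ax]] by (simp add: E_def)
      from det_one_plus_lower_bound[OF this e1 e(1)] show ?thesis unfolding card .
    qed
    moreover have "(\<Sum>i\<in>UNIV. E $ i $ i) = (\<Sum>b\<in>Basis. B b (R' x) \<bullet> b)"
    proof -
      have "(\<Sum>i\<in>UNIV. E $ i $ i) = (\<Sum>i\<in>UNIV. B (axis (Rep_wo i) 1) (R' x) $ Rep_wo i)" by (simp add: E_def)
      also have "\<dots> = (\<Sum>k\<in>UNIV. B (axis k 1) (R' x) $ k)"
        by (rule sum.reindex_bij_betw[OF bR(1), of "\<lambda>k. B (axis k 1) (R' x) $ k"])
      also have "\<dots> = (\<Sum>k\<in>UNIV. B (axis k 1) (R' x) \<bullet> axis k 1)" by (simp add: inner_axis)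
      also have "\<dots> = (\<Sum>b\<in>Basis. B b (R' x) \<bullet> b)" by (rule sum_Basis_vec[symmetric])
      finally show ?thesis .
    qed
    ultimately have "?c \<le> det (matrix (g' x))" using tr[of "R' x"] by simp
    then show "?c \<le> \<bar>det (matrix (g' x))\<bar>" by linarith
  next
    show "0 < ?c" using s by simp
    show "inj g"
    proof (rule injI)
      fix x y assume "g x = g y"
      then have "R' x + A (R' x) = R' y + A (R' y)" unfolding g_def by (metis RR'(2))
      then have "norm (R' x - R' y) = norm (A (R' y + (R' x - R' y)) - A (R' y))"
      proof -
        assume eq: "R' x + A (R' x) = R' y + A (R' y)"
        have "R' x - R' y = (R' x + A (R' x)) - A (R' x) - R' y" by simp
        also have "\<dots> = A (R' y) - A (R' x)" unfolding eq by simp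
        also have "norm \<dots> = norm (A (R' x) - A (R' y))" by (rule norm_minus_commute)
        finally show ?thesis by simp
      qed
      also have "\<dots> \<le> real DIM(real^'d) * \<epsilon> * norm (R' x - R' y)"
        by (rule integral_gradient_lipschitz[OF ig B])
      finally have "norm (R' x - R' y) * (1 - real CARD('d) * \<epsilon>) \<le> 0" by (simp add: algebra_simps)
      then have "norm (R' x - R' y) \<le> 0" using e(2) by (simp add: mult_le_0_iff)
      then have "R' x = R' y" by simp
      then show "x = y" by (metis RR'(1))
    qed
  qed
  then have "compresses (1 * (1 / ?c)) (\<lambda>x. g (R x))"
    by (rule compresses_compose[rotated]) (use compresses_reindex[OF bR(1)] s in \<open>auto simp: R_def[abs_def]\<close>)
  then have "compresses (1 * (1 / ?c) * 1) (\<lambda>x. R' (g (R x)))"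
    by (rule compresses_compose) (use compresses_reindex[OF bR(2)] s in \<open>auto simp: R'_def[abs_def]\<close>)
  then show ?thesis by (simp add: g_def RR')
qed

text \<open>Mollification at scale 1/n preserves \<epsilon> and \<delta>, hence the compression
  constant, and the mollified maps converge pointwise.\<close>

lemma compresses_integral_gradient:
  fixes A :: "real^'d \<Rightarrow> real^'d"
  assumes ig: "integral_gradient A B"
    and B: "\<And>i x. i \<in> Basis \<Longrightarrow> norm (B i x) \<le> \<epsilon>" and tr: "\<And>x. - \<delta> \<le> (\<Sum>i\<in>Basis. B i x \<bullet> i)"
    and e: "0 \<le> \<epsilon>" "real CARD('d) * \<epsilon> < 1"
    and s: "\<delta> + (4 ^ CARD('d) + fact (CARD('d)) * 2 ^ CARD('d)) * \<epsilon>\<^sup>2 < 1"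
  shows "compresses (1 / (1 - \<delta> - (4 ^ CARD('d) + fact (CARD('d)) * 2 ^ CARD('d)) * \<epsilon>\<^sup>2)) (\<lambda>x. x + A x)"
proof -
  have "\<exists>A'. compresses (1 / (1 - \<delta> - (4 ^ CARD('d) + fact (CARD('d)) * 2 ^ CARD('d)) * \<epsilon>\<^sup>2)) (\<lambda>x. x + A' x) \<and>
      (\<forall>x. norm (A' x - A x) \<le> real DIM(real^'d) * \<epsilon> / real (Suc n))" for n
  proof -
    obtain A' B' where *: "integral_gradient A' B'" "\<forall>i\<in>Basis. continuous_on UNIV (B' i)"
      "\<forall>i\<in>Basis. \<forall>x. norm (B' i x) \<le> \<epsilon>" "\<forall>x. - \<delta> \<le> (\<Sum>i\<in>Basis. B' i x \<bullet> i)"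
      "\<forall>x. norm (A' x - A x) \<le> real DIM(real^'d) * \<epsilon> / real (Suc n)"
      using integral_gradient_mollify[OF ig B tr, of "real (Suc n)"] by (simp del: of_nat_Suc) blast
    then have "compresses (1 / (1 - \<delta> - (4 ^ CARD('d) + fact (CARD('d)) * 2 ^ CARD('d)) * \<epsilon>\<^sup>2)) (\<lambda>x. x + A' x)"
      by (intro compresses_continuous_gradient[OF *(1)] e s) auto
    with *(5) show ?thesis by blast
  qed
  then obtain A' where A': "\<And>n. compresses (1 / (1 - \<delta> - (4 ^ CARD('d) + fact (CARD('d)) * 2 ^ CARD('d)) * \<epsilon>\<^sup>2)) (\<lambda>x. x + A' n x)"
    "\<And>n x. norm (A' n x - A x) \<le> real DIM(real^'d) * \<epsilon> / real (Suc n)" by metis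
  show ?thesis
  proof (rule compresses_limit[OF A'(1)])
    fix x
    have "(\<lambda>n. real DIM(real^'d) * \<epsilon> * inverse (real (Suc n))) \<longlonglongrightarrow> real DIM(real^'d) * \<epsilon> * 0"
      by (intro tendsto_intros LIMSEQ_inverse_real_of_nat)
    then have l0: "(\<lambda>n. real DIM(real^'d) * \<epsilon> * inverse (real (Suc n))) \<longlonglongrightarrow> 0" by simp
    have "norm (A' n x - A x) \<le> real DIM(real^'d) * \<epsilon> * inverse (real (Suc n))" for n
      using A'(2)[of n x] by (simp only: divide_inverse)
    then have "(\<lambda>n. A' n x - A x) \<longlonglongrightarrow> 0"
      by (intro Lim_null_comparison[OF _ l0] always_eventually allI)
    then have "(\<lambda>n. A' n x) \<longlonglongrightarrow> A x" by (rule LIM_zero_cancel)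
    then show "(\<lambda>n. x + A' n x) \<longlonglongrightarrow> x + A x" by (intro tendsto_intros)
  qed
qed

section \<open>Laws acting boundedly on \<open>L\<^sup>q\<close>\<close>

text \<open>For 1 < q < \<infinity> this says that the density lies in the conjugate space of L^q
  with norm at most \<open>K\<close>. The formulation through test functions includes q =
  \<infinity> and allows mixtures of image measures to be estimated without computing their
  densities.\<close>

definition dual_bounded :: "ennreal \<Rightarrow> real \<Rightarrow> 'a::euclidean_space measure \<Rightarrow> bool" where
  "dual_bounded q K \<mu> \<longleftrightarrow> prob_space \<mu> \<and> sets \<mu> = sets borel \<and>
    (\<forall>f :: 'a \<Rightarrow> real. f \<in> borel_measurable borel \<longrightarrow> (\<forall>x. 0 \<le> f x) \<longrightarrow>
      (\<integral>\<^sup>+x. ennreal (f x) \<partial>\<mu>) \<le> ennreal K * Lp_norm lborel q f)"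

lemma dual_boundedD:
  assumes "dual_bounded q K \<mu>" "f \<in> borel_measurable borel" "\<And>x. 0 \<le> f x"
  shows "(\<integral>\<^sup>+x. ennreal (f x) \<partial>\<mu>) \<le> ennreal K * Lp_norm lborel q f"
  using assms unfolding dual_bounded_def by blast

lemma Lp_norm_norm: "Lp_norm M p (\<lambda>x. norm (f x)) = Lp_norm M p f"
  by (simp add: Lp_norm_def)

lemma Lp_norm_top: "Lp_norm M \<infinity> f = esssup M (\<lambda>x. ennreal (norm (f x)))"
  by (simp add: Lp_norm_def)

lemma Lp_norm_measure_preserving:
  fixes f :: "'a::euclidean_space \<Rightarrow> 'b::euclidean_space"
  assumes [measurable]: "f \<in> borel_measurable borel" and m: "\<phi> \<in> lborel \<rightarrow>\<^sub>M borel" and d: "distr lborel borel \<phi> = lborel"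
  shows "Lp_norm lborel p (\<lambda>x. f (\<phi> x)) \<le> Lp_norm lborel p f"
proof (cases "p = \<infinity>")
  case True
  have [measurable]: "\<phi> \<in> borel_measurable borel" using m by simp
  have "AE y in distr lborel borel \<phi>. ennreal (norm (f y)) \<le> esssup lborel (\<lambda>x. ennreal (norm (f x)))"
    unfolding d by (rule esssup_AE)
  from AE_distrD[OF m this] show ?thesis
    unfolding True Lp_norm_top by (intro esssup_I) measurable
next
  case False
  have "(\<integral>\<^sup>+x. ennreal (norm (f (\<phi> x)) powr enn2real p) \<partial>lborel) = (\<integral>\<^sup>+x. ennreal (norm (f x) powr enn2real p) \<partial>distr lborel borel \<phi>)"
    by (rule nn_integral_distr[OF m, symmetric]) measurable
  then show ?thesis unfolding d using False by (simp add: Lp_norm_def)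
qed

lemma lborel_distr_reflect: "distr lborel borel (\<lambda>y. x - y) = (lborel :: 'a::euclidean_space measure)"
  using lborel_affine[of "-1 :: real" "x :: 'a"] by (simp add: density_1)

lemma Lp_norm_reflect:
  fixes f :: "'a::euclidean_space \<Rightarrow> 'b::euclidean_space"
  assumes "f \<in> borel_measurable borel"
  shows "Lp_norm lborel p (\<lambda>y. f (x - y)) \<le> Lp_norm lborel p f"
  by (rule Lp_norm_measure_preserving[OF assms _ lborel_distr_reflect]) simp

lemma dual_bounded_absolutely_continuous:
  fixes \<mu> :: "'a::euclidean_space measure"
  assumes d: "dual_bounded q K \<mu>"
  shows "absolutely_continuous lborel \<mu>"
  unfolding absolutely_continuous_def
proof
  fix N :: "'a set" assume N: "N \<in> null_sets lborel"
  then have sN: "N \<in> sets borel" by auto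
  let ?f = "indicator N :: 'a \<Rightarrow> real"
  have AE0: "AE x in lborel. ?f x = 0" using AE_not_in[OF N] by eventually_elim simp
  have "Lp_norm lborel q ?f = 0"
  proof (cases "q = \<infinity>")
    case True
    have "esssup lborel (\<lambda>x. ennreal (norm (?f x))) \<le> 0"
      using sN AE0 by (intro esssup_I) (auto elim!: eventually_mono)
    then show ?thesis unfolding True Lp_norm_top by simp
  next
    case False
    have "(\<integral>\<^sup>+x. ennreal (norm (?f x) powr enn2real q) \<partial>lborel) = (\<integral>\<^sup>+(x::'a). 0 \<partial>lborel)"
      using AE0 by (intro nn_integral_cong_AE) (auto elim!: eventually_mono)
    then show ?thesis using False by (simp add: Lp_norm_def)
  qed
  then have "(\<integral>\<^sup>+x. ennreal (?f x) \<partial>\<mu>) \<le> 0" using dual_boundedD[OF d, of ?f] sN by simp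
  moreover have "(\<integral>\<^sup>+x. ennreal (?f x) \<partial>\<mu>) = emeasure \<mu> N"
    using sN d unfolding dual_bounded_def by (simp add: ennreal_indicator)
  ultimately show "N \<in> null_sets \<mu>" using sN d by (auto simp: dual_bounded_def null_sets_def)
qed

text \<open>Carries almost everywhere properties of the field over to its values at x - y for
  \<mu>-almost every y, at each single x. This is what makes the convolution meaningful pointwise
  and independent of the representative.\<close>

lemma dual_bounded_AE_reflect:
  fixes \<mu> :: "'a::euclidean_space measure"
  assumes d: "dual_bounded q K \<mu>" and P: "AE z in lborel. P z"
  shows "AE y in \<mu>. P (x - y)"
proof -
  have "AE y in lborel. P (x - y)"
  proof -
    have "AE y in distr lborel borel (\<lambda>y. x - y). P y" unfolding lborel_distr_reflect by (rule P)
    then show ?thesis by (rule AE_distrD[rotated]) simp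
  qed
  moreover have "sets \<mu> = sets lborel" using d by (simp add: dual_bounded_def)
  ultimately show ?thesis using absolutely_continuous_AE[OF _ dual_bounded_absolutely_continuous[OF d]] by blast
qed

lemma dual_bounded_convolution_le:
  fixes f :: "'a::euclidean_space \<Rightarrow> 'b::euclidean_space"
  assumes d: "dual_bounded q K \<mu>" and f[measurable]: "f \<in> borel_measurable borel"
    and c: "Lp_norm lborel q f \<le> ennreal c" and K: "0 \<le> K"
  shows "(\<integral>\<^sup>+y. ennreal (norm (f (x - y))) \<partial>\<mu>) \<le> ennreal (K * c)"
proof -
  have "(\<integral>\<^sup>+y. ennreal (norm (f (x - y))) \<partial>\<mu>) \<le> ennreal K * Lp_norm lborel q (\<lambda>y. norm (f (x - y)))"
    by (rule dual_boundedD[OF d]) auto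
  also have "Lp_norm lborel q (\<lambda>y. norm (f (x - y))) = Lp_norm lborel q (\<lambda>y. f (x - y))" by (rule Lp_norm_norm)
  also have "ennreal K * \<dots> \<le> ennreal K * ennreal c"
    by (intro mult_left_mono order_trans[OF Lp_norm_reflect[OF f] c]) simp
  also have "\<dots> = ennreal (K * c)" using K by (rule ennreal_mult'[symmetric])
  finally show ?thesis .
qed

text \<open>Young's inequality with both constants replaced by 1; it suffices to see which of
  \<open>b\<close> and \<open>a powr (q - 1)\<close> is larger.\<close>

lemma mult_le_powr_add_powr:
  fixes a b q :: real
  assumes "0 \<le> a" "0 \<le> b" "1 < q"
  shows "a * b \<le> a powr q + b powr (q / (q - 1))"
proof (cases "b \<le> a powr (q - 1)")
  case True
  have "a * b \<le> a * a powr (q - 1)" using True assms by (intro mult_left_mono)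
  also have "\<dots> = a powr q"
    using assms by (cases "a = 0") (auto simp: powr_mult_base)
  finally show ?thesis by (smt (verit) powr_ge_zero)
next
  case False
  have b: "0 < b" using False by (smt (verit) powr_ge_zero)
  have "a = (a powr (q - 1)) powr (1 / (q - 1))" using assms by (cases "a = 0") (auto simp: powr_powr)
  also have "\<dots> \<le> b powr (1 / (q - 1))" using False assms by (intro powr_mono2) auto
  finally have "a * b \<le> b powr (1 / (q - 1)) * b" using assms by (intro mult_right_mono)
  also have "\<dots> = b powr (1 / (q - 1) + 1)" using b by (simp add: powr_add)
  also have "1 / (q - 1) + 1 = q / (q - 1)" using assms by (simp add: field_simps)
  finally show ?thesis by (smt (verit) powr_ge_zero)
qed

lemma Lp_norm_le_imp_nn_integral_le:
  assumes "p \<noteq> \<infinity>" "1 < p" "Lp_norm M p f \<le> ennreal B" "0 \<le> B"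
  shows "(\<integral>\<^sup>+x. ennreal (norm (f x) powr enn2real p) \<partial>M) \<le> ennreal (B powr enn2real p)"
proof -
  define I where "I = (\<integral>\<^sup>+x. ennreal (norm (f x) powr enn2real p) \<partial>M)"
  have p: "1 < enn2real p" using assms(1,2) by (cases p) auto
  have If: "I \<noteq> \<infinity>" using assms unfolding Lp_norm_def I_def[symmetric] Let_def by (auto simp: top_unique split: if_splits)
  then have "ennreal (enn2real I powr (1 / enn2real p)) \<le> ennreal B"
    using assms unfolding Lp_norm_def I_def[symmetric] Let_def by simp
  then have "enn2real I powr (1 / enn2real p) \<le> B" using assms(4) by simp
  then have "(enn2real I powr (1 / enn2real p)) powr enn2real p \<le> B powr enn2real p" using p by (intro powr_mono2) auto
  moreover have "(enn2real I powr (1 / enn2real p)) powr enn2real p = enn2real I" using p by (simp add: powr_powr)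
  ultimately have "enn2real I \<le> B powr enn2real p" by simp
  then have "ennreal (enn2real I) \<le> ennreal (B powr enn2real p)" by (rule ennreal_leI)
  moreover have "ennreal (enn2real I) = I" using If by (simp add: less_top)
  ultimately show ?thesis unfolding I_def by (simp only:)
qed

lemma Lp_norm_leI_nn_integral:
  assumes "p \<noteq> \<infinity>" "1 < p" "(\<integral>\<^sup>+x. ennreal (norm (f x) powr enn2real p) \<partial>M) \<le> ennreal C" "0 \<le> C"
  shows "Lp_norm M p f \<le> ennreal (C powr (1 / enn2real p))"
proof -
  have p: "1 < enn2real p" using assms(1,2) by (cases p) auto
  define I where "I = (\<integral>\<^sup>+x. ennreal (norm (f x) powr enn2real p) \<partial>M)"
  have If: "I \<noteq> \<infinity>" using assms(3) unfolding I_def[symmetric] by (auto simp: top_unique)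
  then have "enn2real I \<le> C" using assms(3,4) unfolding I_def[symmetric] by (metis enn2real_leI)
  then have "enn2real I powr (1 / enn2real p) \<le> C powr (1 / enn2real p)" using p by (intro powr_mono2) auto
  then show ?thesis using If assms(1) unfolding Lp_norm_def I_def[symmetric] Let_def by (simp add: ennreal_leI)
qed

lemma conjugate_exponent_less:
  fixes p q :: ennreal
  assumes "1 < p" "1 < q" "1 / p + 1 / q < 1" "p \<noteq> \<infinity>" "q \<noteq> \<infinity>"
  shows "enn2real q / (enn2real q - 1) \<le> enn2real p"
proof -
  obtain P Q where PQ: "p = ennreal P" "q = ennreal Q" "0 \<le> P" "0 \<le> Q" using assms(4,5) by (cases p; cases q) auto
  have P1: "1 < P" "1 < Q" using assms(1,2) PQ by auto
  have "1 / p = ennreal (1 / P)" "1 / q = ennreal (1 / Q)"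
    using PQ P1 divide_ennreal[of 1 P] divide_ennreal[of 1 Q] by simp_all
  then have "1 / p + 1 / q = ennreal (1 / P + 1 / Q)" using P1 by (subst ennreal_plus) auto
  then have "ennreal (1 / P + 1 / Q) < ennreal 1" using assms(3) by simp
  then have "1 / P + 1 / Q < 1" using P1 by (subst (asm) ennreal_less_iff) auto
  then have "Q / (Q - 1) \<le> P" using P1 by (simp add: field_simps)
  then show ?thesis using PQ by simp
qed

text \<open>This is where \<open>1/p + 1/q < 1\<close> enters: the conjugate exponent of \<open>q\<close> lies between \<open>1\<close> and \<open>p\<close>.\<close>

lemma density_conjugate_power_bound:
  fixes p q :: ennreal
  assumes pq: "1 < p" "1 < q" "1 / p + 1 / q < 1" and q: "q \<noteq> \<infinity>" and B: "0 \<le> B"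
  shows "\<exists>A\<ge>0. \<forall>\<rho> :: 'a::euclidean_space \<Rightarrow> real. \<rho> \<in> borel_measurable borel \<longrightarrow> (\<forall>x. 0 \<le> \<rho> x) \<longrightarrow>
    (\<integral>\<^sup>+x. ennreal (\<rho> x) \<partial>lborel) = 1 \<longrightarrow> Lp_norm lborel p \<rho> \<le> ennreal B \<longrightarrow>
    (\<integral>\<^sup>+x. ennreal (\<rho> x powr (enn2real q / (enn2real q - 1))) \<partial>lborel) \<le> ennreal A"
proof -
  define r where "r = enn2real q / (enn2real q - 1)"
  have Q: "1 < enn2real q" using pq(2) q by (cases q) auto
  have r: "1 < r" unfolding r_def using Q by simp
  show ?thesis
  proof (cases "p = \<infinity>")
    case False
    have rp: "r \<le> enn2real p" unfolding r_def by (rule conjugate_exponent_less[OF pq False q])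
    show ?thesis unfolding r_def[symmetric]
    proof (intro exI[of _ "1 + B powr enn2real p"] conjI allI impI)
      fix \<rho> :: "'a \<Rightarrow> real"
      assume [measurable]: "\<rho> \<in> borel_measurable borel" and nn: "\<forall>x. 0 \<le> \<rho> x"
        and i1: "(\<integral>\<^sup>+x. ennreal (\<rho> x) \<partial>lborel) = 1" and ip: "Lp_norm lborel p \<rho> \<le> ennreal B"
      \<comment> \<open>As 1 < r \<le> p, the power is below \<rho> where \<rho> \<le> 1 and below
        the p-th power elsewhere; the mass of \<rho> and its L^p norm control the two parts.\<close>
      have "\<rho> x powr r \<le> \<rho> x + norm (\<rho> x) powr enn2real p" for x
      proof (cases "\<rho> x \<le> 1")
        case True
        have "\<rho> x powr r \<le> \<rho> x powr 1" using True nn r by (intro powr_mono') auto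
        also have "\<dots> = \<rho> x" using nn[rule_format, of x] by simp
        finally show ?thesis by (smt (verit) powr_ge_zero)
      next
        case False
        have "\<rho> x powr r \<le> \<rho> x powr enn2real p" using False rp by (intro powr_mono) auto
        then show ?thesis using nn[rule_format, of x] by simp
      qed
      then have "(\<integral>\<^sup>+x. ennreal (\<rho> x powr r) \<partial>lborel) \<le> (\<integral>\<^sup>+x. ennreal (\<rho> x) + ennreal (norm (\<rho> x) powr enn2real p) \<partial>lborel)"
        using nn by (intro nn_integral_mono) (simp add: ennreal_plus[symmetric] ennreal_leI del: ennreal_plus)
      also have "\<dots> = 1 + (\<integral>\<^sup>+x. ennreal (norm (\<rho> x) powr enn2real p) \<partial>lborel)"
        by (subst nn_integral_add) (auto simp: i1)
      also have "\<dots> \<le> 1 + ennreal (B powr enn2real p)"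
        by (intro add_left_mono Lp_norm_le_imp_nn_integral_le[OF False pq(1) ip B])
      also have "\<dots> = ennreal (1 + B powr enn2real p)" by simp
      finally show "(\<integral>\<^sup>+x. ennreal (\<rho> x powr r) \<partial>lborel) \<le> ennreal (1 + B powr enn2real p)" .
    qed simp
  next
    case True
    show ?thesis unfolding r_def[symmetric]
    proof (intro exI[of _ "B powr (r - 1)"] conjI allI impI)
      fix \<rho> :: "'a \<Rightarrow> real"
      assume [measurable]: "\<rho> \<in> borel_measurable borel" and nn: "\<forall>x. 0 \<le> \<rho> x"
        and i1: "(\<integral>\<^sup>+x. ennreal (\<rho> x) \<partial>lborel) = 1" and ip: "Lp_norm lborel p \<rho> \<le> ennreal B"
      have "AE x in lborel. ennreal (norm (\<rho> x)) \<le> ennreal B"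
        using esssup_AE[where M=lborel and f="\<lambda>x. ennreal (norm (\<rho> x))"] ip unfolding True Lp_norm_top by (auto elim!: eventually_mono)
      \<comment> \<open>All but one factor of \<rho> are estimated by \<open>B\<close>; the
        remaining factor has integral 1.\<close>
      then have "AE x in lborel. ennreal (\<rho> x powr r) \<le> ennreal (B powr (r - 1)) * ennreal (\<rho> x)"
      proof eventually_elim
        case (elim x)
        then have "\<rho> x \<le> B" using nn B by simp
        then have "\<rho> x powr (r - 1) * \<rho> x \<le> B powr (r - 1) * \<rho> x" using nn r by (intro mult_right_mono powr_mono2) auto
        moreover have "\<rho> x powr (r - 1) * \<rho> x = \<rho> x powr r"
          using nn[rule_format, of x] by (cases "\<rho> x = 0") (auto simp: powr_mult_base mult.commute)
        ultimately show ?case using nn by (simp add: ennreal_mult[symmetric] ennreal_leI)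
      qed
      then have "(\<integral>\<^sup>+x. ennreal (\<rho> x powr r) \<partial>lborel) \<le> (\<integral>\<^sup>+x. ennreal (B powr (r - 1)) * ennreal (\<rho> x) \<partial>lborel)"
        by (rule nn_integral_mono_AE)
      also have "\<dots> = ennreal (B powr (r - 1))" by (subst nn_integral_cmult) (auto simp: i1)
      finally show "(\<integral>\<^sup>+x. ennreal (\<rho> x powr r) \<partial>lborel) \<le> ennreal (B powr (r - 1))" .
    qed simp
  qed
qed

section \<open>Mixtures, dual bounds and densities\<close>

lemma compresses_AE:
  fixes \<Psi> :: "'a::euclidean_space \<Rightarrow> 'b::euclidean_space"
  assumes c: "compresses \<Lambda> \<Psi>" and P: "AE y in lborel. P y"
  shows "AE x in lborel. P (\<Psi> x)"
proof -
  obtain N where N: "{y. \<not> P y} \<subseteq> N" "N \<in> null_sets lborel"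
    using P by (auto elim!: AE_E simp: null_sets_def)
  have "emeasure lborel (\<Psi> -` N) \<le> ennreal \<Lambda> * emeasure lborel N"
    using c N(2) unfolding compresses_def by auto
  then have "emeasure lborel (\<Psi> -` N) = 0" using N(2) by auto
  moreover have "\<Psi> -` N \<in> sets lborel" using measurable_sets[OF compresses_measurable[OF c], of N] N(2) by auto
  ultimately have "\<Psi> -` N \<in> null_sets lborel" by auto
  then show ?thesis using N(1) by (intro AE_I'[of "\<Psi> -` N"]) auto
qed

text \<open>A duality formulation of: \<open>\<mu>\<close> is a mixture of images of \<open>\<rho>\<close> under \<open>\<Lambda>\<close>-compressing maps.\<close>

definition mixture_bounded :: "ennreal \<Rightarrow> real \<Rightarrow> real \<Rightarrow> ('a::euclidean_space \<Rightarrow> real) \<Rightarrow> 'a measure \<Rightarrow> bool" where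
  "mixture_bounded p B \<Lambda> \<rho> \<mu> \<longleftrightarrow> prob_space \<mu> \<and> sets \<mu> = sets borel \<and> 0 \<le> \<Lambda> \<and>
     \<rho> \<in> borel_measurable borel \<and> (\<forall>x. 0 \<le> \<rho> x) \<and> (\<integral>\<^sup>+x. ennreal (\<rho> x) \<partial>lborel) = 1 \<and> Lp_norm lborel p \<rho> \<le> ennreal B \<and>
     (\<forall>f :: 'a \<Rightarrow> ennreal. f \<in> borel_measurable borel \<longrightarrow>
       (\<forall>C. (\<forall>\<Psi>. compresses \<Lambda> \<Psi> \<longrightarrow> (\<integral>\<^sup>+x. f (\<Psi> x) * ennreal (\<rho> x) \<partial>lborel) \<le> C) \<longrightarrow> (\<integral>\<^sup>+x. f x \<partial>\<mu>) \<le> C))"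

lemma mixture_boundedD:
  assumes "mixture_bounded p B \<Lambda> \<rho> \<mu>" "f \<in> borel_measurable borel"
    and "\<And>\<Psi>. compresses \<Lambda> \<Psi> \<Longrightarrow> (\<integral>\<^sup>+x. f (\<Psi> x) * ennreal (\<rho> x) \<partial>lborel) \<le> C"
  shows "(\<integral>\<^sup>+x. f x \<partial>\<mu>) \<le> C"
  using assms unfolding mixture_bounded_def by blast

text \<open>Hoelder's inequality in the form of Young's inequality for a normalised f. Along a
  compressing map the integral of f^q grows by at most the factor \<open>\<Lambda>\<close>, while
  \<rho> is bounded in the conjugate power. \<open>K\<close> depends on \<rho> only through
  \<open>B\<close>, hence is uniform over all laws that occur.\<close>

lemma mixture_bounded_dual_bounded:
  fixes p q :: ennreal
  assumes pq: "1 < p" "1 < q" "1 / p + 1 / q < 1" and B: "0 \<le> B" and L: "0 \<le> \<Lambda>"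
  shows "\<exists>K\<ge>0. \<forall>\<rho> (\<mu> :: 'a::euclidean_space measure). mixture_bounded p B \<Lambda> \<rho> \<mu> \<longrightarrow> dual_bounded q K \<mu>"
proof (cases "q = \<infinity>")
  case True
  show ?thesis
  proof (intro exI[of _ 1] conjI allI impI)
    fix \<rho> and \<mu> :: "'a measure" assume m: "mixture_bounded p B \<Lambda> \<rho> \<mu>"
    then have [measurable]: "\<rho> \<in> borel_measurable borel" and i1: "(\<integral>\<^sup>+x. ennreal (\<rho> x) \<partial>lborel) = 1" by (auto simp: mixture_bounded_def)
    show "dual_bounded q 1 \<mu>"
      unfolding dual_bounded_def
    proof (intro conjI allI impI)
      fix f :: "'a \<Rightarrow> real" assume [measurable]: "f \<in> borel_measurable borel" and nn: "\<forall>x. 0 \<le> f x"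
      let ?J = "esssup lborel (\<lambda>x. ennreal (norm (f x)))"
      have J: "AE x in lborel. ennreal (f x) \<le> ?J" using esssup_AE[where M=lborel and f="\<lambda>x. ennreal (norm (f x))"] nn by simp
      \<comment> \<open>A compressing map pulls null sets back to null sets, so the essential bound
        on f survives the composition; \<rho> has mass 1.\<close>
      have "(\<integral>\<^sup>+x. ennreal (f x) \<partial>\<mu>) \<le> ?J"
      proof (rule mixture_boundedD[OF m])
        fix \<Psi> :: "'a \<Rightarrow> 'a" assume c: "compresses \<Lambda> \<Psi>"
        have "(\<integral>\<^sup>+x. ennreal (f (\<Psi> x)) * ennreal (\<rho> x) \<partial>lborel) \<le> (\<integral>\<^sup>+x. ?J * ennreal (\<rho> x) \<partial>lborel)"
          using compresses_AE[OF c J] by (intro nn_integral_mono_AE) (auto elim!: eventually_mono intro!: mult_right_mono)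
        also have "\<dots> = ?J" by (subst nn_integral_cmult) (auto simp: i1)
        finally show "(\<integral>\<^sup>+x. ennreal (f (\<Psi> x)) * ennreal (\<rho> x) \<partial>lborel) \<le> ?J" .
      qed measurable
      then show "(\<integral>\<^sup>+x. ennreal (f x) \<partial>\<mu>) \<le> ennreal 1 * Lp_norm lborel q f" unfolding True Lp_norm_top by simp
    qed (use m in \<open>auto simp: mixture_bounded_def\<close>)
  qed simp
next
  case False
  let ?Q = "enn2real q" let ?r = "?Q / (?Q - 1)"
  have Q: "1 < ?Q" using pq(2) False by (cases q) auto
  obtain A where A: "0 \<le> A" and rb: "\<And>\<rho> :: 'a \<Rightarrow> real. \<rho> \<in> borel_measurable borel \<Longrightarrow> (\<forall>x. 0 \<le> \<rho> x) \<Longrightarrow>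
    (\<integral>\<^sup>+x. ennreal (\<rho> x) \<partial>lborel) = 1 \<Longrightarrow> Lp_norm lborel p \<rho> \<le> ennreal B \<Longrightarrow>
    (\<integral>\<^sup>+x. ennreal (\<rho> x powr ?r) \<partial>lborel) \<le> ennreal A"
    using density_conjugate_power_bound[OF pq False B, where 'a='a] by blast
  \<comment> \<open>\<open>\<Lambda>\<close> and \<open>A\<close> stem from the two terms of Young's
    inequality; the summand 1 makes the constant positive, since \<open>e\<close> is divided by it
    below.\<close>
  let ?K = "1 + \<Lambda> + A"
  show ?thesis
  proof (intro exI[of _ ?K] conjI allI impI)
    show "0 \<le> ?K" using A L by simp
    fix \<rho> and \<mu> :: "'a measure" assume m: "mixture_bounded p B \<Lambda> \<rho> \<mu>"
    then have [measurable]: "\<rho> \<in> borel_measurable borel" and nr: "\<And>x. 0 \<le> \<rho> x"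
      and ir: "(\<integral>\<^sup>+x. ennreal (\<rho> x powr ?r) \<partial>lborel) \<le> ennreal A"
      using rb[of \<rho>] by (auto simp: mixture_bounded_def)
    show "dual_bounded q ?K \<mu>"
      unfolding dual_bounded_def
    proof (intro conjI allI impI)
      fix f :: "'a \<Rightarrow> real" assume [measurable]: "f \<in> borel_measurable borel" and nn: "\<forall>x. 0 \<le> f x"
      show "(\<integral>\<^sup>+x. ennreal (f x) \<partial>\<mu>) \<le> ennreal ?K * Lp_norm lborel q f"
      proof (cases "Lp_norm lborel q f = \<infinity>")
        case True
        then show ?thesis using A L by (simp add: ennreal_mult_top)
      next
        case norm: False
        then obtain J where J: "Lp_norm lborel q f = ennreal J" "0 \<le> J" by (cases "Lp_norm lborel q f") auto
        have Iq: "(\<integral>\<^sup>+x. ennreal (f x powr ?Q) \<partial>lborel) \<le> ennreal (J powr ?Q)"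
          using Lp_norm_le_imp_nn_integral_le[OF False pq(2), of lborel f J] J nn by simp
        have step: "(\<integral>\<^sup>+x. ennreal (f x) \<partial>\<mu>) \<le> ennreal ((J + e) * ?K)" if e: "0 < e" for e
        proof (rule mixture_boundedD[OF m])
          fix \<Psi> :: "'a \<Rightarrow> 'a" assume c: "compresses \<Lambda> \<Psi>"
          have [measurable]: "\<Psi> \<in> borel_measurable borel" by (rule compresses_measurable[OF c])
          \<comment> \<open>Normalises f to norm at most one; the summand \<open>e\<close> covers
            the case \<open>J = 0\<close>.\<close>
          define k where "k = 1 / (J + e)"
          have k: "0 < k" using J e by (simp add: k_def)
          have kJ: "k powr ?Q * J powr ?Q \<le> 1"
          proof -
            have "k powr ?Q * J powr ?Q = (k * J) powr ?Q" using k J by (simp add: powr_mult)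
            also have "\<dots> \<le> 1 powr ?Q" using k J e Q by (intro powr_mono2) (auto simp: k_def)
            finally show ?thesis by simp
          qed
          have pt: "ennreal (f (\<Psi> x)) * ennreal (\<rho> x) \<le> ennreal (J + e) * (ennreal (k powr ?Q) * ennreal (f (\<Psi> x) powr ?Q) + ennreal (\<rho> x powr ?r))" for x
          proof -
            have "(k * f (\<Psi> x)) * \<rho> x \<le> (k * f (\<Psi> x)) powr ?Q + \<rho> x powr ?r"
              using k nn nr Q by (intro mult_le_powr_add_powr) auto
            then have "(J + e) * ((k * f (\<Psi> x)) * \<rho> x) \<le> (J + e) * (k powr ?Q * f (\<Psi> x) powr ?Q + \<rho> x powr ?r)"
              using J e k nn by (intro mult_left_mono) (auto simp: powr_mult)
            moreover have "(J + e) * ((k * f (\<Psi> x)) * \<rho> x) = f (\<Psi> x) * \<rho> x" using J e by (simp add: k_def)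
            ultimately have "ennreal (f (\<Psi> x) * \<rho> x) \<le> ennreal ((J + e) * (k powr ?Q * f (\<Psi> x) powr ?Q + \<rho> x powr ?r))"
              by (intro ennreal_leI) simp
            then show ?thesis using nn nr J e k by (simp add: ennreal_mult)
          qed
          have "(\<integral>\<^sup>+x. ennreal (f (\<Psi> x)) * ennreal (\<rho> x) \<partial>lborel)
             \<le> (\<integral>\<^sup>+x. ennreal (J + e) * (ennreal (k powr ?Q) * ennreal (f (\<Psi> x) powr ?Q) + ennreal (\<rho> x powr ?r)) \<partial>lborel)"
            by (intro nn_integral_mono pt)
          also have "\<dots> = ennreal (J + e) * (ennreal (k powr ?Q) * (\<integral>\<^sup>+x. ennreal (f (\<Psi> x) powr ?Q) \<partial>lborel) + (\<integral>\<^sup>+x. ennreal (\<rho> x powr ?r) \<partial>lborel))"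
            by (subst nn_integral_cmult, measurable, subst nn_integral_add, measurable, subst nn_integral_cmult) auto
          also have "\<dots> \<le> ennreal (J + e) * (ennreal (k powr ?Q) * (ennreal \<Lambda> * ennreal (J powr ?Q)) + ennreal A)"
          proof (intro mult_left_mono add_mono ir)
            have "(\<integral>\<^sup>+x. ennreal (f (\<Psi> x) powr ?Q) \<partial>lborel) \<le> ennreal \<Lambda> * (\<integral>\<^sup>+x. ennreal (f x powr ?Q) \<partial>lborel)"
              by (rule compresses_nn_integral[OF c, of "\<lambda>x. ennreal (f x powr ?Q)"]) measurable
            also have "\<dots> \<le> ennreal \<Lambda> * ennreal (J powr ?Q)" by (intro mult_left_mono Iq) simp
            finally show "(\<integral>\<^sup>+x. ennreal (f (\<Psi> x) powr ?Q) \<partial>lborel) \<le> ennreal \<Lambda> * ennreal (J powr ?Q)" .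
          qed auto
          also have "\<dots> = ennreal ((J + e) * (\<Lambda> * (k powr ?Q * J powr ?Q) + A))"
            using J e L A by (simp add: ennreal_mult mult_ac)
          also have "\<dots> \<le> ennreal ((J + e) * ?K)"
          proof (intro ennreal_leI mult_left_mono)
            have "\<Lambda> * (k powr ?Q * J powr ?Q) \<le> \<Lambda> * 1" using kJ L by (intro mult_left_mono)
            then show "\<Lambda> * (k powr ?Q * J powr ?Q) + A \<le> ?K" by simp
          qed (use J e in simp)
          finally show "(\<integral>\<^sup>+x. ennreal (f (\<Psi> x)) * ennreal (\<rho> x) \<partial>lborel) \<le> ennreal ((J + e) * ?K)" .
        qed measurable
        have "(\<integral>\<^sup>+x. ennreal (f x) \<partial>\<mu>) \<le> ennreal (J * ?K)"
        proof (rule ennreal_le_epsilon)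
          fix e :: real assume e: "0 < e"
          have "(\<integral>\<^sup>+x. ennreal (f x) \<partial>\<mu>) \<le> ennreal ((J + e / ?K) * ?K)" using e A L by (intro step) (simp add: add_pos_nonneg)
          also have "(J + e / ?K) * ?K = J * ?K + e" using A L by (simp add: field_simps add_pos_nonneg)
          also have "ennreal \<dots> = ennreal (J * ?K) + ennreal e" using J A L e by (intro ennreal_plus) auto
          finally show "(\<integral>\<^sup>+x. ennreal (f x) \<partial>\<mu>) \<le> ennreal (J * ?K) + ennreal e" .
        qed
        also have "ennreal (J * ?K) = ennreal ?K * ennreal J" using J A L by (simp add: ennreal_mult mult.commute)
        finally show ?thesis using J by simp
      qed
    qed (use m in \<open>auto simp: mixture_bounded_def\<close>)
  qed
qed

lemma mixture_boundedI:
  fixes \<Psi> :: "'w \<Rightarrow> 'a::euclidean_space \<Rightarrow> 'a" and \<mu> :: "'a measure"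
  assumes "prob_space \<mu>" "sets \<mu> = sets borel" "0 \<le> \<Lambda>" "prob_space \<nu>"
    and "\<rho> \<in> borel_measurable borel" "\<And>x. 0 \<le> \<rho> x" "(\<integral>\<^sup>+x. ennreal (\<rho> x) \<partial>lborel) = 1" "Lp_norm lborel p \<rho> \<le> ennreal B"
    and c: "\<And>w. w \<in> space \<nu> \<Longrightarrow> compresses \<Lambda> (\<Psi> w)"
    and eq: "\<And>f. f \<in> borel_measurable borel \<Longrightarrow>
      (\<integral>\<^sup>+x. f x \<partial>\<mu>) = (\<integral>\<^sup>+w. (\<integral>\<^sup>+x. f (\<Psi> w x) * ennreal (\<rho> x) \<partial>lborel) \<partial>\<nu>)"
  shows "mixture_bounded p B \<Lambda> \<rho> \<mu>"
  unfolding mixture_bounded_def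
proof (intro conjI allI impI assms(1,2,3,5,6,7,8))
  fix f :: "'a \<Rightarrow> ennreal" and C assume f: "f \<in> borel_measurable borel"
    and C: "\<forall>\<Psi>. compresses \<Lambda> \<Psi> \<longrightarrow> (\<integral>\<^sup>+x. f (\<Psi> x) * ennreal (\<rho> x) \<partial>lborel) \<le> C"
  have "(\<integral>\<^sup>+x. f x \<partial>\<mu>) \<le> (\<integral>\<^sup>+w. C \<partial>\<nu>)"
    unfolding eq[OF f] using C c by (intro nn_integral_mono) blast
  also have "\<dots> = C" using assms(4) by (simp add: prob_space.emeasure_space_1)
  finally show "(\<integral>\<^sup>+x. f x \<partial>\<mu>) \<le> C" .
qed

lemma density_enn2real_RN_deriv:
  fixes \<mu> :: "'a::euclidean_space measure"
  assumes "prob_space \<mu>" "sets \<mu> = sets borel" "absolutely_continuous lborel \<mu>"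
  shows "density lborel (\<lambda>x. ennreal (enn2real (RN_deriv lborel \<mu> x))) = \<mu>"
proof -
  interpret prob_space \<mu> by fact
  have "AE x in lborel. RN_deriv lborel \<mu> x \<noteq> \<infinity>"
    using sigma_finite_measure.RN_deriv_finite[OF sigma_finite_lborel sigma_finite_measure_axioms assms(3)] assms(2) by simp
  then have "density lborel (\<lambda>x. ennreal (enn2real (RN_deriv lborel \<mu> x))) = density lborel (RN_deriv lborel \<mu>)"
    by (intro density_cong) (auto elim!: eventually_mono simp: less_top)
  also have "\<dots> = \<mu>" using sigma_finite_measure.density_RN_deriv[OF sigma_finite_lborel assms(3)] assms(2) by simp
  finally show ?thesis .
qed

text \<open>The trivial mixture, with the identity as its only map and the density itself as
  starting density. Through it the solutions of the uniqueness class obtain dual bounds in the same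
  way as the Euler scheme.\<close>

lemma density_Lp_norm_mixture_bounded:
  fixes \<mu> :: "'a::euclidean_space measure"
  assumes "prob_space \<mu>" "sets \<mu> = sets borel" "density_Lp_norm p \<mu> \<le> ennreal B"
  shows "mixture_bounded p B 1 (\<lambda>x. enn2real (RN_deriv lborel \<mu> x)) \<mu>"
proof -
  interpret prob_space \<mu> by fact
  have ac: "absolutely_continuous lborel \<mu>" and n: "Lp_norm lborel p (\<lambda>x. enn2real (RN_deriv lborel \<mu> x)) \<le> ennreal B"
    using assms(3) by (auto simp: density_Lp_norm_def top_unique split: if_splits)
  note d = density_enn2real_RN_deriv[OF assms(1,2) ac]
  have m: "(\<lambda>x. enn2real (RN_deriv lborel \<mu> x)) \<in> borel_measurable borel" by simp
  have s: "space \<mu> = UNIV" using sets_eq_imp_space_eq[OF assms(2)] by simp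
  have f: "(\<integral>\<^sup>+x. f x \<partial>\<mu>) = (\<integral>\<^sup>+x. f x * ennreal (enn2real (RN_deriv lborel \<mu> x)) \<partial>lborel)"
    if "f \<in> borel_measurable borel" for f :: "'a \<Rightarrow> ennreal"
    by (subst d[symmetric], subst nn_integral_density) (use that m in \<open>simp_all add: mult.commute\<close>)
  show ?thesis
  proof (rule mixture_boundedI[where \<nu>="return (count_space UNIV) ()" and \<Psi>="\<lambda>_ x. x"])
    show "(\<integral>\<^sup>+x. ennreal (enn2real (RN_deriv lborel \<mu> x)) \<partial>lborel) = 1"
      using f[of "\<lambda>_. 1"] emeasure_space_1 by simp
    show "prob_space (return (count_space UNIV) ())" by (rule prob_space_return) simp
  qed (use assms n f compresses_id in \<open>simp_all add: nn_integral_return\<close>)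
qed

lemma mixture_bounded_absolutely_continuous:
  assumes m: "mixture_bounded p B \<Lambda> \<rho> \<mu>"
  shows "absolutely_continuous lborel \<mu>"
  unfolding absolutely_continuous_def
proof
  fix N :: "'a set" assume N: "N \<in> null_sets lborel"
  have "(\<integral>\<^sup>+x. indicator N x \<partial>\<mu>) \<le> 0"
  proof (rule mixture_boundedD[OF m])
    fix \<Psi> :: "'a \<Rightarrow> 'a" assume c: "compresses \<Lambda> \<Psi>"
    have "AE x in lborel. \<Psi> x \<notin> N" by (rule compresses_AE[OF c AE_not_in[OF N]])
    then have "(\<integral>\<^sup>+x. indicator N (\<Psi> x) * ennreal (\<rho> x) \<partial>lborel) = (\<integral>\<^sup>+(x::'a). 0 \<partial>lborel)"
      by (intro nn_integral_cong_AE) (auto elim!: eventually_mono)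
    then show "(\<integral>\<^sup>+x. indicator N (\<Psi> x) * ennreal (\<rho> x) \<partial>lborel) \<le> 0" by simp
  qed (use N in auto)
  then show "N \<in> null_sets \<mu>" using N m by (auto simp: mixture_bounded_def null_sets_def)
qed

text \<open>The way back to an L^p bound. For p = \<infinity> a set where the density exceeds
  \<open>B * \<Lambda>\<close> would receive too much mass. For finite p the law is tested with the
  power p - 1 of its own truncated density; Young's inequality splits the result, and the part that
  contains the density again is absorbed on the left.\<close>

lemma mixture_bounded_density_Lp_norm:
  fixes \<mu> :: "'a::euclidean_space measure"
  assumes p: "1 < p" and B: "0 \<le> B"
  shows "\<exists>B'. \<forall>\<rho> (\<mu> :: 'a measure). mixture_bounded p B \<Lambda> \<rho> \<mu> \<longrightarrow> density_Lp_norm p \<mu> \<le> ennreal B'"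
proof (cases "p = \<infinity>")
  case True
  show ?thesis
  proof (intro exI[of _ "B * \<Lambda>"] allI impI)
    fix \<rho> and \<mu> :: "'a measure" assume m: "mixture_bounded p B \<Lambda> \<rho> \<mu>"
    note ac = mixture_bounded_absolutely_continuous[OF m]
    have L: "0 \<le> \<Lambda>" and nr: "\<And>x. 0 \<le> \<rho> x" and mr[measurable]: "\<rho> \<in> borel_measurable borel" and P: "prob_space \<mu>" "sets \<mu> = sets borel"
      using m by (auto simp: mixture_bounded_def)
    have nB: "esssup lborel (\<lambda>x. ennreal (norm (\<rho> x))) \<le> ennreal B"
      using m unfolding mixture_bounded_def True Lp_norm_top by blast
    define g where "g x = enn2real (RN_deriv lborel \<mu> x)" for x
    have mg[measurable]: "g \<in> borel_measurable borel" unfolding g_def by simp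
    have d: "density lborel (\<lambda>x. ennreal (g x)) = \<mu>" unfolding g_def by (rule density_enn2real_RN_deriv[OF P ac])
    have rB: "AE x in lborel. ennreal (\<rho> x) \<le> ennreal B"
      using esssup_AE[where M=lborel and f="\<lambda>x. ennreal (norm (\<rho> x))"] nB nr by (auto elim!: eventually_mono)
    have le: "emeasure \<mu> S \<le> ennreal (B * \<Lambda>) * emeasure lborel S" if S: "S \<in> sets borel" for S
    proof -
      have [measurable]: "S \<in> sets borel" by fact
      have "(\<integral>\<^sup>+x. indicator S x \<partial>\<mu>) \<le> ennreal (B * \<Lambda>) * emeasure lborel S"
      proof (rule mixture_boundedD[OF m])
        fix \<Psi> :: "'a \<Rightarrow> 'a" assume c: "compresses \<Lambda> \<Psi>"
        have [measurable]: "\<Psi> \<in> borel_measurable borel" by (rule compresses_measurable[OF c])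
        have "(\<integral>\<^sup>+x. indicator S (\<Psi> x) * ennreal (\<rho> x) \<partial>lborel) \<le> (\<integral>\<^sup>+x. indicator S (\<Psi> x) * ennreal B \<partial>lborel)"
          using rB by (intro nn_integral_mono_AE) (auto elim!: eventually_mono intro!: mult_left_mono)
        also have "\<dots> = (\<integral>\<^sup>+x. indicator S (\<Psi> x) \<partial>lborel) * ennreal B" by (rule nn_integral_multc) measurable
        also have "\<dots> \<le> (ennreal \<Lambda> * (\<integral>\<^sup>+x. indicator S x \<partial>lborel)) * ennreal B"
          by (intro mult_right_mono compresses_nn_integral[OF c]) auto
        also have "\<dots> = ennreal (B * \<Lambda>) * emeasure lborel S" using S B L by (simp add: ennreal_mult mult_ac)
        finally show "(\<integral>\<^sup>+x. indicator S (\<Psi> x) * ennreal (\<rho> x) \<partial>lborel) \<le> ennreal (B * \<Lambda>) * emeasure lborel S" .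
      qed measurable
      then show ?thesis using S P by simp
    qed
    \<comment> \<open>Inside a ball the set where \<open>g\<close> exceeds
      \<open>B * \<Lambda>\<close> has finite volume, so the two integrals over it may be
      subtracted.\<close>
    have "AE x in lborel. \<forall>n::nat. x \<in> ball 0 (real n) \<longrightarrow> g x \<le> B * \<Lambda>"
      unfolding AE_all_countable
    proof
      fix n :: nat
      define S where "S = {x \<in> ball 0 (real n). B * \<Lambda> < g x}"
      have S[measurable]: "S \<in> sets borel" unfolding S_def by measurable
      have fin: "emeasure lborel S < \<infinity>" 
        unfolding S_def by (intro emeasure_bounded_finite bounded_subset[OF bounded_ball[of 0 "real n"]]) auto
      have "(\<integral>\<^sup>+x. (ennreal (g x) - ennreal (B * \<Lambda>)) * indicator S x \<partial>lborel)
         = (\<integral>\<^sup>+x. ennreal (g x) * indicator S x - ennreal (B * \<Lambda>) * indicator S x \<partial>lborel)"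
        by (intro nn_integral_cong) (auto simp: indicator_def)
      also have "\<dots> = (\<integral>\<^sup>+x. ennreal (g x) * indicator S x \<partial>lborel) - (\<integral>\<^sup>+x. ennreal (B * \<Lambda>) * indicator S x \<partial>lborel)"
      proof (rule nn_integral_diff)
        show "(\<integral>\<^sup>+x. ennreal (B * \<Lambda>) * indicator S x \<partial>lborel) \<noteq> \<infinity>"
          using fin S by (simp add: nn_integral_cmult_indicator ennreal_mult_eq_top_iff)
        show "AE x in lborel. ennreal (B * \<Lambda>) * indicator S x \<le> ennreal (g x) * indicator S x"
          by (auto simp: S_def indicator_def intro!: AE_I2 ennreal_leI)
      qed measurable
      also have "(\<integral>\<^sup>+x. ennreal (g x) * indicator S x \<partial>lborel) = emeasure \<mu> S"
        by (subst d[symmetric], subst emeasure_density) auto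
      also have "(\<integral>\<^sup>+x. ennreal (B * \<Lambda>) * indicator S x \<partial>lborel) = ennreal (B * \<Lambda>) * emeasure lborel S"
        using S by (simp add: nn_integral_cmult_indicator)
      also have "emeasure \<mu> S - ennreal (B * \<Lambda>) * emeasure lborel S = 0" using le[OF S] 
        by (intro diff_eq_0_ennreal) (simp add: less_top[symmetric] finite_measure.emeasure_finite[OF prob_space.finite_measure[OF P(1)]])
      finally have "AE x in lborel. (ennreal (g x) - ennreal (B * \<Lambda>)) * indicator S x = 0"
        by (subst (asm) nn_integral_0_iff_AE) auto
      then show "AE x in lborel. x \<in> ball 0 (real n) \<longrightarrow> g x \<le> B * \<Lambda>"
      proof eventually_elim
        case (elim x)
        show ?case
        proof (intro impI, rule ccontr)
          assume x: "x \<in> ball 0 (real n)" "\<not> g x \<le> B * \<Lambda>"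
          then have "x \<in> S" by (simp add: S_def)
          then have "ennreal (g x) - ennreal (B * \<Lambda>) = 0" using elim by simp
          then have "ennreal (g x) \<le> ennreal (B * \<Lambda>)" by (simp add: diff_eq_0_iff_ennreal)
          then show False using x B L by (simp add: ennreal_le_iff)
        qed
      qed
    qed
    then have "AE x in lborel. ennreal (norm (g x)) \<le> ennreal (B * \<Lambda>)"
    proof eventually_elim
      case (elim x)
      obtain n :: nat where "norm x < real n" using reals_Archimedean2 by blast
      then have "g x \<le> B * \<Lambda>" using elim[rule_format, of n] by simp
      then show ?case by (simp add: g_def ennreal_leI)
    qed
    then have "Lp_norm lborel p g \<le> ennreal (B * \<Lambda>)" unfolding True Lp_norm_top by (intro esssup_I) measurable
    then show "density_Lp_norm p \<mu> \<le> ennreal (B * \<Lambda>)" using ac unfolding density_Lp_norm_def g_def[abs_def] by simp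
  qed
next
  case False
  define P where "P = enn2real p"
  have P: "1 < P" unfolding P_def using p False by (cases p) auto
  define P' where "P' = P / (P - 1)"
  have P': "1 < P'" "P' / (P' - 1) = P" "(P - 1) * P' = P" "P' = 1 + 1 / (P - 1)" using P by (auto simp: P'_def field_simps)
  define L where "L = max 1 \<Lambda>"
  have L: "1 \<le> L" "\<Lambda> \<le> L" by (auto simp: L_def)
  \<comment> \<open>Chosen such that \<open>L * c powr P'\<close> equals \<open>c / 2\<close>, as
    \<open>cP'\<close> verifies: the term that returns is then half of the left-hand side.\<close>
  define c where "c = (2 * L) powr (- (P - 1))"
  have c: "0 < c" using L by (simp add: c_def)
  have cP': "L * c powr P' = c / 2"
  proof -
    have "c powr P' = c * c powr (1 / (P - 1))" using c by (simp add: P'(4) powr_add)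
    also have "c powr (1 / (P - 1)) = (2 * L) powr (- 1)"
    proof -
      have "- (P - 1) * (1 / (P - 1)) = - 1" using P by (simp add: field_simps)
      then show ?thesis by (simp only: c_def powr_powr)
    qed
    also have "\<dots> = 1 / (2 * L)" using L by (simp add: powr_minus_divide)
    finally show ?thesis using L by simp
  qed
  let ?D = "2 * B powr P / c"
  show ?thesis
  proof (intro exI[of _ "?D powr (1 / enn2real p)"] allI impI)
    fix \<rho> and \<mu> :: "'a measure" assume m: "mixture_bounded p B \<Lambda> \<rho> \<mu>"
    note ac = mixture_bounded_absolutely_continuous[OF m]
    have nr: "\<And>x. 0 \<le> \<rho> x" and mr[measurable]: "\<rho> \<in> borel_measurable borel" and pr: "prob_space \<mu>" "sets \<mu> = sets borel"
      and nB: "Lp_norm lborel p \<rho> \<le> ennreal B"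
      using m by (auto simp: mixture_bounded_def)
    define g where "g x = enn2real (RN_deriv lborel \<mu> x)" for x
    have mg[measurable]: "g \<in> borel_measurable borel" unfolding g_def by simp
    have g0: "0 \<le> g x" for x by (simp add: g_def)
    have d: "density lborel (\<lambda>x. ennreal (g x)) = \<mu>" unfolding g_def by (rule density_enn2real_RN_deriv[OF pr ac])
    have rP: "(\<integral>\<^sup>+x. ennreal (\<rho> x powr P) \<partial>lborel) \<le> ennreal (B powr P)"
      using Lp_norm_le_imp_nn_integral_le[OF False p nB B] nr by (simp add: P_def)
    \<comment> \<open>Truncation in height and in space makes the integral \<open>M\<close> finite,
      without which it could not be absorbed; Fatou's lemma removes the truncation in the
      end.\<close>
    define h where "h n x = min (g x) (real n) powr (P - 1) * indicator (ball 0 (real n)) x" for n x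
    define m' where "m' n x = min (g x) (real n) powr P * indicator (ball 0 (real n)) x" for n x
    have [measurable]: "ball (0::'a) (real n) \<in> sets borel" for n by simp
    have [measurable]: "h n \<in> borel_measurable borel" "m' n \<in> borel_measurable borel" for n unfolding h_def m'_def by measurable
    have h0: "0 \<le> h n x" and m0: "0 \<le> m' n x" for n x by (auto simp: h_def m'_def)
    have hP: "h n x powr P' = m' n x" for n x
      using g0[of x] P'(3) P by (cases "x \<in> ball 0 (real n)") (auto simp: h_def m'_def powr_powr)
    have mh: "m' n x \<le> h n x * g x" for n x
    proof (cases "x \<in> ball 0 (real n)")
      case True
      have "min (g x) (real n) powr P = min (g x) (real n) powr (P - 1) * min (g x) (real n)"
        using g0[of x] by (cases "min (g x) (real n) = 0") (auto simp: powr_mult_base mult.commute)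
      also have "\<dots> \<le> min (g x) (real n) powr (P - 1) * g x" by (intro mult_left_mono) auto
      finally show ?thesis using True by (simp add: h_def m'_def)
    qed (simp add: h_def m'_def)
    have Mle: "(\<integral>\<^sup>+x. ennreal (m' n x) \<partial>lborel) \<le> ennreal ?D" for n
    proof -
      let ?M = "\<integral>\<^sup>+x. ennreal (m' n x) \<partial>lborel"
      have "?M \<le> (\<integral>\<^sup>+x. ennreal (real n powr P) * indicator (ball (0::'a) (real n)) x \<partial>lborel)"
        using g0 P by (intro nn_integral_mono) (auto simp: m'_def indicator_def intro!: ennreal_leI powr_mono2)
      also have "\<dots> < \<infinity>"
        using emeasure_bounded_finite[of "ball (0::'a) (real n)"] by (simp add: nn_integral_cmult_indicator ennreal_mult_less_top)
      finally obtain M where M: "?M = ennreal M" "0 \<le> M" by (cases ?M) auto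
      have "ennreal c * ?M = (\<integral>\<^sup>+x. ennreal (c * m' n x) \<partial>lborel)"
        using c m0 by (subst nn_integral_cmult[symmetric]) (auto simp: ennreal_mult)
      also have "\<dots> \<le> (\<integral>\<^sup>+x. ennreal (g x) * ennreal (c * h n x) \<partial>lborel)"
      proof (intro nn_integral_mono)
        fix x
        have "c * m' n x \<le> c * (h n x * g x)" using c by (intro mult_left_mono mh) simp
        then have "ennreal (c * m' n x) \<le> ennreal (g x * (c * h n x))" by (intro ennreal_leI) (simp add: mult_ac)
        then show "ennreal (c * m' n x) \<le> ennreal (g x) * ennreal (c * h n x)" using g0 h0 c by (simp add: ennreal_mult)
      qed
      also have "\<dots> = (\<integral>\<^sup>+x. ennreal (c * h n x) \<partial>\<mu>)"
        by (subst d[symmetric], subst nn_integral_density) auto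
      also have "\<dots> \<le> ennreal (c / 2 * M + B powr P)"
      proof (rule mixture_boundedD[OF m])
        fix \<Psi> :: "'a \<Rightarrow> 'a" assume co: "compresses \<Lambda> \<Psi>"
        have [measurable]: "\<Psi> \<in> borel_measurable borel" by (rule compresses_measurable[OF co])
        have "(\<integral>\<^sup>+x. ennreal (c * h n (\<Psi> x)) * ennreal (\<rho> x) \<partial>lborel)
            \<le> (\<integral>\<^sup>+x. ennreal (c powr P') * ennreal (m' n (\<Psi> x)) + ennreal (\<rho> x powr P) \<partial>lborel)"
        proof (intro nn_integral_mono)
          fix x
          have "c * h n (\<Psi> x) * \<rho> x \<le> (c * h n (\<Psi> x)) powr P' + \<rho> x powr P"
            using mult_le_powr_add_powr[of "c * h n (\<Psi> x)" "\<rho> x" P'] c h0 nr P' by simp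
          also have "(c * h n (\<Psi> x)) powr P' = c powr P' * m' n (\<Psi> x)" using c h0 by (simp add: powr_mult hP)
          finally have "ennreal (c * h n (\<Psi> x) * \<rho> x) \<le> ennreal (c powr P' * m' n (\<Psi> x) + \<rho> x powr P)" by (rule ennreal_leI)
          then show "ennreal (c * h n (\<Psi> x)) * ennreal (\<rho> x) \<le> ennreal (c powr P') * ennreal (m' n (\<Psi> x)) + ennreal (\<rho> x powr P)"
            using c h0 nr m0 by (simp add: ennreal_mult)
        qed
        also have "\<dots> = ennreal (c powr P') * (\<integral>\<^sup>+x. ennreal (m' n (\<Psi> x)) \<partial>lborel) + (\<integral>\<^sup>+x. ennreal (\<rho> x powr P) \<partial>lborel)"
          by (subst nn_integral_add, measurable, subst nn_integral_cmult) auto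
        also have "\<dots> \<le> ennreal (c powr P') * (ennreal \<Lambda> * ?M) + ennreal (B powr P)"
          by (intro add_mono mult_left_mono rP compresses_nn_integral[OF co, of "\<lambda>x. ennreal (m' n x)"]) auto
        also have "\<dots> \<le> ennreal (c powr P') * (ennreal L * ?M) + ennreal (B powr P)"
          using L by (intro add_mono mult_left_mono mult_right_mono ennreal_leI) auto
        also have "\<dots> = ennreal (L * c powr P' * M + B powr P)" using M L by (simp add: ennreal_mult mult_ac)
        also have "L * c powr P' * M + B powr P = c / 2 * M + B powr P" unfolding cP' ..
        finally show "(\<integral>\<^sup>+x. ennreal (c * h n (\<Psi> x)) * ennreal (\<rho> x) \<partial>lborel) \<le> ennreal (c / 2 * M + B powr P)" .
      qed measurable
      finally have "ennreal (c * M) \<le> ennreal (c / 2 * M + B powr P)" using M c by (simp add: ennreal_mult)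
      then have "c * M \<le> c / 2 * M + B powr P" using M c by (subst (asm) ennreal_le_iff) auto
      then have "M \<le> ?D" using c by (simp add: field_simps)
      then show ?thesis using M by (simp add: ennreal_leI)
    qed
    have "(\<integral>\<^sup>+x. ennreal (norm (g x) powr P) \<partial>lborel) \<le> (\<integral>\<^sup>+x. liminf (\<lambda>n. ennreal (m' n x)) \<partial>lborel)"
    proof (intro nn_integral_mono Liminf_bounded)
      fix x
      obtain N :: nat where N: "max (norm x) (g x) < real N" using reals_Archimedean2 by blast
      show "\<forall>\<^sub>F n in sequentially. ennreal (norm (g x) powr P) \<le> ennreal (m' n x)"
        using eventually_ge_at_top[of N]
      proof eventually_elim
        case (elim n)
        then have "real N \<le> real n" by simp
        then have "norm x < real n" "min (g x) (real n) = g x" using N by linarith+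
        then show ?case using g0 by (simp add: m'_def)
      qed
    qed
    also have "\<dots> \<le> liminf (\<lambda>n. \<integral>\<^sup>+x. ennreal (m' n x) \<partial>lborel)" by (rule nn_integral_liminf) measurable
    also have "\<dots> \<le> limsup (\<lambda>n. \<integral>\<^sup>+x. ennreal (m' n x) \<partial>lborel)" by (rule Liminf_le_Limsup) simp
    also have "\<dots> \<le> ennreal ?D" by (intro Limsup_bounded always_eventually allI Mle)
    finally have "Lp_norm lborel p g \<le> ennreal (?D powr (1 / enn2real p))"
      using c B by (intro Lp_norm_leI_nn_integral[OF False p]) (auto simp: P_def)
    then show "density_Lp_norm p \<mu> \<le> ennreal (?D powr (1 / enn2real p))" using ac unfolding density_Lp_norm_def g_def[abs_def] by simp
  qed
qed

section \<open>The mean-field drift\<close>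

text \<open>For fixed \<open>x\<close> and \<open>h\<close> the identity along the segment may fail
  on an \<open>N\<close>-null set. Integration over \<open>N\<close> erases this set, and Fubini
  moves the average inside the integral over \<theta>; the averaged identity holds for all
  \<open>x\<close> and \<open>h\<close>.\<close>

lemma integral_gradient_mixture:
  fixes u :: "'n \<Rightarrow> 'a::euclidean_space \<Rightarrow> 'b::euclidean_space" and g :: "'a \<Rightarrow> 'n \<Rightarrow> 'a \<Rightarrow> 'b"
  assumes N: "sigma_finite_measure N"
    and u[measurable]: "(\<lambda>(n, x). u n x) \<in> borel_measurable (N \<Otimes>\<^sub>M borel)"
    and g: "\<And>i. i \<in> Basis \<Longrightarrow> (\<lambda>(n, x). g i n x) \<in> borel_measurable (N \<Otimes>\<^sub>M borel)"
    and eq: "\<And>x h. AE n in N. u n (x + h) - u n x = (LINT \<theta>:{0..1}|lborel. (\<Sum>i\<in>Basis. (h \<bullet> i) *\<^sub>R g i n (x + \<theta> *\<^sub>R h)))"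
    and iu: "\<And>x. integrable N (\<lambda>n. u n x)"
    and C: "\<And>i x. i \<in> Basis \<Longrightarrow> (\<integral>\<^sup>+n. ennreal (norm (g i n x)) \<partial>N) \<le> ennreal C" "0 \<le> C"
  shows "integral_gradient (\<lambda>x. \<integral>n. u n x \<partial>N) (\<lambda>i x. \<integral>n. g i n x \<partial>N)"
    and "i \<in> Basis \<Longrightarrow> norm (\<integral>n. g i n x \<partial>N) \<le> C" and "i \<in> Basis \<Longrightarrow> integrable N (\<lambda>n. g i n x)"
proof -
  interpret N: sigma_finite_measure N by fact
  interpret P: pair_sigma_finite "lborel :: real measure" N
    by (intro pair_sigma_finite.intro sigma_finite_lborel N)
  have gm: "(\<lambda>n. g i n x) \<in> borel_measurable N" if "i \<in> Basis" for i x
    using measurable_compose[OF _ g[OF that], of "\<lambda>n. (n, x)" N] by simp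
  show ig: "integrable N (\<lambda>n. g i n x)" if "i \<in> Basis" for i x
  proof (rule integrableI_bounded[OF gm[OF that]])
    show "(\<integral>\<^sup>+n. ennreal (norm (g i n x)) \<partial>N) < \<infinity>" using C(1)[OF that, of x] by (rule le_less_trans) simp
  qed
  show "norm (\<integral>n. g i n x \<partial>N) \<le> C" if "i \<in> Basis" for i x
  proof -
    have "ennreal (norm (\<integral>n. g i n x \<partial>N)) \<le> (\<integral>\<^sup>+n. ennreal (norm (g i n x)) \<partial>N)" by (rule integral_norm_bound_ennreal[OF ig[OF that]])
    also have "\<dots> \<le> ennreal C" by (rule C(1)[OF that])
    finally show ?thesis using C(2) by simp
  qed
  show "integral_gradient (\<lambda>x. \<integral>n. u n x \<partial>N) (\<lambda>i x. \<integral>n. g i n x \<partial>N)"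
    unfolding integral_gradient_def
  proof (intro conjI ballI allI)
    show "(\<lambda>x. \<integral>n. g i n x \<partial>N) \<in> borel_measurable borel" if i: "i \<in> Basis" for i
    proof (rule N.borel_measurable_lebesgue_integral)
      show "(\<lambda>(x, n). g i n x) \<in> borel_measurable (borel \<Otimes>\<^sub>M N)"
        using measurable_compose[OF measurable_pair_swap' g[OF i]] by (simp add: case_prod_beta')
    qed
    fix x h
    define G where "G \<theta> n = (\<Sum>i\<in>Basis. (h \<bullet> i) *\<^sub>R g i n (x + \<theta> *\<^sub>R h))" for \<theta> n
    have Gm: "(\<lambda>(\<theta>, n). G \<theta> n) \<in> borel_measurable (borel \<Otimes>\<^sub>M N)"
      unfolding G_def case_prod_beta
    proof (intro borel_measurable_sum borel_measurable_scaleR borel_measurable_const)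
      fix i :: 'a assume i: "i \<in> Basis"
      have "(\<lambda>p. (snd p, x + fst p *\<^sub>R h)) \<in> (borel \<Otimes>\<^sub>M N) \<rightarrow>\<^sub>M (N \<Otimes>\<^sub>M borel)" by measurable
      from measurable_compose[OF this g[OF i]]
      show "(\<lambda>p. g i (snd p) (x + fst p *\<^sub>R h)) \<in> borel_measurable (borel \<Otimes>\<^sub>M N)" by simp
    qed
    let ?F = "\<lambda>(\<theta>, n). indicator {0..1::real} \<theta> *\<^sub>R G \<theta> n"
    have Fm: "?F \<in> borel_measurable (lborel \<Otimes>\<^sub>M N)"
    proof -
      have "(\<lambda>p. G (fst p) (snd p)) \<in> borel_measurable (lborel \<Otimes>\<^sub>M N)"
        using Gm by (simp add: case_prod_beta cong: measurable_cong_sets sets_pair_measure_cong)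
      moreover have "(\<lambda>p. indicator {0..1::real} (fst p)) \<in> borel_measurable (lborel \<Otimes>\<^sub>M N)" by measurable
      ultimately show ?thesis unfolding case_prod_beta by (intro borel_measurable_scaleR)
    qed
    have Gle: "(\<integral>\<^sup>+n. ennreal (norm (G \<theta> n)) \<partial>N) \<le> ennreal (\<Sum>i\<in>Basis. \<bar>h \<bullet> i\<bar> * C)" for \<theta>
    proof -
      have "(\<integral>\<^sup>+n. ennreal (norm (G \<theta> n)) \<partial>N) \<le> (\<integral>\<^sup>+n. (\<Sum>i\<in>Basis. ennreal \<bar>h \<bullet> i\<bar> * ennreal (norm (g i n (x + \<theta> *\<^sub>R h)))) \<partial>N)"
      proof (intro nn_integral_mono)
        fix n
        have "norm (G \<theta> n) \<le> (\<Sum>i\<in>Basis. norm ((h \<bullet> i) *\<^sub>R g i n (x + \<theta> *\<^sub>R h)))" unfolding G_def by (rule norm_sum)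
        then have "ennreal (norm (G \<theta> n)) \<le> ennreal (\<Sum>i\<in>Basis. \<bar>h \<bullet> i\<bar> * norm (g i n (x + \<theta> *\<^sub>R h)))" by (intro ennreal_leI) simp
        also have "\<dots> = (\<Sum>i\<in>Basis. ennreal (\<bar>h \<bullet> i\<bar> * norm (g i n (x + \<theta> *\<^sub>R h))))" by (intro sum_ennreal[symmetric]) auto
        finally show "ennreal (norm (G \<theta> n)) \<le> (\<Sum>i\<in>Basis. ennreal \<bar>h \<bullet> i\<bar> * ennreal (norm (g i n (x + \<theta> *\<^sub>R h))))"
          by (simp add: ennreal_mult)
      qed
      also have "\<dots> = (\<Sum>i\<in>Basis. \<integral>\<^sup>+n. ennreal \<bar>h \<bullet> i\<bar> * ennreal (norm (g i n (x + \<theta> *\<^sub>R h))) \<partial>N)"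
        using gm by (intro nn_integral_sum) measurable
      also have "\<dots> = (\<Sum>i\<in>Basis. ennreal \<bar>h \<bullet> i\<bar> * (\<integral>\<^sup>+n. ennreal (norm (g i n (x + \<theta> *\<^sub>R h))) \<partial>N))"
        using gm by (intro sum.cong refl nn_integral_cmult) measurable
      also have "\<dots> \<le> (\<Sum>i\<in>Basis. ennreal \<bar>h \<bullet> i\<bar> * ennreal C)" by (intro sum_mono mult_left_mono C) auto
      also have "\<dots> = (\<Sum>i\<in>Basis. ennreal (\<bar>h \<bullet> i\<bar> * C))" using C(2) by (simp add: ennreal_mult)
      also have "\<dots> = ennreal (\<Sum>i\<in>Basis. \<bar>h \<bullet> i\<bar> * C)" using C(2) by (intro sum_ennreal) auto
      finally show ?thesis .
    qed
    have iF: "integrable (lborel \<Otimes>\<^sub>M N) ?F"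
    proof (rule integrableI_bounded[OF Fm])
      have "(\<integral>\<^sup>+p. ennreal (norm (?F p)) \<partial>(lborel \<Otimes>\<^sub>M N)) = (\<integral>\<^sup>+\<theta>. \<integral>\<^sup>+n. ennreal (norm (?F (\<theta>, n))) \<partial>N \<partial>lborel)"
        by (rule N.nn_integral_fst[symmetric]) (rule measurable_compose[OF measurable_compose[OF Fm borel_measurable_norm] measurable_ennreal])
      also have "\<dots> \<le> (\<integral>\<^sup>+\<theta>. ennreal (\<Sum>i\<in>Basis. \<bar>h \<bullet> i\<bar> * C) * indicator {0..1::real} \<theta> \<partial>lborel)"
      proof (intro nn_integral_mono)
        fix \<theta> :: real
        show "(\<integral>\<^sup>+n. ennreal (norm (?F (\<theta>, n))) \<partial>N) \<le> ennreal (\<Sum>i\<in>Basis. \<bar>h \<bullet> i\<bar> * C) * indicator {0..1::real} \<theta>"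
          using Gle[of \<theta>] by (cases "\<theta> \<in> {0..1}") auto
      qed
      also have "\<dots> < \<infinity>" by (simp add: nn_integral_cmult_indicator)
      finally show "(\<integral>\<^sup>+p. ennreal (norm (?F p)) \<partial>(lborel \<Otimes>\<^sub>M N)) < \<infinity>" .
    qed
    have "(\<integral>n. u n (x + h) \<partial>N) - (\<integral>n. u n x \<partial>N) = (\<integral>n. u n (x + h) - u n x \<partial>N)"
      by (rule Bochner_Integration.integral_diff[OF iu iu, symmetric])
    also have "\<dots> = (\<integral>n. (\<integral>\<theta>. ?F (\<theta>, n) \<partial>lborel) \<partial>N)"
    proof (rule integral_cong_AE)
      show "AE n in N. u n (x + h) - u n x = (\<integral>\<theta>. ?F (\<theta>, n) \<partial>lborel)"
        using eq[of x h] by eventually_elim (simp add: set_lebesgue_integral_def G_def)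
      show "(\<lambda>n. u n (x + h) - u n x) \<in> borel_measurable N" using iu by measurable
      have "(\<lambda>(n, \<theta>). ?F (\<theta>, n)) \<in> borel_measurable (N \<Otimes>\<^sub>M lborel)"
        using measurable_compose[OF measurable_pair_swap' Fm] by (simp add: case_prod_beta')
      then show "(\<lambda>n. \<integral>\<theta>. ?F (\<theta>, n) \<partial>lborel) \<in> borel_measurable N"
        by (rule lborel.borel_measurable_lebesgue_integral)
    qed
    also have "\<dots> = (\<integral>\<theta>. (\<integral>n. ?F (\<theta>, n) \<partial>N) \<partial>lborel)"
      using P.Fubini_integral[OF iF] by (simp only: prod.case)
    also have "\<dots> = (LINT \<theta>:{0..1}|lborel. (\<Sum>i\<in>Basis. (h \<bullet> i) *\<^sub>R (\<integral>n. g i n (x + \<theta> *\<^sub>R h) \<partial>N)))"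
      unfolding set_lebesgue_integral_def
    proof (rule Bochner_Integration.integral_cong[OF refl])
      fix \<theta> :: real
      have "(\<integral>n. G \<theta> n \<partial>N) = (\<Sum>i\<in>Basis. \<integral>n. (h \<bullet> i) *\<^sub>R g i n (x + \<theta> *\<^sub>R h) \<partial>N)"
        unfolding G_def by (rule Bochner_Integration.integral_sum) (intro integrable_scaleR_right ig)
      also have "\<dots> = (\<Sum>i\<in>Basis. (h \<bullet> i) *\<^sub>R (\<integral>n. g i n (x + \<theta> *\<^sub>R h) \<partial>N))" by (simp only: integral_scaleR_right)
      finally show "(\<integral>n. ?F (\<theta>, n) \<partial>N) = indicator {0..1} \<theta> *\<^sub>R (\<Sum>i\<in>Basis. (h \<bullet> i) *\<^sub>R (\<integral>n. g i n (x + \<theta> *\<^sub>R h) \<partial>N))"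
        by (simp only: prod.case integral_scaleR_right)
    qed
    finally show "(\<integral>n. u n (x + h) \<partial>N) - (\<integral>n. u n x \<partial>N)
       = (LINT \<theta>:{0..1}|lborel. (\<Sum>i\<in>Basis. (h \<bullet> i) *\<^sub>R (\<integral>n. g i n (x + \<theta> *\<^sub>R h) \<partial>N)))" .
  qed
qed

text \<open>All conditions are imposed at every time and with real-valued bounds; exceptional times
  are disposed of beforehand, by setting the field to zero there. The trace is bounded from below
  only, the direction that limits compression.\<close>

locale sobolev_drift =
  fixes b :: "real \<Rightarrow> 'a::euclidean_space \<Rightarrow> 'a" and v :: "'a \<Rightarrow> real \<Rightarrow> 'a \<Rightarrow> 'a"
    and q :: ennreal and \<alpha> \<beta> \<gamma> :: "real \<Rightarrow> real"
  assumes b_joint: "(\<lambda>(t, x). b t x) \<in> borel_measurable (borel \<Otimes>\<^sub>M borel)"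
    and v_joint: "\<And>i. i \<in> Basis \<Longrightarrow> (\<lambda>(t, x). v i t x) \<in> borel_measurable (borel \<Otimes>\<^sub>M borel)"
    and b_norm: "\<And>t. Lp_norm lborel q (b t) \<le> ennreal (\<alpha> t)"
    and v_norm: "\<And>i t. i \<in> Basis \<Longrightarrow> Lp_norm lborel q (v i t) \<le> ennreal (\<beta> t)"
    and increment: "\<And>t h. AE x in lborel. b t (x + h) - b t x = (LINT \<theta>:{0..1}|lborel. (\<Sum>i\<in>Basis. (h \<bullet> i) *\<^sub>R v i t (x + \<theta> *\<^sub>R h)))"
    and trace: "\<And>t. AE x in lborel. - \<gamma> t \<le> (\<Sum>i\<in>Basis. v i t x \<bullet> i)"
    and nonneg: "\<And>t. 0 \<le> \<alpha> t" "\<And>t. 0 \<le> \<beta> t" "\<And>t. 0 \<le> \<gamma> t"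
    and int: "integrable lborel \<alpha>" "integrable lborel \<beta>" "integrable lborel \<gamma>"
begin

lemma b_measurable[measurable (raw)]:
  assumes "f \<in> borel_measurable M" "g \<in> borel_measurable M"
  shows "(\<lambda>\<omega>. b (f \<omega>) (g \<omega>)) \<in> borel_measurable M"
  using measurable_compose[OF measurable_Pair[OF assms] b_joint] by simp

lemma v_measurable:
  assumes "i \<in> Basis" "f \<in> borel_measurable M" "g \<in> borel_measurable M"
  shows "(\<lambda>\<omega>. v i (f \<omega>) (g \<omega>)) \<in> borel_measurable M"
  using measurable_compose[OF measurable_Pair[OF assms(2,3)] v_joint[OF assms(1)]] by simp

lemma b_convolution_le:
  assumes "dual_bounded q K \<mu>" "0 \<le> K"
  shows "(\<integral>\<^sup>+y. ennreal (norm (b t (x - y))) \<partial>\<mu>) \<le> ennreal (K * \<alpha> t)"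
  by (rule dual_bounded_convolution_le[OF assms(1) _ b_norm assms(2)]) measurable

lemma v_convolution_le:
  assumes "dual_bounded q K \<mu>" "0 \<le> K" "i \<in> Basis"
  shows "(\<integral>\<^sup>+y. ennreal (norm (v i t (x - y))) \<partial>\<mu>) \<le> ennreal (K * \<beta> t)"
  by (rule dual_bounded_convolution_le[OF assms(1) _ v_norm[OF assms(3)] assms(2)]) (intro v_measurable assms, auto)

text \<open>The shift \<open>h\<close> is deterministic, so along the whole segment the derivatives
  are evaluated at translates of one random point and tested against one law; each of them costs
  \<open>K * \<beta> t\<close>.\<close>

lemma b_increment_le:
  assumes d: "dual_bounded q K \<mu>" and K: "0 \<le> K"
  shows "(\<integral>\<^sup>+y. ennreal (norm (b t (x + h - y) - b t (x - y))) \<partial>\<mu>) \<le> ennreal (K * (real DIM('a) * norm h * \<beta> t))"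
proof -
  have sm: "sets \<mu> = sets borel" using d by (simp add: dual_bounded_def)
  interpret M: prob_space \<mu> using d by (simp add: dual_bounded_def)
  interpret P: pair_sigma_finite \<mu> "lborel :: real measure"
    by (intro pair_sigma_finite.intro sigma_finite_lborel M.sigma_finite_measure_axioms)
  have idm[measurable]: "(\<lambda>y. y) \<in> borel_measurable \<mu>" using sm by (simp add: measurable_def sets_eq_imp_space_eq[OF sm])
  define G where "G \<theta> y = (\<Sum>i\<in>Basis. ennreal \<bar>h \<bullet> i\<bar> * ennreal (norm (v i t (x + \<theta> *\<^sub>R h - y))))" for \<theta> y
  have vm: "(\<lambda>p. v i t (x + snd p *\<^sub>R h - fst p)) \<in> borel_measurable (\<mu> \<Otimes>\<^sub>M lborel)" if "i \<in> Basis" for i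
    by (intro v_measurable that borel_measurable_const borel_measurable_diff borel_measurable_add borel_measurable_scaleR
        measurable_compose[OF measurable_fst idm]) (auto intro!: measurable_compose[OF measurable_snd])
  have pt: "AE y in \<mu>. ennreal (norm (b t (x + h - y) - b t (x - y))) \<le> (\<integral>\<^sup>+\<theta>. indicator {0..1} \<theta> * G \<theta> y \<partial>lborel)"
    using dual_bounded_AE_reflect[OF d increment[of t h], of x]
  proof eventually_elim
    case (elim y)
    let ?f = "\<lambda>\<theta>. \<Sum>i\<in>Basis. (h \<bullet> i) *\<^sub>R v i t (x - y + \<theta> *\<^sub>R h)"
    have "ennreal (norm (b t (x + h - y) - b t (x - y))) = ennreal (norm (LINT \<theta>:{0..1}|lborel. ?f \<theta>))"
      using elim by (simp add: algebra_simps)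
    also have "\<dots> \<le> (\<integral>\<^sup>+\<theta>. ennreal (norm (indicator {0..1} \<theta> *\<^sub>R ?f \<theta>)) \<partial>lborel)"
    proof (cases "integrable lborel (\<lambda>\<theta>. indicator {0..1} \<theta> *\<^sub>R ?f \<theta>)")
      case True
      then show ?thesis unfolding set_lebesgue_integral_def by (rule integral_norm_bound_ennreal)
    next
      case False
      then show ?thesis unfolding set_lebesgue_integral_def by (simp add: not_integrable_integral_eq)
    qed
    also have "\<dots> \<le> (\<integral>\<^sup>+\<theta>. indicator {0..1} \<theta> * G \<theta> y \<partial>lborel)"
    proof (intro nn_integral_mono)
      fix \<theta> :: real
      have "norm (?f \<theta>) \<le> (\<Sum>i\<in>Basis. norm ((h \<bullet> i) *\<^sub>R v i t (x - y + \<theta> *\<^sub>R h)))" by (rule norm_sum)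
      also have "\<dots> = (\<Sum>i\<in>Basis. \<bar>h \<bullet> i\<bar> * norm (v i t (x + \<theta> *\<^sub>R h - y)))"
        by (intro sum.cong refl) (simp add: algebra_simps)
      finally have "ennreal (norm (?f \<theta>)) \<le> ennreal (\<Sum>i\<in>Basis. \<bar>h \<bullet> i\<bar> * norm (v i t (x + \<theta> *\<^sub>R h - y)))" by (rule ennreal_leI)
      also have "\<dots> = (\<Sum>i\<in>Basis. ennreal (\<bar>h \<bullet> i\<bar> * norm (v i t (x + \<theta> *\<^sub>R h - y))))" by (intro sum_ennreal[symmetric]) auto
      also have "\<dots> = G \<theta> y" unfolding G_def by (intro sum.cong refl ennreal_mult) auto
      finally show "ennreal (norm (indicator {0..1} \<theta> *\<^sub>R ?f \<theta>)) \<le> indicator {0..1} \<theta> * G \<theta> y"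
        by (cases "\<theta> \<in> {0..1}") auto
    qed
    finally show ?case .
  qed
  have Gm: "(\<lambda>(y, \<theta>). indicator {0..1::real} \<theta> * G \<theta> y) \<in> borel_measurable (\<mu> \<Otimes>\<^sub>M lborel)"
    unfolding G_def case_prod_beta using vm by measurable
  have "(\<integral>\<^sup>+y. ennreal (norm (b t (x + h - y) - b t (x - y))) \<partial>\<mu>) \<le> (\<integral>\<^sup>+y. \<integral>\<^sup>+\<theta>. indicator {0..1} \<theta> * G \<theta> y \<partial>lborel \<partial>\<mu>)"
    by (rule nn_integral_mono_AE[OF pt])
  also have "\<dots> = (\<integral>\<^sup>+\<theta>. \<integral>\<^sup>+y. indicator {0..1} \<theta> * G \<theta> y \<partial>\<mu> \<partial>lborel)"
    by (rule P.Fubini'[symmetric, OF Gm])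
  also have "\<dots> \<le> (\<integral>\<^sup>+\<theta>. ennreal (K * (real DIM('a) * norm h * \<beta> t)) * indicator {0..1::real} \<theta> \<partial>lborel)"
  proof (intro nn_integral_mono)
    fix \<theta> :: real
    have vm': "(\<lambda>y. v i t (x + \<theta> *\<^sub>R h - y)) \<in> borel_measurable \<mu>" if "i \<in> Basis" for i
      by (intro v_measurable that borel_measurable_const borel_measurable_diff idm)
    have wm: "(\<lambda>y. ennreal (norm (v i t (x + \<theta> *\<^sub>R h - y)))) \<in> borel_measurable \<mu>" if "i \<in> Basis" for i
      by (rule measurable_compose[OF measurable_compose[OF vm'[OF that] borel_measurable_norm] measurable_ennreal])
    have "(\<integral>\<^sup>+y. G \<theta> y \<partial>\<mu>) = (\<Sum>i\<in>Basis. \<integral>\<^sup>+y. ennreal \<bar>h \<bullet> i\<bar> * ennreal (norm (v i t (x + \<theta> *\<^sub>R h - y))) \<partial>\<mu>)"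
      unfolding G_def by (intro nn_integral_sum borel_measurable_times_ennreal borel_measurable_const wm)
    also have "\<dots> = (\<Sum>i\<in>Basis. ennreal \<bar>h \<bullet> i\<bar> * (\<integral>\<^sup>+y. ennreal (norm (v i t (x + \<theta> *\<^sub>R h - y))) \<partial>\<mu>))"
      by (intro sum.cong refl nn_integral_cmult wm)
    also have "\<dots> \<le> (\<Sum>i\<in>(Basis::'a set). ennreal (norm h) * ennreal (K * \<beta> t))"
      by (intro sum_mono mult_mono ennreal_leI v_convolution_le d K) (auto intro: Basis_le_norm)
    also have "\<dots> = ennreal (K * (real DIM('a) * norm h * \<beta> t))"
      using K nonneg(2)[of t] by (simp add: ennreal_mult[symmetric] ennreal_of_nat_eq_real_of_nat mult_ac)
    finally show "(\<integral>\<^sup>+y. indicator {0..1} \<theta> * G \<theta> y \<partial>\<mu>) \<le> ennreal (K * (real DIM('a) * norm h * \<beta> t)) * indicator {0..1} \<theta>"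
      by (cases "\<theta> \<in> {0..1}") auto
  qed
  also have "\<dots> = ennreal (K * (real DIM('a) * norm h * \<beta> t))" by (simp add: nn_integral_cmult_indicator)
  finally show ?thesis .
qed

end

lemma ennreal_le_add: "a \<le> b + c \<Longrightarrow> 0 \<le> b \<Longrightarrow> 0 \<le> c \<Longrightarrow> ennreal a \<le> ennreal b + ennreal c"
  by (metis ennreal_leI ennreal_plus)

text \<open>The shift z' - z is random in the application. In the second term it is removed by
  translation invariance of Lebesgue measure, at the price of enlarging the ball to radius 2
  \<delta>: the points z' + k lie within this distance of z.\<close>

lemma ball_average_le:
  fixes f :: "'a::euclidean_space \<Rightarrow> 'b::euclidean_space"
  assumes [measurable]: "f \<in> borel_measurable borel" and d: "norm (z - z') \<le> \<delta>"
  shows "emeasure lborel (cball (0::'a) \<delta>) * ennreal (norm (f z - f z'))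
    \<le> (\<integral>\<^sup>+k. indicator (cball 0 \<delta>) k * ennreal (norm (f (z' + k) - f z')) \<partial>lborel)
     + (\<integral>\<^sup>+k. indicator (cball 0 (2 * \<delta>)) k * ennreal (norm (f (z + k) - f z)) \<partial>lborel)"
proof -
  have [measurable]: "cball (0::'a) r \<in> sets borel" for r by simp
  have "emeasure lborel (cball (0::'a) \<delta>) * ennreal (norm (f z - f z'))
     = (\<integral>\<^sup>+k. indicator (cball (0::'a) \<delta>) k * ennreal (norm (f z - f z')) \<partial>lborel)"
    by (subst nn_integral_multc) auto
  also have "\<dots> \<le> (\<integral>\<^sup>+k. indicator (cball 0 \<delta>) k * ennreal (norm (f (z' + k) - f z'))
      + indicator (cball 0 \<delta>) k * ennreal (norm (f (z' + k) - f z)) \<partial>lborel)"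
  proof (intro nn_integral_mono)
    fix k
    have "norm (f z - f z') \<le> norm (f (z' + k) - f z') + norm (f (z' + k) - f z)"
      using norm_triangle_ineq4[of "f (z' + k) - f z'" "f (z' + k) - f z"] by simp
    then have "ennreal (norm (f z - f z')) \<le> ennreal (norm (f (z' + k) - f z')) + ennreal (norm (f (z' + k) - f z))"
      by (rule ennreal_le_add) auto
    then show "indicator (cball 0 \<delta>) k * ennreal (norm (f z - f z'))
      \<le> indicator (cball 0 \<delta>) k * ennreal (norm (f (z' + k) - f z')) + indicator (cball 0 \<delta>) k * ennreal (norm (f (z' + k) - f z))"
      by (cases "k \<in> cball 0 \<delta>") auto
  qed
  also have "\<dots> = (\<integral>\<^sup>+k. indicator (cball 0 \<delta>) k * ennreal (norm (f (z' + k) - f z')) \<partial>lborel)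
      + (\<integral>\<^sup>+k. indicator (cball 0 \<delta>) k * ennreal (norm (f (z' + k) - f z)) \<partial>lborel)"
    by (rule nn_integral_add) measurable
  also have "(\<integral>\<^sup>+k. indicator (cball 0 \<delta>) k * ennreal (norm (f (z' + k) - f z)) \<partial>lborel)
     \<le> (\<integral>\<^sup>+k. (\<lambda>k. indicator (cball 0 (2 * \<delta>)) k * ennreal (norm (f (z + k) - f z))) (k + (z' - z)) \<partial>lborel)"
  proof (intro nn_integral_mono)
    fix k
    have "k + (z' - z) \<in> cball 0 (2 * \<delta>)" if "k \<in> cball 0 \<delta>"
      using that d norm_triangle_ineq[of k "z' - z"] by (simp add: norm_minus_commute)
    moreover have eq: "z + (k + (z' - z)) = z' + k" by simp
    ultimately show "indicator (cball 0 \<delta>) k * ennreal (norm (f (z' + k) - f z))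
      \<le> indicator (cball 0 (2 * \<delta>)) (k + (z' - z)) * ennreal (norm (f (z + (k + (z' - z))) - f z))"
      unfolding eq by (cases "k \<in> cball 0 \<delta>") auto
  qed
  also have "\<dots> = (\<integral>\<^sup>+k. indicator (cball 0 (2 * \<delta>)) k * ennreal (norm (f (z + k) - f z)) \<partial>lborel)"
    by (rule nn_integral_lborel_add) measurable
  finally show ?thesis by (simp add: add_left_mono)
qed

context sobolev_drift
begin

lemma ball_integral_increment_le:
  fixes Z :: "'w \<Rightarrow> 'a"
  assumes P: "prob_space P" and Z[measurable]: "Z \<in> borel_measurable P"
    and d: "dual_bounded q K (distr P borel Z)" and K: "0 \<le> K" and r: "0 \<le> r"
  shows "(\<integral>\<^sup>+\<omega>. (\<integral>\<^sup>+k. indicator (cball 0 r) k * ennreal (norm (b t (x - Z \<omega> + k) - b t (x - Z \<omega>))) \<partial>lborel) \<partial>P)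
    \<le> emeasure lborel (cball (0::'a) r) * ennreal (K * (real DIM('a) * r * \<beta> t))"
proof -
  interpret M: prob_space P by fact
  interpret Q: pair_sigma_finite P "lborel :: 'a measure"
    by (intro pair_sigma_finite.intro sigma_finite_lborel M.sigma_finite_measure_axioms)
  have [measurable]: "cball (0::'a) r \<in> sets borel" by simp
  have "(\<integral>\<^sup>+\<omega>. (\<integral>\<^sup>+k. indicator (cball 0 r) k * ennreal (norm (b t (x - Z \<omega> + k) - b t (x - Z \<omega>))) \<partial>lborel) \<partial>P)
     = (\<integral>\<^sup>+k. (\<integral>\<^sup>+\<omega>. indicator (cball 0 r) k * ennreal (norm (b t (x - Z \<omega> + k) - b t (x - Z \<omega>))) \<partial>P) \<partial>lborel)"
    by (rule Q.Fubini'[symmetric]) measurable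
  also have "\<dots> \<le> (\<integral>\<^sup>+k. ennreal (K * (real DIM('a) * r * \<beta> t)) * indicator (cball (0::'a) r) k \<partial>lborel)"
  proof (intro nn_integral_mono)
    fix k :: 'a
    show "(\<integral>\<^sup>+\<omega>. indicator (cball 0 r) k * ennreal (norm (b t (x - Z \<omega> + k) - b t (x - Z \<omega>))) \<partial>P)
       \<le> ennreal (K * (real DIM('a) * r * \<beta> t)) * indicator (cball 0 r) k"
    proof (cases "k \<in> cball 0 r")
      case True
      have "(\<integral>\<^sup>+\<omega>. ennreal (norm (b t (x - Z \<omega> + k) - b t (x - Z \<omega>))) \<partial>P)
         = (\<integral>\<^sup>+y. ennreal (norm (b t (x + k - y) - b t (x - y))) \<partial>distr P borel Z)"
        by (subst nn_integral_distr) (auto simp: algebra_simps)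
      also have "\<dots> \<le> ennreal (K * (real DIM('a) * norm k * \<beta> t))" by (rule b_increment_le[OF d K])
      also have "\<dots> \<le> ennreal (K * (real DIM('a) * r * \<beta> t))"
        using True K nonneg(2)[of t] by (intro ennreal_leI mult_left_mono mult_right_mono) auto
      finally show ?thesis using True by simp
    qed simp
  qed
  also have "\<dots> = emeasure lborel (cball (0::'a) r) * ennreal (K * (real DIM('a) * r * \<beta> t))"
    by (subst nn_integral_cmult_indicator) (auto simp: mult.commute)
  finally show ?thesis .
qed

text \<open>The joint law of \<open>Z\<close> and \<open>Z'\<close> enters only through the bound
  \<delta>; the two ball integrals see one marginal each. Division by the volume of the small ball
  leaves the constant 1 from the first and 2 * 2^d from the second, whose ball has 2^d times the
  volume and twice the radius.\<close>

lemma coupling_le: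
  fixes Z Z' :: "'w \<Rightarrow> 'a"
  assumes P: "prob_space P" and Z[measurable]: "Z \<in> borel_measurable P" and Z'[measurable]: "Z' \<in> borel_measurable P"
    and d: "dual_bounded q K (distr P borel Z)" "dual_bounded q K (distr P borel Z')" and K: "0 \<le> K"
    and \<delta>: "0 \<le> \<delta>" "AE \<omega> in P. norm (Z \<omega> - Z' \<omega>) \<le> \<delta>"
  shows "(\<integral>\<^sup>+\<omega>. ennreal (norm (b t (x - Z \<omega>) - b t (x - Z' \<omega>))) \<partial>P)
     \<le> ennreal (K * (real DIM('a) * (1 + 2 * 2 ^ DIM('a)) * \<delta> * \<beta> t))"
proof (cases "\<delta> = 0")
  \<comment> \<open>For \<delta> = 0 the ball is a null set and one cannot divide by its
    volume.\<close>
  case True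
  have "(\<integral>\<^sup>+\<omega>. ennreal (norm (b t (x - Z \<omega>) - b t (x - Z' \<omega>))) \<partial>P) = (\<integral>\<^sup>+\<omega>. 0 \<partial>P)"
    using \<delta>(2) True by (intro nn_integral_cong_AE) (auto elim!: eventually_mono)
  then show ?thesis by simp
next
  case False
  then have d0: "0 < \<delta>" using \<delta>(1) by simp
  define V where "V = unit_ball_vol (real DIM('a)) * \<delta> ^ DIM('a)"
  have V: "0 < V" using d0 by (simp add: V_def)
  have V1: "emeasure lborel (cball (0::'a) \<delta>) = ennreal V" unfolding V_def using d0 by (intro emeasure_cball) simp
  have V2: "emeasure lborel (cball (0::'a) (2 * \<delta>)) = ennreal (2 ^ DIM('a) * V)"
  proof -
    have "emeasure lborel (cball (0::'a) (2 * \<delta>)) = ennreal (unit_ball_vol (real DIM('a)) * (2 * \<delta>) ^ DIM('a))"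
      using d0 by (intro emeasure_cball) simp
    then show ?thesis by (simp add: V_def power_mult_distrib mult_ac)
  qed
  have [measurable]: "cball (0::'a) r \<in> sets borel" for r by simp
  let ?I = "\<lambda>r Z \<omega>. \<integral>\<^sup>+k. indicator (cball 0 r) k * ennreal (norm (b t (x - Z \<omega> + k) - b t (x - Z \<omega>))) \<partial>lborel"
  have "ennreal V * (\<integral>\<^sup>+\<omega>. ennreal (norm (b t (x - Z \<omega>) - b t (x - Z' \<omega>))) \<partial>P)
     = (\<integral>\<^sup>+\<omega>. ennreal V * ennreal (norm (b t (x - Z \<omega>) - b t (x - Z' \<omega>))) \<partial>P)"
    by (rule nn_integral_cmult[symmetric]) measurable
  also have "\<dots> \<le> (\<integral>\<^sup>+\<omega>. ?I \<delta> Z' \<omega> + ?I (2 * \<delta>) Z \<omega> \<partial>P)"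
  proof (rule nn_integral_mono_AE)
    show "AE \<omega> in P. ennreal V * ennreal (norm (b t (x - Z \<omega>) - b t (x - Z' \<omega>))) \<le> ?I \<delta> Z' \<omega> + ?I (2 * \<delta>) Z \<omega>"
      using \<delta>(2)
    proof eventually_elim
      case (elim \<omega>)
      then have "norm ((x - Z \<omega>) - (x - Z' \<omega>)) \<le> \<delta>" by (simp add: norm_minus_commute)
      then show ?case unfolding V1[symmetric] by (intro ball_average_le) measurable
    qed
  qed
  also have "\<dots> = (\<integral>\<^sup>+\<omega>. ?I \<delta> Z' \<omega> \<partial>P) + (\<integral>\<^sup>+\<omega>. ?I (2 * \<delta>) Z \<omega> \<partial>P)"
    by (rule nn_integral_add) measurable
  also have "\<dots> \<le> ennreal V * ennreal (K * (real DIM('a) * \<delta> * \<beta> t))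
      + ennreal (2 ^ DIM('a) * V) * ennreal (K * (real DIM('a) * (2 * \<delta>) * \<beta> t))"
    unfolding V1[symmetric] V2[symmetric] using d0
    by (intro add_mono ball_integral_increment_le P Z Z' d K) auto
  also have "\<dots> = ennreal V * ennreal (K * (real DIM('a) * (1 + 2 * 2 ^ DIM('a)) * \<delta> * \<beta> t))"
    using V K d0 nonneg(2)[of t] by (simp add: ennreal_mult[symmetric] ennreal_plus[symmetric] algebra_simps del: ennreal_plus)
  finally show ?thesis using V by (subst (asm) ennreal_mult_le_mult_iff) auto
qed

lemma b_convolution_integrable:
  fixes Z :: "'w \<Rightarrow> 'a"
  assumes P: "prob_space P" and Z[measurable]: "Z \<in> borel_measurable P"
    and d: "dual_bounded q K (distr P borel Z)" and K: "0 \<le> K"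
  shows "integrable P (\<lambda>\<omega>. b t (x - Z \<omega>))" and "norm (\<integral>\<omega>. b t (x - Z \<omega>) \<partial>P) \<le> K * \<alpha> t"
    and "(\<integral>\<^sup>+\<omega>. ennreal (norm (b t (x - Z \<omega>))) \<partial>P) \<le> ennreal (K * \<alpha> t)"
proof -
  show le: "(\<integral>\<^sup>+\<omega>. ennreal (norm (b t (x - Z \<omega>))) \<partial>P) \<le> ennreal (K * \<alpha> t)"
    using b_convolution_le[OF d K, of t x] by (subst (asm) nn_integral_distr) auto
  show i: "integrable P (\<lambda>\<omega>. b t (x - Z \<omega>))"
    using le by (intro integrableI_bounded) (auto intro: le_less_trans)
  have "ennreal (norm (\<integral>\<omega>. b t (x - Z \<omega>) \<partial>P)) \<le> ennreal (K * \<alpha> t)"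
    using integral_norm_bound_ennreal[OF i] le by (rule order_trans)
  then show "norm (\<integral>\<omega>. b t (x - Z \<omega>) \<partial>P) \<le> K * \<alpha> t" using K nonneg(1)[of t] by (subst (asm) ennreal_le_iff) auto
qed

text \<open>In dimension d, moving the evaluation point costs d, and \<open>coupling_le\<close> adds
  d (1 + 2 * 2^d).\<close>

definition drift_const :: real where "drift_const = real DIM('a) * (2 + 2 * 2 ^ DIM('a))"

lemma drift_const_nonneg: "0 \<le> drift_const" by (simp add: drift_const_def)

text \<open>The intermediate value \<open>b t (z' - Z \<omega>)\<close> separates a deterministic
  shift under one law from the change of the random point, which is the case of
  \<open>coupling_le\<close>.\<close>

lemma drift_difference_le:
  fixes Z Z' :: "'w \<Rightarrow> 'a"
  assumes P: "prob_space P" and Z[measurable]: "Z \<in> borel_measurable P" and Z'[measurable]: "Z' \<in> borel_measurable P"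
    and d: "dual_bounded q K (distr P borel Z)" "dual_bounded q K (distr P borel Z')" and K: "0 \<le> K"
    and \<delta>: "0 \<le> \<delta>" "AE \<omega> in P. norm (Z \<omega> - Z' \<omega>) \<le> \<delta>" "norm (z - z') \<le> \<delta>"
  shows "norm ((\<integral>\<omega>. b t (z - Z \<omega>) \<partial>P) - (\<integral>\<omega>. b t (z' - Z' \<omega>) \<partial>P)) \<le> K * drift_const * \<delta> * \<beta> t"
proof -
  have zz: "z' + (z - z') = z" by simp
  note i = b_convolution_integrable(1)[OF P Z d(1) K] b_convolution_integrable(1)[OF P Z' d(2) K]
  have "(\<integral>\<omega>. b t (z - Z \<omega>) \<partial>P) - (\<integral>\<omega>. b t (z' - Z' \<omega>) \<partial>P) = (\<integral>\<omega>. b t (z - Z \<omega>) - b t (z' - Z' \<omega>) \<partial>P)"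
    by (rule Bochner_Integration.integral_diff[symmetric]) (rule i)+
  also have "ennreal (norm \<dots>) \<le> (\<integral>\<^sup>+\<omega>. ennreal (norm (b t (z - Z \<omega>) - b t (z' - Z' \<omega>))) \<partial>P)"
    by (intro integral_norm_bound_ennreal Bochner_Integration.integrable_diff i)
  also have "\<dots> \<le> (\<integral>\<^sup>+\<omega>. ennreal (norm (b t (z' + (z - z') - Z \<omega>) - b t (z' - Z \<omega>))) + ennreal (norm (b t (z' - Z \<omega>) - b t (z' - Z' \<omega>))) \<partial>P)"
  proof (intro nn_integral_mono)
    fix \<omega>
    have "norm (b t (z - Z \<omega>) - b t (z' - Z' \<omega>)) \<le> norm (b t (z - Z \<omega>) - b t (z' - Z \<omega>)) + norm (b t (z' - Z \<omega>) - b t (z' - Z' \<omega>))"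
      using norm_triangle_ineq[of "b t (z - Z \<omega>) - b t (z' - Z \<omega>)" "b t (z' - Z \<omega>) - b t (z' - Z' \<omega>)"] by simp
    then show "ennreal (norm (b t (z - Z \<omega>) - b t (z' - Z' \<omega>)))
       \<le> ennreal (norm (b t (z' + (z - z') - Z \<omega>) - b t (z' - Z \<omega>))) + ennreal (norm (b t (z' - Z \<omega>) - b t (z' - Z' \<omega>)))"
      unfolding zz by (rule ennreal_le_add) auto
  qed
  also have "\<dots> = (\<integral>\<^sup>+\<omega>. ennreal (norm (b t (z' + (z - z') - Z \<omega>) - b t (z' - Z \<omega>))) \<partial>P)
      + (\<integral>\<^sup>+\<omega>. ennreal (norm (b t (z' - Z \<omega>) - b t (z' - Z' \<omega>))) \<partial>P)"
    by (rule nn_integral_add) measurable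
  also have "\<dots> \<le> ennreal (K * (real DIM('a) * \<delta> * \<beta> t)) + ennreal (K * (real DIM('a) * (1 + 2 * 2 ^ DIM('a)) * \<delta> * \<beta> t))"
  proof (intro add_mono coupling_le[OF P Z Z' d K \<delta>(1,2)])
    have "(\<integral>\<^sup>+\<omega>. ennreal (norm (b t (z' + (z - z') - Z \<omega>) - b t (z' - Z \<omega>))) \<partial>P)
       = (\<integral>\<^sup>+y. ennreal (norm (b t (z' + (z - z') - y) - b t (z' - y))) \<partial>distr P borel Z)"
      by (subst nn_integral_distr) auto
    also have "\<dots> \<le> ennreal (K * (real DIM('a) * norm (z - z') * \<beta> t))" by (rule b_increment_le[OF d(1) K])
    also have "\<dots> \<le> ennreal (K * (real DIM('a) * \<delta> * \<beta> t))"
      using K nonneg(2)[of t] \<delta>(3) by (intro ennreal_leI mult_left_mono mult_right_mono) auto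
    finally show "(\<integral>\<^sup>+\<omega>. ennreal (norm (b t (z' + (z - z') - Z \<omega>) - b t (z' - Z \<omega>))) \<partial>P) \<le> ennreal (K * (real DIM('a) * \<delta> * \<beta> t))" .
  qed
  also have "\<dots> = ennreal (K * drift_const * \<delta> * \<beta> t)"
    using K \<delta>(1) nonneg(2)[of t] by (simp add: drift_const_def ennreal_plus[symmetric] algebra_simps del: ennreal_plus)
  finally show ?thesis using K \<delta>(1) nonneg(2)[of t] drift_const_nonneg by (subst (asm) ennreal_le_iff) auto
qed

lemma drift_gradient:
  fixes Z :: "real \<Rightarrow> 'w \<Rightarrow> 'a" and w :: "real \<Rightarrow> 'a"
  assumes P: "prob_space P" and Zm[measurable]: "(\<lambda>p. Z (fst p) (snd p)) \<in> borel_measurable (lborel \<Otimes>\<^sub>M P)"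
    and Zs[measurable]: "\<And>s. Z s \<in> borel_measurable P"
    and d: "\<And>s. s \<in> S \<Longrightarrow> dual_bounded q K (distr P borel (Z s))" and K: "0 \<le> K"
    and w[measurable]: "w \<in> borel_measurable borel" and S[measurable]: "S \<in> sets borel"
  shows "\<exists>B. integral_gradient (\<lambda>z. LINT s:S|lborel. (\<integral>y. b s (z + w s - Z s y) \<partial>P)) B \<and>
     (\<forall>i\<in>Basis. \<forall>z. norm (B i z) \<le> K * (LINT s:S|lborel. \<beta> s)) \<and>
     (\<forall>z. - (LINT s:S|lborel. \<gamma> s) \<le> (\<Sum>i\<in>Basis. B i z \<bullet> i))"
proof -
  interpret M: prob_space P by fact
  interpret Q: pair_sigma_finite "lborel :: real measure" P
    by (intro pair_sigma_finite.intro sigma_finite_lborel M.sigma_finite_measure_axioms)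
  let ?N = "(lborel :: real measure) \<Otimes>\<^sub>M P"
  have sfN: "sigma_finite_measure ?N" by (rule sigma_finite_pair_measure[OF sigma_finite_lborel M.sigma_finite_measure_axioms])
  let ?arg = "\<lambda>n x. x + w (fst n) - Z (fst n) (snd n)"
  define u where "u n x = indicator S (fst n) *\<^sub>R b (fst n) (?arg n x)" for n x
  define g where "g i n x = indicator S (fst n) *\<^sub>R v i (fst n) (?arg n x)" for i n x
  have Sb: "set_integrable lborel S \<alpha>" "set_integrable lborel S \<beta>" "set_integrable lborel S \<gamma>"
    unfolding set_integrable_def by (intro integrable_mult_indicator int, simp)+
  have mF[measurable]: "(\<lambda>n. fst n) \<in> borel_measurable ?N" using measurable_fst[of "lborel :: real measure" P] by simp
  have mw[measurable]: "(\<lambda>n. w (fst n)) \<in> borel_measurable ?N" by (rule measurable_compose[OF mF w])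
  have arg1: "(\<lambda>n. ?arg n x) \<in> borel_measurable ?N" for x by measurable
  have arg2: "(\<lambda>p. ?arg (fst p) (snd p)) \<in> borel_measurable (?N \<Otimes>\<^sub>M borel)"
    using measurable_compose[OF measurable_fst mw] measurable_compose[OF measurable_fst Zm] by measurable
  have F2: "(\<lambda>p. fst (fst p)) \<in> borel_measurable (?N \<Otimes>\<^sub>M borel)" by (rule measurable_compose[OF measurable_fst mF])
  have I2: "(\<lambda>p. indicat_real S (fst (fst p))) \<in> borel_measurable (?N \<Otimes>\<^sub>M borel)"
    by (rule measurable_compose[OF F2]) simp
  have um: "(\<lambda>(n, x). u n x) \<in> borel_measurable (?N \<Otimes>\<^sub>M borel)"
    unfolding u_def case_prod_beta by (intro borel_measurable_scaleR I2 b_measurable F2 arg2)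
  have gm: "(\<lambda>(n, x). g i n x) \<in> borel_measurable (?N \<Otimes>\<^sub>M borel)" if "i \<in> Basis" for i
    unfolding g_def case_prod_beta by (intro borel_measurable_scaleR I2 v_measurable that F2 arg2)
  have um1: "(\<lambda>n. u n x) \<in> borel_measurable ?N" for x
    using measurable_compose[OF _ um, of "\<lambda>n. (n, x)" ?N] by simp
  have gm1: "(\<lambda>n. g i n x) \<in> borel_measurable ?N" if "i \<in> Basis" for x i
    using measurable_compose[OF _ gm[OF that], of "\<lambda>n. (n, x)" ?N] by simp
  have fub: "(\<integral>\<^sup>+n. ennreal (norm (h n)) \<partial>?N) \<le> ennreal (K * (LINT s:S|lborel. \<phi> s))"
    if hm: "h \<in> borel_measurable ?N" and \<phi>: "\<And>s. 0 \<le> \<phi> s" "set_integrable lborel S \<phi>"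
      and h0: "\<And>s y. s \<notin> S \<Longrightarrow> h (s, y) = 0"
      and hle: "\<And>s. s \<in> S \<Longrightarrow> (\<integral>\<^sup>+y. ennreal (norm (h (s, y))) \<partial>P) \<le> ennreal (K * \<phi> s)" for h :: "real \<times> 'w \<Rightarrow> 'a" and \<phi>
  proof -
    have "(\<integral>\<^sup>+n. ennreal (norm (h n)) \<partial>?N) = (\<integral>\<^sup>+s. \<integral>\<^sup>+y. ennreal (norm (h (s, y))) \<partial>P \<partial>lborel)"
      by (rule M.nn_integral_fst[symmetric]) (rule measurable_compose[OF measurable_compose[OF hm borel_measurable_norm] measurable_ennreal])
    also have "\<dots> \<le> (\<integral>\<^sup>+s. ennreal (K * (indicator S s *\<^sub>R \<phi> s)) \<partial>lborel)"
    proof (intro nn_integral_mono)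
      fix s
      show "(\<integral>\<^sup>+y. ennreal (norm (h (s, y))) \<partial>P) \<le> ennreal (K * (indicator S s *\<^sub>R \<phi> s))"
        using hle[of s] h0[of s] by (cases "s \<in> S") auto
    qed
    also have "\<dots> = ennreal (\<integral>s. K * (indicator S s *\<^sub>R \<phi> s) \<partial>lborel)"
      using \<phi> K unfolding set_integrable_def by (intro nn_integral_eq_integral integrable_mult_right) auto
    also have "(\<integral>s. K * (indicator S s *\<^sub>R \<phi> s) \<partial>lborel) = K * (LINT s:S|lborel. \<phi> s)"
      unfolding set_lebesgue_integral_def by (rule integral_mult_right_zero)
    finally show ?thesis .
  qed
  have iu: "integrable ?N (\<lambda>n. u n x)" for x
  proof (rule integrableI_bounded[OF um1])
    have "(\<integral>\<^sup>+n. ennreal (norm (u n x)) \<partial>?N) \<le> ennreal (K * (LINT s:S|lborel. \<alpha> s))"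
    proof (rule fub[OF um1 nonneg(1) Sb(1)])
      fix s assume s: "s \<in> S"
      show "(\<integral>\<^sup>+y. ennreal (norm (u (s, y) x)) \<partial>P) \<le> ennreal (K * \<alpha> s)"
        using b_convolution_integrable(3)[OF P Zs d[OF s] K, of s "x + w s"] s by (simp add: u_def)
    qed (simp add: u_def)
    then show "(\<integral>\<^sup>+n. ennreal (norm (u n x)) \<partial>?N) < \<infinity>" by (rule le_less_trans) simp
  qed
  have gC: "(\<integral>\<^sup>+n. ennreal (norm (g i n x)) \<partial>?N) \<le> ennreal (K * (LINT s:S|lborel. \<beta> s))" if i: "i \<in> Basis" for i x
  proof (rule fub[OF gm1[OF i] nonneg(2) Sb(2)])
    fix s assume s: "s \<in> S"
    have vm: "(\<lambda>y. v i s (x + w s - y)) \<in> borel_measurable borel" by (intro v_measurable i) auto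
    have "(\<integral>\<^sup>+y. ennreal (norm (v i s (x + w s - Z s y))) \<partial>P) = (\<integral>\<^sup>+y. ennreal (norm (v i s (x + w s - y))) \<partial>distr P borel (Z s))"
      using vm by (subst nn_integral_distr) auto
    then show "(\<integral>\<^sup>+y. ennreal (norm (g i (s, y) x)) \<partial>P) \<le> ennreal (K * \<beta> s)"
      using v_convolution_le[OF d[OF s] K i, of s "x + w s"] s by (simp add: g_def)
  qed (simp add: g_def)
  have AEs: "AE n in ?N. R n" if Rm: "{n \<in> space ?N. R n} \<in> sets ?N" and R: "\<And>s. AE y in P. R (s, y)" for R
    by (rule Q.AE_pair_measure[OF Rm]) (simp add: R)
  have eq: "AE n in ?N. u n (x + h) - u n x = (LINT \<theta>:{0..1}|lborel. (\<Sum>i\<in>Basis. (h \<bullet> i) *\<^sub>R g i n (x + \<theta> *\<^sub>R h)))" for x h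
  proof (rule AEs)
    have LM: "(\<lambda>n. LINT \<theta>:{0..1}|lborel. (\<Sum>i\<in>Basis. (h \<bullet> i) *\<^sub>R g i n (x + \<theta> *\<^sub>R h))) \<in> borel_measurable ?N"
      unfolding set_lebesgue_integral_def
    proof (rule lborel.borel_measurable_lebesgue_integral)
      have "(\<lambda>p. g i (fst p) (x + snd p *\<^sub>R h)) \<in> borel_measurable (?N \<Otimes>\<^sub>M lborel)" if i: "i \<in> Basis" for i
      proof -
        have "(\<lambda>p. (fst p, x + snd p *\<^sub>R h)) \<in> (?N \<Otimes>\<^sub>M lborel) \<rightarrow>\<^sub>M (?N \<Otimes>\<^sub>M borel)" by measurable
        from measurable_compose[OF this gm[OF i]] show ?thesis by simp
      qed
      moreover have "(\<lambda>p. indicat_real {0..1::real} (snd p)) \<in> borel_measurable (?N \<Otimes>\<^sub>M lborel)"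
        by (rule measurable_compose[OF measurable_snd[of ?N lborel]]) (rule borel_measurable_indicator, simp)
      ultimately show "(\<lambda>(n, \<theta>). indicat_real {0..1} \<theta> *\<^sub>R (\<Sum>i\<in>Basis. (h \<bullet> i) *\<^sub>R g i n (x + \<theta> *\<^sub>R h))) \<in> borel_measurable (?N \<Otimes>\<^sub>M lborel)"
        unfolding case_prod_beta by (intro borel_measurable_scaleR borel_measurable_sum borel_measurable_const)
    qed
    show "{n \<in> space ?N. u n (x + h) - u n x = (LINT \<theta>:{0..1}|lborel. (\<Sum>i\<in>Basis. (h \<bullet> i) *\<^sub>R g i n (x + \<theta> *\<^sub>R h)))} \<in> sets ?N"
    proof -
      have "{n \<in> space ?N. norm (u n (x + h) - u n x - (LINT \<theta>:{0..1}|lborel. (\<Sum>i\<in>Basis. (h \<bullet> i) *\<^sub>R g i n (x + \<theta> *\<^sub>R h)))) \<le> 0} \<in> sets ?N"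
        by (intro borel_measurable_le borel_measurable_const measurable_compose[OF _ borel_measurable_norm] borel_measurable_diff um1 LM)
      then show ?thesis by simp
    qed
    fix s
    show "AE y in P. u (s, y) (x + h) - u (s, y) x = (LINT \<theta>:{0..1}|lborel. (\<Sum>i\<in>Basis. (h \<bullet> i) *\<^sub>R g i (s, y) (x + \<theta> *\<^sub>R h)))"
    \<comment> \<open>Dual boundedness is available for \<open>s\<close> in \<open>S\<close> only;
      elsewhere the indicator makes both sides vanish.\<close>
    proof (cases "s \<in> S")
      case False
      then show ?thesis by (simp add: u_def g_def set_lebesgue_integral_def)
    next
      case True
      have "AE y in distr P borel (Z s). b s (x + w s - y + h) - b s (x + w s - y) = (LINT \<theta>:{0..1}|lborel. (\<Sum>i\<in>Basis. (h \<bullet> i) *\<^sub>R v i s (x + w s - y + \<theta> *\<^sub>R h)))"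
        by (rule dual_bounded_AE_reflect[OF d[OF True] increment])
      from AE_distrD[OF Zs this] show ?thesis
      proof eventually_elim
        case (elim y)
        have 1: "x + w s - Z s y + k = x + k + w s - Z s y" for k by simp
        show ?case using elim True unfolding 1 by (simp add: u_def g_def)
      qed
    qed
  qed
  note mix = integral_gradient_mixture[OF sfN um gm eq iu gC]
  have C0: "0 \<le> K * (LINT s:S|lborel. \<beta> s)"
    unfolding set_lebesgue_integral_def using K nonneg(2) by (intro mult_nonneg_nonneg Bochner_Integration.integral_nonneg) auto
  define B where "B i x = (\<integral>n. g i n x \<partial>?N)" for i x
  have A: "(\<integral>n. u n z \<partial>?N) = (LINT s:S|lborel. (\<integral>y. b s (z + w s - Z s y) \<partial>P))" for z
  proof -
    have "(\<integral>n. u n z \<partial>?N) = (\<integral>s. \<integral>y. u (s, y) z \<partial>P \<partial>lborel)" by (rule Q.integral_fst'[symmetric, OF iu])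
    also have "\<dots> = (LINT s:S|lborel. (\<integral>y. b s (z + w s - Z s y) \<partial>P))"
      unfolding set_lebesgue_integral_def u_def by (simp only: fst_conv snd_conv integral_scaleR_right)
    finally show ?thesis .
  qed
  have tr: "- (LINT s:S|lborel. \<gamma> s) \<le> (\<Sum>i\<in>Basis. B i z \<bullet> i)" for z
  proof -
    have gi: "integrable ?N (\<lambda>n. g i n z)" if "i \<in> Basis" for i by (rule mix(3)[OF _ _ C0 that])
    have \<gamma>i: "integrable ?N (\<lambda>n. - (indicator S (fst n) *\<^sub>R \<gamma> (fst n)))"
    proof (intro integrable_minus integrableI_bounded)
      have [measurable]: "\<gamma> \<in> borel_measurable borel" using borel_measurable_integrable[OF int(3)] by simp
      have m\<gamma>: "(\<lambda>n. indicat_real S (fst n) *\<^sub>R \<gamma> (fst n)) \<in> borel_measurable ?N"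
        by (rule measurable_compose[OF mF, of "\<lambda>s. indicat_real S s *\<^sub>R \<gamma> s"]) measurable
      then show "(\<lambda>n. indicat_real S (fst n) *\<^sub>R \<gamma> (fst n)) \<in> borel_measurable ?N" .
      have "(\<integral>\<^sup>+n. ennreal (norm (indicat_real S (fst n) *\<^sub>R \<gamma> (fst n))) \<partial>?N) = (\<integral>\<^sup>+s. \<integral>\<^sup>+y. ennreal (norm (indicat_real S (fst (s, y)) *\<^sub>R \<gamma> (fst (s, y)))) \<partial>P \<partial>lborel)"
        by (rule M.nn_integral_fst[symmetric]) (rule measurable_compose[OF measurable_compose[OF m\<gamma> borel_measurable_norm] measurable_ennreal])
      also have "\<dots> = (\<integral>\<^sup>+s. ennreal (norm (indicat_real S s *\<^sub>R \<gamma> s)) \<partial>lborel)" by (simp add: M.emeasure_space_1)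
      also have "\<dots> < \<infinity>" using Sb(3) unfolding set_integrable_def integrable_iff_bounded by simp
      finally show "(\<integral>\<^sup>+n. ennreal (norm (indicat_real S (fst n) *\<^sub>R \<gamma> (fst n))) \<partial>?N) < \<infinity>" .
    qed
    have "- (LINT s:S|lborel. \<gamma> s) = (\<integral>s. \<integral>y. - (indicator S (fst (s, y)) *\<^sub>R \<gamma> (fst (s, y))) \<partial>P \<partial>lborel)"
      unfolding set_lebesgue_integral_def by (simp add: M.prob_space)
    also have "\<dots> = (\<integral>n. - (indicator S (fst n) *\<^sub>R \<gamma> (fst n)) \<partial>?N)" by (rule Q.integral_fst'[OF \<gamma>i])
    also have "\<dots> \<le> (\<integral>n. (\<Sum>i\<in>Basis. g i n z \<bullet> i) \<partial>?N)"
    proof (rule integral_mono_AE[OF \<gamma>i])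
      show ig: "integrable ?N (\<lambda>n. \<Sum>i\<in>Basis. g i n z \<bullet> i)" by (intro Bochner_Integration.integrable_sum integrable_inner_left gi)
      show "AE n in ?N. - (indicator S (fst n) *\<^sub>R \<gamma> (fst n)) \<le> (\<Sum>i\<in>Basis. g i n z \<bullet> i)"
      proof (rule AEs)
        show "{n \<in> space ?N. - (indicator S (fst n) *\<^sub>R \<gamma> (fst n)) \<le> (\<Sum>i\<in>Basis. g i n z \<bullet> i)} \<in> sets ?N"
          by (intro borel_measurable_le borel_measurable_integrable[OF \<gamma>i] borel_measurable_integrable[OF ig])
        fix s
        show "AE y in P. - (indicator S (fst (s, y)) *\<^sub>R \<gamma> (fst (s, y))) \<le> (\<Sum>i\<in>Basis. g i (s, y) z \<bullet> i)"
        proof (cases "s \<in> S")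
          case False then show ?thesis by (simp add: g_def)
        next
          case True
          have "AE y in distr P borel (Z s). - \<gamma> s \<le> (\<Sum>i\<in>Basis. v i s (z + w s - y) \<bullet> i)"
            by (rule dual_bounded_AE_reflect[OF d[OF True] trace])
          from AE_distrD[OF Zs this] show ?thesis by eventually_elim (use True in \<open>simp add: g_def\<close>)
        qed
      qed
    qed
    also have "\<dots> = (\<Sum>i\<in>Basis. \<integral>n. g i n z \<bullet> i \<partial>?N)" by (rule Bochner_Integration.integral_sum) (intro integrable_inner_left gi)
    also have "\<dots> = (\<Sum>i\<in>Basis. B i z \<bullet> i)" unfolding B_def by (intro sum.cong refl integral_inner_left gi)
    finally show ?thesis .
  qed
  have "integral_gradient (\<lambda>z. LINT s:S|lborel. (\<integral>y. b s (z + w s - Z s y) \<partial>P)) B"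
    unfolding A[symmetric] B_def by (rule mix(1)[OF _ _ C0])
  moreover have "norm (B i z) \<le> K * (LINT s:S|lborel. \<beta> s)" if "i \<in> Basis" for i z
    unfolding B_def by (rule mix(2)[OF _ _ C0 that])
  ultimately show ?thesis using tr by blast
qed

end

section \<open>Stability in the supremum norm\<close>

text \<open>Absolute continuity of the integral, uniformly in the position of the interval:
  truncated at height n, \<open>k\<close> contributes at most n (t - s), and the remainder is small
  in L^1.\<close>

lemma set_integral_interval_small:
  fixes k :: "real \<Rightarrow> real"
  assumes i: "integrable lborel k" and nn: "\<And>s. 0 \<le> k s" and e: "0 < \<epsilon>" and T: "0 < T"
  shows "\<exists>N0>0. \<forall>N\<ge>N0. \<forall>s t. s \<le> t \<longrightarrow> t - s \<le> T / real N \<longrightarrow> (LINT r:{s..t}|lborel. k r) \<le> \<epsilon>"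
proof -
  have mk[measurable]: "k \<in> borel_measurable borel" using borel_measurable_integrable[OF i] by simp
  have "(\<lambda>n. \<integral>r. k r - min (k r) (real n) \<partial>lborel) \<longlonglongrightarrow> (\<integral>r. 0 \<partial>(lborel :: real measure))"
  proof (rule integral_dominated_convergence[OF _ _ i])
    have "(\<lambda>n. k r - min (k r) (real n)) \<longlonglongrightarrow> 0" for r
    proof (rule tendsto_eventually)
      obtain N :: nat where "k r < real N" using reals_Archimedean2 by blast
      then have "k r - min (k r) (real n) = 0" if "N \<le> n" for n
      proof -
        have "real N \<le> real n" using that by simp
        then show ?thesis using \<open>k r < real N\<close> by linarith
      qed
      then show "\<forall>\<^sub>F n in sequentially. k r - min (k r) (real n) = 0" unfolding eventually_sequentially by blast
    qed
    then show "AE r in lborel. (\<lambda>n. k r - min (k r) (real n)) \<longlonglongrightarrow> 0" by simp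
    show "AE r in lborel. norm (k r - min (k r) (real n)) \<le> k r" for n using nn by (intro AE_I2) (simp add: min_def)
  qed measurable
  then have "(\<lambda>n. \<integral>r. k r - min (k r) (real n) \<partial>lborel) \<longlonglongrightarrow> 0" by simp
  from LIMSEQ_D[OF this, of "\<epsilon> / 2"] e
  obtain n0 where "\<And>n. n0 \<le> n \<Longrightarrow> norm ((\<integral>r. k r - min (k r) (real n) \<partial>lborel) - 0) < \<epsilon> / 2" by auto
  from this[of n0] obtain n where n: "\<bar>\<integral>r. k r - min (k r) (real n) \<partial>lborel\<bar> < \<epsilon> / 2" by auto
  have im: "integrable lborel (\<lambda>r. k r - min (k r) (real n))"
    by (rule Bochner_Integration.integrable_bound[OF i]) (auto intro!: AE_I2 simp: min_def nn)
  obtain N1 :: nat where N1: "2 * real n * T / \<epsilon> < real N1" using reals_Archimedean2 by blast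
  show ?thesis
  proof (intro exI[of _ "Suc N1"] conjI allI impI)
    fix N s t assume N: "Suc N1 \<le> N" and st: "s \<le> t" "t - s \<le> T / real N"
    have N': "real N1 \<le> real N" "0 < real N" using N by linarith+
    have "real n * (t - s) \<le> real n * (T / real N)" using st by (intro mult_left_mono) auto
    also have "\<dots> \<le> \<epsilon> / 2"
    proof -
      have "2 * real n * T / \<epsilon> \<le> real N" using N1 N' by linarith
      then show ?thesis using N' e by (simp add: field_simps)
    qed
    finally have small: "real n * (t - s) \<le> \<epsilon> / 2" .
    have "(LINT r:{s..t}|lborel. k r) \<le> (\<integral>r. (k r - min (k r) (real n)) + real n * indicator {s..t} r \<partial>lborel)"
      unfolding set_lebesgue_integral_def
    proof (rule Bochner_Integration.integral_mono)
      show "integrable lborel (\<lambda>r. indicator {s..t} r *\<^sub>R k r)" by (intro integrable_mult_indicator i) simp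
      show "integrable lborel (\<lambda>r. (k r - min (k r) (real n)) + real n * indicator {s..t} r)"
        by (intro Bochner_Integration.integrable_add im integrable_mult_right) (simp add: integrable_indicator_iff emeasure_lborel_Icc_eq)
      show "indicator {s..t} r *\<^sub>R k r \<le> (k r - min (k r) (real n)) + real n * indicator {s..t} r" for r
        using nn[of r] by (auto simp: indicator_def min_def)
    qed
    also have "\<dots> = (\<integral>r. k r - min (k r) (real n) \<partial>lborel) + real n * (t - s)"
      using st by (subst Bochner_Integration.integral_add[OF im]) (auto simp: integrable_indicator_iff emeasure_lborel_Icc_eq)
    also have "\<dots> \<le> \<epsilon>" using n small by linarith
    finally show "(LINT r:{s..t}|lborel. k r) \<le> \<epsilon>" .
  qed simp
qed

text \<open>Gronwall's inequality in a form whose hypothesis needs no measurability of the supremum over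
  \<^term>\<open>\<Omega>\<close>: the bounds \<^term>\<open>D1\<close> and \<^term>\<open>D2\<close> refer to the past and to a short current block.\<close>

lemma gronwall_blocks:
  fixes k :: "real \<Rightarrow> real"
  assumes i: "integrable lborel k" and nn: "\<And>s. 0 \<le> k s" and T: "0 < T"
  shows "\<exists>C\<ge>0. \<forall>(e :: real \<Rightarrow> 'w \<Rightarrow> real) \<Omega> a S. 0 \<le> a \<longrightarrow> (\<forall>t\<in>{0..T}. \<forall>\<omega>\<in>\<Omega>. e t \<omega> \<le> S) \<longrightarrow>
    (\<forall>s t D1 D2. 0 \<le> s \<longrightarrow> s \<le> t \<longrightarrow> t \<le> T \<longrightarrow> 0 \<le> D1 \<longrightarrow> 0 \<le> D2 \<longrightarrow>
      (\<forall>r\<in>{0..<s}. \<forall>\<omega>\<in>\<Omega>. e r \<omega> \<le> D1) \<longrightarrow> (\<forall>r\<in>{s..t}. \<forall>\<omega>\<in>\<Omega>. e r \<omega> \<le> D2) \<longrightarrow>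
      (\<forall>\<omega>\<in>\<Omega>. e t \<omega> \<le> a + D1 * (\<integral>r. k r \<partial>lborel) + D2 * (LINT r:{s..t}|lborel. k r))) \<longrightarrow>
    (\<forall>t\<in>{0..T}. \<forall>\<omega>\<in>\<Omega>. e t \<omega> \<le> C * a)"
proof -
  obtain N where N: "N > 0" "\<And>s t. s \<le> t \<Longrightarrow> t - s \<le> T / real N \<Longrightarrow> (LINT r:{s..t}|lborel. k r) \<le> 1 / 2"
    using set_integral_interval_small[OF i nn _ T, of "1/2"] by (auto intro: order_refl)
  define m where "m = (\<integral>r. k r \<partial>lborel)"
  have m: "0 \<le> m" unfolding m_def by (intro Bochner_Integration.integral_nonneg nn)
  have si: "0 \<le> (LINT r:{s..t}|lborel. k r)" for s t
    unfolding set_lebesgue_integral_def using nn by (intro Bochner_Integration.integral_nonneg) auto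
  \<comment> \<open>Constants for the successive blocks: \<open>block\<close> turns the bound c a on
    the past into 2 (1 + m c) a on the next block, and adding c keeps the sequence increasing. The
    initial value 2 belongs to an empty past.\<close>
  define c :: "nat \<Rightarrow> real" where "c = rec_nat 2 (\<lambda>_ x. 2 * (1 + m * x) + x)"
  have c0: "c 0 = 2" and cS: "c (Suc j) = 2 * (1 + m * c j) + c j" for j by (simp_all add: c_def)
  have cn: "0 \<le> c j" for j by (induction j) (auto simp: c0 cS m)
  show ?thesis
  proof (intro exI[of _ "c N"] conjI cn allI impI)
    fix e :: "real \<Rightarrow> 'w \<Rightarrow> real" and \<Omega> a S0
    assume a: "0 \<le> a" and S0: "\<forall>t\<in>{0..T}. \<forall>\<omega>\<in>\<Omega>. e t \<omega> \<le> S0"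
      and step: "\<forall>s t D1 D2. 0 \<le> s \<longrightarrow> s \<le> t \<longrightarrow> t \<le> T \<longrightarrow> 0 \<le> D1 \<longrightarrow> 0 \<le> D2 \<longrightarrow>
      (\<forall>r\<in>{0..<s}. \<forall>\<omega>\<in>\<Omega>. e r \<omega> \<le> D1) \<longrightarrow> (\<forall>r\<in>{s..t}. \<forall>\<omega>\<in>\<Omega>. e r \<omega> \<le> D2) \<longrightarrow>
      (\<forall>\<omega>\<in>\<Omega>. e t \<omega> \<le> a + D1 * (\<integral>r. k r \<partial>lborel) + D2 * (LINT r:{s..t}|lborel. k r))"
    define S where "S = max S0 0"
    have S: "0 \<le> S" "\<And>t \<omega>. t \<in> {0..T} \<Longrightarrow> \<omega> \<in> \<Omega> \<Longrightarrow> e t \<omega> \<le> S" using S0 by (auto simp: S_def le_max_iff_disj)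
    have stepm: "e t \<omega> \<le> a + D1 * m + D2 * (LINT r:{s..t}|lborel. k r)"
      if "0 \<le> s" "s \<le> t" "t \<le> T" "0 \<le> D1" "0 \<le> D2" "\<forall>r\<in>{0..<s}. \<forall>\<omega>\<in>\<Omega>. e r \<omega> \<le> D1"
        "\<forall>r\<in>{s..t}. \<forall>\<omega>\<in>\<Omega>. e r \<omega> \<le> D2" "\<omega> \<in> \<Omega>" for s t D1 D2 \<omega>
      unfolding m_def using step that by blast
    have block: "e t \<omega> \<le> 2 * (1 + m * c') * a"
      if s: "0 \<le> s" "s \<le> t" "t \<le> T" "t - s \<le> T / real N" and c': "0 \<le> c'" and past: "\<And>r \<omega>. r \<in> {0..<s} \<Longrightarrow> \<omega> \<in> \<Omega> \<Longrightarrow> e r \<omega> \<le> c' * a"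
        and w: "\<omega> \<in> \<Omega>" for s t c' \<omega>
    proof -
      \<comment> \<open>As \<open>k\<close> has integral at most 1/2 on the block, each application
        of the hypothesis halves the contribution of the a priori bound \<open>S\<close>, of which
        only finiteness matters.\<close>
      have it: "\<forall>r\<in>{s..t}. \<forall>\<omega>\<in>\<Omega>. e r \<omega> \<le> 2 * (1 + m * c') * a + S / 2 ^ n" for n
      proof (induction n)
        case 0
        have "0 \<le> 2 * (1 + m * c') * a" using m c' a by simp
        moreover have "e r \<omega> \<le> S" if "r \<in> {s..t}" "\<omega> \<in> \<Omega>" for r \<omega> using S(2)[of r \<omega>] s that by auto
        ultimately show ?case by (auto intro: add_increasing)
      next
        case (Suc n)
        show ?case
        proof (intro ballI)
          fix r \<omega> assume r: "r \<in> {s..t}" and w: "\<omega> \<in> \<Omega>"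
          let ?D2 = "2 * (1 + m * c') * a + S / 2 ^ n"
          have D2: "0 \<le> ?D2" using m c' a S by simp
          have "e r \<omega> \<le> a + (c' * a) * m + ?D2 * (LINT x:{s..r}|lborel. k x)"
          proof (rule stepm[of s r])
            show "\<forall>r\<in>{0..<s}. \<forall>\<omega>\<in>\<Omega>. e r \<omega> \<le> c' * a" using past by blast
            show "\<forall>r\<in>{s..r}. \<forall>\<omega>\<in>\<Omega>. e r \<omega> \<le> ?D2"
            proof (intro ballI)
              fix x \<omega>' assume "x \<in> {s..r}" "\<omega>' \<in> \<Omega>"
              then show "e x \<omega>' \<le> ?D2" using r by (intro Suc[rule_format]) simp_all
            qed
          qed (use s r w D2 c' a in simp_all)
          also have "\<dots> \<le> a + (c' * a) * m + ?D2 * (1 / 2)"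
            using r s D2 by (intro add_left_mono mult_left_mono N) auto
          also have "\<dots> = 2 * (1 + m * c') * a + S / 2 ^ Suc n" by (simp add: algebra_simps)
          finally show "e r \<omega> \<le> 2 * (1 + m * c') * a + S / 2 ^ Suc n" .
        qed
      qed
      have L: "(\<lambda>n. 2 * (1 + m * c') * a + S * (1 / 2) ^ n) \<longlonglongrightarrow> 2 * (1 + m * c') * a + S * 0"
        by (intro tendsto_add tendsto_mult tendsto_const LIMSEQ_realpow_zero) simp_all
      have le: "e t \<omega> \<le> 2 * (1 + m * c') * a + S * (1 / 2) ^ n" for n
      proof -
        have "e t \<omega> \<le> 2 * (1 + m * c') * a + S / 2 ^ n" by (rule it[of n, rule_format]) (use s w in simp_all)
        also have "S / 2 ^ n = S * (1 / 2) ^ n" by (simp only: power_one_over) simp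
        finally show ?thesis .
      qed
      have "e t \<omega> \<le> 2 * (1 + m * c') * a + S * 0" by (rule LIMSEQ_le_const[OF L]) (use le in blast)
      then show ?thesis by simp
    qed
    have main: "\<forall>t\<in>{0..real j * T / real N}. \<forall>\<omega>\<in>\<Omega>. e t \<omega> \<le> c j * a" if "j \<le> N" for j
      using that
    proof (induction j)
      case 0
      show ?case
      proof (intro ballI)
        fix t \<omega> assume t: "t \<in> {0..real 0 * T / real N}" and w: "\<omega> \<in> \<Omega>"
        then have t0: "t = 0" by simp
        have "e 0 \<omega> \<le> 2 * (1 + m * 0) * a" by (rule block[where s=0]) (use T w N in auto)
        then show "e t \<omega> \<le> c 0 * a" by (simp add: c0 t0)
      qed
    next
      case (Suc j)
      let ?s = "real j * T / real N"
      have s: "0 \<le> ?s" "?s \<le> T" using T N Suc.prems by (auto simp: field_simps)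
      have past: "e r \<omega> \<le> c j * a" if "r \<in> {0..?s}" "\<omega> \<in> \<Omega>" for r \<omega> using Suc that by auto
      have past': "e r \<omega> \<le> c j * a" if "r \<in> {0..<?s}" "\<omega> \<in> \<Omega>" for r \<omega> using past that by auto
      show ?case
      proof (intro ballI)
        fix t \<omega> assume t: "t \<in> {0..real (Suc j) * T / real N}" and w: "\<omega> \<in> \<Omega>"
        show "e t \<omega> \<le> c (Suc j) * a"
        proof (cases "t \<le> ?s")
          case True
          then have "e t \<omega> \<le> c j * a" using past t w by auto
          also have "\<dots> \<le> c (Suc j) * a" using a m cn[of j] by (intro mult_right_mono) (auto simp: cS)
          finally show ?thesis .
        next
          case False
          have "real (Suc j) * T \<le> real N * T" using Suc.prems T by (intro mult_right_mono) simp_all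
          then have "real (Suc j) * T / real N \<le> T" using N(1) by (simp add: pos_divide_le_eq mult.commute)
          moreover have "real (Suc j) * T / real N - ?s = T / real N" by (simp add: add_divide_distrib distrib_right)
          ultimately have "e t \<omega> \<le> 2 * (1 + m * c j) * a" using t False s by (intro block[OF s(1) _ _ _ cn past' w]) auto
          also have "\<dots> \<le> c (Suc j) * a" using a cn[of j] by (intro mult_right_mono) (auto simp: cS)
          finally show ?thesis .
        qed
      qed
    qed
    show "\<forall>t\<in>{0..T}. \<forall>\<omega>\<in>\<Omega>. e t \<omega> \<le> c N * a" using main[of N] N by simp
  qed
qed

lemma norm_diff_split:
  fixes x1 :: "'a::real_normed_vector"
  assumes "norm (x1 - y - i1) \<le> a" "norm (x2 - y - i2) \<le> a"
  shows "norm (x1 - x2) \<le> 2 * a + norm (i1 - i2)"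
proof -
  have "norm (x1 - x2) = norm (((x1 - y - i1) - (x2 - y - i2)) + (i1 - i2))" by simp
  then show ?thesis
    using norm_triangle_ineq[of "(x1 - y - i1) - (x2 - y - i2)" "i1 - i2"]
      norm_triangle_ineq4[of "x1 - y - i1" "x2 - y - i2"] assms by linarith
qed

context sobolev_drift
begin

definition drift :: "'w measure \<Rightarrow> (real \<Rightarrow> 'w \<Rightarrow> 'a) \<Rightarrow> real \<Rightarrow> 'a \<Rightarrow> 'a" where
  "drift P X s x = (\<integral>y. b s (x - X s y) \<partial>P)"

text \<open>Solutions with input \<open>Y\<close> up to an error \<open>a\<close>, at every point of
  \<open>\<Omega>\<close> instead of almost surely, so that one can work with bounds uniform over
  \<open>\<Omega>\<close>. The drift is formed with the law of \<open>X\<close> itself. Euler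
  schemes satisfy this with small \<open>a\<close>, exact solutions with
  \<open>a = 0\<close>.\<close>

definition approx_solution ::
    "real \<Rightarrow> 'w measure \<Rightarrow> 'w set \<Rightarrow> real \<Rightarrow> real \<Rightarrow> (real \<Rightarrow> 'w \<Rightarrow> 'a) \<Rightarrow> (real \<Rightarrow> 'w \<Rightarrow> 'a) \<Rightarrow> bool" where
  "approx_solution T P \<Omega> K a Y X \<longleftrightarrow>
    (\<forall>s\<in>{0..T}. X s \<in> borel_measurable P \<and> dual_bounded q K (distr P borel (X s))) \<and>
    (\<forall>\<omega>\<in>\<Omega>. set_borel_measurable lborel {0..T} (\<lambda>s. drift P X s (X s \<omega>))) \<and>
    (\<forall>\<omega>\<in>\<Omega>. \<forall>t\<in>{0..T}. norm (X t \<omega> - Y t \<omega> - (LINT s:{0..t}|lborel. drift P X s (X s \<omega>))) \<le> a)"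

lemma approx_solution_drift:
  assumes P: "prob_space P" and K: "0 \<le> K" and ap: "approx_solution T P \<Omega> K a Y X" and w: "\<omega> \<in> \<Omega>"
  shows "\<And>s. s \<in> {0..T} \<Longrightarrow> norm (drift P X s x) \<le> K * \<alpha> s"
    and "\<And>t. t \<le> T \<Longrightarrow> set_integrable lborel {0..t} (\<lambda>s. drift P X s (X s \<omega>))"
    and "\<And>t. t \<le> T \<Longrightarrow> norm (LINT s:{0..t}|lborel. drift P X s (X s \<omega>)) \<le> K * (\<integral>s. \<alpha> s \<partial>lborel)"
proof -
  show le: "norm (drift P X s x) \<le> K * \<alpha> s" if "s \<in> {0..T}" for s x
    using ap that unfolding drift_def approx_solution_def by (intro b_convolution_integrable(2) P K) auto
  show i: "set_integrable lborel {0..t} (\<lambda>s. drift P X s (X s \<omega>))" if t: "t \<le> T" for t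
  proof -
    have m: "(\<lambda>s. indicator {0..T} s *\<^sub>R drift P X s (X s \<omega>)) \<in> borel_measurable lborel"
      using ap w unfolding approx_solution_def set_borel_measurable_def by auto
    have "(\<lambda>s. indicator {0..t} s *\<^sub>R (indicator {0..T} s *\<^sub>R drift P X s (X s \<omega>))) \<in> borel_measurable lborel"
      by (rule borel_measurable_scaleR[OF _ m]) simp
    moreover have "(\<lambda>s. indicator {0..t} s *\<^sub>R (indicator {0..T} s *\<^sub>R drift P X s (X s \<omega>))) = (\<lambda>s. indicator {0..t} s *\<^sub>R drift P X s (X s \<omega>))"
      using t by (auto simp: indicator_def fun_eq_iff)
    ultimately have m': "(\<lambda>s. indicator {0..t} s *\<^sub>R drift P X s (X s \<omega>)) \<in> borel_measurable lborel" by simp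
    show ?thesis unfolding set_integrable_def
    proof (rule Bochner_Integration.integrable_bound[OF _ m'])
      show "integrable lborel (\<lambda>s. K * \<alpha> s)" by (intro integrable_mult_right int)
      have "norm (indicator {0..t} s *\<^sub>R drift P X s (X s \<omega>)) \<le> norm (K * \<alpha> s)" for s
        using le[of s] t K nonneg(1)[of s] by (cases "s \<in> {0..t}") auto
      then show "AE s in lborel. norm (indicator {0..t} s *\<^sub>R drift P X s (X s \<omega>)) \<le> norm (K * \<alpha> s)" by simp
    qed
  qed
  show "norm (LINT s:{0..t}|lborel. drift P X s (X s \<omega>)) \<le> K * (\<integral>s. \<alpha> s \<partial>lborel)" if t: "t \<le> T" for t
  proof -
    have "norm (LINT s:{0..t}|lborel. drift P X s (X s \<omega>)) \<le> (\<integral>s. K * \<alpha> s \<partial>lborel)"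
      unfolding set_lebesgue_integral_def
    proof (rule Bochner_Integration.integral_norm_bound_integral)
      show "integrable lborel (\<lambda>s. indicator {0..t} s *\<^sub>R drift P X s (X s \<omega>))" using i[OF t] unfolding set_integrable_def .
      show "integrable lborel (\<lambda>s. K * \<alpha> s)" by (intro integrable_mult_right int)
      show "norm (indicator {0..t} s *\<^sub>R drift P X s (X s \<omega>)) \<le> K * \<alpha> s" for s
        using le[of s] t K nonneg(1)[of s] by (cases "s \<in> {0..t}") auto
    qed
    then show ?thesis by simp
  qed
qed

text \<open>By \<open>drift_difference_le\<close> the drifts at time r differ by at most
  \<open>k r\<close> times a uniform bound on the distance at time r, which is the input for
  Gronwall. \<open>C\<close> depends on none of \<open>P\<close>, \<open>\<Omega>\<close>,
  \<open>Y\<close> and \<open>a\<close>: with \<open>a = 0\<close> this is uniqueness, and with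
  \<open>a\<close> tending to 0 it makes the Euler schemes a Cauchy sequence.\<close>

lemma approx_solution_stability:
  assumes K: "0 \<le> K" and T: "0 < T"
  shows "\<exists>C\<ge>0. \<forall>(P :: 'w measure) \<Omega> a Y X1 X2. prob_space P \<longrightarrow> (AE \<omega> in P. \<omega> \<in> \<Omega>) \<longrightarrow> 0 \<le> a \<longrightarrow>
    approx_solution T P \<Omega> K a Y X1 \<longrightarrow> approx_solution T P \<Omega> K a Y X2 \<longrightarrow>
    (\<forall>t\<in>{0..T}. \<forall>\<omega>\<in>\<Omega>. norm (X1 t \<omega> - X2 t \<omega>) \<le> C * a)"
proof -
  define k where "k s = K * drift_const * \<beta> s" for s
  have k: "integrable lborel k" "\<And>s. 0 \<le> k s"
    unfolding k_def using K drift_const_nonneg nonneg(2) int by auto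
  obtain C where CC: "0 \<le> C \<and> (\<forall>(e :: real \<Rightarrow> 'w \<Rightarrow> real) \<Omega> a S. 0 \<le> a \<longrightarrow> (\<forall>t\<in>{0..T}. \<forall>\<omega>\<in>\<Omega>. e t \<omega> \<le> S) \<longrightarrow>
    (\<forall>s t D1 D2. 0 \<le> s \<longrightarrow> s \<le> t \<longrightarrow> t \<le> T \<longrightarrow> 0 \<le> D1 \<longrightarrow> 0 \<le> D2 \<longrightarrow>
      (\<forall>r\<in>{0..<s}. \<forall>\<omega>\<in>\<Omega>. e r \<omega> \<le> D1) \<longrightarrow> (\<forall>r\<in>{s..t}. \<forall>\<omega>\<in>\<Omega>. e r \<omega> \<le> D2) \<longrightarrow>
      (\<forall>\<omega>\<in>\<Omega>. e t \<omega> \<le> a + D1 * (\<integral>r. k r \<partial>lborel) + D2 * (LINT r:{s..t}|lborel. k r))) \<longrightarrow>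
    (\<forall>t\<in>{0..T}. \<forall>\<omega>\<in>\<Omega>. e t \<omega> \<le> C * a))"
    by (rule exE[OF gronwall_blocks[OF k T, where 'w='w]])
  note C = CC[THEN conjunct1]
  note gr = CC[THEN conjunct2, THEN spec, THEN spec, THEN spec, THEN spec, THEN mp, THEN mp, THEN mp]
  show ?thesis
  proof (intro exI[of _ "C * 2"] conjI allI impI)
    show "0 \<le> C * 2" using C by simp
    fix P :: "'w measure" and \<Omega> a Y X1 X2
    assume P: "prob_space P" and AE\<Omega>: "AE \<omega> in P. \<omega> \<in> \<Omega>" and a: "0 \<le> a"
      and ap1: "approx_solution T P \<Omega> K a Y X1" and ap2: "approx_solution T P \<Omega> K a Y X2"
    let ?d1 = "\<lambda>\<omega> s. drift P X1 s (X1 s \<omega>)" and ?d2 = "\<lambda>\<omega> s. drift P X2 s (X2 s \<omega>)"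
    have split: "norm (X1 t \<omega> - X2 t \<omega>) \<le> 2 * a + norm ((LINT s:{0..t}|lborel. ?d1 \<omega> s) - (LINT s:{0..t}|lborel. ?d2 \<omega> s))"
      if "t \<in> {0..T}" "\<omega> \<in> \<Omega>" for t \<omega>
    proof -
      have r: "norm (X1 t \<omega> - Y t \<omega> - (LINT s:{0..t}|lborel. ?d1 \<omega> s)) \<le> a" "norm (X2 t \<omega> - Y t \<omega> - (LINT s:{0..t}|lborel. ?d2 \<omega> s)) \<le> a"
        using ap1 ap2 that unfolding approx_solution_def by auto
      show ?thesis by (rule norm_diff_split[OF r])
    qed
    have "\<forall>t\<in>{0..T}. \<forall>\<omega>\<in>\<Omega>. norm (X1 t \<omega> - X2 t \<omega>) \<le> C * (2 * a)"
    proof (rule gr)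
      \<comment> \<open>The a priori bound for Gronwall: whatever the paths are, the norm of either
        drift is at most \<open>K * \<alpha> s\<close>.\<close>
      show "\<forall>t\<in>{0..T}. \<forall>\<omega>\<in>\<Omega>. norm (X1 t \<omega> - X2 t \<omega>) \<le> 2 * a + 2 * (K * (\<integral>s. \<alpha> s \<partial>lborel))"
      proof (intro ballI)
        fix t \<omega> assume t: "t \<in> {0..T}" and w: "\<omega> \<in> \<Omega>"
        have "norm ((LINT s:{0..t}|lborel. ?d1 \<omega> s) - (LINT s:{0..t}|lborel. ?d2 \<omega> s)) \<le> norm (LINT s:{0..t}|lborel. ?d1 \<omega> s) + norm (LINT s:{0..t}|lborel. ?d2 \<omega> s)"
          by (rule norm_triangle_ineq4)
        then show "norm (X1 t \<omega> - X2 t \<omega>) \<le> 2 * a + 2 * (K * (\<integral>s. \<alpha> s \<partial>lborel))"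
          using split[OF t w] approx_solution_drift(3)[OF P K ap1 w, of t] approx_solution_drift(3)[OF P K ap2 w, of t] t by simp
      qed
      show "\<forall>s t D1 D2. 0 \<le> s \<longrightarrow> s \<le> t \<longrightarrow> t \<le> T \<longrightarrow> 0 \<le> D1 \<longrightarrow> 0 \<le> D2 \<longrightarrow>
        (\<forall>r\<in>{0..<s}. \<forall>\<omega>\<in>\<Omega>. norm (X1 r \<omega> - X2 r \<omega>) \<le> D1) \<longrightarrow> (\<forall>r\<in>{s..t}. \<forall>\<omega>\<in>\<Omega>. norm (X1 r \<omega> - X2 r \<omega>) \<le> D2) \<longrightarrow>
        (\<forall>\<omega>\<in>\<Omega>. norm (X1 t \<omega> - X2 t \<omega>) \<le> 2 * a + D1 * (\<integral>r. k r \<partial>lborel) + D2 * (LINT r:{s..t}|lborel. k r))"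
      proof (intro allI impI ballI)
        fix s t D1 D2 \<omega>
        assume st: "0 \<le> s" "s \<le> t" "t \<le> T" and D: "0 \<le> D1" "0 \<le> D2"
          and b1: "\<forall>r\<in>{0..<s}. \<forall>\<omega>\<in>\<Omega>. norm (X1 r \<omega> - X2 r \<omega>) \<le> D1" and b2: "\<forall>r\<in>{s..t}. \<forall>\<omega>\<in>\<Omega>. norm (X1 r \<omega> - X2 r \<omega>) \<le> D2"
          and w: "\<omega> \<in> \<Omega>"
        have diff: "norm (?d1 \<omega> r - ?d2 \<omega> r) \<le> D * k r"
          if r: "r \<in> {0..T}" "0 \<le> D" "\<forall>\<omega>\<in>\<Omega>. norm (X1 r \<omega> - X2 r \<omega>) \<le> D" for r D
        proof -
          have "norm (?d1 \<omega> r - ?d2 \<omega> r) \<le> K * drift_const * D * \<beta> r"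
            unfolding drift_def
          proof (rule drift_difference_le[OF P _ _ _ _ K r(2)])
            show "AE \<omega> in P. norm (X1 r \<omega> - X2 r \<omega>) \<le> D" using AE\<Omega> r(3) by (auto elim!: eventually_mono)
            show "norm (X1 r \<omega> - X2 r \<omega>) \<le> D" using r(3) w by blast
          qed (use ap1 ap2 r(1) in \<open>auto simp: approx_solution_def\<close>)
          then show ?thesis by (simp add: k_def mult_ac)
        qed
        have "(LINT s:{0..t}|lborel. ?d1 \<omega> s) - (LINT s:{0..t}|lborel. ?d2 \<omega> s) = (LINT s:{0..t}|lborel. ?d1 \<omega> s - ?d2 \<omega> s)"
          using st by (intro set_integral_diff(2)[symmetric] approx_solution_drift(2)[OF P K ap1 w] approx_solution_drift(2)[OF P K ap2 w]) auto
        \<comment> \<open>The majorant with \<open>D1\<close> is extended to all times, as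
          \<open>k\<close> is nonnegative and the hypothesis of Gronwall contains its total
          integral.\<close>
        also have "norm \<dots> \<le> (\<integral>r. D1 * k r + D2 * (indicator {s..t} r *\<^sub>R k r) \<partial>lborel)"
          unfolding set_lebesgue_integral_def
        proof (rule Bochner_Integration.integral_norm_bound_integral)
          have "set_integrable lborel {0..t} (\<lambda>s. ?d1 \<omega> s - ?d2 \<omega> s)"
            using st by (intro set_integral_diff(1) approx_solution_drift(2)[OF P K ap1 w] approx_solution_drift(2)[OF P K ap2 w]) auto
          then show "integrable lborel (\<lambda>r. indicator {0..t} r *\<^sub>R (?d1 \<omega> r - ?d2 \<omega> r))" unfolding set_integrable_def .
          have "integrable lborel (\<lambda>r. indicator {s..t} r *\<^sub>R k r)" by (intro integrable_mult_indicator k) simp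
          then show "integrable lborel (\<lambda>r. D1 * k r + D2 * (indicator {s..t} r *\<^sub>R k r))"
            by (intro Bochner_Integration.integrable_add integrable_mult_right k(1))
          fix r
          show "norm (indicator {0..t} r *\<^sub>R (?d1 \<omega> r - ?d2 \<omega> r)) \<le> D1 * k r + D2 * (indicator {s..t} r *\<^sub>R k r)"
          proof (cases "r \<in> {0..t}")
            case False
            then show ?thesis using D k(2)[of r] by simp
          next
            case True
            show ?thesis
            proof (cases "r < s")
              case True
              then have "norm (?d1 \<omega> r - ?d2 \<omega> r) \<le> D1 * k r" using b1 D st \<open>r \<in> {0..t}\<close> by (intro diff) auto
              then show ?thesis using \<open>r \<in> {0..t}\<close> True by simp
            next
              case False
              then have "norm (?d1 \<omega> r - ?d2 \<omega> r) \<le> D2 * k r" using b2 D st \<open>r \<in> {0..t}\<close> by (intro diff) auto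
              moreover have "0 \<le> D1 * k r" using D k(2) by simp
              ultimately show ?thesis using \<open>r \<in> {0..t}\<close> False by simp
            qed
          qed
        qed
        also have "\<dots> = D1 * (\<integral>r. k r \<partial>lborel) + D2 * (LINT r:{s..t}|lborel. k r)"
        proof -
          have "integrable lborel (\<lambda>r. indicator {s..t} r *\<^sub>R k r)" by (intro integrable_mult_indicator k) simp
          then show ?thesis unfolding set_lebesgue_integral_def using k(1) by simp
        qed
        finally show "norm (X1 t \<omega> - X2 t \<omega>) \<le> 2 * a + D1 * (\<integral>r. k r \<partial>lborel) + D2 * (LINT r:{s..t}|lborel. k r)"
          using split[of t \<omega>] st w by auto
      qed
    qed (use a in simp)
    then show "\<forall>t\<in>{0..T}. \<forall>\<omega>\<in>\<Omega>. norm (X1 t \<omega> - X2 t \<omega>) \<le> C * 2 * a" by (simp add: mult.assoc)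
  qed
qed

end

section \<open>The Euler scheme\<close>

definition add_path :: "real \<Rightarrow> 'a \<Rightarrow> (real \<Rightarrow> 'a) \<Rightarrow> real \<Rightarrow> 'a::euclidean_space" where
  "add_path T x w = (\<lambda>t\<in>{0..T}. x + w t)"

text \<open>The law of the path \<xi> + W for independent \<xi> and W. Path space with this law is
  the canonical probability space on which the scheme and its limit are built.\<close>

definition input_law :: "real \<Rightarrow> ('a \<Rightarrow> real) \<Rightarrow> (real \<Rightarrow> 'a) measure \<Rightarrow> (real \<Rightarrow> 'a::euclidean_space) measure" where
  "input_law T \<rho> \<nu> = distr (density lborel \<rho> \<Otimes>\<^sub>M \<nu>) (path_borel T) (\<lambda>(x, w). add_path T x w)"

lemma add_path_space: "w \<in> space (path_borel T) \<Longrightarrow> add_path T x w \<in> space (path_borel T)"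
proof -
  assume w: "w \<in> space (path_borel T)"
  have "continuous_on {0..T} (\<lambda>t. x + w t)" using w by (auto simp: space_path_borel intro!: continuous_intros)
  moreover have "continuous_on {0..T} (add_path T x w) \<longleftrightarrow> continuous_on {0..T} (\<lambda>t. x + w t)"
    by (rule continuous_on_cong) (auto simp: add_path_def)
  ultimately show "add_path T x w \<in> space (path_borel T)" by (simp add: space_path_borel add_path_def)
qed

lemma add_path_measurable:
  assumes T: "0 \<le> T" and f: "f \<in> borel_measurable M" and g: "g \<in> M \<rightarrow>\<^sub>M path_borel T"
  shows "(\<lambda>\<omega>. add_path T (f \<omega>) (g \<omega>)) \<in> M \<rightarrow>\<^sub>M path_borel T"
proof (rule measurable_path_borelI[OF T])
  show "add_path T (f \<omega>) (g \<omega>) \<in> space (path_borel T)" if "\<omega> \<in> space M" for \<omega>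
    using measurable_space[OF g that] by (rule add_path_space)
  fix t assume t: "t \<in> {0..T}"
  have "(\<lambda>\<omega>. f \<omega> + g \<omega> t) \<in> borel_measurable M"
    using measurable_compose[OF g measurable_eval_path[OF T]] f by (rule borel_measurable_add[rotated])
  then show "(\<lambda>\<omega>. add_path T (f \<omega>) (g \<omega>) t) \<in> borel_measurable M" using t by (simp add: add_path_def)
qed

locale particle_input =
  fixes T B :: real and p :: ennreal and \<rho> :: "'a::euclidean_space \<Rightarrow> real" and \<nu> :: "(real \<Rightarrow> 'a) measure"
  assumes T: "0 < T"
    and \<rho>m: "\<rho> \<in> borel_measurable borel" and \<rho>nn: "\<And>x. 0 \<le> \<rho> x" and \<rho>1: "(\<integral>\<^sup>+x. ennreal (\<rho> x) \<partial>lborel) = 1"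
    and \<rho>p: "Lp_norm lborel p \<rho> \<le> ennreal B"
    and \<nu>: "prob_space \<nu>" "sets \<nu> = sets (path_borel T)"
begin

abbreviation "tclamp s \<equiv> max 0 (min T s)"
abbreviation "law \<equiv> input_law T \<rho> \<nu>"

lemma tclamp_mem: "tclamp s \<in> {0..T}" using T by auto

lemma tclamp_id: "s \<in> {0..T} \<Longrightarrow> tclamp s = s" by auto

lemma space_\<nu>: "space \<nu> = space (path_borel T)" using \<nu>(2) by (rule sets_eq_imp_space_eq)

lemma sets_law[simp]: "sets law = sets (path_borel T)" by (simp add: input_law_def)
lemma space_law[simp]: "space law = space (path_borel T)" by (simp add: input_law_def)

lemma measurable_law: "f \<in> path_borel T \<rightarrow>\<^sub>M N \<Longrightarrow> f \<in> law \<rightarrow>\<^sub>M N"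
  by (simp add: measurable_def)

lemma prob_density: "prob_space (density lborel \<rho>)"
  by (rule prob_spaceI) (use \<rho>m \<rho>1 in \<open>simp add: emeasure_density\<close>)

lemma add_path_joint: "(\<lambda>(x, w). add_path T x w) \<in> density lborel \<rho> \<Otimes>\<^sub>M \<nu> \<rightarrow>\<^sub>M path_borel T"
  unfolding case_prod_beta
proof (rule add_path_measurable)
  show "snd \<in> density lborel \<rho> \<Otimes>\<^sub>M \<nu> \<rightarrow>\<^sub>M path_borel T" using \<nu>(2) by (simp add: measurable_cong_sets[OF refl \<nu>(2)[symmetric]])
qed (use T in auto)

lemma prob_law: "prob_space law"
proof -
  interpret A: prob_space "density lborel \<rho>" by (rule prob_density)
  interpret B: prob_space \<nu> by (rule \<nu>)
  interpret AB: pair_prob_space "density lborel \<rho>" \<nu> ..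
  show ?thesis unfolding input_law_def by (rule AB.prob_space_distr[OF add_path_joint])
qed

text \<open>Freezing the noise: the inner integral runs over the starting point alone, where the
  density \<rho> is available.\<close>

lemma nn_integral_law:
  assumes f: "f \<in> borel_measurable (path_borel T)"
  shows "(\<integral>\<^sup>+y. f y \<partial>law) = (\<integral>\<^sup>+w. (\<integral>\<^sup>+x. f (add_path T x w) * ennreal (\<rho> x) \<partial>lborel) \<partial>\<nu>)"
proof -
  interpret A: prob_space "density lborel \<rho>" by (rule prob_density)
  interpret B: prob_space \<nu> by (rule \<nu>)
  interpret AB: pair_prob_space "density lborel \<rho>" \<nu> ..
  have m: "(\<lambda>(x, w). f (add_path T x w)) \<in> borel_measurable (density lborel \<rho> \<Otimes>\<^sub>M \<nu>)"
    using measurable_compose[OF add_path_joint f] by (simp add: case_prod_beta)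
  have "(\<integral>\<^sup>+y. f y \<partial>law) = (\<integral>\<^sup>+z. (\<lambda>(x, w). f (add_path T x w)) z \<partial>(density lborel \<rho> \<Otimes>\<^sub>M \<nu>))"
    unfolding input_law_def by (subst nn_integral_distr[OF add_path_joint]) (use f in \<open>auto simp: case_prod_unfold\<close>)
  also have "\<dots> = (\<integral>\<^sup>+w. (\<integral>\<^sup>+x. f (add_path T x w) \<partial>density lborel \<rho>) \<partial>\<nu>)"
    by (simp only: AB.nn_integral_snd[OF m, symmetric] prod.case)
  also have "\<dots> = (\<integral>\<^sup>+w. (\<integral>\<^sup>+x. f (add_path T x w) * ennreal (\<rho> x) \<partial>lborel) \<partial>\<nu>)"
  proof (rule nn_integral_cong)
    fix w assume w: "w \<in> space \<nu>"
    have "(\<lambda>x. f (add_path T x w)) \<in> borel_measurable lborel"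
      using T w by (intro measurable_compose[OF add_path_measurable f]) (auto simp: space_\<nu>)
    then show "(\<integral>\<^sup>+x. f (add_path T x w) \<partial>density lborel \<rho>) = (\<integral>\<^sup>+x. f (add_path T x w) * ennreal (\<rho> x) \<partial>lborel)"
      using \<rho>m by (subst nn_integral_density) (auto simp: mult.commute)
  qed
  finally show ?thesis .
qed

text \<open>\<open>V\<close> is the displacement due to the drift. For frozen noise \<open>w\<close>
  the position is obtained from the starting point x by the map that adds the displacement, followed
  by the translation by w(s); translations preserve volume, so the constant is that of the first
  map.\<close>

lemma mixture_bounded_law:
  assumes V: "V \<in> borel_measurable (path_borel T)" and L: "0 \<le> \<Lambda>"
    and c: "\<And>w. w \<in> space (path_borel T) \<Longrightarrow> compresses \<Lambda> (\<lambda>x. x + V (add_path T x w))"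
  shows "mixture_bounded p B \<Lambda> \<rho> (distr law borel (\<lambda>y. V y + y (tclamp s)))"
proof (rule mixture_boundedI[OF _ _ L \<nu>(1) \<rho>m \<rho>nn \<rho>1 \<rho>p])
  have T0: "0 \<le> T" using T by simp
  have m: "(\<lambda>y. V y + y (tclamp s)) \<in> borel_measurable (path_borel T)"
    using V measurable_eval_path[OF T0] by (rule borel_measurable_add)
  show "prob_space (distr law borel (\<lambda>y. V y + y (tclamp s)))"
    using measurable_law[OF m] by (intro prob_space.prob_space_distr prob_law)
  show "sets (distr law borel (\<lambda>y. V y + y (tclamp s))) = sets borel" by simp
  show "compresses \<Lambda> (\<lambda>x. x + V (add_path T x w) + w (tclamp s))" if "w \<in> space \<nu>" for w
    using compresses_compose[OF c[of w] compresses_translate[of "w (tclamp s)"]] that L by (simp add: space_\<nu>)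
  fix f :: "'a \<Rightarrow> ennreal" assume f: "f \<in> borel_measurable borel"
  have "(\<integral>\<^sup>+x. f x \<partial>distr law borel (\<lambda>y. V y + y (tclamp s))) = (\<integral>\<^sup>+y. f (V y + y (tclamp s)) \<partial>law)"
    using f by (intro nn_integral_distr[OF measurable_law[OF m]]) simp
  also have "\<dots> = (\<integral>\<^sup>+w. (\<integral>\<^sup>+x. f (V (add_path T x w) + add_path T x w (tclamp s)) * ennreal (\<rho> x) \<partial>lborel) \<partial>\<nu>)"
    by (rule nn_integral_law[OF measurable_compose[OF m f]])
  also have "\<dots> = (\<integral>\<^sup>+w. (\<integral>\<^sup>+x. f (x + V (add_path T x w) + w (tclamp s)) * ennreal (\<rho> x) \<partial>lborel) \<partial>\<nu>)"
  proof -
    have "V (add_path T x w) + add_path T x w (tclamp s) = x + V (add_path T x w) + w (tclamp s)" for x w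
      using tclamp_mem[of s] by (simp add: add_path_def)
    then show ?thesis by (simp only:)
  qed
  finally show "(\<integral>\<^sup>+x. f x \<partial>distr law borel (\<lambda>y. V y + y (tclamp s))) = (\<integral>\<^sup>+w. (\<integral>\<^sup>+x. f (x + V (add_path T x w) + w (tclamp s)) * ennreal (\<rho> x) \<partial>lborel) \<partial>\<nu>)" .
qed

lemma eval_joint_filtration:
  assumes t: "0 \<le> t" "t \<le> T"
  shows "(\<lambda>z. snd z (max 0 (min t (fst z)))) \<in> borel_measurable (borel \<Otimes>\<^sub>M generated_filtration (path_borel T :: (real \<Rightarrow> 'a) measure) (\<lambda>y. y) t)"
proof -
  have "(\<lambda>(s, y). y (max 0 (min t s))) \<in> borel_measurable (borel \<Otimes>\<^sub>M generated_filtration (path_borel T :: (real \<Rightarrow> 'a) measure) (\<lambda>y. y) t)"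
  proof (rule measurable_continuous_process[OF t(1)])
    show "continuous_on {0..t} y" if "y \<in> space (generated_filtration (path_borel T :: (real \<Rightarrow> 'a) measure) (\<lambda>y. y) t)" for y
      using that t by (auto simp: space_path_borel intro: continuous_on_subset)
  qed (rule measurable_generated_filtration_eval)
  then show ?thesis by (simp add: case_prod_beta)
qed

lemma filtration_sub:
  assumes "f \<in> generated_filtration (path_borel T :: (real \<Rightarrow> 'a) measure) (\<lambda>y. y) t \<rightarrow>\<^sub>M N"
  shows "f \<in> path_borel T \<rightarrow>\<^sub>M N"
  using T by (intro measurable_generated_filtration_sub[OF assms] measurable_eval_path) simp

lemma eval_joint: "(\<lambda>z. snd z (tclamp (fst z))) \<in> borel_measurable (borel \<Otimes>\<^sub>M (path_borel T :: (real \<Rightarrow> 'a) measure))"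
proof -
  have "(\<lambda>(s, y). y (max 0 (min T s))) \<in> borel_measurable (borel \<Otimes>\<^sub>M (path_borel T :: (real \<Rightarrow> 'a) measure))"
    using T by (intro measurable_continuous_process measurable_eval_path) (auto simp: space_path_borel)
  then show ?thesis by (simp add: case_prod_beta)
qed

end

lemma (in sobolev_drift) drift_measurable:
  assumes P: "prob_space P" and Z: "(\<lambda>z. X (fst z) (snd z)) \<in> borel_measurable (borel \<Otimes>\<^sub>M P)"
    and f[measurable]: "f \<in> borel_measurable M" and g[measurable]: "g \<in> borel_measurable M"
  shows "(\<lambda>x. drift P X (f x) (g x)) \<in> borel_measurable M"
proof -
  interpret prob_space P by fact
  have "(\<lambda>z. (f (fst z), snd z)) \<in> M \<Otimes>\<^sub>M P \<rightarrow>\<^sub>M borel \<Otimes>\<^sub>M P" by measurable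
  from measurable_compose[OF this Z]
  have [measurable]: "(\<lambda>z. X (f (fst z)) (snd z)) \<in> borel_measurable (M \<Otimes>\<^sub>M P)" by simp
  have "(\<lambda>(x, y). b (f x) (g x - X (f x) y)) \<in> borel_measurable (M \<Otimes>\<^sub>M P)"
    unfolding case_prod_beta by measurable
  then show ?thesis unfolding drift_def by (rule borel_measurable_lebesgue_integral)
qed

lemma set_integral_le_closed:
  fixes k :: "real \<Rightarrow> real"
  assumes i: "integrable lborel k" and nn: "\<And>s. 0 \<le> k s" and A: "A \<in> sets borel" "A \<subseteq> C" "C \<in> sets borel"
  shows "(LINT r:A|lborel. k r) \<le> (LINT r:C|lborel. k r)" and "0 \<le> (LINT r:A|lborel. k r)"
proof -
  show "(LINT r:A|lborel. k r) \<le> (LINT r:C|lborel. k r)"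
    unfolding set_lebesgue_integral_def
  proof (rule Bochner_Integration.integral_mono)
    show "integrable lborel (\<lambda>r. indicator A r *\<^sub>R k r)" "integrable lborel (\<lambda>r. indicator C r *\<^sub>R k r)"
      using A by (intro integrable_mult_indicator i; simp)+
    show "indicator A r *\<^sub>R k r \<le> indicator C r *\<^sub>R k r" for r using nn[of r] A(2) by (auto simp: indicator_def)
  qed
  show "0 \<le> (LINT r:A|lborel. k r)" unfolding set_lebesgue_integral_def
    by (rule Bochner_Integration.integral_nonneg) (use nn in \<open>auto simp: indicator_def\<close>)
qed

lemma inverse_one_minus_le_exp:
  fixes x :: real assumes "0 \<le> x" "x \<le> 1 / 2" shows "1 / (1 - x) \<le> exp (2 * x)"
proof -
  have "1 \<le> (1 - x) * (1 + 2 * x)" using mult_nonneg_nonneg[of x "1 - 2 * x"] assms by (simp add: algebra_simps)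
  then have "1 / (1 - x) \<le> 1 + 2 * x" using assms by (simp add: divide_le_eq mult.commute)
  also have "\<dots> \<le> exp (2 * x)" using exp_ge_add_one_self[of "2 * x"] by simp
  finally show ?thesis .
qed

text \<open>The exponent in \<open>dual\<close> anticipates the compression of the Euler maps: the
  factor 2 comes from the estimate 1/(1 - x) \<le> exp(2 x) for x \<le> 1/2, the summand 1 from the
  accumulated quadratic errors of the determinants.\<close>

locale mean_field = sobolev_drift b v q \<alpha> \<beta> \<gamma> + particle_input T B p \<rho> \<nu>
  for b :: "real \<Rightarrow> real^'d \<Rightarrow> real^'d" and v q \<alpha> \<beta> \<gamma> T B p \<rho> and \<nu> :: "(real \<Rightarrow> real^'d) measure" +
  fixes K :: real
  assumes K: "0 \<le> K"
    and dual: "\<And>\<mu>. mixture_bounded p B (exp (2 * (\<integral>s. \<gamma> s \<partial>lborel) + 1)) \<rho> \<mu> \<Longrightarrow> dual_bounded q K \<mu>"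
begin

text \<open>On a grid of width \<open>mesh\<close>, the quadratic error of the Jacobian determinant in one Euler step is at most
  \<open>slope\<close> times the integral of \<open>\<beta>\<close> over that step, so that all these errors sum up to at most one.\<close>

definition \<Lambda> :: real where "\<Lambda> = exp (2 * (\<integral>s. \<gamma> s \<partial>lborel) + 1)"
definition det_const :: real where "det_const = 4 ^ CARD('d) + fact (CARD('d)) * 2 ^ CARD('d)"
definition slope :: real where "slope = 1 / ((\<integral>s. \<beta> s \<partial>lborel) + 1)"
definition mesh :: real where "mesh = slope / (4 * ((det_const + real CARD('d)) * (K + 1)\<^sup>2))"
definition rate :: "real \<Rightarrow> real" where "rate s = 2 * \<gamma> s + slope * \<beta> s"
definition small_mesh :: "nat \<Rightarrow> bool" where
  "small_mesh N \<longleftrightarrow> 0 < N \<and> (\<forall>s t. s \<le> t \<longrightarrow> t - s \<le> T / real N \<longrightarrow> (LINT r:{s..t}|lborel. \<beta> r + \<gamma> r) \<le> mesh)"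
definition grid :: "nat \<Rightarrow> nat \<Rightarrow> real" where "grid N k = real k * T / real N"

abbreviation "filt \<equiv> generated_filtration (path_borel T :: (real \<Rightarrow> real^'d) measure) (\<lambda>y. y)"

text \<open>The accumulated displacement at the k-th grid time, without the noise. Within a step
  only this displacement is frozen: the noise runs on, so that nothing beyond continuity of
  \<open>y\<close> is used, and the drift is integrated exactly in time, in which the field is
  merely integrable.\<close>

primrec euler :: "nat \<Rightarrow> nat \<Rightarrow> (real \<Rightarrow> real^'d) \<Rightarrow> real^'d" where
  "euler N 0 = (\<lambda>y. 0)"
| "euler N (Suc k) = (\<lambda>y. euler N k y + (LINT s:{grid N k..<grid N (Suc k)}|lborel.
     drift law (\<lambda>s y. euler N k y + y (tclamp s)) s (euler N k y + y (tclamp s))))"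

lemma slope: "0 < slope" "slope \<le> 1" "slope * (\<integral>s. \<beta> s \<partial>lborel) \<le> 1"
proof -
  have "0 \<le> (\<integral>s. \<beta> s \<partial>lborel)" by (rule Bochner_Integration.integral_nonneg) (rule nonneg)
  then show "0 < slope" "slope \<le> 1" "slope * (\<integral>s. \<beta> s \<partial>lborel) \<le> 1" by (simp_all add: slope_def divide_le_eq)
qed

text \<open>The last three bounds provide, in this order, a denominator of at least 1/2 in the
  compression constant of a step, injectivity of the step, and quadratic errors below
  \<open>slope\<close> times the integral of \<beta>.\<close>

lemma mesh: "0 < mesh" "mesh \<le> 1 / 4" "real CARD('d) * (K * mesh) < 1" "2 * det_const * K\<^sup>2 * mesh \<le> slope"
proof -
  define D where "D = (det_const + real CARD('d)) * (K + 1)\<^sup>2"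
  have dc: "0 \<le> det_const" by (simp add: det_const_def)
  have cd: "1 \<le> real CARD('d)" by (simp add: Suc_leI)
  have K2: "1 \<le> (K + 1)\<^sup>2" "K \<le> (K + 1)\<^sup>2" "K\<^sup>2 \<le> (K + 1)\<^sup>2"
    using K by (simp_all add: power2_eq_square algebra_simps)
  have "(det_const + real CARD('d)) * 1 \<le> D" unfolding D_def by (rule mult_left_mono[OF K2(1)]) (use dc in simp)
  then have "det_const + real CARD('d) \<le> D" by simp
  with add_increasing[OF dc cd] have D1: "1 \<le> D" by (rule order_trans)
  have D2: "real CARD('d) * K \<le> D" unfolding D_def by (rule mult_mono) (use K K2 dc in auto)
  have D3: "det_const * K\<^sup>2 \<le> D" unfolding D_def by (rule mult_mono) (use K K2 dc in auto)
  have Dm: "D * mesh = slope / 4" using D1 by (simp add: mesh_def D_def[symmetric])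
  show m0: "0 < mesh" using slope(1) D1 by (simp add: mesh_def D_def[symmetric])
  show "mesh \<le> 1 / 4" using mult_right_mono[OF D1, of mesh] m0 Dm slope(2) by simp
  show "real CARD('d) * (K * mesh) < 1" using mult_right_mono[OF D2, of mesh] m0 Dm slope(2) by (simp add: mult.assoc)
  show "2 * det_const * K\<^sup>2 * mesh \<le> slope" using mult_right_mono[OF D3, of mesh] m0 Dm slope(1) by (simp add: mult.assoc)
qed

lemma grid: 
  shows "grid N 0 = 0" "0 \<le> grid N k" "grid N k \<le> grid N (Suc k)" "grid N (Suc k) - grid N k = T / real N"
    and "0 < N \<Longrightarrow> k \<le> N \<Longrightarrow> grid N k \<le> T"
proof -
  show "grid N 0 = 0" "0 \<le> grid N k" using T by (simp_all add: grid_def)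
  show d: "grid N (Suc k) - grid N k = T / real N" by (simp add: grid_def add_divide_distrib distrib_right)
  have "0 \<le> T / real N" using T by simp
  then show "grid N k \<le> grid N (Suc k)" using d by linarith
  show "grid N k \<le> T" if "0 < N" "k \<le> N"
  proof -
    have "real k * T \<le> real N * T" using that T by (intro mult_right_mono) simp_all
    then show ?thesis using that by (simp add: grid_def divide_le_eq mult.commute)
  qed
qed

lemma rate: "integrable lborel rate" "0 \<le> rate s"
  unfolding rate_def using int nonneg slope(1) by (auto intro!: add_nonneg_nonneg)

text \<open>The total rate is twice the integral of \<gamma> plus \<open>slope\<close> times the
  integral of \<beta>, and \<open>slope\<close> was chosen to make the latter at most 1.\<close>

lemma exp_rate_le: "S \<in> sets borel \<Longrightarrow> exp (LINT s:S|lborel. rate s) \<le> \<Lambda>"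
proof -
  assume S: "S \<in> sets borel"
  have "(LINT s:S|lborel. rate s) \<le> (LINT s:UNIV|lborel. rate s)"
    by (rule set_integral_le_closed(1)[OF rate S]) auto
  also have "\<dots> = (\<integral>s. rate s \<partial>lborel)" by (simp add: set_lebesgue_integral_def)
  also have "\<dots> = 2 * (\<integral>s. \<gamma> s \<partial>lborel) + slope * (\<integral>s. \<beta> s \<partial>lborel)"
    unfolding rate_def using int by simp
  finally show ?thesis using slope(3) by (simp add: \<Lambda>_def)
qed

lemma euler_joint:
  assumes "V \<in> borel_measurable (path_borel T)"
  shows "(\<lambda>z. V (snd z) + (snd z) (tclamp (fst z))) \<in> borel_measurable (borel \<Otimes>\<^sub>M law)"
    and "(\<lambda>z. V (snd z) + (snd z) (tclamp (fst z))) \<in> borel_measurable (lborel \<Otimes>\<^sub>M law)"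
    and "(\<lambda>y. V y + y (tclamp s)) \<in> borel_measurable law"
proof -
  have j: "(\<lambda>z. V (snd z) + (snd z) (tclamp (fst z))) \<in> borel_measurable (borel \<Otimes>\<^sub>M path_borel T)"
    by (rule borel_measurable_add[OF measurable_compose[OF measurable_snd assms] eval_joint])
  have s: "sets (borel \<Otimes>\<^sub>M law) = sets ((borel :: real measure) \<Otimes>\<^sub>M path_borel T)"
      "sets (lborel \<Otimes>\<^sub>M law) = sets ((borel :: real measure) \<Otimes>\<^sub>M path_borel T)"
    by (intro sets_pair_measure_cong; simp)+
  show "(\<lambda>z. V (snd z) + (snd z) (tclamp (fst z))) \<in> borel_measurable (borel \<Otimes>\<^sub>M law)"
    "(\<lambda>z. V (snd z) + (snd z) (tclamp (fst z))) \<in> borel_measurable (lborel \<Otimes>\<^sub>M law)"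
    using j by (simp_all add: measurable_cong_sets[OF s(1) refl] measurable_cong_sets[OF s(2) refl])
  show "(\<lambda>y. V y + y (tclamp s)) \<in> borel_measurable law"
    using T by (intro measurable_law borel_measurable_add assms measurable_eval_path) simp
qed

lemma dual_bounded_law:
  assumes "V \<in> borel_measurable (path_borel T)"
    and "\<And>w. w \<in> space (path_borel T) \<Longrightarrow> compresses \<Lambda> (\<lambda>x. x + V (add_path T x w))"
  shows "dual_bounded q K (distr law borel (\<lambda>y. V y + y (tclamp s)))"
  using mixture_bounded_law[OF assms(1) _ assms(2)] by (intro dual) (simp add: \<Lambda>_def)

lemma path_tclamp_measurable:
  assumes "w \<in> space (path_borel T)" shows "(\<lambda>s. w (tclamp s)) \<in> borel_measurable borel"
proof (rule borel_measurable_continuous_onI)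
  have c: "continuous_on {0..T} w" using assms by (simp add: space_path_borel)
  have i: "(\<lambda>s. tclamp s) ` UNIV \<subseteq> {0..T}" using tclamp_mem by blast
  have t: "continuous_on UNIV (\<lambda>s. tclamp s)" by (intro continuous_intros)
  show "continuous_on UNIV (\<lambda>s. w (tclamp s))" by (rule continuous_on_compose2[OF c t i])
qed

text \<open>Compression up to the k-th grid time bounds the law of the process during the next
  block; this bounds the gradient of the next displacement; and the resulting step compresses by at
  most the exponential of the integral of \<open>rate\<close> over the block. These exponentials
  multiply to the one over the whole past.\<close>

lemma euler_properties:
  assumes f: "small_mesh N" and k: "k \<le> N"
  shows "euler N k \<in> borel_measurable (filt (grid N k)) \<and>
    (\<forall>w\<in>space (path_borel T). compresses (exp (LINT s:{0..<grid N k}|lborel. rate s)) (\<lambda>x. x + euler N k (add_path T x w)))"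
  using k
proof (induction k)
  case 0
  have "(\<lambda>x :: real^'d. x) = (\<lambda>x. x + 0)" by simp
  then have "compresses 1 (\<lambda>x :: real^'d. x + 0)" using compresses_id by simp
  then show ?case by (simp add: grid(1) set_lebesgue_integral_def)
next
  case (Suc k)
  have N: "0 < N" using f by (simp add: small_mesh_def)
  have g: "grid N (Suc k) \<le> T" "grid N k \<le> T" using grid(5)[OF N, of "Suc k"] grid(5)[OF N, of k] Suc.prems by auto
  let ?S = "{grid N k..<grid N (Suc k)}"
  let ?E = "exp (LINT s:{0..<grid N k}|lborel. rate s)"
  let ?Z = "\<lambda>s y. euler N k y + y (tclamp s)"
  have IH: "euler N k \<in> borel_measurable (filt (grid N k))"
      "\<And>w. w \<in> space (path_borel T) \<Longrightarrow> compresses ?E (\<lambda>x. x + euler N k (add_path T x w))"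
    using Suc by auto
  have em: "euler N k \<in> borel_measurable (path_borel T)" by (rule filtration_sub[OF IH(1)])
  note jt = euler_joint[OF em]
  \<comment> \<open>The compression reached so far stays below \<open>\<Lambda>\<close>, so the
    current law acts on L^q with the constant \<open>K\<close> fixed in advance and not with one
    growing from step to step.\<close>
  have d: "dual_bounded q K (distr law borel (?Z s))" for s
    by (rule dual_bounded_law[OF em]) (rule compresses_mono[OF IH(2) exp_rate_le], auto)
  have fr: "(LINT s:?S|lborel. \<beta> s + \<gamma> s) \<le> mesh"
  proof -
    have "(LINT s:?S|lborel. \<beta> s + \<gamma> s) \<le> (LINT s:{grid N k..grid N (Suc k)}|lborel. \<beta> s + \<gamma> s)"
      by (rule set_integral_le_closed(1)) (use int nonneg in auto)
    also have "\<dots> \<le> mesh" using f grid(3,4)[of N k] by (simp add: small_mesh_def)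
    finally show ?thesis .
  qed
  define \<epsilon> where "\<epsilon> = (LINT s:?S|lborel. \<beta> s)"
  define \<delta> where "\<delta> = (LINT s:?S|lborel. \<gamma> s)"
  have si: "set_integrable lborel ?S \<beta>" "set_integrable lborel ?S \<gamma>"
    unfolding set_integrable_def by (intro integrable_mult_indicator int; simp)+
  have e0: "0 \<le> \<epsilon>" "0 \<le> \<delta>" unfolding \<epsilon>_def \<delta>_def using set_integral_le_closed(2)[of _ ?S UNIV] int nonneg by auto
  have "\<epsilon> + \<delta> = (LINT s:?S|lborel. \<beta> s + \<gamma> s)" unfolding \<epsilon>_def \<delta>_def by (rule set_integral_add(2)[OF si, symmetric])
  with fr have ed: "\<epsilon> + \<delta> \<le> mesh" by simp
  have sr: "(LINT s:?S|lborel. rate s) = 2 * \<delta> + slope * \<epsilon>"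
    unfolding rate_def \<epsilon>_def \<delta>_def using si by (subst set_integral_add(2)) auto
  \<comment> \<open>One factor \<epsilon> is traded for \<open>mesh\<close>. What remains is linear
    in the integral of \<beta> over the block, and such terms add up over all blocks.\<close>
  have dce: "2 * (det_const * (K * \<epsilon>)\<^sup>2) \<le> slope * \<epsilon>"
  proof -
    have "2 * (det_const * (K * \<epsilon>)\<^sup>2) = (2 * det_const * K\<^sup>2 * \<epsilon>) * \<epsilon>" by (simp add: power2_eq_square mult_ac)
    also have "\<dots> \<le> (2 * det_const * K\<^sup>2 * mesh) * \<epsilon>"
      using e0 ed by (intro mult_right_mono mult_left_mono) (auto simp: det_const_def)
    also have "\<dots> \<le> slope * \<epsilon>" by (rule mult_right_mono[OF mesh(4) e0(1)])
    finally show ?thesis .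
  qed
  let ?x = "\<delta> + det_const * (K * \<epsilon>)\<^sup>2"
  have x0: "0 \<le> ?x" using e0 by (simp add: det_const_def)
  have "slope * \<epsilon> \<le> 1 * \<epsilon>" by (rule mult_right_mono[OF slope(2) e0(1)])
  then have x1: "?x \<le> 1 / 2" using dce ed mesh(2) e0 by linarith
  have Ee: "1 / (1 - \<delta> - det_const * (K * \<epsilon>)\<^sup>2) \<le> exp (LINT s:?S|lborel. rate s)"
  proof -
    have "1 / (1 - \<delta> - det_const * (K * \<epsilon>)\<^sup>2) = 1 / (1 - ?x)" by (simp add: algebra_simps)
    also have "\<dots> \<le> exp (2 * ?x)" by (rule inverse_one_minus_le_exp[OF x0 x1])
    also have "\<dots> \<le> exp (LINT s:?S|lborel. rate s)" using dce by (simp add: sr)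
    finally show ?thesis .
  qed
  have part2: "compresses (exp (LINT s:{0..<grid N (Suc k)}|lborel. rate s)) (\<lambda>x. x + euler N (Suc k) (add_path T x w))"
    if w: "w \<in> space (path_borel T)" for w
  proof -
    let ?A = "\<lambda>z. LINT s:?S|lborel. (\<integral>y. b s (z + w (tclamp s) - ?Z s y) \<partial>law)"
    have "\<exists>G. integral_gradient ?A G \<and>
       (\<forall>i\<in>Basis. \<forall>z. norm (G i z) \<le> K * (LINT s:?S|lborel. \<beta> s)) \<and>
       (\<forall>z. - (LINT s:?S|lborel. \<gamma> s) \<le> (\<Sum>i\<in>Basis. G i z \<bullet> i))"
      by (rule drift_gradient[OF prob_law jt(2,3) d K path_tclamp_measurable[OF w]]) simp
    then obtain G where G: "integral_gradient ?A G" "\<And>i z. i \<in> Basis \<Longrightarrow> norm (G i z) \<le> K * \<epsilon>"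
        "\<And>z. - \<delta> \<le> (\<Sum>i\<in>Basis. G i z \<bullet> i)"
      unfolding \<epsilon>_def[symmetric] \<delta>_def[symmetric] by blast
    have "K * \<epsilon> \<le> K * mesh" using ed e0 by (intro mult_left_mono[OF _ K]) simp
    then have "real CARD('d) * (K * \<epsilon>) \<le> real CARD('d) * (K * mesh)" by (rule mult_left_mono) simp
    then have c1: "real CARD('d) * (K * \<epsilon>) < 1" using mesh(3) by (rule le_less_trans)
    have c2: "\<delta> + (4 ^ CARD('d) + fact (CARD('d)) * 2 ^ CARD('d)) * (K * \<epsilon>)\<^sup>2 < 1"
      using x1 unfolding det_const_def by simp
    have c3: "0 \<le> K * \<epsilon>" using K e0 by simp
    have "compresses (1 / (1 - \<delta> - det_const * (K * \<epsilon>)\<^sup>2)) (\<lambda>x. x + ?A x)"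
      using compresses_integral_gradient[OF G c3 c1 c2] unfolding det_const_def .
    then have "compresses (exp (LINT s:?S|lborel. rate s)) (\<lambda>x. x + ?A x)" using Ee by (rule compresses_mono)
    from compresses_compose[OF IH(2)[OF w] this]
    have c: "compresses (?E * exp (LINT s:?S|lborel. rate s))
       (\<lambda>x. (x + euler N k (add_path T x w)) + ?A (x + euler N k (add_path T x w)))" by simp
    have ee: "?E * exp (LINT s:?S|lborel. rate s) = exp (LINT s:{0..<grid N (Suc k)}|lborel. rate s)"
    proof -
      have u: "{0..<grid N (Suc k)} = {0..<grid N k} \<union> ?S" using grid(2,3)[of N k] by auto
      have "(LINT s:{0..<grid N k} \<union> ?S|lborel. rate s) = (LINT s:{0..<grid N k}|lborel. rate s) + (LINT s:?S|lborel. rate s)"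
        by (rule set_integral_Un) (auto simp: set_integrable_def intro!: integrable_mult_indicator[where 'b=real, unfolded real_scaleR_def] rate(1))
      then show ?thesis unfolding u by (simp add: exp_add)
    qed
    \<comment> \<open>The step map is evaluated at z = x + euler, so that z + w(s) is the position
      of the particle started at x and driven by w: the new Euler map is the step composed with the
      old one.\<close>
    have fx: "(x + euler N k (add_path T x w)) + ?A (x + euler N k (add_path T x w)) = x + euler N (Suc k) (add_path T x w)" for x
    proof -
      have "x + euler N k (add_path T x w) + w (tclamp s) = euler N k (add_path T x w) + add_path T x w (tclamp s)" for s
      proof -
        have "add_path T x w (tclamp s) = x + w (tclamp s)" using tclamp_mem[of s] by (simp add: add_path_def)
        then show ?thesis by simp
      qed
      then show ?thesis by (simp only: euler.simps drift_def) (rule add.assoc)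
    qed
    show ?thesis using c unfolding ee fx .
  qed
  have part1: "euler N (Suc k) \<in> borel_measurable (filt (grid N (Suc k)))"
  proof -
    let ?t = "grid N (Suc k)"
    have e1: "euler N k \<in> borel_measurable (filt ?t)" by (rule measurable_generated_filtration_mono[OF IH(1) grid(3)])
    have t0: "0 \<le> ?t" by (rule grid(2))
    \<comment> \<open>Clamping at the end \<open>?t\<close> of the block gives the same values on
      the block as clamping at T, but looks at the path up to \<open>?t\<close> only.\<close>
    have zm: "(\<lambda>z. euler N k (snd z) + snd z (max 0 (min ?t (fst z)))) \<in> borel_measurable (lborel \<Otimes>\<^sub>M filt ?t)"
    proof -
      have "(\<lambda>z. euler N k (snd z) + snd z (max 0 (min ?t (fst z)))) \<in> borel_measurable (borel \<Otimes>\<^sub>M filt ?t)"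
        by (rule borel_measurable_add[OF measurable_compose[OF measurable_snd e1] eval_joint_filtration[OF t0 g(1)]])
      moreover have s: "sets (lborel \<Otimes>\<^sub>M filt ?t) = sets ((borel :: real measure) \<Otimes>\<^sub>M filt ?t)"
        by (intro sets_pair_measure_cong; simp)
      ultimately show ?thesis by (simp add: measurable_cong_sets[OF s refl])
    qed
    have fm: "fst \<in> borel_measurable (lborel \<Otimes>\<^sub>M filt ?t)" using measurable_fst[of "lborel :: real measure" "filt ?t"] by simp
    have "(\<lambda>z. indicator ?S (fst z) *\<^sub>R drift law ?Z (fst z) (euler N k (snd z) + snd z (max 0 (min ?t (fst z))))) \<in> borel_measurable (lborel \<Otimes>\<^sub>M filt ?t)"
      by (intro borel_measurable_scaleR drift_measurable[OF prob_law jt(1) fm zm] measurable_compose[OF fm]) simp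
    then have "(\<lambda>(y, s). indicator ?S s *\<^sub>R drift law ?Z s (euler N k y + y (max 0 (min ?t s)))) \<in> borel_measurable (filt ?t \<Otimes>\<^sub>M lborel)"
      by (subst (asm) measurable_pair_swap_iff) (simp add: case_prod_beta)
    from sigma_finite_measure.borel_measurable_lebesgue_integral[OF sigma_finite_lborel this]
    have "(\<lambda>y. \<integral>s. indicator ?S s *\<^sub>R drift law ?Z s (euler N k y + y (max 0 (min ?t s))) \<partial>lborel) \<in> borel_measurable (filt ?t)" .
    moreover have "(\<integral>s. indicator ?S s *\<^sub>R drift law ?Z s (euler N k y + y (max 0 (min ?t s))) \<partial>lborel) =
        (LINT s:?S|lborel. drift law ?Z s (euler N k y + y (tclamp s)))" for y
      unfolding set_lebesgue_integral_def
    proof (rule Bochner_Integration.integral_cong[OF refl])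
      fix s
      have "max 0 (min ?t s) = tclamp s" if "s \<in> ?S" using that g grid(2)[of N k] by auto
      then show "indicator ?S s *\<^sub>R drift law ?Z s (euler N k y + y (max 0 (min ?t s))) = indicator ?S s *\<^sub>R drift law ?Z s (euler N k y + y (tclamp s))"
        by (cases "s \<in> ?S") auto
    qed
    ultimately have "(\<lambda>y. LINT s:?S|lborel. drift law ?Z s (euler N k y + y (tclamp s))) \<in> borel_measurable (filt ?t)" by simp
    then show ?thesis by (simp only: euler.simps) (rule borel_measurable_add[OF e1])
  qed
  show ?case using part1 part2 by blast
qed

end

context sobolev_drift
begin

lemma drift_set_integrable:
  assumes P: "prob_space P" and K: "0 \<le> K"
    and d: "\<And>s. s \<in> {0..T} \<Longrightarrow> X s \<in> borel_measurable P \<and> dual_bounded q K (distr P borel (X s))"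
  shows "\<And>s z. s \<in> {0..T} \<Longrightarrow> norm (drift P X s z) \<le> K * \<alpha> s"
    and "\<And>S x. set_borel_measurable lborel {0..T} (\<lambda>s. drift P X s (x s)) \<Longrightarrow> S \<in> sets borel \<Longrightarrow> S \<subseteq> {0..T} \<Longrightarrow> set_integrable lborel S (\<lambda>s. drift P X s (x s))"
proof -
  show le: "norm (drift P X s z) \<le> K * \<alpha> s" if "s \<in> {0..T}" for s z
    unfolding drift_def using d[OF that] by (intro b_convolution_integrable(2) P K) auto
  fix S x assume m: "set_borel_measurable lborel {0..T} (\<lambda>s. drift P X s (x s))" and S: "S \<in> sets borel" "S \<subseteq> {0..T}"
  have "set_borel_measurable lborel S (\<lambda>s. drift P X s (x s))"
    by (rule set_borel_measurable_subset[OF m]) (use S in auto)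
  then have m': "(\<lambda>s. indicator S s *\<^sub>R drift P X s (x s)) \<in> borel_measurable lborel"
    unfolding set_borel_measurable_def .
  show "set_integrable lborel S (\<lambda>s. drift P X s (x s))" unfolding set_integrable_def
  proof (rule Bochner_Integration.integrable_bound[OF _ m'])
    show "integrable lborel (\<lambda>s. K * \<alpha> s)" by (intro integrable_mult_right int)
    have "norm (indicator S s *\<^sub>R drift P X s (x s)) \<le> norm (K * \<alpha> s)" for s
      using le[of s] S K nonneg(1)[of s] by (cases "s \<in> S") auto
    then show "AE s in lborel. norm (indicator S s *\<^sub>R drift P X s (x s)) \<le> norm (K * \<alpha> s)" by simp
  qed
qed

lemma approx_solution_mono: "approx_solution T P \<Omega> K a Y X \<Longrightarrow> a \<le> a' \<Longrightarrow> approx_solution T P \<Omega> K a' Y X"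
  unfolding approx_solution_def by force

end

section \<open>The interpolated scheme and its defect\<close>

context mean_field
begin

text \<open>On [0,T], the index of the last grid time up to s; the minimum keeps it admissible for
  arguments beyond T.\<close>

definition idx :: "nat \<Rightarrow> real \<Rightarrow> nat" where "idx N s = min N (nat \<lfloor>s * real N / T\<rfloor>)"
definition proc :: "nat \<Rightarrow> real \<Rightarrow> (real \<Rightarrow> real^'d) \<Rightarrow> real^'d" where
  "proc N s y = euler N (idx N s) y + y (tclamp s)"

lemma idx:
  assumes N: "0 < N" and s: "s \<in> {0..T}"
  shows "idx N s \<le> N" "grid N (idx N s) \<le> s" "s - grid N (idx N s) \<le> T / real N"
proof -
  show "idx N s \<le> N" by (simp add: idx_def)
  let ?r = "s * real N / T"
  have r0: "0 \<le> ?r" using s T by simp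
  have "s * real N \<le> T * real N" using s by (intro mult_right_mono) auto
  then have "?r \<le> real N" using T by (simp add: divide_le_eq mult.commute)
  then have "nat \<lfloor>?r\<rfloor> \<le> N" using r0 by linarith
  then have i: "idx N s = nat \<lfloor>?r\<rfloor>" by (simp add: idx_def)
  have r1: "real (idx N s) \<le> ?r" "?r \<le> real (idx N s) + 1" unfolding i using r0 by linarith+
  have sr: "?r * (T / real N) = s" using T N by simp
  have TN: "0 \<le> T / real N" using T by simp
  have g: "grid N (idx N s) = real (idx N s) * (T / real N)" by (simp add: grid_def)
  show "grid N (idx N s) \<le> s" using mult_right_mono[OF r1(1) TN] unfolding sr g .
  show "s - grid N (idx N s) \<le> T / real N" using mult_right_mono[OF r1(2) TN] unfolding sr g by (simp add: distrib_right add_divide_distrib)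
qed

lemma idx_block:
  assumes N: "0 < N" "k < N" and s: "s \<in> {grid N k..<grid N (Suc k)}" shows "idx N s = k"
proof -
  have "real k * T \<le> s * real N" "s * real N < real (Suc k) * T"
    using s N by (simp_all add: grid_def divide_le_eq less_divide_eq)
  then have "real k \<le> s * real N / T" "s * real N / T < real k + 1"
    using T by (simp_all add: le_divide_eq divide_less_eq algebra_simps)
  then have "\<lfloor>s * real N / T\<rfloor> = int k" by (intro floor_unique) auto
  then show ?thesis using N by (simp add: idx_def)
qed

lemma idx_measurable: "idx N \<in> borel \<rightarrow>\<^sub>M count_space UNIV"
proof -
  have "(\<lambda>s::real. \<lfloor>s * real N / T\<rfloor>) \<in> borel \<rightarrow>\<^sub>M count_space UNIV" by measurable
  from measurable_compose[OF this, of "\<lambda>i. min N (nat i)" "count_space UNIV"] show ?thesis by (simp add: idx_def[abs_def])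
qed

lemma euler_path_measurable: "small_mesh N \<Longrightarrow> k \<le> N \<Longrightarrow> euler N k \<in> borel_measurable (path_borel T)"
  by (rule filtration_sub[OF euler_properties[THEN conjunct1]])

lemma euler_compresses:
  "small_mesh N \<Longrightarrow> k \<le> N \<Longrightarrow> w \<in> space (path_borel T) \<Longrightarrow> compresses \<Lambda> (\<lambda>x. x + euler N k (add_path T x w))"
  by (rule compresses_mono[OF euler_properties[THEN conjunct2, rule_format] exp_rate_le]) auto

lemma proc_joint:
  assumes f: "small_mesh N"
  shows "(\<lambda>z. proc N (fst z) (snd z)) \<in> borel_measurable (borel \<Otimes>\<^sub>M law)"
proof -
  \<comment> \<open>The composition rule ranges over all natural numbers, whereas the Euler maps are
    known to be measurable up to index \<open>N\<close>; hence the minimum.\<close>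
  have "(\<lambda>z. (\<lambda>z. euler N (min N (idx N (fst z))) (snd z) + snd z (tclamp (fst z))) z) \<in> borel_measurable (borel \<Otimes>\<^sub>M law)"
    by (rule measurable_compose_countable[where f="\<lambda>i z. euler N (min N i) (snd z) + snd z (tclamp (fst z))",
          OF euler_joint(1)[OF euler_path_measurable[OF f]] measurable_compose[OF measurable_fst idx_measurable]]) simp
  moreover have "min N (idx N s) = idx N s" for s by (simp add: idx_def)
  ultimately show ?thesis by (simp add: proc_def)
qed

lemma proc_law:
  assumes f: "small_mesh N"
  shows "proc N s \<in> borel_measurable law \<and> dual_bounded q K (distr law borel (proc N s))"
proof -
  have i: "idx N s \<le> N" by (simp add: idx_def)
  have p: "proc N s = (\<lambda>y. euler N (idx N s) y + y (tclamp s))" by (simp add: proc_def fun_eq_iff)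
  show ?thesis unfolding p
    by (intro conjI euler_joint(3) dual_bounded_law euler_path_measurable[OF f i] euler_compresses[OF f i])
qed

lemma proc_drift_measurable:
  assumes f: "small_mesh N" and y: "y \<in> space (path_borel T)"
  shows "(\<lambda>s. drift law (proc N) s (proc N s y)) \<in> borel_measurable borel"
proof (rule drift_measurable[OF prob_law proc_joint[OF f]])
  have "(\<lambda>s. (s, y)) \<in> borel \<rightarrow>\<^sub>M borel \<Otimes>\<^sub>M law" using y by simp
  from measurable_compose[OF this proc_joint[OF f]] show "(\<lambda>s. proc N s y) \<in> borel_measurable borel" by simp
qed simp

lemma proc_drift_integrable:
  assumes f: "small_mesh N" and y: "y \<in> space (path_borel T)" and S: "S \<in> sets borel" "S \<subseteq> {0..T}"
  shows "set_integrable lborel S (\<lambda>s. drift law (proc N) s (proc N s y))"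
proof (rule drift_set_integrable(2)[OF prob_law K proc_law[OF f] _ S])
  show "set_borel_measurable lborel {0..T} (\<lambda>s. drift law (proc N) s (proc N s y))"
    unfolding set_borel_measurable_def using proc_drift_measurable[OF f y] by (intro borel_measurable_scaleR) auto
qed

text \<open>On the half-open block from the k-th grid time on, the index is constantly k, so the
  drift in the recursion is the drift of \<open>proc\<close> itself.\<close>

lemma euler_integral:
  assumes f: "small_mesh N" and y: "y \<in> space (path_borel T)" and k: "k \<le> N"
  shows "euler N k y = (LINT s:{0..<grid N k}|lborel. drift law (proc N) s (proc N s y))"
  using k
proof (induction k)
  case 0
  then show ?case by (simp add: grid(1) set_lebesgue_integral_def)
next
  case (Suc k)
  have N: "0 < N" using f by (simp add: small_mesh_def)
  have g: "grid N (Suc k) \<le> T" using grid(5)[OF N] Suc.prems by blast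
  let ?S = "{grid N k..<grid N (Suc k)}"
  have "(LINT s:?S|lborel. drift law (\<lambda>s y. euler N k y + y (tclamp s)) s (euler N k y + y (tclamp s))) =
     (LINT s:?S|lborel. drift law (proc N) s (proc N s y))"
    unfolding set_lebesgue_integral_def
  proof (rule Bochner_Integration.integral_cong[OF refl])
    fix s
    have "idx N s = k" if "s \<in> ?S" using idx_block[OF N _ that] Suc.prems by simp
    then show "indicator ?S s *\<^sub>R drift law (\<lambda>s y. euler N k y + y (tclamp s)) s (euler N k y + y (tclamp s)) =
       indicator ?S s *\<^sub>R drift law (proc N) s (proc N s y)"
      by (cases "s \<in> ?S") (auto simp: drift_def proc_def)
  qed
  moreover have u: "{0..<grid N (Suc k)} = {0..<grid N k} \<union> ?S" using grid(2,3)[of N k] by auto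
  moreover have "(LINT s:{0..<grid N k} \<union> ?S|lborel. drift law (proc N) s (proc N s y)) =
     (LINT s:{0..<grid N k}|lborel. drift law (proc N) s (proc N s y)) + (LINT s:?S|lborel. drift law (proc N) s (proc N s y))"
    using g grid(2,3)[of N k] by (intro set_integral_Un proc_drift_integrable[OF f y]) auto
  ultimately show ?case using Suc by simp
qed

text \<open>At grid times the scheme solves the equation for its own drift exactly, by
  \<open>euler_integral\<close>. In between the displacement is not updated, so the defect is the
  drift integral over the current incomplete block.\<close>

lemma proc_approx_solution:
  assumes f: "small_mesh N" and e: "\<And>s t. s \<le> t \<Longrightarrow> t - s \<le> T / real N \<Longrightarrow> (LINT r:{s..t}|lborel. \<alpha> r) \<le> e"
  shows "approx_solution T law (space law) K (K * e) (\<lambda>s y. y (tclamp s)) (proc N)"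
  unfolding approx_solution_def
proof (intro conjI ballI)
  have N: "0 < N" using f by (simp add: small_mesh_def)
  fix s assume "s \<in> {0..T}"
  show "proc N s \<in> borel_measurable law" "dual_bounded q K (distr law borel (proc N s))" using proc_law[OF f] by auto
next
  have N: "0 < N" using f by (simp add: small_mesh_def)
  fix y assume "y \<in> space law"
  then have y: "y \<in> space (path_borel T)" by simp
  let ?D = "\<lambda>s. drift law (proc N) s (proc N s y)"
  show "set_borel_measurable lborel {0..T} ?D"
    unfolding set_borel_measurable_def using proc_drift_measurable[OF f y] by (intro borel_measurable_scaleR) auto
  fix t assume t: "t \<in> {0..T}"
  let ?g = "grid N (idx N t)"
  note i = idx[OF N t]
  have u: "{0..t} = {0..<?g} \<union> {?g..t}" using i grid(2)[of N "idx N t"] by auto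
  have "(LINT s:{0..<?g} \<union> {?g..t}|lborel. ?D s) = (LINT s:{0..<?g}|lborel. ?D s) + (LINT s:{?g..t}|lborel. ?D s)"
    using t i grid(2)[of N "idx N t"] by (intro set_integral_Un proc_drift_integrable[OF f y]) auto
  then have "proc N t y - y (tclamp t) - (LINT s:{0..t}|lborel. ?D s) = - (LINT s:{?g..t}|lborel. ?D s)"
    unfolding u by (simp add: proc_def euler_integral[OF f y i(1)])
  moreover have "norm (LINT s:{?g..t}|lborel. ?D s) \<le> (LINT s:{?g..t}|lborel. K * \<alpha> s)"
    unfolding set_lebesgue_integral_def
  proof (rule Bochner_Integration.integral_norm_bound_integral)
    have "set_integrable lborel {?g..t} ?D"
      using t grid(2)[of N "idx N t"] by (intro proc_drift_integrable[OF f y]) auto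
    then show "integrable lborel (\<lambda>s. indicator {?g..t} s *\<^sub>R ?D s)" unfolding set_integrable_def .
    show "integrable lborel (\<lambda>s. indicator {?g..t} s *\<^sub>R (K * \<alpha> s))"
      by (intro integrable_mult_indicator integrable_mult_right int) simp
    fix s
    show "norm (indicator {?g..t} s *\<^sub>R ?D s) \<le> indicator {?g..t} s *\<^sub>R (K * \<alpha> s)"
    proof (cases "s \<in> {?g..t}")
      case True
      then have "s \<in> {0..T}" using t grid(2)[of N "idx N t"] by auto
      from drift_set_integrable(1)[OF prob_law K proc_law[OF f] this] show ?thesis using True by simp
    qed simp
  qed
  moreover have "(LINT s:{?g..t}|lborel. K * \<alpha> s) \<le> K * e"
    using mult_left_mono[OF e[OF i(2,3)] K] by simp
  ultimately show "norm (proc N t y - y (tclamp t) - (LINT s:{0..t}|lborel. ?D s)) \<le> K * e" by simp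
qed

end

section \<open>Convergence of the scheme\<close>

context mean_field
begin

text \<open>The defects tend to zero, so by stability the schemes converge uniformly over all times
  and all paths. Convergence everywhere instead of almost surely is what preserves measurability for
  a filtration that is not completed.\<close>

lemma solution_exists:
  "\<exists>X. (\<forall>t\<in>{0..T}. X t \<in> borel_measurable (filt t)) \<and>
     (\<forall>t\<in>{0..T}. mixture_bounded p B \<Lambda> \<rho> (distr law borel (X t))) \<and>
     approx_solution T law (space law) K 0 (\<lambda>s y. y (tclamp s)) X"
proof -
  let ?Y = "\<lambda>s y :: real \<Rightarrow> real^'d. y (tclamp s)"
  have ex: "\<exists>N. small_mesh N \<and> (\<forall>s t. s \<le> t \<longrightarrow> t - s \<le> T / real N \<longrightarrow> (LINT r:{s..t}|lborel. \<alpha> r) \<le> 1 / real (Suc n))" for n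
  proof -
    have i: "integrable lborel (\<lambda>s. \<beta> s + \<gamma> s)" using int by simp
    have nn: "0 \<le> \<beta> s + \<gamma> s" for s using nonneg(2,3)[of s] by simp
    obtain N1 where N1: "N1 > 0" "\<forall>N\<ge>N1. \<forall>s t. s \<le> t \<longrightarrow> t - s \<le> T / real N \<longrightarrow> (LINT r:{s..t}|lborel. \<beta> r + \<gamma> r) \<le> mesh"
      using set_integral_interval_small[OF i nn mesh(1) T] by blast
    obtain N2 where N2: "\<forall>N\<ge>N2. \<forall>s t. s \<le> t \<longrightarrow> t - s \<le> T / real N \<longrightarrow> (LINT r:{s..t}|lborel. \<alpha> r) \<le> 1 / real (Suc n)"
      using set_integral_interval_small[OF int(1) nonneg(1), of "1 / real (Suc n)" T] T by auto
    have "small_mesh (max N1 N2)" unfolding small_mesh_def using N1(1) N1(2)[rule_format, of "max N1 N2"] by auto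
    then show ?thesis using N2[rule_format, of "max N1 N2"] by (intro exI[of _ "max N1 N2"]) auto
  qed
  define NN where "NN n = (SOME N. small_mesh N \<and> (\<forall>s t. s \<le> t \<longrightarrow> t - s \<le> T / real N \<longrightarrow> (LINT r:{s..t}|lborel. \<alpha> r) \<le> 1 / real (Suc n)))" for n
  have NN: "small_mesh (NN n)" "\<And>s t. s \<le> t \<Longrightarrow> t - s \<le> T / real (NN n) \<Longrightarrow> (LINT r:{s..t}|lborel. \<alpha> r) \<le> 1 / real (Suc n)" for n
    using someI_ex[OF ex[of n]] unfolding NN_def by auto
  define Xn where "Xn n = proc (NN n)" for n
  have apn: "approx_solution T law (space law) K (K * (1 / real (Suc n))) ?Y (Xn n)" for n
    unfolding Xn_def by (rule proc_approx_solution[OF NN])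
  obtain C where CC: "0 \<le> C \<and> (\<forall>(P :: (real \<Rightarrow> real^'d) measure) \<Omega> a Y X1 X2. prob_space P \<longrightarrow> (AE \<omega> in P. \<omega> \<in> \<Omega>) \<longrightarrow> 0 \<le> a \<longrightarrow>
    approx_solution T P \<Omega> K a Y X1 \<longrightarrow> approx_solution T P \<Omega> K a Y X2 \<longrightarrow>
    (\<forall>t\<in>{0..T}. \<forall>\<omega>\<in>\<Omega>. norm (X1 t \<omega> - X2 t \<omega>) \<le> C * a))"
    by (rule exE[OF approx_solution_stability[OF K T]])
  note C = CC[THEN conjunct1]
  note st = CC[THEN conjunct2, THEN spec, THEN spec, THEN spec, THEN spec, THEN spec, THEN spec, THEN mp, THEN mp, THEN mp, THEN mp, THEN mp, THEN bspec, THEN bspec]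
  define d where "d n = C * (K * (1 / real (Suc n)))" for n
  have d0: "0 \<le> d n" for n using C K by (simp add: d_def)
  have dlim: "d \<longlonglongrightarrow> 0"
    using LIMSEQ_Suc[OF lim_const_over_n[of "C * K"]] by (simp add: d_def[abs_def] mult.assoc)
  have cauchy: "norm (Xn m t y - Xn n t y) \<le> d M" if "M \<le> m" "M \<le> n" "t \<in> {0..T}" "y \<in> space law" for m n M t y
    unfolding d_def
  proof (rule st[OF prob_law _ _ _ _ that(3,4)])
    have k: "K * (1 / real (Suc m)) \<le> K * (1 / real (Suc M))" "K * (1 / real (Suc n)) \<le> K * (1 / real (Suc M))"
      using that K by (intro mult_left_mono divide_left_mono; simp)+
    show "approx_solution T law (space law) K (K * (1 / real (Suc M))) ?Y (Xn m)"
      by (rule approx_solution_mono[OF apn k(1)])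
    show "approx_solution T law (space law) K (K * (1 / real (Suc M))) ?Y (Xn n)"
      by (rule approx_solution_mono[OF apn k(2)])
  qed (use K in auto)
  define X where "X t y = lim (\<lambda>n. Xn n t y)" for t y
  have lim: "(\<lambda>n. Xn n t y) \<longlonglongrightarrow> X t y" if t: "t \<in> {0..T}" and y: "y \<in> space law" for t y
  proof -
    have "Cauchy (\<lambda>n. Xn n t y)"
    proof (rule CauchyI)
      fix e :: real assume "0 < e"
      from LIMSEQ_D[OF dlim this] obtain M where "d M < e" using d0 by fastforce
      then show "\<exists>M. \<forall>m\<ge>M. \<forall>n\<ge>M. norm (Xn m t y - Xn n t y) < e"
        using cauchy[OF _ _ t y] by (intro exI[of _ M]) (auto intro: le_less_trans)
    qed
    then show ?thesis unfolding X_def by (simp add: Cauchy_convergent_iff convergent_LIMSEQ_iff)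
  qed
  have Xd: "norm (Xn n t y - X t y) \<le> d n" if t: "t \<in> {0..T}" and y: "y \<in> space law" for n t y
  proof (rule Lim_bounded)
    show "(\<lambda>m. norm (Xn n t y - Xn m t y)) \<longlonglongrightarrow> norm (Xn n t y - X t y)" by (intro tendsto_intros lim t y)
    show "\<forall>m\<ge>n. norm (Xn n t y - Xn m t y) \<le> d n" using cauchy[OF _ _ t y] by auto
  qed
  \<comment> \<open>The grid time that determines the scheme at time t is at most t, hence the
    displacement depends on the path up to t only.\<close>
  have adapted: "X t \<in> borel_measurable (filt t)" if t: "t \<in> {0..T}" for t
  proof (rule borel_measurable_LIMSEQ_metric)
    show "(\<lambda>n. Xn n t y) \<longlonglongrightarrow> X t y" if "y \<in> space (filt t)" for y
      using that by (intro lim t) simp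
    show "Xn n t \<in> borel_measurable (filt t)" for n
    proof -
      have N: "0 < NN n" using NN(1) by (simp add: small_mesh_def)
      have "euler (NN n) (idx (NN n) t) \<in> borel_measurable (filt t)"
        by (rule measurable_generated_filtration_mono[OF euler_properties[OF NN(1), THEN conjunct1]]) (use idx[OF N t] in auto)
      then have "(\<lambda>y. euler (NN n) (idx (NN n) t) y + y t) \<in> borel_measurable (filt t)"
        using t by (intro borel_measurable_add measurable_generated_filtration_eval) auto
      moreover have "Xn n t = (\<lambda>y. euler (NN n) (idx (NN n) t) y + y t)" using t by (simp add: Xn_def proc_def fun_eq_iff tclamp_id)
      ultimately show ?thesis by simp
    qed
  qed
  \<comment> \<open>The bound passes to the limit through the maps and not through the laws: for
    each frozen w the Euler maps converge pointwise, so the limit map compresses by the same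
    factor.\<close>
  have mix: "mixture_bounded p B \<Lambda> \<rho> (distr law borel (X t))" if t: "t \<in> {0..T}" for t
  proof -
    have "mixture_bounded p B \<Lambda> \<rho> (distr law borel (\<lambda>y. (X t y - y (tclamp t)) + y (tclamp t)))"
    proof (rule mixture_bounded_law)
      show "(\<lambda>y. X t y - y (tclamp t)) \<in> borel_measurable (path_borel T)"
        using T by (intro borel_measurable_diff filtration_sub[OF adapted[OF t]] measurable_eval_path) simp
      show "0 \<le> \<Lambda>" by (simp add: \<Lambda>_def)
      fix w :: "real \<Rightarrow> real^'d" assume w: "w \<in> space (path_borel T)"
      show "compresses \<Lambda> (\<lambda>x. x + (X t (add_path T x w) - add_path T x w (tclamp t)))"
      proof (rule compresses_limit)
        show "compresses \<Lambda> (\<lambda>x. x + euler (NN n) (idx (NN n) t) (add_path T x w))" for n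
          by (rule euler_compresses[OF NN(1) _ w]) (simp add: idx_def)
        fix x
        have "(\<lambda>n. x + (Xn n t (add_path T x w) - add_path T x w (tclamp t))) \<longlonglongrightarrow> x + (X t (add_path T x w) - add_path T x w (tclamp t))"
          by (intro tendsto_intros lim t) (simp add: add_path_space[OF w])
        then show "(\<lambda>n. x + euler (NN n) (idx (NN n) t) (add_path T x w)) \<longlonglongrightarrow> x + (X t (add_path T x w) - add_path T x w (tclamp t))"
          by (simp add: Xn_def proc_def)
      qed
    qed
    then show ?thesis by simp
  qed
  have Xlaw: "X t \<in> borel_measurable law \<and> dual_bounded q K (distr law borel (X t))" if t: "t \<in> {0..T}" for t
    using measurable_law[OF filtration_sub[OF adapted[OF t]]] dual mix[OF t] unfolding \<Lambda>_def by blast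
  define D where "D y s = drift law X s (X s y)" for y s
  define Dn where "Dn n y s = drift law (Xn n) s (Xn n s y)" for n y s
  \<comment> \<open>The drifts converge although the field is discontinuous in general:
    \<open>drift_difference_le\<close> only asks for uniform closeness of the processes and of the
    evaluation points.\<close>
  have Dd: "norm (Dn n y s - D y s) \<le> K * drift_const * d n * \<beta> s" if s: "s \<in> {0..T}" and y: "y \<in> space law" for n y s
    unfolding D_def Dn_def drift_def
  proof (rule drift_difference_le[OF prob_law _ _ _ _ K d0])
    show "AE \<omega> in law. norm (Xn n s \<omega> - X s \<omega>) \<le> d n" using Xd[OF s] by (rule AE_I2)
    show "norm (Xn n s y - X s y) \<le> d n" by (rule Xd[OF s y])
    show "Xn n s \<in> borel_measurable law" "dual_bounded q K (distr law borel (Xn n s))"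
      using proc_law[OF NN(1)] unfolding Xn_def by auto
    show "X s \<in> borel_measurable law" "dual_bounded q K (distr law borel (X s))" using Xlaw[OF s] by auto
  qed
  have Dm: "set_borel_measurable lborel {0..T} (D y)" if y: "y \<in> space law" for y
    unfolding set_borel_measurable_def
  proof (rule borel_measurable_LIMSEQ_metric)
    show "(\<lambda>s. indicator {0..T} s *\<^sub>R Dn n y s) \<in> borel_measurable lborel" for n
      using proc_drift_measurable[OF NN(1), of y n] y unfolding Dn_def Xn_def by (intro borel_measurable_scaleR) auto
    fix s
    show "(\<lambda>n. indicator {0..T} s *\<^sub>R Dn n y s) \<longlonglongrightarrow> indicator {0..T} s *\<^sub>R D y s"
    proof (cases "s \<in> {0..T}")
      case True
      have "(\<lambda>n. K * drift_const * d n * \<beta> s) \<longlonglongrightarrow> K * drift_const * 0 * \<beta> s" by (intro tendsto_intros dlim)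
      then have "(\<lambda>n. Dn n y s - D y s) \<longlonglongrightarrow> 0"
        using Dd[OF True y] by (intro Lim_null_comparison[of "\<lambda>n. Dn n y s - D y s" "\<lambda>n. K * drift_const * d n * \<beta> s"] always_eventually allI) auto
      then have "(\<lambda>n. Dn n y s) \<longlonglongrightarrow> D y s" by (simp add: LIM_zero_iff)
      then show ?thesis by (intro tendsto_intros)
    qed simp
  qed
  have "approx_solution T law (space law) K 0 ?Y X"
    unfolding approx_solution_def
  proof (intro conjI ballI)
    show "X s \<in> borel_measurable law" "dual_bounded q K (distr law borel (X s))" if "s \<in> {0..T}" for s using Xlaw[OF that] by auto
    fix y assume y: "y \<in> space law"
    show "set_borel_measurable lborel {0..T} (\<lambda>s. drift law X s (X s y))" using Dm[OF y] unfolding D_def .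
    fix t assume t: "t \<in> {0..T}"
    have iD: "set_integrable lborel {0..t} (D y)"
      unfolding D_def by (rule drift_set_integrable(2)[OF prob_law K Xlaw Dm[OF y, unfolded D_def]]) (use t in auto)
    have iDn: "set_integrable lborel {0..t} (Dn n y)" for n
      unfolding Dn_def Xn_def by (rule proc_drift_integrable[OF NN(1)]) (use t y in auto)
    \<comment> \<open>Three errors: the distance to the scheme, the defect of the scheme and the
      difference of the drift integrals.\<close>
    let ?R = "\<lambda>n. d n + K * (1 / real (Suc n)) + K * drift_const * d n * (\<integral>s. \<beta> s \<partial>lborel)"
    have le: "norm (X t y - ?Y t y - (LINT s:{0..t}|lborel. D y s)) \<le> ?R n" for n
    proof -
      have "(LINT s:{0..t}|lborel. Dn n y s) - (LINT s:{0..t}|lborel. D y s) = (LINT s:{0..t}|lborel. Dn n y s - D y s)"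
        by (rule set_integral_diff(2)[OF iDn iD, symmetric])
      moreover have "norm (LINT s:{0..t}|lborel. Dn n y s - D y s) \<le> (\<integral>s. K * drift_const * d n * \<beta> s \<partial>lborel)"
        unfolding set_lebesgue_integral_def
      proof (rule Bochner_Integration.integral_norm_bound_integral)
        show "integrable lborel (\<lambda>s. indicator {0..t} s *\<^sub>R (Dn n y s - D y s))"
          using set_integral_diff(1)[OF iDn iD] unfolding set_integrable_def .
        show "integrable lborel (\<lambda>s. K * drift_const * d n * \<beta> s)" by (intro integrable_mult_right int)
        show "norm (indicator {0..t} s *\<^sub>R (Dn n y s - D y s)) \<le> K * drift_const * d n * \<beta> s" for s
        proof (cases "s \<in> {0..t}")
          case True
          then show ?thesis using Dd[of s y n] t y by simp
        next
          case False
          then show ?thesis using K drift_const_nonneg d0[of n] nonneg(2)[of s] by simp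
        qed
      qed
      ultimately have a: "norm ((LINT s:{0..t}|lborel. Dn n y s) - (LINT s:{0..t}|lborel. D y s)) \<le> K * drift_const * d n * (\<integral>s. \<beta> s \<partial>lborel)" by simp
      have b: "norm (Xn n t y - ?Y t y - (LINT s:{0..t}|lborel. Dn n y s)) \<le> K * (1 / real (Suc n))"
        using apn[of n] y t unfolding approx_solution_def Dn_def by blast
      have c: "norm (X t y - Xn n t y) \<le> d n" using Xd[OF t y, of n] by (simp add: norm_minus_commute)
      have "X t y - ?Y t y - (LINT s:{0..t}|lborel. D y s) = (X t y - Xn n t y) + (Xn n t y - ?Y t y - (LINT s:{0..t}|lborel. Dn n y s))
          + ((LINT s:{0..t}|lborel. Dn n y s) - (LINT s:{0..t}|lborel. D y s))" by simp
      then show ?thesis using norm_triangle_mono[OF norm_triangle_mono[OF c b] a] by (simp only:)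
    qed
    have "?R \<longlonglongrightarrow> 0 + K * 0 + K * drift_const * 0 * (\<integral>s. \<beta> s \<partial>lborel)"
      by (intro tendsto_intros dlim LIMSEQ_Suc[OF lim_const_over_n])
    then have "?R \<longlonglongrightarrow> 0" by simp
    then show "norm (X t y - ?Y t y - (LINT s:{0..t}|lborel. drift law X s (X s y))) \<le> 0"
      by (rule LIMSEQ_le_const) (use le in \<open>auto simp: D_def\<close>)
  qed
  then show ?thesis using adapted mix by blast
qed

end

section \<open>Borel representatives of the drift\<close>

text \<open>For finite q this is Tonelli. For q = \<infinity> the essential supremum is at most c
  exactly when the set where the norm exceeds c is null, and the volume of this set is a measurable
  function of t.\<close>

lemma Lp_norm_measurable:
  fixes g :: "real \<Rightarrow> 'a::euclidean_space \<Rightarrow> 'b::euclidean_space"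
  assumes g[measurable]: "(\<lambda>(t, x). g t x) \<in> borel_measurable (borel \<Otimes>\<^sub>M borel)"
  shows "(\<lambda>t. Lp_norm lborel q (g t)) \<in> borel_measurable borel"
proof -
  have gt: "g t \<in> borel_measurable borel" for t
  proof -
    have "(\<lambda>x. (t, x)) \<in> borel \<rightarrow>\<^sub>M borel \<Otimes>\<^sub>M (borel :: 'a measure)" by simp
    from measurable_compose[OF this g] show ?thesis by simp
  qed
  have gl: "(\<lambda>z. g (fst z) (snd z)) \<in> borel_measurable (borel \<Otimes>\<^sub>M lborel)"
  proof -
    have s: "sets (borel \<Otimes>\<^sub>M lborel) = sets ((borel :: real measure) \<Otimes>\<^sub>M (borel :: 'a measure))"
      by (intro sets_pair_measure_cong; simp)
    show ?thesis using g by (simp add: measurable_cong_sets[OF s refl] case_prod_unfold)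
  qed
  show ?thesis
  proof (cases "q = \<infinity>")
    case False
    have "(\<lambda>(t, x). ennreal (norm (g t x) powr enn2real q)) \<in> borel_measurable (borel \<Otimes>\<^sub>M lborel)"
      unfolding case_prod_unfold using gl by measurable
    from sigma_finite_measure.borel_measurable_nn_integral[OF sigma_finite_lborel this]
    have [measurable]: "(\<lambda>t. \<integral>\<^sup>+x. ennreal (norm (g t x) powr enn2real q) \<partial>lborel) \<in> borel_measurable borel" by simp
    show ?thesis using False unfolding Lp_norm_def Let_def by simp
  next
    case True
    show ?thesis
    proof (rule borel_measurableI_le)
      fix c :: ennreal
      define F where "F t = (\<integral>\<^sup>+x. indicator {x. c < ennreal (norm (g t x))} x \<partial>lborel)" for t
      have "(\<lambda>(t, x). indicator {z. c < ennreal (norm (g (fst z) (snd z)))} (t, x) :: ennreal) \<in> borel_measurable (borel \<Otimes>\<^sub>M lborel)"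
      proof -
        have "{z \<in> space (borel \<Otimes>\<^sub>M lborel). c < ennreal (norm (g (fst z) (snd z)))} \<in> sets (borel \<Otimes>\<^sub>M lborel)"
          using gl by measurable
        then have "{z. c < ennreal (norm (g (fst z) (snd z)))} \<in> sets ((borel :: real measure) \<Otimes>\<^sub>M (lborel :: 'a measure))"
          by (simp add: space_pair_measure)
        then show ?thesis unfolding case_prod_unfold prod.collapse by (rule borel_measurable_indicator)
      qed
      from sigma_finite_measure.borel_measurable_nn_integral[OF sigma_finite_lborel this]
      have Fm[measurable]: "F \<in> borel_measurable borel" unfolding F_def[abs_def] by (simp add: indicator_def)
      have "Lp_norm lborel q (g t) \<le> c \<longleftrightarrow> F t = 0" for t
      proof -
        have gm: "(\<lambda>x. ennreal (norm (g t x))) \<in> borel_measurable lborel" using gt[of t] by measurable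
        have "Lp_norm lborel q (g t) \<le> c \<longleftrightarrow> (AE x in lborel. ennreal (norm (g t x)) \<le> c)"
        proof
          assume "Lp_norm lborel q (g t) \<le> c"
          then have e: "esssup lborel (\<lambda>x. ennreal (norm (g t x))) \<le> c" using True by (simp add: Lp_norm_def)
          show "AE x in lborel. ennreal (norm (g t x)) \<le> c"
            using esssup_AE[where M=lborel and f="\<lambda>x. ennreal (norm (g t x))"]
          proof eventually_elim
            case (elim x) then show ?case using e by (rule order_trans)
          qed
        next
          assume "AE x in lborel. ennreal (norm (g t x)) \<le> c"
          then show "Lp_norm lborel q (g t) \<le> c" using esssup_I[OF gm] True by (simp add: Lp_norm_def)
        qed
        also have "\<dots> \<longleftrightarrow> F t = 0"
        proof -
          have s: "{x. c < ennreal (norm (g t x))} \<in> sets lborel"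
            using measurable_sets[OF gm, of "{c<..}"] by (simp add: vimage_def greaterThan_def)
          have "F t = emeasure lborel {x. c < ennreal (norm (g t x))}" unfolding F_def using s by simp
          moreover have "(AE x in lborel. ennreal (norm (g t x)) \<le> c) \<longleftrightarrow> emeasure lborel {x. c < ennreal (norm (g t x))} = 0"
            by (rule AE_iff_measurable[OF s]) (auto simp: not_le)
          ultimately show ?thesis by simp
        qed
        finally show ?thesis .
      qed
      then have "{t \<in> space borel. Lp_norm lborel q (g t) \<le> c} = F -` {0} \<inter> space borel" by auto
      also have "\<dots> \<in> sets borel" by (rule measurable_sets[OF Fm]) simp
      finally show "{t \<in> space borel. Lp_norm lborel q (g t) \<le> c} \<in> sets borel" .
    qed
  qed
qed

lemma Lp_norm_zero: "Lp_norm (lborel :: 'a::euclidean_space measure) q (\<lambda>x. 0) = 0"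
proof (cases "q = \<infinity>")
  case True
  have "esssup (lborel :: 'a measure) (\<lambda>x. ennreal (norm (0 :: 'b))) \<le> 0" by (rule esssup_I) simp_all
  then show ?thesis using True by (simp add: Lp_norm_def)
qed (simp add: Lp_norm_def Let_def)

text \<open>Clamping maps the whole line measurably into [0,T], and the indicator then discards the
  times outside \<open>G\<close>; values of \<open>f\<close> at times outside [0,T] never
  enter.\<close>

lemma time_cut_measurable:
  fixes f :: "real \<Rightarrow> 'a::euclidean_space \<Rightarrow> 'b::euclidean_space"
  assumes T: "0 < T" and f: "(\<lambda>(t, x). f t x) \<in> borel_measurable (time_measure T \<Otimes>\<^sub>M lborel)"
    and G: "G \<in> sets borel" "G \<subseteq> {0..T}"
  shows "(\<lambda>(t, x). indicator G t *\<^sub>R f t x) \<in> borel_measurable (borel \<Otimes>\<^sub>M borel)"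
proof -
  have c: "(\<lambda>t. max 0 (min T t)) \<in> borel \<rightarrow>\<^sub>M time_measure T"
    using T by (intro measurable_restrict_space2) auto
  have "(\<lambda>z. (max 0 (min T (fst z)), snd z)) \<in> (borel :: real measure) \<Otimes>\<^sub>M (borel :: 'a measure) \<rightarrow>\<^sub>M time_measure T \<Otimes>\<^sub>M lborel"
    by (intro measurable_Pair measurable_compose[OF measurable_fst c]) (simp add: measurable_snd)
  from measurable_compose[OF this f]
  have m: "(\<lambda>z. f (max 0 (min T (fst z))) (snd z)) \<in> borel_measurable (borel \<Otimes>\<^sub>M borel)" by simp
  have i: "(\<lambda>z. indicator G (fst z) :: real) \<in> borel_measurable ((borel :: real measure) \<Otimes>\<^sub>M (borel :: 'a measure))"
    by (rule measurable_compose[OF measurable_fst]) (use G in simp)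
  have "(\<lambda>z. indicator G (fst z) *\<^sub>R f (max 0 (min T (fst z))) (snd z)) = (\<lambda>(t, x). indicator G t *\<^sub>R f t x)"
  proof (rule ext)
    fix z :: "real \<times> 'a"
    show "indicator G (fst z) *\<^sub>R f (max 0 (min T (fst z))) (snd z) = (case z of (t, x) \<Rightarrow> indicator G t *\<^sub>R f t x)"
    proof (cases "fst z \<in> G")
      case True
      then have "max 0 (min T (fst z)) = fst z" using G by auto
      then show ?thesis by (simp add: case_prod_unfold)
    qed (simp add: case_prod_unfold)
  qed
  then show ?thesis using borel_measurable_scaleR[OF i m] by simp
qed

text \<open>On \<open>G\<close> the norm is finite, so its real value loses nothing; off
  \<open>G\<close> the function is zero. The real-valued bound inherits integrability in
  time.\<close>

lemma L1_Lq_cut: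
  fixes f :: "real \<Rightarrow> 'a::euclidean_space \<Rightarrow> 'b::euclidean_space"
  assumes T: "0 < T" and f: "L1_Lq T q f" and G: "G \<in> sets borel" "G \<subseteq> {0..T}"
    and fin: "\<And>t. t \<in> G \<Longrightarrow> Lp_norm lborel q (f t) < \<infinity>"
  defines "a t \<equiv> enn2real (Lp_norm lborel q (\<lambda>x. indicator G t *\<^sub>R f t x))"
  shows "\<And>t. Lp_norm lborel q (\<lambda>x. indicator G t *\<^sub>R f t x) \<le> ennreal (a t)" and "integrable lborel a"
proof -
  have e: "Lp_norm lborel q (\<lambda>x. indicator G t *\<^sub>R f t x) = (if t \<in> G then Lp_norm lborel q (f t) else 0)" for t
    by (simp add: Lp_norm_zero)
  have ea: "ennreal (a t) = Lp_norm lborel q (\<lambda>x. indicator G t *\<^sub>R f t x)" for t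
    using fin[of t] unfolding a_def e by (simp add: less_top)
  show "Lp_norm lborel q (\<lambda>x. indicator G t *\<^sub>R f t x) \<le> ennreal (a t)" for t by (simp add: ea)
  have "(\<lambda>(t, x). indicator G t *\<^sub>R f t x) \<in> borel_measurable (borel \<Otimes>\<^sub>M borel)"
    using f by (intro time_cut_measurable[OF T _ G]) (simp add: L1_Lq_def)
  from Lp_norm_measurable[OF this, of q] have m: "a \<in> borel_measurable lborel" unfolding a_def[abs_def] by measurable
  show "integrable lborel a"
  proof (rule integrableI_bounded[OF m])
    have "(\<integral>\<^sup>+t. ennreal (norm (a t)) \<partial>lborel) = (\<integral>\<^sup>+t. ennreal (a t) \<partial>lborel)" by (simp add: a_def)
    also have "\<dots> \<le> (\<integral>\<^sup>+t. Lp_norm lborel q (f t) * indicator {0..T} t \<partial>lborel)"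
    proof (rule nn_integral_mono)
      show "ennreal (a t) \<le> Lp_norm lborel q (f t) * indicator {0..T} t" for t
        unfolding ea e using G(2) by (cases "t \<in> G") auto
    qed
    also have "\<dots> = (\<integral>\<^sup>+ t. Lp_norm lborel q (f t) \<partial>time_measure T)" by (rule nn_integral_restrict_space[symmetric]) simp
    also have "\<dots> < \<infinity>" using f by (simp add: L1_Lq_def)
    finally show "(\<integral>\<^sup>+t. ennreal (norm (a t)) \<partial>lborel) < \<infinity>" .
  qed
qed

lemma L1_Lq_finite:
  fixes f :: "real \<Rightarrow> 'a::euclidean_space \<Rightarrow> 'b::euclidean_space"
  assumes T: "0 < T" and f: "L1_Lq T q f"
  shows "AE t in lborel. t \<in> {0..T} \<longrightarrow> Lp_norm lborel q (f t) < \<infinity>"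
proof -
  have c: "(\<lambda>(t, x). indicator {0..T} t *\<^sub>R f t x) \<in> borel_measurable (borel \<Otimes>\<^sub>M borel)"
    using f by (intro time_cut_measurable[OF T]) (auto simp: L1_Lq_def)
  let ?n = "\<lambda>t. Lp_norm lborel q (\<lambda>x. indicator {0..T} t *\<^sub>R f t x)"
  have e: "?n t = Lp_norm lborel q (f t) * indicator {0..T} t" for t
    by (cases "t \<in> {0..T}") (simp_all add: Lp_norm_zero)
  have "(\<integral>\<^sup>+t. ?n t \<partial>lborel) = (\<integral>\<^sup>+ t. Lp_norm lborel q (f t) \<partial>time_measure T)"
    unfolding e by (rule nn_integral_restrict_space[symmetric]) simp
  then have "(\<integral>\<^sup>+t. ?n t \<partial>lborel) \<noteq> \<infinity>" using f by (simp add: L1_Lq_def less_top)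
  moreover have "?n \<in> borel_measurable lborel" using Lp_norm_measurable[OF c, of q] by simp
  ultimately have "AE t in lborel. ?n t \<noteq> \<infinity>" by (intro nn_integral_PInf_AE)
  then show ?thesis
  proof eventually_elim
    case (elim t)
    then show ?case unfolding e by (auto simp: less_top)
  qed
qed

lemma AE_time_measure: "(AE t in time_measure T. P t) \<longleftrightarrow> (AE t in lborel. t \<in> {0..T} \<longrightarrow> P t)"
  by (simp add: AE_restrict_space_iff)

text \<open>The hypotheses on the field hold at almost every time. At the other times, and outside
  [0,T], the field and its derivatives are replaced by zero, for which every condition of
  \<open>sobolev_drift\<close> is trivial. Time integrals do not see the change.\<close>

lemma sobolev_drift_representative:
  fixes b :: "real \<Rightarrow> 'a::euclidean_space \<Rightarrow> 'a"
  assumes T: "0 < T" and b: "L1_W1q T q b" and dv: "divergence_L1_Lq T \<infinity> b"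
  shows "\<exists>b' v \<alpha> \<beta> \<gamma>. sobolev_drift b' v q \<alpha> \<beta> \<gamma> \<and> (AE t in lborel. t \<in> {0..T} \<longrightarrow> b' t = b t)"
proof -
  have bL: "L1_Lq T q b" using b by (simp add: L1_W1q_def)
  have "\<forall>i\<in>Basis. \<exists>v. L1_Lq T q v \<and> (AE t in time_measure T. has_weak_partial (b t) i (v t))"
    using b unfolding L1_W1q_def by blast
  then obtain v where v: "\<And>i. i \<in> Basis \<Longrightarrow> L1_Lq T q (v i)"
      "\<And>i. i \<in> Basis \<Longrightarrow> AE t in time_measure T. has_weak_partial (b t) i (v i t)"
    unfolding bchoice_iff by blast
  obtain g where g: "L1_Lq T \<infinity> g" "AE t in time_measure T. has_weak_divergence (b t) (g t)"
    using dv unfolding divergence_L1_Lq_def by blast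
  let ?good = "\<lambda>t. Lp_norm lborel q (b t) < \<infinity> \<and> Lp_norm lborel \<infinity> (g t) < \<infinity> \<and> has_weak_divergence (b t) (g t) \<and>
     (\<forall>i\<in>Basis. Lp_norm lborel q (v i t) < \<infinity> \<and> has_weak_partial (b t) i (v i t))"
  have "AE t in lborel. \<forall>i\<in>Basis. t \<in> {0..T} \<longrightarrow> Lp_norm lborel q (v i t) < \<infinity> \<and> has_weak_partial (b t) i (v i t)"
  proof (rule AE_finite_allI[OF finite_Basis])
    fix i :: 'a assume i: "i \<in> Basis"
    show "AE t in lborel. t \<in> {0..T} \<longrightarrow> Lp_norm lborel q (v i t) < \<infinity> \<and> has_weak_partial (b t) i (v i t)"
      using L1_Lq_finite[OF T v(1)[OF i]] v(2)[OF i] unfolding AE_time_measure by eventually_elim simp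
  qed
  then have good: "AE t in lborel. t \<in> {0..T} \<longrightarrow> ?good t"
    using L1_Lq_finite[OF T bL] L1_Lq_finite[OF T g(1)] g(2) unfolding AE_time_measure by eventually_elim simp
  \<comment> \<open>A measurable null set covering all bad times, so that its complement
    \<open>G\<close> in [0,T] is Borel.\<close>
  obtain N where N: "{t. \<not> (t \<in> {0..T} \<longrightarrow> ?good t)} \<subseteq> N" "N \<in> null_sets lborel"
    using good by (auto elim!: AE_E simp: null_sets_def)
  define G where "G = {0..T} - N"
  have G: "G \<in> sets borel" "G \<subseteq> {0..T}" using N(2) by (auto simp: G_def null_sets_def)
  have gG: "?good t" if "t \<in> G" for t using that N(1) by (auto simp: G_def)
  define cut :: "(real \<Rightarrow> 'a \<Rightarrow> 'a) \<Rightarrow> real \<Rightarrow> 'a \<Rightarrow> 'a" where "cut f t x = indicator G t *\<^sub>R f t x" for f t x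
  define gc where "gc t x = indicator G t *\<^sub>R g t x" for t x
  define \<alpha> where "\<alpha> t = enn2real (Lp_norm lborel q (cut b t))" for t
  \<comment> \<open>The sum over the directions dominates each partial derivative and stays
    integrable.\<close>
  define \<beta> where "\<beta> t = (\<Sum>i\<in>Basis. enn2real (Lp_norm lborel q (cut (v i) t)))" for t
  define \<gamma> where "\<gamma> t = enn2real (Lp_norm lborel \<infinity> (gc t))" for t
  have c_eta: "cut f t = (\<lambda>x. indicator G t *\<^sub>R f t x)" "gc t = (\<lambda>x. indicator G t *\<^sub>R g t x)" for f t
    by (auto simp: cut_def gc_def)
  note bc = L1_Lq_cut[OF T bL G gG[THEN conjunct1], folded c_eta]
  note gcc = L1_Lq_cut[OF T g(1) G gG[THEN conjunct2, THEN conjunct1], folded c_eta]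
  have vc: "Lp_norm lborel q (cut (v i) t) \<le> ennreal (enn2real (Lp_norm lborel q (cut (v i) t)))"
     "integrable lborel (\<lambda>t. enn2real (Lp_norm lborel q (cut (v i) t)))" if i: "i \<in> Basis" for i t
    unfolding c_eta using L1_Lq_cut[OF T v(1)[OF i] G] gG i by blast+
  have cm: "(\<lambda>(t, x). cut f t x) \<in> borel_measurable (borel \<Otimes>\<^sub>M borel)" if "L1_Lq T q f" for f
    unfolding cut_def using that by (intro time_cut_measurable[OF T _ G]) (simp add: L1_Lq_def)
  have gm: "(\<lambda>(t, x). gc t x) \<in> borel_measurable (borel \<Otimes>\<^sub>M borel)"
    unfolding gc_def using g(1) by (intro time_cut_measurable[OF T _ G]) (simp add: L1_Lq_def)
  have slice: "h t \<in> borel_measurable borel" if h: "(\<lambda>(t, x). h t x) \<in> borel_measurable (borel \<Otimes>\<^sub>M borel)"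
    for h :: "real \<Rightarrow> 'a \<Rightarrow> 'c::euclidean_space" and t
  proof -
    have "(\<lambda>x. (t, x)) \<in> borel \<rightarrow>\<^sub>M borel \<Otimes>\<^sub>M (borel :: 'a measure)" by simp
    from measurable_compose[OF this h] show ?thesis by simp
  qed
  have inG: "cut f t = f t" "gc t = g t" if "t \<in> G" for f t using that by (auto simp: cut_def gc_def)
  have outG: "cut f t x = 0" if "t \<notin> G" for f t x using that by (simp add: cut_def)
  have sd: "sobolev_drift (cut b) (\<lambda>i. cut (v i)) q \<alpha> \<beta> \<gamma>"
  proof
    show "(\<lambda>(t, x). cut b t x) \<in> borel_measurable (borel \<Otimes>\<^sub>M borel)" by (rule cm[OF bL])
    show "(\<lambda>(t, x). cut (v i) t x) \<in> borel_measurable (borel \<Otimes>\<^sub>M borel)" if "i \<in> Basis" for i by (rule cm[OF v(1)[OF that]])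
    show "Lp_norm lborel q (cut b t) \<le> ennreal (\<alpha> t)" for t unfolding \<alpha>_def by (rule bc(1))
    show "Lp_norm lborel q (cut (v i) t) \<le> ennreal (\<beta> t)" if i: "i \<in> Basis" for i t
    proof -
      have "enn2real (Lp_norm lborel q (cut (v i) t)) \<le> \<beta> t" unfolding \<beta>_def by (rule member_le_sum[OF i]) auto
      then show ?thesis using vc(1)[OF i, of t] by (meson ennreal_leI order_trans)
    qed
    show "AE x in lborel. cut b t (x + h) - cut b t x = (LINT \<theta>:{0..1}|lborel. (\<Sum>i\<in>Basis. (h \<bullet> i) *\<^sub>R cut (v i) t (x + \<theta> *\<^sub>R h)))" for t h
    proof (cases "t \<in> G")
      case True
      have "AE x in lborel. cut b t (x + h) - cut b t x = (LINT \<theta>:{0..1}|lborel. (\<Sum>i\<in>Basis. (h \<bullet> i) *\<^sub>R (\<lambda>i. cut (v i) t) i (x + \<theta> *\<^sub>R h)))"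
      proof (rule sobolev_increment)
        show "has_weak_partial (cut b t) i (cut (v i) t)" if "i \<in> Basis" for i unfolding inG(1)[OF True] using gG[OF True] that by blast
      qed (intro slice cm bL v(1); assumption)+
      then show ?thesis .
    next
      case False
      then show ?thesis by (simp add: outG set_lebesgue_integral_def)
    qed
    show "AE x in lborel. - \<gamma> t \<le> (\<Sum>i\<in>Basis. cut (v i) t x \<bullet> i)" for t
    proof (cases "t \<in> G")
      case True
      have "AE x in lborel. (\<Sum>i\<in>Basis. (\<lambda>i. cut (v i) t) i x \<bullet> i) = gc t x"
      proof (rule weak_divergence_trace)
        show "has_weak_partial (cut b t) i (cut (v i) t)" if "i \<in> Basis" for i unfolding inG(1)[OF True] using gG[OF True] that by blast
        show "has_weak_divergence (cut b t) (gc t)" unfolding inG[OF True] using gG[OF True] by blast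
        show "gc t \<in> borel_measurable borel" by (rule slice[OF gm])
      qed (intro slice cm bL v(1); assumption)+
      moreover have "AE x in lborel. ennreal (norm (gc t x)) \<le> esssup lborel (\<lambda>x. ennreal (norm (gc t x)))"
        by (rule esssup_AE)
      ultimately show ?thesis
      proof eventually_elim
        case (elim x)
        have "esssup lborel (\<lambda>x. ennreal (norm (gc t x))) \<le> ennreal (\<gamma> t)" using gcc(1)[of t] by (simp add: \<gamma>_def Lp_norm_def)
        with elim(2) have "ennreal (norm (gc t x)) \<le> ennreal (\<gamma> t)" by (rule order_trans)
        then have "norm (gc t x) \<le> \<gamma> t" by (subst (asm) ennreal_le_iff) (simp add: \<gamma>_def)
        then show ?case using elim(1) by simp
      qed
    next
      case False
      then show ?thesis by (simp add: outG \<gamma>_def)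
    qed
    show "0 \<le> \<alpha> t" "0 \<le> \<beta> t" "0 \<le> \<gamma> t" for t by (auto simp: \<alpha>_def \<beta>_def \<gamma>_def intro: sum_nonneg)
    show "integrable lborel \<alpha>" unfolding \<alpha>_def[abs_def] by (rule bc(2))
    show "integrable lborel \<gamma>" unfolding \<gamma>_def[abs_def] c_eta using L1_Lq_cut(2)[OF T g(1) G] gG by blast
    show "integrable lborel \<beta>" unfolding \<beta>_def[abs_def] by (intro Bochner_Integration.integrable_sum vc(2))
  qed
  have "AE t in lborel. t \<notin> N" using N(2) by (rule AE_not_in)
  then have "AE t in lborel. t \<in> {0..T} \<longrightarrow> cut b t = b t"
  proof eventually_elim
    case (elim t) then show ?case by (auto simp: inG(1) G_def)
  qed
  with sd show ?thesis by blast
qed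

section \<open>The McKean--Vlasov equation\<close>

lemma convolution_measurable:
  fixes f :: "real \<Rightarrow> 'a::euclidean_space \<Rightarrow> 'a"
  assumes P: "prob_space P" and f: "(\<lambda>(t, x). f t x) \<in> borel_measurable (borel \<Otimes>\<^sub>M borel)"
    and Z: "(\<lambda>z. X (fst z) (snd z)) \<in> borel_measurable (borel \<Otimes>\<^sub>M P)" and x[measurable]: "x \<in> borel_measurable borel"
  shows "(\<lambda>s. \<integral>y. f s (x s - X s y) \<partial>P) \<in> borel_measurable borel"
proof -
  interpret prob_space P by fact
  have "(\<lambda>z. (fst z, x (fst z) - X (fst z) (snd z))) \<in> borel \<Otimes>\<^sub>M P \<rightarrow>\<^sub>M borel \<Otimes>\<^sub>M borel"
    using Z by measurable
  from measurable_compose[OF this f]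
  have "(\<lambda>(s, y). f s (x s - X s y)) \<in> borel_measurable (borel \<Otimes>\<^sub>M P)" by (simp add: case_prod_unfold)
  then show ?thesis by (rule borel_measurable_lebesgue_integral)
qed

locale mckean_vlasov = mean_field b v q \<alpha> \<beta> \<gamma> T B p \<rho> \<nu> K
  for b :: "real \<Rightarrow> real^'d \<Rightarrow> real^'d" and v q \<alpha> \<beta> \<gamma> T B p \<rho> and \<nu> :: "(real \<Rightarrow> real^'d) measure" and K +
  fixes b0 :: "real \<Rightarrow> real^'d \<Rightarrow> real^'d"
  assumes pq: "1 < p" "1 < q" "1 / p + 1 / q < 1" and B: "0 \<le> B"
    and b0: "(\<lambda>(t, x). b0 t x) \<in> borel_measurable (time_measure T \<Otimes>\<^sub>M lborel)"
    and rep: "AE t in lborel. t \<in> {0..T} \<longrightarrow> b t = b0 t"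
begin

lemma b0_cut: "(\<lambda>(t, x). indicator {0..T} t *\<^sub>R b0 t x) \<in> borel_measurable (borel \<Otimes>\<^sub>M borel)"
  by (rule time_cut_measurable[OF T b0]) auto

lemma b0_slice: "t \<in> {0..T} \<Longrightarrow> b0 t \<in> borel_measurable borel"
proof -
  assume t: "t \<in> {0..T}"
  have "(\<lambda>x. (t, x)) \<in> borel \<rightarrow>\<^sub>M borel \<Otimes>\<^sub>M (borel :: (real^'d) measure)" by simp
  from measurable_compose[OF this b0_cut] show ?thesis using t by simp
qed

lemma measure_convolution_distr:
  assumes "t \<in> {0..T}" and X: "X \<in> borel_measurable P"
  shows "measure_convolution (b0 t) (distr P borel X) z = (\<integral>y. b0 t (z - X y) \<partial>P)"
  unfolding measure_convolution_def
proof (rule integral_distr[OF X])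
  show "(\<lambda>y. b0 t (z - y)) \<in> borel_measurable borel"
    by (rule measurable_compose[OF _ b0_slice[OF assms(1)]]) measurable
qed

text \<open>Both sides integrate over time, so the null set of times at which \<open>b0\<close> and
  \<open>b\<close> differ disappears. The cut-off with the indicator of [0,T] supplies the Borel
  measurability required of both integrands.\<close>

lemma set_integral_convolution:
  assumes P: "prob_space P" and X: "(\<lambda>z. X (fst z) (snd z)) \<in> borel_measurable (borel \<Otimes>\<^sub>M P)"
    and Xs: "\<And>s. X s \<in> borel_measurable P" and x: "x \<in> borel_measurable borel"
    and S: "S \<in> sets borel" "S \<subseteq> {0..T}" and \<mu>: "\<And>s. s \<in> {0..T} \<Longrightarrow> \<mu> s = distr P borel (X s)"
  shows "(LINT s:S|lborel. measure_convolution (b0 s) (\<mu> s) (x s)) = (LINT s:S|lborel. drift P X s (x s))"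
proof -
  have "(\<integral>s. indicator S s *\<^sub>R (\<integral>y. indicator {0..T} s *\<^sub>R b0 s (x s - X s y) \<partial>P) \<partial>lborel) = (\<integral>s. indicator S s *\<^sub>R drift P X s (x s) \<partial>lborel)"
  proof (rule integral_cong_AE)
    have "(\<lambda>s. \<integral>y. indicator {0..T} s *\<^sub>R b0 s (x s - X s y) \<partial>P) \<in> borel_measurable borel"
      by (rule convolution_measurable[OF P b0_cut X x])
    then show "(\<lambda>s. indicator S s *\<^sub>R (\<integral>y. indicator {0..T} s *\<^sub>R b0 s (x s - X s y) \<partial>P)) \<in> borel_measurable lborel"
      using S by (intro borel_measurable_scaleR) auto
    have "(\<lambda>s. drift P X s (x s)) \<in> borel_measurable borel"
      unfolding drift_def by (rule convolution_measurable[OF P b_joint X x])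
    then show "(\<lambda>s. indicator S s *\<^sub>R drift P X s (x s)) \<in> borel_measurable lborel"
      using S by (intro borel_measurable_scaleR) auto
    show "AE s in lborel. indicator S s *\<^sub>R (\<integral>y. indicator {0..T} s *\<^sub>R b0 s (x s - X s y) \<partial>P) = indicator S s *\<^sub>R drift P X s (x s)"
      using rep
    proof eventually_elim
      case (elim s)
      then show ?case using S(2) by (cases "s \<in> S") (auto simp: drift_def)
    qed
  qed
  moreover have "indicator S s *\<^sub>R measure_convolution (b0 s) (\<mu> s) (x s) = indicator S s *\<^sub>R (\<integral>y. indicator {0..T} s *\<^sub>R b0 s (x s - X s y) \<partial>P)" for s
  proof (cases "s \<in> S")
    case True
    then have "s \<in> {0..T}" using S by auto
    then show ?thesis by (simp add: \<mu> measure_convolution_distr[OF _ Xs])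
  qed simp
  ultimately show ?thesis unfolding set_lebesgue_integral_def by simp
qed

lemma process_joint:
  assumes X: "X \<in> M \<rightarrow>\<^sub>M path_borel T"
  shows "(\<lambda>z. X (snd z) (tclamp (fst z)) :: real^'d) \<in> borel_measurable (borel \<Otimes>\<^sub>M M)"
proof -
  have "(\<lambda>z. (fst z, X (snd z))) \<in> borel \<Otimes>\<^sub>M M \<rightarrow>\<^sub>M (borel :: real measure) \<Otimes>\<^sub>M path_borel T"
    by (intro measurable_Pair measurable_fst measurable_compose[OF measurable_snd X])
  from measurable_compose[OF this eval_joint] show ?thesis by simp
qed

text \<open>One functional is fixed once and for all, so that solutions on different probability
  spaces can be compared with the same object.\<close>

definition sol :: "real \<Rightarrow> (real \<Rightarrow> real^'d) \<Rightarrow> real^'d" where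
  "sol = (SOME X. (\<forall>t\<in>{0..T}. X t \<in> borel_measurable (filt t)) \<and>
     (\<forall>t\<in>{0..T}. mixture_bounded p B \<Lambda> \<rho> (distr law borel (X t))) \<and>
     approx_solution T law (space law) K 0 (\<lambda>s y. y (tclamp s)) X)"

lemma sol:
  "\<And>t. t \<in> {0..T} \<Longrightarrow> sol t \<in> borel_measurable (filt t)"
  "\<And>t. t \<in> {0..T} \<Longrightarrow> mixture_bounded p B \<Lambda> \<rho> (distr law borel (sol t))"
  "approx_solution T law (space law) K 0 (\<lambda>s y. y (tclamp s)) sol"
  using someI_ex[OF solution_exists, folded sol_def] by blast+

lemma sol_law: "t \<in> {0..T} \<Longrightarrow> sol t \<in> borel_measurable law \<and> dual_bounded q K (distr law borel (sol t))"
  using sol(3) unfolding approx_solution_def by blast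

lemma sol_equation:
  assumes "t \<in> {0..T}" "y \<in> space (path_borel T)"
  shows "sol t y = y t + (LINT s:{0..t}|lborel. drift law sol s (sol s y))"
proof -
  have "norm (sol t y - y (tclamp t) - (LINT s:{0..t}|lborel. drift law sol s (sol s y))) \<le> 0"
    using sol(3) assms unfolding approx_solution_def by simp
  then show ?thesis using tclamp_id[OF assms(1)] by (simp add: diff_eq_eq add.commute)
qed

text \<open>The construction at single times carries no information on path regularity; it comes
  from the equation, as the input is continuous and the drift term is an indefinite
  integral.\<close>

lemma sol_continuous:
  assumes y: "y \<in> space (path_borel T)" shows "continuous_on {0..T} (\<lambda>t. sol t y)"
proof -
  let ?D = "\<lambda>s. drift law sol s (sol s y)"
  have m: "set_borel_measurable lborel {0..T} ?D" using sol(3) y unfolding approx_solution_def by simp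
  have i: "set_integrable lborel S ?D" if "S \<in> sets borel" "S \<subseteq> {0..T}" for S
    by (rule drift_set_integrable(2)[OF prob_law K sol_law m that])
  have "?D integrable_on {0..T}" by (rule set_borel_integral_eq_integral(1)[OF i]) auto
  then have "continuous_on {0..T} (\<lambda>t. y t + integral {0..t} ?D)"
    using y by (intro continuous_on_add indefinite_integral_continuous_1) (auto simp: space_path_borel)
  then show ?thesis
  proof (rule continuous_on_eq)
    fix t assume t: "t \<in> {0..T}"
    show "y t + integral {0..t} ?D = sol t y"
      using sol_equation[OF t y] set_borel_integral_eq_integral(2)[OF i, of "{0..t}"] t by simp
  qed
qed

definition sol_path :: "(real \<Rightarrow> real^'d) \<Rightarrow> real \<Rightarrow> real^'d" where
  "sol_path y = (\<lambda>t\<in>{0..T}. sol t y)"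

lemma sol_path_apply: "t \<in> {0..T} \<Longrightarrow> sol_path y t = sol t y" by (simp add: sol_path_def)

lemma sol_path_space: "y \<in> space (path_borel T) \<Longrightarrow> sol_path y \<in> space (path_borel T)"
proof -
  assume y: "y \<in> space (path_borel T)"
  have "continuous_on {0..T} (sol_path y) \<longleftrightarrow> continuous_on {0..T} (\<lambda>t. sol t y)"
    by (rule continuous_on_cong[OF refl]) (rule sol_path_apply)
  then show ?thesis using sol_continuous[OF y] by (simp add: space_path_borel sol_path_def)
qed

lemma sol_path_measurable: "sol_path \<in> path_borel T \<rightarrow>\<^sub>M path_borel T"
proof (rule measurable_path_borelI)
  show "0 \<le> T" using T by simp
  show "(\<lambda>y. sol_path y t) \<in> borel_measurable (path_borel T)" if "t \<in> {0..T}" for t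
    using filtration_sub[OF sol(1)[OF that]] by (simp add: sol_path_apply[OF that])
qed (rule sol_path_space)

lemma sol_path_equation:
  assumes "t \<in> {0..T}" "y \<in> space (path_borel T)"
  shows "sol_path y t = y t + (LINT s:{0..t}|lborel. drift law (\<lambda>s y. sol_path y (tclamp s)) s (sol_path y (tclamp s)))"
proof -
  have "(LINT s:{0..t}|lborel. drift law (\<lambda>s y. sol_path y (tclamp s)) s (sol_path y (tclamp s))) = (LINT s:{0..t}|lborel. drift law sol s (sol s y))"
  proof (rule set_lebesgue_integral_cong)
    show "\<forall>s. s \<in> {0..t} \<longrightarrow> drift law (\<lambda>s y. sol_path y (tclamp s)) s (sol_path y (tclamp s)) = drift law sol s (sol s y)"
    proof (intro allI impI)
      fix s assume "s \<in> {0..t}"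
      then have s: "s \<in> {0..T}" using assms by auto
      show "drift law (\<lambda>s y. sol_path y (tclamp s)) s (sol_path y (tclamp s)) = drift law sol s (sol s y)"
        unfolding drift_def tclamp_id[OF s] sol_path_apply[OF s] ..
    qed
  qed simp
  then show ?thesis using sol_equation[OF assms] by (simp add: sol_path_apply[OF assms(1)])
qed

lemma input_measurable:
  assumes "input_data T (density lborel \<rho>) \<nu> M W \<xi>"
  shows "(\<lambda>\<omega>. add_path T (\<xi> \<omega>) (W \<omega>)) \<in> M \<rightarrow>\<^sub>M path_borel T"
  using assms T by (intro add_path_measurable) (auto simp: input_data_def)

text \<open>Independence turns the joint law of \<xi> and W into the product, so the law of \<xi> +
  W is the same on every space carrying such data. The functional evaluated at this path therefore
  has the marginals computed on path space, and the drift formed there is the right one.\<close>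

lemma input_distr:
  assumes i: "input_data T (density lborel \<rho>) \<nu> M W \<xi>"
  shows "distr M (path_borel T) (\<lambda>\<omega>. add_path T (\<xi> \<omega>) (W \<omega>)) = law"
proof -
  interpret M: prob_space M using i by (simp add: input_data_def)
  have W: "W \<in> M \<rightarrow>\<^sub>M path_borel T" and \<xi>: "\<xi> \<in> borel_measurable M"
    and ind: "M.indep_set (sets (vimage_algebra (space M) \<xi> borel)) (sets (vimage_algebra (space M) W (path_borel T)))"
    and d: "distr M borel \<xi> = density lborel \<rho>" "distr M (path_borel T) W = \<nu>"
    using i by (auto simp: input_data_def)
  interpret A: prob_space "density lborel \<rho>" by (rule prob_density)
  interpret N: prob_space \<nu> by (rule \<nu>)
  have pm: "(\<lambda>\<omega>. (\<xi> \<omega>, W \<omega>)) \<in> M \<rightarrow>\<^sub>M borel \<Otimes>\<^sub>M path_borel T" using \<xi> W by (rule measurable_Pair)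
  have "density lborel \<rho> \<Otimes>\<^sub>M \<nu> = distr M (borel \<Otimes>\<^sub>M path_borel T) (\<lambda>\<omega>. (\<xi> \<omega>, W \<omega>))"
  proof (rule pair_measure_eqI)
    show "sets (density lborel \<rho> \<Otimes>\<^sub>M \<nu>) = sets (distr M (borel \<Otimes>\<^sub>M path_borel T) (\<lambda>\<omega>. (\<xi> \<omega>, W \<omega>)))"
      using \<nu>(2) by (simp cong: sets_pair_measure_cong)
    fix S U assume "S \<in> sets (density lborel \<rho>)" "U \<in> sets \<nu>"
    then have S: "S \<in> sets borel" and U: "U \<in> sets (path_borel T)" using \<nu>(2) by auto
    let ?S = "\<xi> -` S \<inter> space M" and ?U = "W -` U \<inter> space M"
    have "M.prob (?S \<inter> ?U) = M.prob ?S * M.prob ?U"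
      by (rule M.indep_setD[OF ind]) (use S U in \<open>auto intro: in_vimage_algebra\<close>)
    then have "emeasure M (?S \<inter> ?U) = emeasure M ?S * emeasure M ?U"
      by (simp add: M.emeasure_eq_measure ennreal_mult)
    moreover have "emeasure (density lborel \<rho>) S = emeasure M ?S" unfolding d(1)[symmetric] by (rule emeasure_distr[OF \<xi> S])
    moreover have "emeasure \<nu> U = emeasure M ?U" unfolding d(2)[symmetric] by (rule emeasure_distr[OF W U])
    moreover have "(\<lambda>\<omega>. (\<xi> \<omega>, W \<omega>)) -` (S \<times> U) \<inter> space M = ?S \<inter> ?U" by auto
    moreover have "emeasure (distr M (borel \<Otimes>\<^sub>M path_borel T) (\<lambda>\<omega>. (\<xi> \<omega>, W \<omega>))) (S \<times> U) = emeasure M ((\<lambda>\<omega>. (\<xi> \<omega>, W \<omega>)) -` (S \<times> U) \<inter> space M)"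
      by (rule emeasure_distr[OF pm]) (use S U in simp)
    ultimately show "emeasure (density lborel \<rho>) S * emeasure \<nu> U = emeasure (distr M (borel \<Otimes>\<^sub>M path_borel T) (\<lambda>\<omega>. (\<xi> \<omega>, W \<omega>))) (S \<times> U)"
      by simp
  qed (rule A.sigma_finite_measure_axioms N.sigma_finite_measure_axioms)+
  moreover have m: "(\<lambda>(x, w). add_path T x w) \<in> borel \<Otimes>\<^sub>M path_borel T \<rightarrow>\<^sub>M path_borel T"
    unfolding case_prod_beta using T by (intro add_path_measurable) auto
  ultimately show ?thesis unfolding input_law_def by (simp add: distr_distr[OF m pm] comp_def)
qed

lemma sol_time_law:
  assumes i: "input_data T (density lborel \<rho>) \<nu> M W \<xi>" and t: "t \<in> {0..T}"
  shows "time_law M (\<lambda>\<omega>. sol_path (add_path T (\<xi> \<omega>) (W \<omega>))) t = distr law borel (sol t)"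
proof -
  have "distr (distr M (path_borel T) (\<lambda>\<omega>. add_path T (\<xi> \<omega>) (W \<omega>))) borel (sol t) = distr M borel (sol t \<circ> (\<lambda>\<omega>. add_path T (\<xi> \<omega>) (W \<omega>)))"
    by (rule distr_distr[OF filtration_sub[OF sol(1)[OF t]] input_measurable[OF i]])
  then show ?thesis unfolding time_law_def input_distr[OF i] sol_path_apply[OF t] by (simp add: comp_def)
qed

text \<open>The constant \<open>B'\<close> is common to all mixtures with the same \<open>B\<close>
  and \<open>\<Lambda>\<close>, hence uniform in time.\<close>

lemma sol_bounded_marginals:
  assumes i: "input_data T (density lborel \<rho>) \<nu> M W \<xi>"
  shows "bounded_marginals T p M (\<lambda>\<omega>. sol_path (add_path T (\<xi> \<omega>) (W \<omega>)))"
proof -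
  obtain B' where B': "\<And>\<rho> (\<mu> :: (real^'d) measure). mixture_bounded p B \<Lambda> \<rho> \<mu> \<Longrightarrow> density_Lp_norm p \<mu> \<le> ennreal B'"
    using mixture_bounded_density_Lp_norm[OF pq(1) B, of \<Lambda>] by blast
  have "(SUP t\<in>{0..T}. density_Lp_norm p (time_law M (\<lambda>\<omega>. sol_path (add_path T (\<xi> \<omega>) (W \<omega>))) t)) \<le> ennreal B'"
  proof (rule SUP_least)
    fix t assume t: "t \<in> {0..T}"
    show "density_Lp_norm p (time_law M (\<lambda>\<omega>. sol_path (add_path T (\<xi> \<omega>) (W \<omega>))) t) \<le> ennreal B'"
      unfolding sol_time_law[OF i t] by (rule B'[OF sol(2)[OF t]])
  qed
  also have "\<dots> < \<infinity>" by simp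
  finally show ?thesis unfolding bounded_marginals_def .
qed

end

section \<open>The strong solution and uniqueness\<close>

context mckean_vlasov
begin

lemma AE_time_product:
  assumes "AE t in time_measure T. P t"
  shows "AE z in time_measure T \<Otimes>\<^sub>M (lborel :: (real^'d) measure). P (fst z)"
proof -
  obtain N where N: "{t \<in> space (time_measure T). \<not> P t} \<subseteq> N" "emeasure (time_measure T) N = 0" "N \<in> sets (time_measure T)"
    using assms by (auto elim!: AE_E)
  have "emeasure (time_measure T \<Otimes>\<^sub>M (lborel :: (real^'d) measure)) (N \<times> space lborel) = emeasure (time_measure T) N * emeasure (lborel :: (real^'d) measure) (space lborel)"
    by (rule sigma_finite_measure.emeasure_pair_measure_Times[OF sigma_finite_lborel N(3)]) simp
  then have "emeasure (time_measure T \<Otimes>\<^sub>M (lborel :: (real^'d) measure)) (N \<times> space lborel) = 0" using N(2) by simp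
  then show ?thesis
    by (rule AE_I[rotated]) (use N in \<open>auto simp: space_pair_measure intro!: pair_measureI\<close>)
qed

lemma sol_strong_solution:
  assumes i: "input_data T (density lborel \<rho>) \<nu> M W \<xi>"
  shows "strong_solution T b0 (density lborel \<rho>) \<nu> M (\<lambda>\<omega>. sol_path (add_path T (\<xi> \<omega>) (W \<omega>))) W \<xi>"
proof -
  let ?Y = "\<lambda>\<omega>. add_path T (\<xi> \<omega>) (W \<omega>)"
  let ?X = "\<lambda>\<omega>. sol_path (?Y \<omega>)"
  let ?S = "\<lambda>s y. sol_path y (tclamp s)"
  have Ym: "?Y \<in> M \<rightarrow>\<^sub>M path_borel T" by (rule input_measurable[OF i])
  have Ys: "?Y \<omega> \<in> space (path_borel T)" if "\<omega> \<in> space M" for \<omega> by (rule measurable_space[OF Ym that])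
  have spl: "sol_path \<in> law \<rightarrow>\<^sub>M path_borel T" by (rule measurable_law[OF sol_path_measurable])
  have Sj: "(\<lambda>z. ?S (fst z) (snd z)) \<in> borel_measurable (borel \<Otimes>\<^sub>M law)" by (rule process_joint[OF spl])
  have Ss: "?S s \<in> borel_measurable law" for s
    using T by (intro measurable_compose[OF spl] measurable_eval_path) simp
  have Seq: "?S s = sol s" if "s \<in> {0..T}" for s unfolding tclamp_id[OF that] sol_path_apply[OF that] ..
  have tl: "time_law M ?X t = distr law borel (?S t)" if "t \<in> {0..T}" for t
    unfolding Seq[OF that] by (rule sol_time_law[OF i that])
  \<comment> \<open>The measurable representative asked for in (2). It is formed with
    \<open>b\<close> in place of \<open>b0\<close>, which changes the convolution at a null set of
    times only.\<close>
  define h where "h z = (\<integral>\<^sup>+y. ennreal (norm (b (fst z) (snd z - ?S (fst z) y))) \<partial>law)" for z :: "real \<times> (real^'d)"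
  have hm: "h \<in> borel_measurable (time_measure T \<Otimes>\<^sub>M lborel)"
  proof -
    interpret L: prob_space law by (rule prob_law)
    have "(\<lambda>z. (fst (fst z), snd z)) \<in> (borel \<Otimes>\<^sub>M borel) \<Otimes>\<^sub>M law \<rightarrow>\<^sub>M (borel :: real measure) \<Otimes>\<^sub>M law" by measurable
    from measurable_compose[OF this Sj]
    have s1: "(\<lambda>z. ?S (fst (fst z)) (snd z)) \<in> borel_measurable (((borel :: real measure) \<Otimes>\<^sub>M (borel :: (real^'d) measure)) \<Otimes>\<^sub>M law)" by simp
    have "(\<lambda>z. b (fst (fst z)) (snd (fst z) - ?S (fst (fst z)) (snd z))) \<in> borel_measurable (((borel :: real measure) \<Otimes>\<^sub>M (borel :: (real^'d) measure)) \<Otimes>\<^sub>M law)"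
      by (rule b_measurable) (use s1 in measurable)
    then have "(\<lambda>(z, y). ennreal (norm (b (fst z) (snd z - ?S (fst z) y)))) \<in> borel_measurable (((borel :: real measure) \<Otimes>\<^sub>M (borel :: (real^'d) measure)) \<Otimes>\<^sub>M law)"
      unfolding case_prod_unfold by (rule measurable_compose[OF measurable_compose[OF _ borel_measurable_norm] measurable_ennreal])
    then have hb: "h \<in> borel_measurable (borel \<Otimes>\<^sub>M borel)" unfolding h_def[abs_def] by (rule L.borel_measurable_nn_integral)
    have f: "(\<lambda>t. t) \<in> borel_measurable (time_measure T)" by (rule measurable_restrict_space1) simp
    have "(\<lambda>z. (fst z, snd z)) \<in> time_measure T \<Otimes>\<^sub>M (lborel :: (real^'d) measure) \<rightarrow>\<^sub>M borel \<Otimes>\<^sub>M borel"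
      by (intro measurable_Pair measurable_compose[OF measurable_fst f] measurable_compose[OF measurable_snd]) simp
    from measurable_compose[OF this hb] show ?thesis by simp
  qed
  have hAE: "AE (t, x) in time_measure T \<Otimes>\<^sub>M lborel. h (t, x) = abs_measure_convolution (b0 t) (time_law M ?X t) x"
  proof -
    have "AE t in time_measure T. t \<in> {0..T} \<and> b t = b0 t" unfolding AE_time_measure using rep by eventually_elim simp
    from AE_time_product[OF this] show ?thesis
    proof eventually_elim
      case (elim z)
      obtain t x where z: "z = (t, x)" by (cases z)
      then have t: "t \<in> {0..T}" and bt: "b t = b0 t" using elim by auto
      have "abs_measure_convolution (b0 t) (time_law M ?X t) x = (\<integral>\<^sup>+y. ennreal (norm (b0 t (x - ?S t y))) \<partial>law)"
        unfolding abs_measure_convolution_def tl[OF t]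
      proof (rule nn_integral_distr[OF Ss])
        have "(\<lambda>y. b0 t (x - y)) \<in> borel_measurable borel"
          by (rule measurable_compose[OF _ b0_slice[OF t]]) measurable
        from measurable_compose[OF measurable_compose[OF this borel_measurable_norm] measurable_ennreal]
        show "(\<lambda>y. ennreal (norm (b0 t (x - y)))) \<in> borel_measurable (distr law borel (?S t))" by simp
      qed
      then show ?case unfolding z by (simp add: h_def bt)
    qed
  qed
  \<comment> \<open>The convolution is at most \<open>K * \<alpha> s\<close> at every point of
    space, so the integral is finite along every path.\<close>
  have hfin: "(\<integral>\<^sup>+ s. h (s, ?X \<omega> s) \<partial>time_measure T) < \<infinity>" for \<omega>
  proof -
    have "(\<integral>\<^sup>+ s. h (s, ?X \<omega> s) \<partial>time_measure T) = (\<integral>\<^sup>+ s. h (s, ?X \<omega> s) * indicator {0..T} s \<partial>lborel)"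
      by (rule nn_integral_restrict_space) simp
    also have "\<dots> \<le> (\<integral>\<^sup>+ s. ennreal (K * \<alpha> s) \<partial>lborel)"
    proof (rule nn_integral_mono)
      fix s
      show "h (s, ?X \<omega> s) * indicator {0..T} s \<le> ennreal (K * \<alpha> s)"
      proof (cases "s \<in> {0..T}")
        case True
        have "dual_bounded q K (distr law borel (?S s))" unfolding Seq[OF True] using sol_law[OF True] by blast
        from b_convolution_integrable(3)[OF prob_law Ss this K, of s "?X \<omega> s"] show ?thesis using True by (simp add: h_def)
      qed simp
    qed
    also have "\<dots> < \<infinity>"
    proof -
      have "integrable lborel (\<lambda>s. K * \<alpha> s)" by (intro integrable_mult_right int)
      then have "(\<integral>\<^sup>+ s. ennreal (K * \<alpha> s) \<partial>lborel) = ennreal (\<integral>s. K * \<alpha> s \<partial>lborel)"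
        by (rule nn_integral_eq_integral) (use K nonneg in simp)
      then show ?thesis by simp
    qed
    finally show ?thesis .
  qed
  have eq: "?X \<omega> t = \<xi> \<omega> + (LINT s:{0..t}|lborel. measure_convolution (b0 s) (time_law M ?X s) (?X \<omega> s)) + W \<omega> t"
    if w: "\<omega> \<in> space M" and t: "t \<in> {0..T}" for \<omega> t
  proof -
    have "(LINT s:{0..t}|lborel. measure_convolution (b0 s) (time_law M ?X s) (?X \<omega> s)) = (LINT s:{0..t}|lborel. measure_convolution (b0 s) (time_law M ?X s) (?S s (?Y \<omega>)))"
    proof (rule set_lebesgue_integral_cong)
      show "\<forall>s. s \<in> {0..t} \<longrightarrow> measure_convolution (b0 s) (time_law M ?X s) (?X \<omega> s) = measure_convolution (b0 s) (time_law M ?X s) (?S s (?Y \<omega>))"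
        using t by (auto simp: tclamp_id)
    qed simp
    also have "\<dots> = (LINT s:{0..t}|lborel. drift law ?S s (?S s (?Y \<omega>)))"
      by (rule set_integral_convolution[OF prob_law Sj Ss path_tclamp_measurable[OF sol_path_space[OF Ys[OF w]]] _ _ tl]) (use t in auto)
    finally show ?thesis using sol_path_equation[OF t Ys[OF w]] t by (simp add: add_path_def)
  qed
  have ws: "weak_solution T b0 (density lborel \<rho>) \<nu> M ?X W \<xi>"
    unfolding weak_solution_def
  proof (intro conjI ballI)
    show "input_data T (density lborel \<rho>) \<nu> M W \<xi>" by (rule i)
    show "?X \<in> M \<rightarrow>\<^sub>M path_borel T" by (rule measurable_compose[OF Ym sol_path_measurable])
    show "absolutely_continuous lborel (time_law M ?X t)" if "t \<in> {0<..T}" for t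
    proof -
      have t: "t \<in> {0..T}" using that by auto
      show ?thesis unfolding sol_time_law[OF i t] by (rule mixture_bounded_absolutely_continuous[OF sol(2)[OF t]])
    qed
    show "\<exists>h. h \<in> borel_measurable (time_measure T \<Otimes>\<^sub>M lborel) \<and>
      (AE (t, x) in time_measure T \<Otimes>\<^sub>M lborel. h (t, x) = abs_measure_convolution (b0 t) (time_law M ?X t) x) \<and>
      (AE \<omega> in M. (\<integral>\<^sup>+ s. h (s, ?X \<omega> s) \<partial>time_measure T) < \<infinity>)"
      by (rule exI[of _ h], intro conjI hm hAE, rule AE_I2, rule hfin)
    show "AE \<omega> in M. \<forall>t\<in>{0..T}. ?X \<omega> t = \<xi> \<omega> + (LINT s:{0..t}|lborel. measure_convolution (b0 s) (time_law M ?X s) (?X \<omega> s)) + W \<omega> t"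
      by (intro AE_I2 ballI eq)
  qed
  \<comment> \<open>For s \<le> t the path \<open>?Y\<close> at time s is \<xi> + W at time s, so
    \<open>?Y\<close> is measurable from the raw filtration of the input into the filtration on path
    space, and adaptedness of \<open>sol\<close> carries over.\<close>
  have ad: "(\<lambda>\<omega>. ?X \<omega> t) \<in> borel_measurable (generated_filtration M (\<lambda>\<omega> s. \<xi> \<omega> + W \<omega> s) t)" if t: "t \<in> {0..T}" for t
  proof -
    let ?F = "generated_filtration M (\<lambda>\<omega> s. \<xi> \<omega> + W \<omega> s) t"
    have "?Y \<in> ?F \<rightarrow>\<^sub>M filt t"
    proof (rule measurable_generated_filtrationI)
      show "?Y \<in> space ?F \<rightarrow> space (path_borel T)" using Ys by simp
      fix s assume s: "s \<in> {0..t}"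
      then have "s \<in> {0..T}" using t by auto
      then have "?Y \<omega> s = \<xi> \<omega> + W \<omega> s" for \<omega> by (simp add: add_path_def)
      then show "(\<lambda>\<omega>. ?Y \<omega> s) \<in> borel_measurable ?F"
        using measurable_generated_filtration_eval[OF s, of "\<lambda>\<omega> s. \<xi> \<omega> + W \<omega> s" M] by simp
    qed
    from measurable_compose[OF this sol(1)[OF t]] show ?thesis unfolding sol_path_apply[OF t] .
  qed
  show ?thesis unfolding strong_solution_def using ws ad by blast
qed

text \<open>With \<open>\<Omega>\<close> the set where the equation holds, a solution is an
  \<open>approx_solution\<close> with error 0 on its own probability space. The bound on its
  marginals enters through the dual bound \<open>K1\<close>, which replaces the constant of the
  constructed solution.\<close>

lemma weak_solution_approx:
  assumes ws: "weak_solution T b0 (density lborel \<rho>) \<nu> M X W \<xi>"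
    and bd: "\<And>t. t \<in> {0..T} \<Longrightarrow> density_Lp_norm p (time_law M X t) \<le> ennreal B1"
    and K1: "\<And>\<rho> \<mu>. mixture_bounded p B1 1 \<rho> (\<mu> :: (real^'d) measure) \<Longrightarrow> dual_bounded q K1 \<mu>"
  shows "approx_solution T M {\<omega>\<in>space M. \<forall>t\<in>{0..T}.
      X \<omega> t = \<xi> \<omega> + (LINT s:{0..t}|lborel. measure_convolution (b0 s) (time_law M X s) (X \<omega> s)) + W \<omega> t}
    K1 0 (\<lambda>s \<omega>. \<xi> \<omega> + W \<omega> s) (\<lambda>s \<omega>. X \<omega> (tclamp s))"
proof -
  have P: "prob_space M" and X: "X \<in> M \<rightarrow>\<^sub>M path_borel T" using ws by (auto simp: weak_solution_def input_data_def)
  let ?S = "\<lambda>s \<omega>. X \<omega> (tclamp s)"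
  have Sj: "(\<lambda>z. ?S (fst z) (snd z)) \<in> borel_measurable (borel \<Otimes>\<^sub>M M)" by (rule process_joint[OF X])
  have Ss: "?S s \<in> borel_measurable M" for s using T by (intro measurable_compose[OF X] measurable_eval_path) simp
  have tl: "time_law M X s = distr M borel (?S s)" if "s \<in> {0..T}" for s unfolding tclamp_id[OF that] time_law_def ..
  have xm: "(\<lambda>s. ?S s \<omega>) \<in> borel_measurable borel" if "\<omega> \<in> space M" for \<omega>
    by (rule path_tclamp_measurable[OF measurable_space[OF X that]])
  show ?thesis
    unfolding approx_solution_def
  proof (intro conjI ballI)
    fix s assume s: "s \<in> {0..T}"
    show "?S s \<in> borel_measurable M" by (rule Ss)
    have "mixture_bounded p B1 1 (\<lambda>x. enn2real (RN_deriv lborel (time_law M X s) x)) (time_law M X s)"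
    proof (rule density_Lp_norm_mixture_bounded[OF _ _ bd[OF s]])
      show "prob_space (time_law M X s)" unfolding tl[OF s] by (rule prob_space.prob_space_distr[OF P Ss])
      show "sets (time_law M X s) = sets borel" by (simp add: time_law_def)
    qed
    then show "dual_bounded q K1 (distr M borel (?S s))" unfolding tl[OF s] by (rule K1)
  next
    fix \<omega> assume "\<omega> \<in> {\<omega>\<in>space M. \<forall>t\<in>{0..T}.
      X \<omega> t = \<xi> \<omega> + (LINT s:{0..t}|lborel. measure_convolution (b0 s) (time_law M X s) (X \<omega> s)) + W \<omega> t}"
    then have w: "\<omega> \<in> space M" and eq: "\<And>t. t \<in> {0..T} \<Longrightarrow>
      X \<omega> t = \<xi> \<omega> + (LINT s:{0..t}|lborel. measure_convolution (b0 s) (time_law M X s) (X \<omega> s)) + W \<omega> t" by auto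
    have "(\<lambda>s. drift M ?S s (?S s \<omega>)) \<in> borel_measurable borel"
      unfolding drift_def by (rule convolution_measurable[OF P b_joint Sj xm[OF w]])
    then show "set_borel_measurable lborel {0..T} (\<lambda>s. drift M ?S s (?S s \<omega>))"
      unfolding set_borel_measurable_def by (intro borel_measurable_scaleR) auto
    fix t assume t: "t \<in> {0..T}"
    have "(LINT s:{0..t}|lborel. measure_convolution (b0 s) (time_law M X s) (X \<omega> s)) = (LINT s:{0..t}|lborel. measure_convolution (b0 s) (time_law M X s) (?S s \<omega>))"
    proof (rule set_lebesgue_integral_cong)
      show "\<forall>s. s \<in> {0..t} \<longrightarrow> measure_convolution (b0 s) (time_law M X s) (X \<omega> s) = measure_convolution (b0 s) (time_law M X s) (?S s \<omega>)"
        using t by (auto simp: tclamp_id)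
    qed simp
    also have "\<dots> = (LINT s:{0..t}|lborel. drift M ?S s (?S s \<omega>))"
      by (rule set_integral_convolution[OF P Sj Ss xm[OF w] _ _ tl]) (use t in auto)
    finally show "norm (?S t \<omega> - (\<xi> \<omega> + W \<omega> t) - (LINT s:{0..t}|lborel. drift M ?S s (?S s \<omega>))) \<le> 0"
      using eq[OF t] unfolding tclamp_id[OF t] by (simp add: algebra_simps)
  qed
qed

lemma approx_solution_subset: "approx_solution T P \<Omega> K1 a Y X \<Longrightarrow> \<Omega>' \<subseteq> \<Omega> \<Longrightarrow> approx_solution T P \<Omega>' K1 a Y X"
  unfolding approx_solution_def by blast

lemma bounded_marginals_real:
  assumes "bounded_marginals T p M X"
  shows "\<exists>B1\<ge>0. \<forall>t\<in>{0..T}. \<forall>B2\<ge>B1. density_Lp_norm p (time_law M X t) \<le> ennreal B2"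
proof -
  let ?S = "SUP t\<in>{0..T}. density_Lp_norm p (time_law M X t)"
  have e: "?S = ennreal (enn2real ?S)" using assms by (simp add: bounded_marginals_def)
  show ?thesis
  proof (intro exI[of _ "enn2real ?S"] conjI ballI allI impI)
    fix t B2 assume t: "t \<in> {0..T}" and B2: "enn2real ?S \<le> B2"
    have "density_Lp_norm p (time_law M X t) \<le> ?S" using t by (rule SUP_upper)
    also have "\<dots> \<le> ennreal B2" by (subst e) (rule ennreal_leI[OF B2])
    finally show "density_Lp_norm p (time_law M X t) \<le> ennreal B2" .
  qed simp
qed

text \<open>Stability with error 0, applied on the intersection of the two sets where the equations
  hold. The marginals of the two solutions may obey different bounds; the larger one provides a
  common \<open>K1\<close>.\<close>

lemma pathwise_unique:
  assumes w1: "weak_solution T b0 (density lborel \<rho>) \<nu> (M :: 'w measure) X1 W \<xi>" and bd1: "bounded_marginals T p M X1"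
    and w2: "weak_solution T b0 (density lborel \<rho>) \<nu> M X2 W \<xi>" and bd2: "bounded_marginals T p M X2"
  shows "AE \<omega> in M. X1 \<omega> = X2 \<omega>"
proof -
  obtain B1 where B1: "0 \<le> B1" "\<And>t B. t \<in> {0..T} \<Longrightarrow> B1 \<le> B \<Longrightarrow> density_Lp_norm p (time_law M X1 t) \<le> ennreal B"
    using bounded_marginals_real[OF bd1] by blast
  obtain B2 where B2: "0 \<le> B2" "\<And>t B. t \<in> {0..T} \<Longrightarrow> B2 \<le> B \<Longrightarrow> density_Lp_norm p (time_law M X2 t) \<le> ennreal B"
    using bounded_marginals_real[OF bd2] by blast
  let ?B = "max B1 B2"
  have m: "0 \<le> ?B" using B1(1) by (simp add: le_max_iff_disj)
  obtain K1 where K1: "0 \<le> K1" "\<And>\<rho> \<mu>. mixture_bounded p ?B 1 \<rho> (\<mu> :: (real^'d) measure) \<Longrightarrow> dual_bounded q K1 \<mu>"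
    using mixture_bounded_dual_bounded[OF pq m zero_le_one] by blast
  define E where "E X = {\<omega>\<in>space M. \<forall>t\<in>{0..T}.
      X \<omega> t = \<xi> \<omega> + (LINT s:{0..t}|lborel. measure_convolution (b0 s) (time_law M X s) (X \<omega> s)) + W \<omega> t}" for X
  have ap1: "approx_solution T M (E X1) K1 0 (\<lambda>s \<omega>. \<xi> \<omega> + W \<omega> s) (\<lambda>s \<omega>. X1 \<omega> (tclamp s))"
    unfolding E_def by (rule weak_solution_approx[OF w1 B1(2) K1(2)]) auto
  have ap2: "approx_solution T M (E X2) K1 0 (\<lambda>s \<omega>. \<xi> \<omega> + W \<omega> s) (\<lambda>s \<omega>. X2 \<omega> (tclamp s))"
    unfolding E_def by (rule weak_solution_approx[OF w2 B2(2) K1(2)]) auto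
  have aeE: "AE \<omega> in M. \<omega> \<in> E X" if "weak_solution T b0 (density lborel \<rho>) \<nu> M X W \<xi>" for X
  proof -
    have "AE \<omega> in M. \<forall>t\<in>{0..T}. X \<omega> t = \<xi> \<omega> + (LINT s:{0..t}|lborel. measure_convolution (b0 s) (time_law M X s) (X \<omega> s)) + W \<omega> t"
      using that unfolding weak_solution_def by (elim conjE)
    with AE_space show ?thesis unfolding E_def by eventually_elim (rule CollectI, rule conjI)
  qed
  have ae: "AE \<omega> in M. \<omega> \<in> E X1 \<inter> E X2" using aeE[OF w1] aeE[OF w2] by eventually_elim simp
  have P: "prob_space M" and s: "X1 \<in> M \<rightarrow>\<^sub>M path_borel T" "X2 \<in> M \<rightarrow>\<^sub>M path_borel T"
    using w1 w2 by (auto simp: weak_solution_def input_data_def)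
  obtain C where CC: "0 \<le> C \<and> (\<forall>(P :: 'w measure) \<Omega> a Y X1 X2. prob_space P \<longrightarrow> (AE \<omega> in P. \<omega> \<in> \<Omega>) \<longrightarrow> 0 \<le> a \<longrightarrow>
    approx_solution T P \<Omega> K1 a Y X1 \<longrightarrow> approx_solution T P \<Omega> K1 a Y X2 \<longrightarrow>
    (\<forall>t\<in>{0..T}. \<forall>\<omega>\<in>\<Omega>. norm (X1 t \<omega> - X2 t \<omega>) \<le> C * a))"
    by (rule exE[OF approx_solution_stability[OF K1(1) T]])
  note st = CC[THEN conjunct2, THEN spec, THEN spec, THEN spec, THEN spec, THEN spec, THEN spec, THEN mp, THEN mp, THEN mp, THEN mp, THEN mp, THEN bspec, THEN bspec]
  have d: "norm (X1 \<omega> (tclamp t) - X2 \<omega> (tclamp t)) \<le> C * 0" if "t \<in> {0..T}" "\<omega> \<in> E X1 \<inter> E X2" for t \<omega>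
    by (rule st[OF P ae order_refl approx_solution_subset[OF ap1 Int_lower1] approx_solution_subset[OF ap2 Int_lower2] that])
  show ?thesis using ae
  proof eventually_elim
    case (elim \<omega>)
    then have w: "\<omega> \<in> space M" by (simp add: E_def)
    have "X1 \<omega> t = X2 \<omega> t" if "t \<in> {0..T}" for t using d[OF that elim] unfolding tclamp_id[OF that] by simp
    moreover have "X1 \<omega> \<in> extensional {0..T}" "X2 \<omega> \<in> extensional {0..T}"
      using measurable_space[OF s(1) w] measurable_space[OF s(2) w] by (auto simp: space_path_borel)
    ultimately show ?case by (intro extensionalityI[of _ "{0..T}"]) auto
  qed
qed

text \<open>On its own probability space the solution is compared with the functional
  \<open>sol_path\<close> of its own input, a solution in the same class. The law of the latter
  depends only on the laws of the data, so uniqueness in law across two spaces needs no coupling of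
  these spaces.\<close>

lemma weak_solution_law:
  assumes ws: "weak_solution T b0 (density lborel \<rho>) \<nu> M X W \<xi>" and bd: "bounded_marginals T p M X"
  shows "distr M (path_borel T) X = distr law (path_borel T) sol_path"
proof -
  have i: "input_data T (density lborel \<rho>) \<nu> M W \<xi>" and X: "X \<in> M \<rightarrow>\<^sub>M path_borel T" using ws by (auto simp: weak_solution_def)
  let ?Y = "\<lambda>\<omega>. add_path T (\<xi> \<omega>) (W \<omega>)"
  have "AE \<omega> in M. X \<omega> = sol_path (?Y \<omega>)"
    using sol_strong_solution[OF i] by (intro pathwise_unique[OF ws bd _ sol_bounded_marginals[OF i]]) (simp add: strong_solution_def)
  then have "distr M (path_borel T) X = distr M (path_borel T) (\<lambda>\<omega>. sol_path (?Y \<omega>))"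
    by (intro distr_cong_AE refl X measurable_compose[OF input_measurable[OF i] sol_path_measurable]) auto
  also have "\<dots> = distr (distr M (path_borel T) ?Y) (path_borel T) sol_path"
    by (simp add: distr_distr[OF sol_path_measurable input_measurable[OF i]] comp_def)
  finally show ?thesis unfolding input_distr[OF i] .
qed

end

theorem theorem4p6:
  fixes T :: real and p q :: ennreal
    and b :: "real \<Rightarrow> real ^ 'd \<Rightarrow> real ^ 'd"
    and \<rho> :: "real ^ 'd \<Rightarrow> real"
    and \<nu> :: "(real \<Rightarrow> real ^ 'd) measure"
  assumes "0 < T"
    and "1 < p" and "1 < q" and "1 / p + 1 / q < 1"
    and "L1_W1q T q b"
    and "divergence_L1_Lq T \<infinity> b"
    and "\<rho> \<in> borel_measurable lborel" and "\<And>x. 0 \<le> \<rho> x"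
    and "(\<integral>\<^sup>+ x. ennreal (\<rho> x) \<partial>lborel) = 1"
    and "Lp_norm lborel p \<rho> < \<infinity>"
  shows
    "(\<forall>(M :: 'w measure) W \<xi>. input_data T (density lborel \<rho>) \<nu> M W \<xi> \<longrightarrow>
        (\<exists>X. strong_solution T b (density lborel \<rho>) \<nu> M X W \<xi> \<and> bounded_marginals T p M X)) \<and>
     (\<forall>(M1 :: 'w1 measure) X1 W1 \<xi>1 (M2 :: 'w2 measure) X2 W2 \<xi>2.
        weak_solution T b (density lborel \<rho>) \<nu> M1 X1 W1 \<xi>1 \<and> bounded_marginals T p M1 X1 \<and>
        weak_solution T b (density lborel \<rho>) \<nu> M2 X2 W2 \<xi>2 \<and> bounded_marginals T p M2 X2 \<longrightarrow>
        distr M1 (path_borel T) X1 = distr M2 (path_borel T) X2) \<and>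
     (\<forall>(M :: 'w measure) X1 X2 W \<xi>.
        weak_solution T b (density lborel \<rho>) \<nu> M X1 W \<xi> \<and> bounded_marginals T p M X1 \<and>
        weak_solution T b (density lborel \<rho>) \<nu> M X2 W \<xi> \<and> bounded_marginals T p M X2 \<longrightarrow>
        (AE \<omega> in M. X1 \<omega> = X2 \<omega>))"
proof -
  obtain b' v \<alpha> \<beta> \<gamma> where sd: "sobolev_drift b' v q \<alpha> \<beta> \<gamma>" and rep: "AE t in lborel. t \<in> {0..T} \<longrightarrow> b' t = b t"
    using sobolev_drift_representative[OF assms(1,5,6)] by blast
  define B where "B = enn2real (Lp_norm lborel p \<rho>)"
  have B: "0 \<le> B" "Lp_norm lborel p \<rho> \<le> ennreal B" using assms(10) by (simp_all add: B_def)
  obtain K where K: "0 \<le> K" "\<And>\<rho> \<mu>. mixture_bounded p B (exp (2 * (\<integral>s. \<gamma> s \<partial>lborel) + 1)) \<rho> (\<mu> :: (real^'d) measure) \<Longrightarrow> dual_bounded q K \<mu>"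
    using mixture_bounded_dual_bounded[OF assms(2,3,4) B(1), of "exp (2 * (\<integral>s. \<gamma> s \<partial>lborel) + 1)"] by auto
  \<comment> \<open>That \<nu> is a probability law on path space follows from the existence of
    input data with this noise law; the locale can therefore be interpreted only once such data are
    given.\<close>
  have mv: "mckean_vlasov b' v q \<alpha> \<beta> \<gamma> T B p \<rho> \<nu> K b" if \<nu>: "prob_space \<nu>" "sets \<nu> = sets (path_borel T)"
  proof (intro mckean_vlasov.intro mean_field.intro sd particle_input.intro mean_field_axioms.intro mckean_vlasov_axioms.intro assms B K \<nu> rep)
    show "\<rho> \<in> borel_measurable borel" using assms(7) by simp
    show "(\<lambda>(t, x). b t x) \<in> borel_measurable (time_measure T \<Otimes>\<^sub>M lborel)" using assms(5) by (simp add: L1_W1q_def L1_Lq_def)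
  qed
  show ?thesis
  proof (intro conjI allI impI)
    fix M :: "'w measure" and W \<xi> assume i: "input_data T (density lborel \<rho>) \<nu> M W \<xi>"
    have "prob_space \<nu> \<and> sets \<nu> = sets (path_borel T)" using i by (auto simp: input_data_def intro: prob_space.prob_space_distr)
    then interpret mckean_vlasov b' v q \<alpha> \<beta> \<gamma> T B p \<rho> \<nu> K b by (intro mv) auto
    show "\<exists>X. strong_solution T b (density lborel \<rho>) \<nu> M X W \<xi> \<and> bounded_marginals T p M X"
      using sol_strong_solution[OF i] sol_bounded_marginals[OF i] by blast
  next
    fix M1 :: "'w1 measure" and X1 W1 \<xi>1 and M2 :: "'w2 measure" and X2 W2 \<xi>2
    assume a: "weak_solution T b (density lborel \<rho>) \<nu> M1 X1 W1 \<xi>1 \<and> bounded_marginals T p M1 X1 \<and>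
        weak_solution T b (density lborel \<rho>) \<nu> M2 X2 W2 \<xi>2 \<and> bounded_marginals T p M2 X2"
    then have w1: "weak_solution T b (density lborel \<rho>) \<nu> M1 X1 W1 \<xi>1" and b1: "bounded_marginals T p M1 X1"
      and w2: "weak_solution T b (density lborel \<rho>) \<nu> M2 X2 W2 \<xi>2" and b2: "bounded_marginals T p M2 X2" by auto
    have "input_data T (density lborel \<rho>) \<nu> M1 W1 \<xi>1" using w1 by (simp add: weak_solution_def)
    then have "prob_space \<nu> \<and> sets \<nu> = sets (path_borel T)" by (auto simp: input_data_def intro: prob_space.prob_space_distr)
    then interpret mckean_vlasov b' v q \<alpha> \<beta> \<gamma> T B p \<rho> \<nu> K b by (intro mv) auto
    show "distr M1 (path_borel T) X1 = distr M2 (path_borel T) X2"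
      unfolding weak_solution_law[OF w1 b1] weak_solution_law[OF w2 b2] ..
  next
    fix M :: "'w measure" and X1 X2 W \<xi>
    assume a: "weak_solution T b (density lborel \<rho>) \<nu> M X1 W \<xi> \<and> bounded_marginals T p M X1 \<and>
        weak_solution T b (density lborel \<rho>) \<nu> M X2 W \<xi> \<and> bounded_marginals T p M X2"
    then have w1: "weak_solution T b (density lborel \<rho>) \<nu> M X1 W \<xi>" and b1: "bounded_marginals T p M X1"
      and w2: "weak_solution T b (density lborel \<rho>) \<nu> M X2 W \<xi>" and b2: "bounded_marginals T p M X2" by auto
    have "prob_space \<nu> \<and> sets \<nu> = sets (path_borel T)" using w1 by (auto simp: weak_solution_def input_data_def intro: prob_space.prob_space_distr)
    then interpret mckean_vlasov b' v q \<alpha> \<beta> \<gamma> T B p \<rho> \<nu> K b by (intro mv) auto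
    show "AE \<omega> in M. X1 \<omega> = X2 \<omega>" by (rule pathwise_unique[OF w1 b1 w2 b2])
  qed
qed

end
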